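(* Let $Q$ be a quiver, $\underline f\in\mathbb{Z}_{\ge0}^{Q_0}$, and let $\underline d=\underline d^{(0)},\underline d^{(1)},\ldots,\underline d^{(\ell)}\in\mathbb{Z}_{\ge 0}^{Q_0}$ be such that for every $i=0,\ldots,\ell-1$ there is $v_i\in Q_0$ with $\underline d^{(i)}-\underline d^{(i+1)}=\delta_{v_i}$. Let $\underline k=\underline d^{(0)}-\underline d^{(\ell)}$. Then the space $$\mathcal{M}^{\underline k}_Q(\underline d;\underline f):=\mathcal{M}_Q(\underline d^{(0)},\ldots,\underline d^{(\ell)};\underline f)$$ depends (up to isomorphism) only on $\underline k,\underline d,\underline f$ but not on the specific sequence $\underline d^{(i)}$. The natural projection $$\mathcal{M}^{\underline k}_Q(\underline d;\underline f)\to\mathcal{M}_Q(\underline d,\underline d-\underline k;\underline f)$$ is a locally trivial fibration with fiber the product of complete flag varieties $\prod_{v\in Q_0}\mathrm{Fl}(k_v)$.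
   Context: Everything is over $\mathbb{C}$. $Q=(Q_0,Q_1,\mathrm{out},\mathrm{in})$ is a quiver; an arrow $e\in Q_1$ goes from $\mathrm{out}(e)$ to $\mathrm{in}(e)$; $\delta_v\in\mathbb{Z}^{Q_0}$ has $1$ in position $v$ and zeros elsewhere. $\mathrm{Fl}(n)$ is the variety of complete flags in $\mathbb{C}^n$. Given $\underline{d},\underline{f}\in\mathbb{Z}_{\ge0}^{Q_0}$, fix vector spaces $D_v,F_v$ with $\dim D_v=d_v$, $\dim F_v=f_v$. A representation of the double framed quiver with dimension vector $\underline d$ and framing vector $\underline f$ is a tuple $(A_e,B_e,i_v,j_v)$ with $A_e:D_{\mathrm{out}(e)}\to D_{\mathrm{in}(e)}$, $B_e:D_{\mathrm{in}(e)}\to D_{\mathrm{out}(e)}$, $i_v:F_v\to D_v$, $j_v:D_v\to F_v$ linear. Moment map equations: for all $v$, $\sum_{\mathrm{in}(e)=v}A_eB_e-\sum_{\mathrm{out}(e)=v}B_eA_e+i_vj_v=0$. Stability: the only collection of subspaces $D'_v\subseteq D_v$ with $i_v(F_v)\subseteq D'_v$ for all $v$ and preserved by all $A_e,B_e$ is $D'_v=D_v$. The group $G_{\underline d}=\prod_v\mathrm{GL}(D_v)$ acts by $g\cdot(A,B,i,j)=(g_{\mathrm{in}(e)}A_eg_{\mathrm{out}(e)}^{-1},g_{\mathrm{out}(e)}B_eg_{\mathrm{in}(e)}^{-1},g_vi_v,j_vg_v^{-1})$. Split parabolic quiver variety: let $\mathcal{P}_Q(\underline{d}^{(0)},\ldots,\underline{d}^{(\ell)};\underline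 f)$ be the variety of tuples $(A^{(m)},B^{(m)},i^{(m)},j^{(m)})_{0\le m\le\ell}$, $(\pi^{(m)}_v)_{0\le m\le \ell-1,\,v\in Q_0}$ such that: (1) for each $m$, $(A^{(m)},B^{(m)},i^{(m)},j^{(m)})$ is a stable representation of the double framed quiver on spaces $D^{(m)}_v$ of dimension $d^{(m)}_v$, with the same framing spaces $F_v$ for all $m$, satisfying the moment map equations; (2) $\pi_v^{(m)}:D_v^{(m)}\to D_v^{(m+1)}$ are linear maps with $\pi^{(m)}A^{(m)}_e=A^{(m+1)}_e\pi^{(m)}$, $\pi^{(m)}B^{(m)}_e=B^{(m+1)}_e\pi^{(m)}$ (at the relevant vertices), $\pi^{(m)}_vi^{(m)}_v=i^{(m+1)}_v$, $j_v^{(m+1)}\pi_v^{(m)}=j_v^{(m)}$; (3) for $K_v:=\ker(\pi_v^{(\ell-1)}\circ\cdots\circ\pi_v^{(0)})\subseteq D_v^{(0)}$, all $A^{(0)}_e$ (with $\mathrm{out}(e)=v$), $B_e^{(0)}$ (with $\mathrm{in}(e)=v$) and $j^{(0)}_v$ vanish on $K_v$, for every $v$. (Stability forces all $\pi^{(m)}_v$ to be surjective.) The group $G=\prod_{m=0}^{\ell}G_{\underline d^{(m)}}$ acts freely, with $\pi_v^{(m)}\mapsto g_{m+1,v}\pi^{(m)}_vg_{m,v}^{-1}$, and $\mathcal{M}_Q(\underline{d}^{(0)},\ldots,\underline{d}^{(\ell)};\underline f):=\mathcal{P}_Q/G$. The natural projection keeps $D^{(0)}$, $D^{(\ell)}$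 and the composition $\pi_v^{(\ell-1)}\circ\cdots\circ\pi_v^{(0)}$. *)

theory Defs
  imports
    "HOL-Analysis.Function_Topology"
    "HOL-Algebra.Group_Action"
    "HOL-Algebra.Product_Groups"
    "Graph_Theory.Digraph"
    "Jordan_Normal_Form.Matrix_Kernel"
begin

section \<open>Spaces with functions\<close>

text \<open>Complex varieties are treated as spaces with functions in the sense of Serre and Kempf: a
  (Zariski) topological space together with, for each open set \<open>U\<close>, the set of regular functions
  \<open>U \<rightarrow> \<complex>\<close>. A function on \<open>U\<close> is represented by any of its extensions to the whole type; in all
  spaces below, membership in \<open>regular X U\<close> depends only on the values on \<open>U\<close>, and it is meaningful
  only for open \<open>U\<close>.\<close>

record 'a fspace =
  zariski :: "'a topology"
  regular :: "'a set \<Rightarrow> ('a \<Rightarrow> complex) set"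

abbreviation points :: "'a fspace \<Rightarrow> 'a set" where
  "points X \<equiv> topspace (zariski X)"

definition fmorphism :: "'a fspace \<Rightarrow> 'b fspace \<Rightarrow> ('a \<Rightarrow> 'b) \<Rightarrow> bool" where
  "fmorphism X Y p \<longleftrightarrow> continuous_map (zariski X) (zariski Y) p \<and>
     (\<forall>V \<phi>. openin (zariski Y) V \<longrightarrow> \<phi> \<in> regular Y V \<longrightarrow>
        \<phi> \<circ> p \<in> regular X {x \<in> points X. p x \<in> V})"

definition fisomorphism :: "'a fspace \<Rightarrow> 'b fspace \<Rightarrow> ('a \<Rightarrow> 'b) \<Rightarrow> bool" where
  "fisomorphism X Y p \<longleftrightarrow> fmorphism X Y p \<and>
     (\<exists>q. fmorphism Y X q \<and> (\<forall>x\<in>points X. q (p x) = x) \<and> (\<forall>y\<in>points Y. p (q y) = y))"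

definition fisomorphic :: "'a fspace \<Rightarrow> 'b fspace \<Rightarrow> bool" where
  "fisomorphic X Y \<longleftrightarrow> (\<exists>p. fisomorphism X Y p)"

definition open_fsubspace :: "'a fspace \<Rightarrow> 'a set \<Rightarrow> 'a fspace" where
  "open_fsubspace X U = \<lparr>zariski = subtopology (zariski X) U, regular = regular X\<rparr>"

inductive_set poly_algebra :: "('a \<Rightarrow> complex) set \<Rightarrow> ('a \<Rightarrow> complex) set"
  for H :: "('a \<Rightarrow> complex) set" where
  gen: "h \<in> H \<Longrightarrow> h \<in> poly_algebra H"
| const: "(\<lambda>_. c) \<in> poly_algebra H"
| add: "\<lbrakk>g \<in> poly_algebra H; h \<in> poly_algebra H\<rbrakk> \<Longrightarrow> (\<lambda>x. g x + h x) \<in> poly_algebra H"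
| mult: "\<lbrakk>g \<in> poly_algebra H; h \<in> poly_algebra H\<rbrakk> \<Longrightarrow> (\<lambda>x. g x * h x) \<in> poly_algebra H"

text \<open>Given a set \<open>\<G>\<close> of pairs \<open>(V, h)\<close> of a subset \<open>V\<close> of \<open>S\<close> and a function \<open>h\<close> on it, the
  generated space is the coarsest space with functions on \<open>S\<close> for which all these \<open>V\<close> are open and
  all these \<open>h\<close> are regular on \<open>V\<close>: basic open sets are the nonvanishing loci of polynomials in
  finitely many of the \<open>h\<close>, and regular functions are locally quotients of such polynomials.\<close>

definition generated_topology :: "'a set \<Rightarrow> ('a set \<times> ('a \<Rightarrow> complex)) set \<Rightarrow> 'a topology" where
  "generated_topology S \<G> = topology_generated_by
     {{x \<in> S \<inter> \<Inter>(fst ` F). h x \<noteq> 0} |F h. finite F \<and> F \<subseteq> \<G> \<and> h \<in> poly_algebra (snd ` F)}"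

definition generated_fspace :: "'a set \<Rightarrow> ('a set \<times> ('a \<Rightarrow> complex)) set \<Rightarrow> 'a fspace" where
  "generated_fspace S \<G> =
     \<lparr>zariski = generated_topology S \<G>,
      regular = (\<lambda>U. {\<phi>. \<forall>x\<in>U. \<exists>N F g h.
         openin (generated_topology S \<G>) N \<and> x \<in> N \<and> N \<subseteq> U \<and>
         finite F \<and> F \<subseteq> \<G> \<and> N \<subseteq> \<Inter>(fst ` F) \<and>
         g \<in> poly_algebra (snd ` F) \<and> h \<in> poly_algebra (snd ` F) \<and>
         (\<forall>y\<in>N. h y \<noteq> 0 \<and> \<phi> y = g y / h y)})\<rparr>"

text \<open>A subset \<open>S\<close> of the affine space with coordinate functions \<open>C\<close>.\<close>

definition affine_fspace :: "('a \<Rightarrow> complex) set \<Rightarrow> 'a set \<Rightarrow> 'a fspace" where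
  "affine_fspace C S = generated_fspace S ((\<lambda>c. (S, c)) ` C)"

text \<open>The categorical products. For varieties this is the usual product, whose topology is finer
  than the product topology.\<close>

definition prod_fspace :: "'a fspace \<Rightarrow> 'b fspace \<Rightarrow> ('a \<times> 'b) fspace" where
  "prod_fspace X Y = generated_fspace (points X \<times> points Y)
     ({(U \<times> points Y, \<phi> \<circ> fst) |U \<phi>. openin (zariski X) U \<and> \<phi> \<in> regular X U} \<union>
      {(points X \<times> V, \<psi> \<circ> snd) |V \<psi>. openin (zariski Y) V \<and> \<psi> \<in> regular Y V})"

definition product_fspace :: "'i set \<Rightarrow> ('i \<Rightarrow> 'a fspace) \<Rightarrow> ('i \<Rightarrow> 'a) fspace" where
  "product_fspace I X = generated_fspace (\<Pi>\<^sub>E i\<in>I. points (X i))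
     {({x \<in> \<Pi>\<^sub>E i\<in>I. points (X i). x i \<in> U}, \<lambda>x. \<phi> (x i)) |i U \<phi>.
        i \<in> I \<and> openin (zariski (X i)) U \<and> \<phi> \<in> regular (X i) U}"

text \<open>The quotient structure on \<open>S\<close> along a surjection \<open>p\<close> from the points of \<open>X\<close> onto \<open>S\<close>. For
  the orbit map of a group action, the regular functions are the invariant regular functions on
  saturated open sets, as for a geometric quotient.\<close>

definition quotient_fspace :: "'a fspace \<Rightarrow> ('a \<Rightarrow> 'b) \<Rightarrow> 'b set \<Rightarrow> 'b fspace" where
  "quotient_fspace X p S =
     \<lparr>zariski = topology (\<lambda>U. U \<subseteq> S \<and> openin (zariski X) {x \<in> points X. p x \<in> U}),
      regular = (\<lambda>U. {\<phi>. \<phi> \<circ> p \<in> regular X {x \<in> points X. p x \<in> U}})\<rparr>"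

lemma openin_quotient_fspace:
  "openin (zariski (quotient_fspace X p S)) U \<longleftrightarrow>
     U \<subseteq> S \<and> openin (zariski X) {x \<in> points X. p x \<in> U}"
proof -
  have "istopology (\<lambda>U. U \<subseteq> S \<and> openin (zariski X) {x \<in> points X. p x \<in> U})"
    unfolding istopology_def
  proof (intro conjI allI impI)
    fix U V
    assume a: "U \<subseteq> S \<and> openin (zariski X) {x \<in> points X. p x \<in> U}"
      and b: "V \<subseteq> S \<and> openin (zariski X) {x \<in> points X. p x \<in> V}"
    have "{x \<in> points X. p x \<in> U \<inter> V} = {x \<in> points X. p x \<in> U} \<inter> {x \<in> points X. p x \<in> V}"
      by blast
    then show "openin (zariski X) {x \<in> points X. p x \<in> U \<inter> V}"
      using openin_Int[of "zariski X" "{x \<in> points X. p x \<in> U}" "{x \<in> points X. p x \<in> V}"] a b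
      by simp
    show "U \<inter> V \<subseteq> S" using a by blast
  next
    fix \<U>
    assume a: "\<forall>K\<in>\<U>. K \<subseteq> S \<and> openin (zariski X) {x \<in> points X. p x \<in> K}"
    have "{x \<in> points X. p x \<in> \<Union>\<U>} = \<Union>((\<lambda>K. {x \<in> points X. p x \<in> K}) ` \<U>)"
      by blast
    then show "openin (zariski X) {x \<in> points X. p x \<in> \<Union>\<U>}"
      using a by (auto intro: openin_Union)
    show "\<Union>\<U> \<subseteq> S" using a by blast
  qed
  then show ?thesis by (simp add: quotient_fspace_def)
qed

text \<open>Local triviality is with respect to the Zariski topology.\<close>

definition locally_trivial_fibration ::
    "'a fspace \<Rightarrow> 'b fspace \<Rightarrow> ('a \<Rightarrow> 'b) \<Rightarrow> 'c fspace \<Rightarrow> bool" where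
  "locally_trivial_fibration E B p F \<longleftrightarrow> fmorphism E B p \<and>
     (\<forall>b\<in>points B. \<exists>U. openin (zariski B) U \<and> b \<in> U \<and>
        (\<exists>\<Phi>. fisomorphism (open_fsubspace E {x \<in> points E. p x \<in> U})
                (prod_fspace (open_fsubspace B U) F) \<Phi> \<and>
             (\<forall>x\<in>points E. p x \<in> U \<longrightarrow> fst (\<Phi> x) = p x)))"


section \<open>Complete flag varieties\<close>

abbreviation GL :: "nat \<Rightarrow> complex mat monoid" where
  "GL n \<equiv> units_of (ring_mat TYPE(complex) n ())"

abbreviation is_subspace :: "nat \<Rightarrow> complex vec set \<Rightarrow> bool" where
  "is_subspace n W \<equiv> VectorSpace.subspace class_ring W (module_vec TYPE(complex) n)"

definition complete_flags :: "nat \<Rightarrow> (nat \<Rightarrow> complex vec set) set" where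
  "complete_flags n = {W \<in> extensional {..n}.
     (\<forall>r\<le>n. is_subspace n (W r) \<and>
        vectorspace.dim class_ring (module_vec TYPE(complex) n\<lparr>carrier := W r\<rparr>) = r) \<and>
     (\<forall>r<n. W r \<subseteq> W (Suc r))}"

text \<open>\<open>frame_flag n g r\<close> is the span of the first \<open>r\<close> columns of \<open>g\<close>, so \<open>Fl n\<close> carries the variety
  structure of \<open>GL\<^sub>n/B\<close>, with \<open>B\<close> the upper triangular matrices.\<close>

definition frame_flag :: "nat \<Rightarrow> complex mat \<Rightarrow> nat \<Rightarrow> complex vec set" where
  "frame_flag n g = (\<lambda>r\<in>{..n}. (\<lambda>x. g *\<^sub>v x) ` {x \<in> carrier_vec n. \<forall>i\<in>{r..<n}. x $ i = 0})"

definition Fl :: "nat \<Rightarrow> (nat \<Rightarrow> complex vec set) fspace" where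
  "Fl n = quotient_fspace
     (affine_fspace {\<lambda>g. g $$ (a, b) |a b. a < n \<and> b < n} (carrier (GL n)))
     (frame_flag n) (complete_flags n)"


section \<open>Representations of the double framed quiver\<close>

text \<open>A quiver is a finite directed multigraph, \<open>tail\<close> and \<open>head\<close> being \<open>out\<close> and \<open>in\<close>.
  The spaces are \<open>D\<^sub>v = \<complex>^(d v)\<close> and \<open>F\<^sub>v = \<complex>^(f v)\<close>, and linear maps are matrices.\<close>

record ('v, 'e) framed_rep =
  Amap :: "'e \<Rightarrow> complex mat"
  Bmap :: "'e \<Rightarrow> complex mat"
  imap :: "'v \<Rightarrow> complex mat"
  jmap :: "'v \<Rightarrow> complex mat"

definition framed_reps ::
    "('v, 'e) pre_digraph \<Rightarrow> ('v \<Rightarrow> nat) \<Rightarrow> ('v \<Rightarrow> nat) \<Rightarrow> ('v, 'e) framed_rep set" where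
  "framed_reps Q d f = {R.
     Amap R \<in> (\<Pi>\<^sub>E e\<in>arcs Q. carrier_mat (d (head Q e)) (d (tail Q e))) \<and>
     Bmap R \<in> (\<Pi>\<^sub>E e\<in>arcs Q. carrier_mat (d (tail Q e)) (d (head Q e))) \<and>
     imap R \<in> (\<Pi>\<^sub>E v\<in>verts Q. carrier_mat (d v) (f v)) \<and>
     jmap R \<in> (\<Pi>\<^sub>E v\<in>verts Q. carrier_mat (f v) (d v))}"

definition moment_map_eq ::
    "('v, 'e) pre_digraph \<Rightarrow> ('v \<Rightarrow> nat) \<Rightarrow> ('v, 'e) framed_rep \<Rightarrow> bool" where
  "moment_map_eq Q d R \<longleftrightarrow> (\<forall>v\<in>verts Q.
     finsum (module_mat TYPE(complex) (d v) (d v))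
       (\<lambda>e. Amap R e * Bmap R e) {e \<in> arcs Q. head Q e = v}
     - finsum (module_mat TYPE(complex) (d v) (d v))
       (\<lambda>e. Bmap R e * Amap R e) {e \<in> arcs Q. tail Q e = v}
     + imap R v * jmap R v = 0\<^sub>m (d v) (d v))"

definition stable ::
    "('v, 'e) pre_digraph \<Rightarrow> ('v \<Rightarrow> nat) \<Rightarrow> ('v \<Rightarrow> nat) \<Rightarrow> ('v, 'e) framed_rep \<Rightarrow> bool" where
  "stable Q d f R \<longleftrightarrow> (\<forall>D'.
     (\<forall>v\<in>verts Q. is_subspace (d v) (D' v) \<and> (\<forall>x\<in>carrier_vec (f v). imap R v *\<^sub>v x \<in> D' v)) \<and>
     (\<forall>e\<in>arcs Q. (\<forall>x\<in>D' (tail Q e). Amap R e *\<^sub>v x \<in> D' (head Q e)) \<and>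
                 (\<forall>x\<in>D' (head Q e). Bmap R e *\<^sub>v x \<in> D' (tail Q e)))
     \<longrightarrow> (\<forall>v\<in>verts Q. D' v = carrier_vec (d v)))"


section \<open>Split parabolic quiver varieties\<close>

type_synonym ('v, 'e) parabolic =
  "(nat \<Rightarrow> ('v, 'e) framed_rep) \<times> (nat \<Rightarrow> 'v \<Rightarrow> complex mat)"

text \<open>\<open>comp_pi n \<pi> v m\<close> is the composition of \<open>\<pi> 0 v\<close>, ..., \<open>\<pi> (m - 1) v\<close> on \<open>\<complex>^n\<close>.\<close>

primrec comp_pi ::
    "nat \<Rightarrow> (nat \<Rightarrow> 'v \<Rightarrow> complex mat) \<Rightarrow> 'v \<Rightarrow> nat \<Rightarrow> complex mat" where
  "comp_pi n \<pi> v 0 = 1\<^sub>m n"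
| "comp_pi n \<pi> v (Suc m) = \<pi> m v * comp_pi n \<pi> v m"

definition parabolic_data ::
    "('v, 'e) pre_digraph \<Rightarrow> nat \<Rightarrow> (nat \<Rightarrow> 'v \<Rightarrow> nat) \<Rightarrow> ('v \<Rightarrow> nat) \<Rightarrow> ('v, 'e) parabolic set" where
  "parabolic_data Q l d f = {(R, \<pi>).
     R \<in> (\<Pi>\<^sub>E m\<in>{..l}. {r \<in> framed_reps Q (d m) f. stable Q (d m) f r \<and> moment_map_eq Q (d m) r}) \<and>
     \<pi> \<in> (\<Pi>\<^sub>E m\<in>{..<l}. \<Pi>\<^sub>E v\<in>verts Q. carrier_mat (d (Suc m) v) (d m v)) \<and>
     (\<forall>m<l.
        (\<forall>e\<in>arcs Q.
           \<pi> m (head Q e) * Amap (R m) e = Amap (R (Suc m)) e * \<pi> m (tail Q e) \<and>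
           \<pi> m (tail Q e) * Bmap (R m) e = Bmap (R (Suc m)) e * \<pi> m (head Q e)) \<and>
        (\<forall>v\<in>verts Q.
           \<pi> m v * imap (R m) v = imap (R (Suc m)) v \<and>
           jmap (R (Suc m)) v * \<pi> m v = jmap (R m) v)) \<and>
     (\<forall>v\<in>verts Q. \<forall>x\<in>mat_kernel (comp_pi (d 0 v) \<pi> v l).
        (\<forall>e\<in>arcs Q. tail Q e = v \<longrightarrow> Amap (R 0) e *\<^sub>v x = 0\<^sub>v (d 0 (head Q e))) \<and>
        (\<forall>e\<in>arcs Q. head Q e = v \<longrightarrow> Bmap (R 0) e *\<^sub>v x = 0\<^sub>v (d 0 (tail Q e))) \<and>
        jmap (R 0) v *\<^sub>v x = 0\<^sub>v (f v))}"

definition parabolic_coords ::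
    "('v, 'e) pre_digraph \<Rightarrow> nat \<Rightarrow> (nat \<Rightarrow> 'v \<Rightarrow> nat) \<Rightarrow> ('v \<Rightarrow> nat) \<Rightarrow>
       (('v, 'e) parabolic \<Rightarrow> complex) set" where
  "parabolic_coords Q l d f =
     {\<lambda>x. Amap (fst x m) e $$ (a, b) |m e a b.
        m \<le> l \<and> e \<in> arcs Q \<and> a < d m (head Q e) \<and> b < d m (tail Q e)} \<union>
     {\<lambda>x. Bmap (fst x m) e $$ (a, b) |m e a b.
        m \<le> l \<and> e \<in> arcs Q \<and> a < d m (tail Q e) \<and> b < d m (head Q e)} \<union>
     {\<lambda>x. imap (fst x m) v $$ (a, b) |m v a b. m \<le> l \<and> v \<in> verts Q \<and> a < d m v \<and> b < f v} \<union>
     {\<lambda>x. jmap (fst x m) v $$ (a, b) |m v a b. m \<le> l \<and> v \<in> verts Q \<and> a < f v \<and> b < d m v} \<union>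
     {\<lambda>x. snd x m v $$ (a, b) |m v a b. m < l \<and> v \<in> verts Q \<and> a < d (Suc m) v \<and> b < d m v}"

definition parabolic_group ::
    "('v, 'e) pre_digraph \<Rightarrow> nat \<Rightarrow> (nat \<Rightarrow> 'v \<Rightarrow> nat) \<Rightarrow> (nat \<Rightarrow> 'v \<Rightarrow> complex mat) monoid" where
  "parabolic_group Q l d = product_group {..l} (\<lambda>m. product_group (verts Q) (\<lambda>v. GL (d m v)))"

definition rep_act ::
    "('v, 'e) pre_digraph \<Rightarrow> ('v \<Rightarrow> nat) \<Rightarrow> ('v \<Rightarrow> complex mat) \<Rightarrow>
       ('v, 'e) framed_rep \<Rightarrow> ('v, 'e) framed_rep" where
  "rep_act Q d g R =
     \<lparr>Amap = (\<lambda>e\<in>arcs Q. g (head Q e) * Amap R e * inv\<^bsub>GL (d (tail Q e))\<^esub> (g (tail Q e))),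
      Bmap = (\<lambda>e\<in>arcs Q. g (tail Q e) * Bmap R e * inv\<^bsub>GL (d (head Q e))\<^esub> (g (head Q e))),
      imap = (\<lambda>v\<in>verts Q. g v * imap R v),
      jmap = (\<lambda>v\<in>verts Q. jmap R v * inv\<^bsub>GL (d v)\<^esub> (g v))\<rparr>"

definition parabolic_act ::
    "('v, 'e) pre_digraph \<Rightarrow> nat \<Rightarrow> (nat \<Rightarrow> 'v \<Rightarrow> nat) \<Rightarrow> (nat \<Rightarrow> 'v \<Rightarrow> complex mat) \<Rightarrow>
       ('v, 'e) parabolic \<Rightarrow> ('v, 'e) parabolic" where
  "parabolic_act Q l d g x =
     (\<lambda>m\<in>{..l}. rep_act Q (d m) (g m) (fst x m),
      \<lambda>m\<in>{..<l}. \<lambda>v\<in>verts Q. g (Suc m) v * snd x m v * inv\<^bsub>GL (d m v)\<^esub> (g m v))"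

abbreviation parabolic_orbit ::
    "('v, 'e) pre_digraph \<Rightarrow> nat \<Rightarrow> (nat \<Rightarrow> 'v \<Rightarrow> nat) \<Rightarrow>
       ('v, 'e) parabolic \<Rightarrow> ('v, 'e) parabolic set" where
  "parabolic_orbit Q l d \<equiv> Group_Action.orbit (parabolic_group Q l d) (parabolic_act Q l d)"

definition parabolic_quiver_variety ::
    "('v, 'e) pre_digraph \<Rightarrow> nat \<Rightarrow> (nat \<Rightarrow> 'v \<Rightarrow> nat) \<Rightarrow> ('v \<Rightarrow> nat) \<Rightarrow>
       ('v, 'e) parabolic set fspace" where
  "parabolic_quiver_variety Q l d f = quotient_fspace
     (affine_fspace (parabolic_coords Q l d f) (parabolic_data Q l d f))
     (parabolic_orbit Q l d)
     (orbits (parabolic_group Q l d) (parabolic_data Q l d f) (parabolic_act Q l d))"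

definition two_step :: "('v \<Rightarrow> nat) \<Rightarrow> ('v \<Rightarrow> nat) \<Rightarrow> nat \<Rightarrow> 'v \<Rightarrow> nat" where
  "two_step d d' = (\<lambda>m. if m = 0 then d else d')"

definition forget_middle ::
    "('v, 'e) pre_digraph \<Rightarrow> nat \<Rightarrow> (nat \<Rightarrow> 'v \<Rightarrow> nat) \<Rightarrow> ('v, 'e) parabolic \<Rightarrow> ('v, 'e) parabolic" where
  "forget_middle Q l d x =
     (\<lambda>m\<in>{..1}. if m = 0 then fst x 0 else fst x l,
      \<lambda>m\<in>{..<1}. \<lambda>v\<in>verts Q. comp_pi (d 0 v) (snd x) v l)"

text \<open>All \<open>x\<close> in one orbit \<open>X\<close> give the same orbit of \<open>forget_middle Q l d x\<close>, which is the union
  below.\<close>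

definition natural_projection ::
    "('v, 'e) pre_digraph \<Rightarrow> nat \<Rightarrow> (nat \<Rightarrow> 'v \<Rightarrow> nat) \<Rightarrow>
       ('v, 'e) parabolic set \<Rightarrow> ('v, 'e) parabolic set" where
  "natural_projection Q l d X =
     (\<Union>x\<in>X. parabolic_orbit Q 1 (two_step (d 0) (d l)) (forget_middle Q l d x))"

definition unit_step_path ::
    "('v, 'e) pre_digraph \<Rightarrow> ('v \<Rightarrow> nat) \<Rightarrow> ('v \<Rightarrow> nat) \<Rightarrow> nat \<Rightarrow> (nat \<Rightarrow> 'v \<Rightarrow> nat) \<Rightarrow> bool" where
  "unit_step_path Q d k l ds \<longleftrightarrow>
     (\<forall>v\<in>verts Q. ds 0 v = d v) \<and>
     (\<forall>i<l. \<exists>w\<in>verts Q. \<forall>v\<in>verts Q.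
        int (ds i v) - int (ds (Suc i) v) = (if v = w then 1 else 0)) \<and>
     (\<forall>v\<in>verts Q. int (k v) = int (ds 0 v) - int (ds l v))"

end

theory Submission
  imports Defs "Jordan_Normal_Form.DL_Rank"
begin

text \<open>Write \<open>d\<close> and \<open>c\<close> for the first and the last dimension vector of a path.

  Stability makes all maps \<open>\<pi>\<close> surjective, so every orbit contains points for which each \<open>\<pi>\<close> is the
  projection of a coordinate space onto its last coordinates. The target of a surjective morphism is
  determined by its source, so such a point is determined by its first representation \<open>R\<close>. Here \<open>R\<close>
  can be any point of \<open>core_reps d c\<close>, the stable solutions of the moment map equation for which
  \<open>A\<close>, \<open>B\<close> and \<open>j\<close> vanish on the first \<open>d\<^sub>v - c\<^sub>v\<close> unit vectors: \<open>R\<close> descends to every quotient by a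
  smaller coordinate subspace, and so do stability and the moment map equation. Hence the space of
  normal forms depends on \<open>d\<close> and \<open>c\<close> only. Two normal forms are in one orbit iff they differ by a
  change of basis \<open>h\<close> preserving the coordinate subspaces \<open>\<complex>\<^sup>r\<close> where \<open>r\<close> is the dimension of the
  kernel of some composition of the \<open>\<pi>\<close> (\<open>porbit_norm_pt_eq_iff\<close>). Since frames adapted to the \<open>\<pi>\<close> can
  be chosen regularly near every point, the moduli space is also as a space with functions the quotient
  of \<open>core_reps d c\<close> by the group \<open>H\<close> of these \<open>h\<close> (\<open>fquotient_core\<close>).

  If each step lowers the dimension by one at one vertex, all \<open>r \<le> d\<^sub>v - c\<^sub>v\<close> occur at \<open>v\<close>. Then \<open>H\<close>
  depends on \<open>d\<close> and \<open>c\<close> only, and so does the moduli space. For the path consisting of \<open>d\<close> and \<open>c\<close>,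
  the group is the larger group \<open>H\<^sub>2\<close> of all \<open>h\<close> preserving \<open>\<complex>\<^sup>r\<close> for \<open>r = d\<^sub>v - c\<^sub>v\<close>. The natural
  projection is the map from the quotient by \<open>H\<close> to the quotient by \<open>H\<^sub>2\<close>, and \<open>H\<^sub>2 / H\<close> is a product
  of complete flag varieties.

  For local triviality, the quotient by \<open>H\<^sub>2\<close> needs local sections. By stability, the vectors
  obtained from the framing along paths of the doubled quiver span all spaces. For suitable paths
  they form invertible matrices \<open>b\<^sub>v(R)\<close> with \<open>b\<^sub>v(h R) = h\<^sub>v b\<^sub>v(R)\<close> on an open set, and the paths can be
  chosen such that the lower right block of size \<open>c\<^sub>v\<close> is invertible as well (\<open>word_frame_exists\<close>).
  Column operations then make the matrix block triangular without destroying the equivariance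
  (\<open>block_normal_mult\<close>), and the inverse of the resulting \<open>L\<^sub>v(R)\<close> moves \<open>R\<close> to a representative that
  depends only on the \<open>H\<^sub>2\<close>-orbit. The upper left block of the inverse of \<open>L\<^sub>v(R)\<close> is a frame whose flag
  depends only on the \<open>H\<close>-orbit. The representative and the flags together determine the \<open>H\<close>-orbit, and
  the inverse map is regular because the map from frames to complete flags has local sections, given by
  the big cell (\<open>flag_local_section\<close>).\<close>

section \<open>Spaces with functions\<close>

text \<open>The properties of a sheaf of algebras of functions on which the arguments rely. In particular,
  nonvanishing functions can be inverted and their nonvanishing loci are open, as on a variety.\<close>
locale function_space =
  fixes X :: "'a fspace"
  assumes reg_cong: "\<lbrakk>openin (zariski X) U; \<phi> \<in> regular X U; \<And>x. x \<in> U \<Longrightarrow> \<phi> x = \<psi> x\<rbrakk>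
      \<Longrightarrow> \<psi> \<in> regular X U"
    and reg_mono: "\<lbrakk>openin (zariski X) U; openin (zariski X) V; V \<subseteq> U; \<phi> \<in> regular X U\<rbrakk>
      \<Longrightarrow> \<phi> \<in> regular X V"
    and reg_local: "\<lbrakk>openin (zariski X) U;
        \<And>x. x \<in> U \<Longrightarrow> \<exists>N. openin (zariski X) N \<and> x \<in> N \<and> N \<subseteq> U \<and> \<phi> \<in> regular X N\<rbrakk>
      \<Longrightarrow> \<phi> \<in> regular X U"
    and reg_const: "openin (zariski X) U \<Longrightarrow> (\<lambda>_. c) \<in> regular X U"
    and reg_add: "\<lbrakk>openin (zariski X) U; \<phi> \<in> regular X U; \<psi> \<in> regular X U\<rbrakk>
      \<Longrightarrow> (\<lambda>x. \<phi> x + \<psi> x) \<in> regular X U"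
    and reg_mult: "\<lbrakk>openin (zariski X) U; \<phi> \<in> regular X U; \<psi> \<in> regular X U\<rbrakk>
      \<Longrightarrow> (\<lambda>x. \<phi> x * \<psi> x) \<in> regular X U"
    and reg_inverse: "\<lbrakk>openin (zariski X) U; \<phi> \<in> regular X U; \<And>x. x \<in> U \<Longrightarrow> \<phi> x \<noteq> 0\<rbrakk>
      \<Longrightarrow> (\<lambda>x. 1 / \<phi> x) \<in> regular X U"
    and open_nonvanishing: "\<lbrakk>openin (zariski X) U; \<phi> \<in> regular X U\<rbrakk>
      \<Longrightarrow> openin (zariski X) {x \<in> U. \<phi> x \<noteq> 0}"

lemma poly_algebra_mono:
  assumes "h \<in> poly_algebra H" and "H \<subseteq> H'"
  shows "h \<in> poly_algebra H'"
  using assms(1)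
proof induction
  case (gen h)
  then show ?case using assms(2) by (auto intro: poly_algebra.gen)
next
  case (const c) show ?case by (rule poly_algebra.const)
next
  case (add g h) from add.IH show ?case by (rule poly_algebra.add)
next
  case (mult g h) from mult.IH show ?case by (rule poly_algebra.mult)
qed

lemma points_generated [simp]: "points (generated_fspace S \<G>) = S"
proof -
  have "S = {x \<in> S \<inter> \<Inter>(fst ` {}). (\<lambda>_. 1::complex) x \<noteq> 0}" by simp
  moreover have "{} \<subseteq> \<G>" "(\<lambda>_. 1::complex) \<in> poly_algebra (snd ` {})"
    by (auto intro: poly_algebra.const)
  ultimately have "S \<in> {{x \<in> S \<inter> \<Inter>(fst ` F). h x \<noteq> 0} |F h.
      finite F \<and> F \<subseteq> \<G> \<and> h \<in> poly_algebra (snd ` F)}"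
    by (intro CollectI exI[of _ "{}"] exI[of _ "\<lambda>_. 1"] conjI) auto
  then show ?thesis
    unfolding generated_fspace_def generated_topology_def fspace.simps topology_generated_by_topspace
    by (intro subset_antisym Union_least Union_upper) blast
qed

lemma openin_generated_basis:
  assumes "finite F" "F \<subseteq> \<G>" "h \<in> poly_algebra (snd ` F)"
  shows "openin (zariski (generated_fspace S \<G>)) {x \<in> S \<inter> \<Inter>(fst ` F). h x \<noteq> 0}"
  unfolding generated_fspace_def generated_topology_def using assms
  by (auto intro!: topology_generated_by_Basis)

lemma regular_generated_iff:
  "\<phi> \<in> regular (generated_fspace S \<G>) U \<longleftrightarrow> (\<forall>x\<in>U. \<exists>N F g h.
         openin (zariski (generated_fspace S \<G>)) N \<and> x \<in> N \<and> N \<subseteq> U \<and>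
         finite F \<and> F \<subseteq> \<G> \<and> N \<subseteq> \<Inter>(fst ` F) \<and>
         g \<in> poly_algebra (snd ` F) \<and> h \<in> poly_algebra (snd ` F) \<and>
         (\<forall>y\<in>N. h y \<noteq> 0 \<and> \<phi> y = g y / h y))"
  by (simp add: generated_fspace_def)

lemma regular_generatedI:
  assumes "openin (zariski (generated_fspace S \<G>)) N" "x \<in> N" "N \<subseteq> U"
    "finite F" "F \<subseteq> \<G>" "N \<subseteq> \<Inter>(fst ` F)"
    "g \<in> poly_algebra (snd ` F)" "h \<in> poly_algebra (snd ` F)"
    "\<And>y. y \<in> N \<Longrightarrow> h y \<noteq> 0 \<and> \<phi> y = g y / h y"
  shows "\<exists>N F g h.
         openin (zariski (generated_fspace S \<G>)) N \<and> x \<in> N \<and> N \<subseteq> U \<and>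
         finite F \<and> F \<subseteq> \<G> \<and> N \<subseteq> \<Inter>(fst ` F) \<and>
         g \<in> poly_algebra (snd ` F) \<and> h \<in> poly_algebra (snd ` F) \<and>
         (\<forall>y\<in>N. h y \<noteq> 0 \<and> \<phi> y = g y / h y)"
  by (rule exI[of _ N], rule exI[of _ F], rule exI[of _ g], rule exI[of _ h]) (use assms in auto)

lemma regular_generatedE:
  assumes "\<phi> \<in> regular (generated_fspace S \<G>) U" "x \<in> U"
  obtains N F g h where
    "openin (zariski (generated_fspace S \<G>)) N" "x \<in> N" "N \<subseteq> U"
    "finite F" "F \<subseteq> \<G>" "N \<subseteq> \<Inter>(fst ` F)"
    "g \<in> poly_algebra (snd ` F)" "h \<in> poly_algebra (snd ` F)"
    "\<forall>y\<in>N. h y \<noteq> 0" "\<forall>y\<in>N. \<phi> y = g y / h y"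
  using bspec[OF assms(1)[unfolded regular_generated_iff] assms(2)]
  by (elim exE conjE) (rule that, assumption+, auto)

lemma regular_generated_binop:
  fixes S :: "'a set"
  assumes \<phi>: "\<phi> \<in> regular (generated_fspace S \<G>) U" and \<psi>: "\<psi> \<in> regular (generated_fspace S \<G>) U"
    and op: "\<And>(H :: ('a \<Rightarrow> complex) set) g h g' h'. \<lbrakk>g \<in> poly_algebra H; h \<in> poly_algebra H; g' \<in> poly_algebra H;
        h' \<in> poly_algebra H\<rbrakk> \<Longrightarrow> \<exists>k\<in>poly_algebra H. \<forall>y. h y \<noteq> 0 \<longrightarrow> h' y \<noteq> 0 \<longrightarrow>
          bop (g y / h y) (g' y / h' y) = k y / (h y * h' y)"
  shows "(\<lambda>x. bop (\<phi> x) (\<psi> x)) \<in> regular (generated_fspace S \<G>) U"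
  unfolding regular_generated_iff
proof
  fix x assume x: "x \<in> U"
  obtain N F g h where 1: "openin (zariski (generated_fspace S \<G>)) N" "x \<in> N" "N \<subseteq> U"
    "finite F" "F \<subseteq> \<G>" "N \<subseteq> \<Inter>(fst ` F)"
    "g \<in> poly_algebra (snd ` F)" "h \<in> poly_algebra (snd ` F)"
    "\<forall>y\<in>N. h y \<noteq> 0" "\<forall>y\<in>N. \<phi> y = g y / h y"
    by (rule regular_generatedE[OF \<phi> x])
  obtain N' F' g' h' where 2: "openin (zariski (generated_fspace S \<G>)) N'" "x \<in> N'" "N' \<subseteq> U"
    "finite F'" "F' \<subseteq> \<G>" "N' \<subseteq> \<Inter>(fst ` F')"
    "g' \<in> poly_algebra (snd ` F')" "h' \<in> poly_algebra (snd ` F')"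
    "\<forall>y\<in>N'. h' y \<noteq> 0" "\<forall>y\<in>N'. \<psi> y = g' y / h' y"
    by (rule regular_generatedE[OF \<psi> x])
  let ?H = "snd ` (F \<union> F')"
  have mem: "g \<in> poly_algebra ?H" "h \<in> poly_algebra ?H" "g' \<in> poly_algebra ?H" "h' \<in> poly_algebra ?H"
    using 1 2 by (auto elim!: poly_algebra_mono)
  obtain k where k: "k \<in> poly_algebra ?H" "\<And>y. h y \<noteq> 0 \<Longrightarrow> h' y \<noteq> 0 \<Longrightarrow>
      bop (g y / h y) (g' y / h' y) = k y / (h y * h' y)"
    using op[OF mem] by blast
  show "\<exists>N F g h.
         openin (zariski (generated_fspace S \<G>)) N \<and> x \<in> N \<and> N \<subseteq> U \<and>
         finite F \<and> F \<subseteq> \<G> \<and> N \<subseteq> \<Inter>(fst ` F) \<and>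
         g \<in> poly_algebra (snd ` F) \<and> h \<in> poly_algebra (snd ` F) \<and>
         (\<forall>y\<in>N. h y \<noteq> 0 \<and> bop (\<phi> y) (\<psi> y) = g y / h y)"
    by (rule regular_generatedI[of _ _ "N \<inter> N'" _ _ "F \<union> F'" k "\<lambda>y. h y * h' y"])
       (use 1 2 k mem poly_algebra.mult[OF mem(2,4)] in auto)
qed

text \<open>A regular function on a generated space is locally a quotient of polynomials in finitely many
  generators, and quotients of polynomials over two finite sets of generators can be combined over
  their union.\<close>

lemma function_space_generated: "function_space (generated_fspace S \<G>)"
proof
  let ?X = "generated_fspace S \<G>"
  fix U \<phi> \<psi>
  assume U: "openin (zariski ?X) U" and \<phi>: "\<phi> \<in> regular ?X U"
  show "\<psi> \<in> regular ?X U" if eq: "\<And>x. x \<in> U \<Longrightarrow> \<phi> x = \<psi> x"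
    unfolding regular_generated_iff
  proof
    fix x assume xU: "x \<in> U"
    obtain N F g h where *:
      "openin (zariski (generated_fspace S \<G>)) N" "x \<in> N" "N \<subseteq> U"
      "finite F" "F \<subseteq> \<G>" "N \<subseteq> \<Inter>(fst ` F)"
      "g \<in> poly_algebra (snd ` F)" "h \<in> poly_algebra (snd ` F)"
      "\<forall>y\<in>N. h y \<noteq> 0" "\<forall>y\<in>N. \<phi> y = g y / h y"
      by (rule regular_generatedE[OF \<phi> xU])
    have "h y \<noteq> 0 \<and> \<psi> y = g y / h y" if "y \<in> N" for y
      using bspec[OF *(9) that] bspec[OF *(10) that] eq[of y] subsetD[OF *(3) that] by simp
    then show "\<exists>N F g h. openin (zariski (generated_fspace S \<G>)) N \<and> x \<in> N \<and> N \<subseteq> U \<and>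
         finite F \<and> F \<subseteq> \<G> \<and> N \<subseteq> \<Inter>(fst ` F) \<and>
         g \<in> poly_algebra (snd ` F) \<and> h \<in> poly_algebra (snd ` F) \<and>
         (\<forall>y\<in>N. h y \<noteq> 0 \<and> \<psi> y = g y / h y)"
      using * by (intro regular_generatedI[of _ _ N _ _ F g h])
  qed
  show "\<phi> \<in> regular ?X V" if V: "openin (zariski ?X) V" "V \<subseteq> U" for V
    unfolding regular_generated_iff
  proof
    fix x assume "x \<in> V"
    then have xU: "x \<in> U" using V by auto
    obtain N F g h where
      "openin (zariski (generated_fspace S \<G>)) N" "x \<in> N" "N \<subseteq> U"
      "finite F" "F \<subseteq> \<G>" "N \<subseteq> \<Inter>(fst ` F)"
      "g \<in> poly_algebra (snd ` F)" "h \<in> poly_algebra (snd ` F)"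
      "\<forall>y\<in>N. h y \<noteq> 0" "\<forall>y\<in>N. \<phi> y = g y / h y"
      by (rule regular_generatedE[OF \<phi> xU])
    then show "\<exists>N F g h. openin (zariski (generated_fspace S \<G>)) N \<and> x \<in> N \<and> N \<subseteq> V \<and>
         finite F \<and> F \<subseteq> \<G> \<and> N \<subseteq> \<Inter>(fst ` F) \<and>
         g \<in> poly_algebra (snd ` F) \<and> h \<in> poly_algebra (snd ` F) \<and>
         (\<forall>y\<in>N. h y \<noteq> 0 \<and> \<phi> y = g y / h y)"
      using V \<open>x \<in> V\<close> by (intro regular_generatedI[of _ _ "N \<inter> V" _ _ F g h]) auto
  qed
  show "(\<lambda>x. \<phi> x + \<psi> x) \<in> regular ?X U" if \<psi>: "\<psi> \<in> regular ?X U"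
  proof (rule regular_generated_binop[OF \<phi> \<psi>])
    fix H and g h g' h' :: "'a \<Rightarrow> complex"
    assume "g \<in> poly_algebra H" "h \<in> poly_algebra H" "g' \<in> poly_algebra H" "h' \<in> poly_algebra H"
    then have "(\<lambda>y. g y * h' y + g' y * h y) \<in> poly_algebra H"
      by (intro poly_algebra.add[of "\<lambda>y. g y * h' y" H "\<lambda>y. g' y * h y"] poly_algebra.mult)
    then show "\<exists>k\<in>poly_algebra H. \<forall>y. h y \<noteq> 0 \<longrightarrow> h' y \<noteq> 0 \<longrightarrow>
          g y / h y + g' y / h' y = k y / (h y * h' y)"
      by (rule rev_bexI) (simp add: add_frac_eq)
  qed
  show "(\<lambda>x. \<phi> x * \<psi> x) \<in> regular ?X U" if \<psi>: "\<psi> \<in> regular ?X U"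
  proof (rule regular_generated_binop[OF \<phi> \<psi>])
    fix H and g h g' h' :: "'a \<Rightarrow> complex"
    assume "g \<in> poly_algebra H" "h \<in> poly_algebra H" "g' \<in> poly_algebra H" "h' \<in> poly_algebra H"
    then have "(\<lambda>y. g y * g' y) \<in> poly_algebra H"
      by (intro poly_algebra.mult)
    then show "\<exists>k\<in>poly_algebra H. \<forall>y. h y \<noteq> 0 \<longrightarrow> h' y \<noteq> 0 \<longrightarrow>
          g y / h y * (g' y / h' y) = k y / (h y * h' y)"
      by (rule rev_bexI) simp
  qed
  show "(\<lambda>x. 1 / \<phi> x) \<in> regular ?X U" if nz: "\<And>x. x \<in> U \<Longrightarrow> \<phi> x \<noteq> 0"
    unfolding regular_generated_iff
  proof
    fix x assume xU: "x \<in> U"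
    obtain N F g h where
      *: "openin (zariski (generated_fspace S \<G>)) N" "x \<in> N" "N \<subseteq> U"
      "finite F" "F \<subseteq> \<G>" "N \<subseteq> \<Inter>(fst ` F)"
      "g \<in> poly_algebra (snd ` F)" "h \<in> poly_algebra (snd ` F)"
      "\<forall>y\<in>N. h y \<noteq> 0" "\<forall>y\<in>N. \<phi> y = g y / h y"
      by (rule regular_generatedE[OF \<phi> xU])
    have "g y \<noteq> 0 \<and> 1 / \<phi> y = h y / g y" if "y \<in> N" for y
      using bspec[OF *(9) that] bspec[OF *(10) that] nz[of y] *(3) that by auto
    then show "\<exists>N F g h. openin (zariski (generated_fspace S \<G>)) N \<and> x \<in> N \<and> N \<subseteq> U \<and>
         finite F \<and> F \<subseteq> \<G> \<and> N \<subseteq> \<Inter>(fst ` F) \<and>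
         g \<in> poly_algebra (snd ` F) \<and> h \<in> poly_algebra (snd ` F) \<and>
         (\<forall>y\<in>N. h y \<noteq> 0 \<and> 1 / \<phi> y = g y / h y)"
      using * by (intro regular_generatedI[of _ _ N _ _ F h g]) auto
  qed
  show "openin (zariski ?X) {x \<in> U. \<phi> x \<noteq> 0}"
  proof (subst openin_subopen, safe)
    fix x assume xU: "x \<in> U" and x0: "\<phi> x \<noteq> 0"
    obtain N F g h where
      *: "openin (zariski (generated_fspace S \<G>)) N" "x \<in> N" "N \<subseteq> U"
      "finite F" "F \<subseteq> \<G>" "N \<subseteq> \<Inter>(fst ` F)"
      "g \<in> poly_algebra (snd ` F)" "h \<in> poly_algebra (snd ` F)"
      "\<forall>y\<in>N. h y \<noteq> 0" "\<forall>y\<in>N. \<phi> y = g y / h y"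
      by (rule regular_generatedE[OF \<phi> xU])
    have "N \<subseteq> S" using openin_subset[OF *(1)] by simp
    let ?T = "N \<inter> {x \<in> S \<inter> \<Inter>(fst ` F). g x \<noteq> 0}"
    have "openin (zariski ?X) ?T"
      using * by (intro openin_Int openin_generated_basis) auto
    moreover have "x \<in> ?T" using * x0 \<open>N \<subseteq> S\<close> by auto
    moreover have "?T \<subseteq> {x \<in> U. \<phi> x \<noteq> 0}" using * by auto
    ultimately show "\<exists>T. openin (zariski ?X) T \<and> x \<in> T \<and> T \<subseteq> {x \<in> U. \<phi> x \<noteq> 0}" by blast
  qed
next
  fix U \<phi>
  assume U: "openin (zariski (generated_fspace S \<G>)) U"
    and loc: "\<And>x. x \<in> U \<Longrightarrow> \<exists>N. openin (zariski (generated_fspace S \<G>)) N \<and> x \<in> N \<and> N \<subseteq> U \<and>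
      \<phi> \<in> regular (generated_fspace S \<G>) N"
  show "\<phi> \<in> regular (generated_fspace S \<G>) U"
    unfolding regular_generated_iff
  proof
    fix x assume xU: "x \<in> U"
    from loc[OF xU] obtain M where M: "x \<in> M" "M \<subseteq> U" "\<phi> \<in> regular (generated_fspace S \<G>) M"
      by blast
    obtain N F g h where
      "openin (zariski (generated_fspace S \<G>)) N" "x \<in> N" "N \<subseteq> M"
      "finite F" "F \<subseteq> \<G>" "N \<subseteq> \<Inter>(fst ` F)"
      "g \<in> poly_algebra (snd ` F)" "h \<in> poly_algebra (snd ` F)"
      "\<forall>y\<in>N. h y \<noteq> 0" "\<forall>y\<in>N. \<phi> y = g y / h y"
      by (rule regular_generatedE[OF M(3,1)])
    then show "\<exists>N F g h. openin (zariski (generated_fspace S \<G>)) N \<and> x \<in> N \<and> N \<subseteq> U \<and>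
         finite F \<and> F \<subseteq> \<G> \<and> N \<subseteq> \<Inter>(fst ` F) \<and>
         g \<in> poly_algebra (snd ` F) \<and> h \<in> poly_algebra (snd ` F) \<and>
         (\<forall>y\<in>N. h y \<noteq> 0 \<and> \<phi> y = g y / h y)"
      using M by (intro regular_generatedI[of _ _ N _ _ F g h]) auto
  qed
next
  fix U and c :: complex
  assume U: "openin (zariski (generated_fspace S \<G>)) U"
  show "(\<lambda>_. c) \<in> regular (generated_fspace S \<G>) U"
    unfolding regular_generated_iff
    by (intro ballI regular_generatedI[of _ _ U _ _ "{}" "\<lambda>_. c" "\<lambda>_. 1"])
       (use U in \<open>auto intro: poly_algebra.const poly_algebra.gen\<close>)
qed

lemma regular_generator:
  assumes "(V, c) \<in> \<G>" "V \<subseteq> S"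
  shows "openin (zariski (generated_fspace S \<G>)) V" "c \<in> regular (generated_fspace S \<G>) V"
proof -
  have "{x \<in> S \<inter> \<Inter>(fst ` {(V, c)}). (\<lambda>_. 1::complex) x \<noteq> 0} = V" using assms by auto
  then show V: "openin (zariski (generated_fspace S \<G>)) V"
    using openin_generated_basis[of "{(V, c)}" \<G> "\<lambda>_. 1" S] assms poly_algebra.const by auto
  show "c \<in> regular (generated_fspace S \<G>) V"
    unfolding regular_generated_iff
    by (intro ballI regular_generatedI[of _ _ V _ _ "{(V,c)}" c "\<lambda>_. 1"])
       (use V assms in \<open>auto intro: poly_algebra.const poly_algebra.gen\<close>)
qed

subsection \<open>Morphisms\<close>

lemma continuous_mapD:
  assumes "continuous_map (zariski X) (zariski Y) h"
  shows "openin (zariski Y) V \<Longrightarrow> openin (zariski X) {x \<in> points X. h x \<in> V}"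
    and "x \<in> points X \<Longrightarrow> h x \<in> points Y"
  using assms by (auto simp: continuous_map_def)

lemma fmorphismD:
  assumes "fmorphism X Y h"
  shows "openin (zariski Y) V \<Longrightarrow> openin (zariski X) {x \<in> points X. h x \<in> V}"
    and "x \<in> points X \<Longrightarrow> h x \<in> points Y"
    and "\<lbrakk>openin (zariski Y) V; \<phi> \<in> regular Y V\<rbrakk> \<Longrightarrow> \<phi> \<circ> h \<in> regular X {x \<in> points X. h x \<in> V}"
  using assms by (auto simp: fmorphism_def dest: continuous_mapD)

lemma fmorphismI:
  assumes "\<And>x. x \<in> points X \<Longrightarrow> h x \<in> points Y"
    and "\<And>V. openin (zariski Y) V \<Longrightarrow> openin (zariski X) {x \<in> points X. h x \<in> V}"
    and "\<And>V \<phi>. \<lbrakk>openin (zariski Y) V; \<phi> \<in> regular Y V\<rbrakk>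
      \<Longrightarrow> \<phi> \<circ> h \<in> regular X {x \<in> points X. h x \<in> V}"
  shows "fmorphism X Y h"
  using assms by (auto simp: fmorphism_def continuous_map_def)

lemma fmorphism_compose:
  assumes h: "fmorphism X Y h" and k: "fmorphism Y Z k"
  shows "fmorphism X Z (k \<circ> h)"
proof (rule fmorphismI)
  have eq: "{x \<in> points X. (k \<circ> h) x \<in> V} = {x \<in> points X. h x \<in> {y \<in> points Y. k y \<in> V}}" for V
    using fmorphismD(2)[OF h] by auto
  fix V assume V: "openin (zariski Z) V"
  show "openin (zariski X) {x \<in> points X. (k \<circ> h) x \<in> V}"
    unfolding eq by (intro fmorphismD(1)[OF h] fmorphismD(1)[OF k] V)
  fix \<phi> assume "\<phi> \<in> regular Z V"
  then show "\<phi> \<circ> (k \<circ> h) \<in> regular X {x \<in> points X. (k \<circ> h) x \<in> V}"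
    unfolding eq o_assoc by (intro fmorphismD(3)[OF h] fmorphismD(1,3)[OF k] V)
qed (use fmorphismD(2)[OF h] fmorphismD(2)[OF k] in auto)

lemma (in function_space) fmorphism_cong:
  assumes h: "fmorphism X Y h" and eq: "\<And>x. x \<in> points X \<Longrightarrow> h x = h' x"
  shows "fmorphism X Y h'"
proof (rule fmorphismI)
  fix x assume "x \<in> points X" then show "h' x \<in> points Y"
    using fmorphismD(2)[OF h] eq by auto
next
  have s: "{x \<in> points X. h' x \<in> V} = {x \<in> points X. h x \<in> V}" for V using eq by auto
  fix V assume V: "openin (zariski Y) V"
  show o: "openin (zariski X) {x \<in> points X. h' x \<in> V}"
    unfolding s using V by (rule fmorphismD(1)[OF h])
  fix \<phi> assume "\<phi> \<in> regular Y V"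
  with V have "\<phi> \<circ> h \<in> regular X {x \<in> points X. h x \<in> V}" by (rule fmorphismD(3)[OF h])
  then show "\<phi> \<circ> h' \<in> regular X {x \<in> points X. h' x \<in> V}"
    using o eq unfolding s by (elim reg_cong[rotated]) auto
qed

text \<open>The universal property of the coarsest structure for which the generators are regular.\<close>
lemma fmorphism_generatedI:
  assumes X: "function_space X"
    and into: "\<And>x. x \<in> points X \<Longrightarrow> h x \<in> S"
    and gen: "\<And>V c. (V, c) \<in> \<G> \<Longrightarrow> openin (zariski X) {x \<in> points X. h x \<in> V} \<and>
        c \<circ> h \<in> regular X {x \<in> points X. h x \<in> V}"
  shows "fmorphism X (generated_fspace S \<G>) h"
proof -
  interpret function_space X by fact
  have top: "openin (zariski X) (points X)" by simp
  have opF: "openin (zariski X) {x \<in> points X. h x \<in> \<Inter>(fst ` F)}" if "finite F" "F \<subseteq> \<G>" for F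
    using that
  proof (induction F)
    case (insert p F)
    have "{x \<in> points X. h x \<in> \<Inter>(fst ` insert p F)} =
        {x \<in> points X. h x \<in> fst p} \<inter> {x \<in> points X. h x \<in> \<Inter>(fst ` F)}" by auto
    moreover have "openin (zariski X) {x \<in> points X. h x \<in> fst p}"
      using gen[of "fst p" "snd p"] insert by auto
    ultimately show ?case using insert by auto
  qed auto
  have pol: "q \<circ> h \<in> regular X {x \<in> points X. h x \<in> \<Inter>(fst ` F)}"
    if F: "finite F" "F \<subseteq> \<G>" and q: "q \<in> poly_algebra (snd ` F)" for q F
    using q
  proof induction
    case (gen c)
    then obtain V where V: "(V, c) \<in> F" by auto
    then have "openin (zariski X) {x \<in> points X. h x \<in> V}"
        "c \<circ> h \<in> regular X {x \<in> points X. h x \<in> V}" using assms(3)[of V c] F by auto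
    then show ?case using V opF[OF F] by (elim reg_mono[rotated 3]) auto
  next
    case (const c)
    then show ?case using reg_const[OF opF[OF F]] by (simp add: o_def)
  next
    case (add g k)
    then show ?case using reg_add[OF opF[OF F] add.IH] by (simp add: o_def)
  next
    case (mult g k)
    then show ?case using reg_mult[OF opF[OF F] mult.IH] by (simp add: o_def)
  qed
  have cont: "continuous_map (zariski X) (zariski (generated_fspace S \<G>)) h"
    unfolding generated_fspace_def generated_topology_def fspace.simps continuous_on_generated_topo_iff
  proof (intro conjI allI impI)
    fix U assume "U \<in> {{x \<in> S \<inter> \<Inter>(fst ` F). k x \<noteq> 0} |F k.
        finite F \<and> F \<subseteq> \<G> \<and> k \<in> poly_algebra (snd ` F)}"
    then obtain F k where U: "U = {x \<in> S \<inter> \<Inter>(fst ` F). k x \<noteq> 0}"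
      and F: "finite F" "F \<subseteq> \<G>" and k: "k \<in> poly_algebra (snd ` F)" by blast
    have "h -` U \<inter> points X = {x \<in> {x \<in> points X. h x \<in> \<Inter>(fst ` F)}. (k \<circ> h) x \<noteq> 0}"
      using into unfolding U by auto
    then show "openin (zariski X) (h -` U \<inter> points X)"
      using open_nonvanishing[OF opF[OF F] pol[OF F k]] by simp
  next
    have "\<Union> {{x \<in> S \<inter> \<Inter>(fst ` F). k x \<noteq> 0} |F k.
        finite F \<and> F \<subseteq> \<G> \<and> k \<in> poly_algebra (snd ` F)} = S"
      using points_generated[of S \<G>] unfolding generated_fspace_def generated_topology_def by simp
    then show "h ` points X \<subseteq> \<Union> {{x \<in> S \<inter> \<Inter>(fst ` F). k x \<noteq> 0} |F k.
        finite F \<and> F \<subseteq> \<G> \<and> k \<in> poly_algebra (snd ` F)}"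
      using into by auto
  qed
  show ?thesis
  proof (rule fmorphismI)
    fix V \<phi> assume V: "openin (zariski (generated_fspace S \<G>)) V"
      and \<phi>: "\<phi> \<in> regular (generated_fspace S \<G>) V"
    show "\<phi> \<circ> h \<in> regular X {x \<in> points X. h x \<in> V}"
    proof (rule reg_local)
      show "openin (zariski X) {x \<in> points X. h x \<in> V}" using V by (rule continuous_mapD[OF cont])
      fix x assume x: "x \<in> {x \<in> points X. h x \<in> V}"
      then obtain N F g k where *: "openin (zariski (generated_fspace S \<G>)) N" "h x \<in> N" "N \<subseteq> V"
        "finite F" "F \<subseteq> \<G>" "N \<subseteq> \<Inter>(fst ` F)"
        "g \<in> poly_algebra (snd ` F)" "k \<in> poly_algebra (snd ` F)"
        "\<forall>y\<in>N. k y \<noteq> 0" "\<forall>y\<in>N. \<phi> y = g y / k y"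
        using regular_generatedE[OF \<phi>] by (metis (no_types, lifting) mem_Collect_eq)
      let ?N = "{x \<in> points X. h x \<in> N}"
      have N: "openin (zariski X) ?N" using *(1) by (rule continuous_mapD[OF cont])
      have sub: "?N \<subseteq> {x \<in> points X. h x \<in> \<Inter>(fst ` F)}" using * by auto
      have g: "g \<circ> h \<in> regular X ?N" by (rule reg_mono[OF opF N sub pol]) (use * in auto)
      have k: "k \<circ> h \<in> regular X ?N" by (rule reg_mono[OF opF N sub pol]) (use * in auto)
      have "(\<lambda>x. (g \<circ> h) x * (1 / (k \<circ> h) x)) \<in> regular X ?N"
        by (rule reg_mult[OF N g reg_inverse[OF N k]]) (use * in auto)
      then have "\<phi> \<circ> h \<in> regular X ?N"
        by (rule reg_cong[OF N]) (use * in auto)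
      then show "\<exists>N. openin (zariski X) N \<and> x \<in> N \<and> N \<subseteq> {x \<in> points X. h x \<in> V} \<and>
          \<phi> \<circ> h \<in> regular X N"
        using N x * by (intro exI[of _ ?N]) auto
    qed
  qed (use continuous_mapD[OF cont] in auto)
qed

subsection \<open>Open subspaces\<close>

lemma points_open_fsubspace [simp]: "points (open_fsubspace X U) = points X \<inter> U"
  by (simp add: open_fsubspace_def)

lemma regular_open_fsubspace [simp]: "regular (open_fsubspace X U) = regular X"
  by (simp add: open_fsubspace_def)

lemma openin_open_fsubspace:
  assumes "openin (zariski X) U"
  shows "openin (zariski (open_fsubspace X U)) V \<longleftrightarrow> openin (zariski X) V \<and> V \<subseteq> U"
  using assms by (simp add: open_fsubspace_def openin_open_subtopology)

lemma function_space_open: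
  assumes X: "function_space X" and U: "openin (zariski X) U"
  shows "function_space (open_fsubspace X U)"
proof -
  interpret function_space X by fact
  show ?thesis
    apply (unfold_locales; unfold openin_open_fsubspace[OF U] regular_open_fsubspace; (elim conjE)?)
    subgoal by (rule reg_cong)
    subgoal by (rule reg_mono)
    subgoal for V \<phi> by (erule reg_local) meson
    subgoal by (rule reg_const)
    subgoal by (rule reg_add)
    subgoal by (rule reg_mult)
    subgoal by (rule reg_inverse)
    subgoal using open_nonvanishing by auto
    done
qed

lemma fmorphism_into_open:
  assumes U: "openin (zariski Y) U"
    and h: "fmorphism X Y h" and into: "\<And>x. x \<in> points X \<Longrightarrow> h x \<in> U"
  shows "fmorphism X (open_fsubspace Y U) h"
proof (rule fmorphismI)
qed (use fmorphismD[OF h] into in \<open>auto simp: openin_open_fsubspace[OF U]\<close>)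

lemma (in function_space) fmorphism_restrict:
  assumes h: "fmorphism X Y h" and N: "openin (zariski X) N"
  shows "fmorphism (open_fsubspace X N) Y h"
proof (rule fmorphismI)
  have eq: "{x \<in> points (open_fsubspace X N). h x \<in> V} = N \<inter> {x \<in> points X. h x \<in> V}" for V
    by auto
  fix V assume V: "openin (zariski Y) V"
  show o: "openin (zariski (open_fsubspace X N)) {x \<in> points (open_fsubspace X N). h x \<in> V}"
    unfolding eq openin_open_fsubspace[OF N] using fmorphismD(1)[OF h V] N by auto
  fix \<phi> assume "\<phi> \<in> regular Y V"
  then have "\<phi> \<circ> h \<in> regular X {x \<in> points X. h x \<in> V}" using V by (intro fmorphismD(3)[OF h])
  then show "\<phi> \<circ> h \<in> regular (open_fsubspace X N) {x \<in> points (open_fsubspace X N). h x \<in> V}"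
    unfolding regular_open_fsubspace eq
    by (elim reg_mono[rotated 3]) (use fmorphismD(1)[OF h V] N in auto)
qed (use fmorphismD(2)[OF h] in auto)

lemma (in function_space) fmorphism_local:
  assumes loc: "\<And>x. x \<in> points X \<Longrightarrow>
      \<exists>N. openin (zariski X) N \<and> x \<in> N \<and> fmorphism (open_fsubspace X N) Y h"
  shows "fmorphism X Y h"
proof (rule fmorphismI)
  fix x assume "x \<in> points X"
  from loc[OF this] this show "h x \<in> points Y" by (auto dest: fmorphismD(2))
next
  have eq: "{x \<in> points (open_fsubspace X N). h x \<in> V} = N \<inter> {x \<in> points X. h x \<in> V}" for N V
    by auto
  fix V assume V: "openin (zariski Y) V"
  show o: "openin (zariski X) {x \<in> points X. h x \<in> V}"
  proof (subst openin_subopen, safe)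
    fix x assume "x \<in> points X" "h x \<in> V"
    from loc[OF this(1)] obtain N where N: "openin (zariski X) N" "x \<in> N"
      and h: "fmorphism (open_fsubspace X N) Y h" by blast
    have "openin (zariski X) (N \<inter> {x \<in> points X. h x \<in> V})"
      using fmorphismD(1)[OF h V] unfolding eq openin_open_fsubspace[OF N(1)] by auto
    then show "\<exists>T. openin (zariski X) T \<and> x \<in> T \<and> T \<subseteq> {x \<in> points X. h x \<in> V}"
      using N \<open>x \<in> points X\<close> \<open>h x \<in> V\<close> by blast
  qed
  fix \<phi> assume \<phi>: "\<phi> \<in> regular Y V"
  show "\<phi> \<circ> h \<in> regular X {x \<in> points X. h x \<in> V}"
  proof (rule reg_local[OF o])
    fix x assume "x \<in> {x \<in> points X. h x \<in> V}"
    then have x: "x \<in> points X" "h x \<in> V" by auto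
    from loc[OF this(1)] obtain N where N: "openin (zariski X) N" "x \<in> N"
      and h: "fmorphism (open_fsubspace X N) Y h" by blast
    have "openin (zariski X) (N \<inter> {x \<in> points X. h x \<in> V})"
      using fmorphismD(1)[OF h V] unfolding eq openin_open_fsubspace[OF N(1)] by auto
    moreover have "\<phi> \<circ> h \<in> regular X (N \<inter> {x \<in> points X. h x \<in> V})"
      using fmorphismD(3)[OF h V \<phi>] unfolding eq by simp
    ultimately show "\<exists>M. openin (zariski X) M \<and> x \<in> M \<and> M \<subseteq> {x \<in> points X. h x \<in> V} \<and>
        \<phi> \<circ> h \<in> regular X M"
      using N x by blast
  qed
qed

subsection \<open>Quotients\<close>

text \<open>\<open>fquotient X E \<nu>\<close> says that \<open>E\<close> carries the quotient structure along \<open>\<nu>\<close>, wherever \<open>E\<close> comes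
  from; this makes it possible to replace the space that \<open>E\<close> was constructed from by a smaller one.\<close>

definition fquotient :: "'a fspace \<Rightarrow> 'b fspace \<Rightarrow> ('a \<Rightarrow> 'b) \<Rightarrow> bool" where
  "fquotient X E \<nu> \<longleftrightarrow> fmorphism X E \<nu> \<and> \<nu> ` points X = points E \<and>
     (\<forall>V\<subseteq>points E. openin (zariski X) {x \<in> points X. \<nu> x \<in> V} \<longrightarrow> openin (zariski E) V) \<and>
     (\<forall>V \<phi>. openin (zariski E) V \<longrightarrow> \<phi> \<circ> \<nu> \<in> regular X {x \<in> points X. \<nu> x \<in> V} \<longrightarrow>
        \<phi> \<in> regular E V)"

lemma fquotientD:
  assumes "fquotient X E \<nu>"
  shows "fmorphism X E \<nu>" "\<nu> ` points X = points E"
    "\<lbrakk>V \<subseteq> points E; openin (zariski X) {x \<in> points X. \<nu> x \<in> V}\<rbrakk> \<Longrightarrow> openin (zariski E) V"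
    "\<lbrakk>openin (zariski E) V; \<phi> \<circ> \<nu> \<in> regular X {x \<in> points X. \<nu> x \<in> V}\<rbrakk> \<Longrightarrow> \<phi> \<in> regular E V"
  using assms by (auto simp: fquotient_def)

lemma points_quotient_fspace:
  assumes "\<And>x. x \<in> points X \<Longrightarrow> p x \<in> S"
  shows "points (quotient_fspace X p S) = S"
proof -
  have "{x \<in> points X. p x \<in> S} = points X" using assms by auto
  then have "openin (zariski (quotient_fspace X p S)) S"
    unfolding openin_quotient_fspace by simp
  moreover have "U \<subseteq> S" if "openin (zariski (quotient_fspace X p S)) U" for U
    using that unfolding openin_quotient_fspace by simp
  ultimately show ?thesis by (meson openin_subset openin_topspace subset_antisym)
qed

lemma regular_quotient_fspace:
  "\<phi> \<in> regular (quotient_fspace X p S) U \<longleftrightarrow> \<phi> \<circ> p \<in> regular X {x \<in> points X. p x \<in> U}"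
  by (simp add: quotient_fspace_def)

lemma fquotient_quotient_fspace:
  assumes "p ` points X = S"
  shows "fquotient X (quotient_fspace X p S) p"
proof -
  have pts: "points (quotient_fspace X p S) = S"
    by (rule points_quotient_fspace) (use assms in auto)
  then have "fmorphism X (quotient_fspace X p S) p"
    using assms by (intro fmorphismI) (auto simp: openin_quotient_fspace regular_quotient_fspace)
  then show ?thesis
    unfolding fquotient_def pts openin_quotient_fspace regular_quotient_fspace using assms by auto
qed

lemma function_space_quotient:
  assumes X: "function_space X"
  shows "function_space (quotient_fspace X p S)"
proof -
  interpret function_space X by fact
  have eq: "{x \<in> {x \<in> points X. p x \<in> U}. \<phi> (p x) \<noteq> 0} = {x \<in> points X. p x \<in> {y \<in> U. \<phi> y \<noteq> 0}}"
    for U \<phi> by auto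
  show ?thesis
    apply (unfold_locales; unfold openin_quotient_fspace regular_quotient_fspace; (elim conjE)?)
    subgoal for U \<phi> \<psi> by (erule (1) reg_cong) auto
    subgoal for U V \<phi> by (rule reg_mono[of "{x \<in> points X. p x \<in> U}"]) auto
    subgoal for U \<phi>
    proof (erule reg_local)
      fix x assume loc: "\<And>x. x \<in> U \<Longrightarrow> \<exists>N. (N \<subseteq> S \<and> openin (zariski X) {x \<in> points X. p x \<in> N}) \<and>
          x \<in> N \<and> N \<subseteq> U \<and> \<phi> \<circ> p \<in> regular X {x \<in> points X. p x \<in> N}"
        and "x \<in> {x \<in> points X. p x \<in> U}"
      then have x: "x \<in> points X" "p x \<in> U" by auto
      from loc[OF x(2)] obtain N where "openin (zariski X) {x \<in> points X. p x \<in> N}"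
          "p x \<in> N" "N \<subseteq> U" "\<phi> \<circ> p \<in> regular X {x \<in> points X. p x \<in> N}" by blast
      then show "\<exists>N. openin (zariski X) N \<and> x \<in> N \<and> N \<subseteq> {x \<in> points X. p x \<in> U} \<and>
          \<phi> \<circ> p \<in> regular X N"
        using x by (intro exI[of _ "{x \<in> points X. p x \<in> N}"]) auto
    qed
    subgoal using reg_const by (simp add: o_def)
    subgoal using reg_add by (simp add: o_def)
    subgoal using reg_mult by (simp add: o_def)
    subgoal for U \<phi> using reg_inverse[of "{x \<in> points X. p x \<in> U}" "\<phi> \<circ> p"] by (simp add: o_def)
    subgoal for U \<phi> using open_nonvanishing[of "{x \<in> points X. p x \<in> U}" "\<phi> \<circ> p"]
      unfolding eq[symmetric] by auto
    done
qed

lemma fquotient_lift: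
  assumes q: "fquotient X E \<nu>" and h: "fmorphism X Z (h \<circ> \<nu>)"
  shows "fmorphism E Z h"
proof (rule fmorphismI)
  fix y assume "y \<in> points E"
  then obtain x where "x \<in> points X" "y = \<nu> x" using fquotientD(2)[OF q] by blast
  then show "h y \<in> points Z" using fmorphismD(2)[OF h] by simp
next
  have eq: "{x \<in> points X. \<nu> x \<in> {y \<in> points E. h y \<in> V}} = {x \<in> points X. (h \<circ> \<nu>) x \<in> V}" for V
    using fquotientD(2)[OF q] by auto
  fix V assume V: "openin (zariski Z) V"
  show o: "openin (zariski E) {y \<in> points E. h y \<in> V}"
    by (rule fquotientD(3)[OF q]) (use fmorphismD(1)[OF h V] in \<open>auto simp only: eq\<close>)
  fix \<phi> assume "\<phi> \<in> regular Z V"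
  from fmorphismD(3)[OF h V this] show "\<phi> \<circ> h \<in> regular E {y \<in> points E. h y \<in> V}"
    by (intro fquotientD(4)[OF q o]) (simp only: eq o_assoc)
qed

lemma fquotient_restrict:
  assumes X: "function_space X" and q: "fquotient X E \<nu>" and U: "openin (zariski E) U"
  shows "fquotient (open_fsubspace X {x \<in> points X. \<nu> x \<in> U}) (open_fsubspace E U) \<nu>"
proof -
  interpret function_space X by fact
  let ?N = "{x \<in> points X. \<nu> x \<in> U}"
  have N: "openin (zariski X) ?N" using U by (rule fmorphismD(1)[OF fquotientD(1)[OF q]])
  have eq: "{x \<in> points (open_fsubspace X ?N). \<nu> x \<in> V} = {x \<in> points X. \<nu> x \<in> V}" if "V \<subseteq> U" for V
    using that by auto
  have mor: "fmorphism (open_fsubspace X ?N) (open_fsubspace E U) \<nu>"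
    by (rule fmorphism_into_open[OF U fmorphism_restrict[OF fquotientD(1)[OF q] N]]) auto
  have onto: "\<nu> ` points (open_fsubspace X ?N) = points (open_fsubspace E U)"
    using fquotientD(2)[OF q] by auto
  show ?thesis
    unfolding fquotient_def
  proof (intro conjI mor onto allI impI)
    fix V assume V: "V \<subseteq> points (open_fsubspace E U)"
      and o: "openin (zariski (open_fsubspace X ?N)) {x \<in> points (open_fsubspace X ?N). \<nu> x \<in> V}"
    have "openin (zariski X) {x \<in> points X. \<nu> x \<in> V}"
      using o V unfolding openin_open_fsubspace[OF N] by (subst (asm) eq) auto
    then show "openin (zariski (open_fsubspace E U)) V"
      using V fquotientD(3)[OF q] by (auto simp: openin_open_fsubspace[OF U])
  next
    fix V \<phi> assume V: "openin (zariski (open_fsubspace E U)) V"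
      and \<phi>: "\<phi> \<circ> \<nu> \<in> regular (open_fsubspace X ?N) {x \<in> points (open_fsubspace X ?N). \<nu> x \<in> V}"
    show "\<phi> \<in> regular (open_fsubspace E U) V"
      using V \<phi> fquotientD(4)[OF q, of V \<phi>] unfolding openin_open_fsubspace[OF U]
      by (simp only: eq regular_open_fsubspace simp_thms)
  qed
qed

text \<open>The quotient of \<open>P\<close> can be computed on \<open>X\<close> as soon as \<open>X\<close> maps to \<open>P\<close> and \<open>P\<close> can locally be
  pushed back into \<open>X\<close> without leaving the fibres of \<open>p\<close>.\<close>

lemma fquotient_via:
  assumes P: "function_space P" and q: "fquotient P E p" and n: "fmorphism X P n"
    and r: "\<And>y. y \<in> points P \<Longrightarrow> \<exists>N r. openin (zariski P) N \<and> y \<in> N \<and>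
        fmorphism (open_fsubspace P N) X r \<and> (\<forall>z\<in>N. p (n (r z)) = p z)"
  shows "fquotient X E (p \<circ> n)"
proof -
  interpret function_space P by fact
  have mor: "fmorphism X E (p \<circ> n)" by (rule fmorphism_compose[OF n fquotientD(1)[OF q]])
  have onto: "(p \<circ> n) ` points X = points E"
  proof safe
    fix x assume "x \<in> points X" then show "(p \<circ> n) x \<in> points E" by (rule fmorphismD(2)[OF mor])
  next
    fix e assume "e \<in> points E"
    then obtain y where y: "y \<in> points P" "e = p y" using fquotientD(2)[OF q] by blast
    from r[OF y(1)] obtain N r where N: "openin (zariski P) N" "y \<in> N"
      and r: "fmorphism (open_fsubspace P N) X r" "\<forall>z\<in>N. p (n (r z)) = p z" by blast
    have "r y \<in> points X" using fmorphismD(2)[OF r(1), of y] y N by auto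
    moreover have "e = (p \<circ> n) (r y)" using r N y by auto
    ultimately show "e \<in> (p \<circ> n) ` points X" by blast
  qed
  have pre: "N \<inter> {z \<in> points P. p z \<in> V} = {z \<in> points (open_fsubspace P N). r z \<in> {x \<in> points X. (p \<circ> n) x \<in> V}}"
    if "openin (zariski P) N" "fmorphism (open_fsubspace P N) X r" "\<forall>z\<in>N. p (n (r z)) = p z" for N r V
    using that fmorphismD(2)[OF that(2)] by auto
  show ?thesis
    unfolding fquotient_def
  proof (intro conjI mor onto allI impI)
    fix V assume V: "V \<subseteq> points E" and o: "openin (zariski X) {x \<in> points X. (p \<circ> n) x \<in> V}"
    have "openin (zariski P) {z \<in> points P. p z \<in> V}"
    proof (subst openin_subopen, safe)
      fix y assume y: "y \<in> points P" "p y \<in> V"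
      from r[OF y(1)] obtain N r where N: "openin (zariski P) N" "y \<in> N"
        and r: "fmorphism (open_fsubspace P N) X r" "\<forall>z\<in>N. p (n (r z)) = p z" by blast
      have "openin (zariski P) (N \<inter> {z \<in> points P. p z \<in> V})"
        using fmorphismD(1)[OF r(1) o] unfolding pre[OF N(1) r] openin_open_fsubspace[OF N(1)] by blast
      then show "\<exists>T. openin (zariski P) T \<and> y \<in> T \<and> T \<subseteq> {z \<in> points P. p z \<in> V}"
        using N y by blast
    qed
    then show "openin (zariski E) V" by (rule fquotientD(3)[OF q V])
  next
    fix V \<phi> assume V: "openin (zariski E) V"
      and \<phi>: "\<phi> \<circ> (p \<circ> n) \<in> regular X {x \<in> points X. (p \<circ> n) x \<in> V}"
    have oX: "openin (zariski X) {x \<in> points X. (p \<circ> n) x \<in> V}" using V by (rule fmorphismD(1)[OF mor])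
    have oP: "openin (zariski P) {z \<in> points P. p z \<in> V}" using V by (rule fmorphismD(1)[OF fquotientD(1)[OF q]])
    have "\<phi> \<circ> p \<in> regular P {z \<in> points P. p z \<in> V}"
    proof (rule reg_local[OF oP])
      fix y assume "y \<in> {z \<in> points P. p z \<in> V}"
      then have y: "y \<in> points P" "p y \<in> V" by auto
      from r[OF y(1)] obtain N r where N: "openin (zariski P) N" "y \<in> N"
        and r: "fmorphism (open_fsubspace P N) X r" "\<forall>z\<in>N. p (n (r z)) = p z" by blast
      have oN: "openin (zariski P) (N \<inter> {z \<in> points P. p z \<in> V})" using N oP by auto
      have "\<phi> \<circ> (p \<circ> n) \<circ> r \<in> regular P (N \<inter> {z \<in> points P. p z \<in> V})"
        using fmorphismD(3)[OF r(1) oX \<phi>] unfolding pre[OF N(1) r] by simp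
      then have "\<phi> \<circ> p \<in> regular P (N \<inter> {z \<in> points P. p z \<in> V})"
        by (rule reg_cong[OF oN]) (use r in auto)
      then show "\<exists>N. openin (zariski P) N \<and> y \<in> N \<and> N \<subseteq> {z \<in> points P. p z \<in> V} \<and>
          \<phi> \<circ> p \<in> regular P N"
        using oN N y by blast
    qed
    then show "\<phi> \<in> regular E V" by (rule fquotientD(4)[OF q V])
  qed
qed

lemma fquotient_induced:
  assumes X: "function_space X" and q: "fquotient X E \<nu>" and h: "fmorphism X Z h"
    and inv: "\<And>x y. \<lbrakk>x \<in> points X; y \<in> points X; \<nu> x = \<nu> y\<rbrakk> \<Longrightarrow> h x = h y"
  shows "\<exists>h'. fmorphism E Z h' \<and> (\<forall>x\<in>points X. h' (\<nu> x) = h x)"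
proof -
  define h' where "h' e = h (SOME x. x \<in> points X \<and> \<nu> x = e)" for e
  have eq: "h' (\<nu> x) = h x" if "x \<in> points X" for x
  proof -
    have *: "(SOME y. y \<in> points X \<and> \<nu> y = \<nu> x) \<in> points X \<and> \<nu> (SOME y. y \<in> points X \<and> \<nu> y = \<nu> x) = \<nu> x"
      by (rule someI[of _ x]) (use that in simp)
    show ?thesis unfolding h'_def using inv[of _ x] * that by blast
  qed
  have "fmorphism X Z (h' \<circ> \<nu>)"
    by (rule function_space.fmorphism_cong[OF X h]) (use eq in simp)
  then show ?thesis using fquotient_lift[OF q] eq by blast
qed

text \<open>A quotient structure is determined by the equivalence relation, so two quotients of one space by the
  same relation are isomorphic.\<close>
lemma fquotients_isomorphic:
  assumes X: "function_space X" and q: "fquotient X E \<nu>" and q': "fquotient X E' \<nu>'"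
    and same: "\<And>x y. \<lbrakk>x \<in> points X; y \<in> points X\<rbrakk> \<Longrightarrow> \<nu> x = \<nu> y \<longleftrightarrow> \<nu>' x = \<nu>' y"
  shows "fisomorphic E E'"
proof -
  obtain h where h: "fmorphism E E' h" "\<And>x. x \<in> points X \<Longrightarrow> h (\<nu> x) = \<nu>' x"
    using fquotient_induced[OF X q fquotientD(1)[OF q']] same by blast
  obtain h' where h': "fmorphism E' E h'" "\<And>x. x \<in> points X \<Longrightarrow> h' (\<nu>' x) = \<nu> x"
    using fquotient_induced[OF X q' fquotientD(1)[OF q]] same by blast
  have "h' (h e) = e" if "e \<in> points E" for e
    using that h(2) h'(2) fquotientD(2)[OF q] by (metis imageE)
  moreover have "h (h' e) = e" if "e \<in> points E'" for e
    using that h(2) h'(2) fquotientD(2)[OF q'] by (metis imageE)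
  ultimately show ?thesis unfolding fisomorphic_def fisomorphism_def using h(1) h'(1) by blast
qed

subsection \<open>Products\<close>

lemma points_prod [simp]: "points (prod_fspace X Y) = points X \<times> points Y"
  by (simp add: prod_fspace_def)

lemma points_product [simp]: "points (product_fspace I X) = (\<Pi>\<^sub>E i\<in>I. points (X i))"
  by (simp add: product_fspace_def)

lemma function_space_prod: "function_space (prod_fspace X Y)"
  unfolding prod_fspace_def by (rule function_space_generated)

lemma function_space_product: "function_space (product_fspace I X)"
  unfolding product_fspace_def by (rule function_space_generated)

lemma fmorphism_fst:
  assumes X: "function_space X"
  shows "fmorphism (prod_fspace X Y) X fst"
proof (rule fmorphismI)
  interpret function_space X by fact
  have eq: "{z \<in> points (prod_fspace X Y). fst z \<in> V} = V \<times> points Y" if "openin (zariski X) V" for V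
    using openin_subset[OF that] by auto
  fix V assume V: "openin (zariski X) V"
  have *: "openin (zariski (prod_fspace X Y)) (V \<times> points Y) \<and>
      \<phi> \<circ> fst \<in> regular (prod_fspace X Y) (V \<times> points Y)" if "\<phi> \<in> regular X V" for \<phi>
    unfolding prod_fspace_def using that V openin_subset[OF V]
    by (intro conjI regular_generator[where c = "\<phi> \<circ> fst"]) auto
  show "openin (zariski (prod_fspace X Y)) {z \<in> points (prod_fspace X Y). fst z \<in> V}"
    unfolding eq[OF V] using *[OF reg_const[OF V]] by simp
  fix \<phi> assume "\<phi> \<in> regular X V"
  from *[OF this] show "\<phi> \<circ> fst \<in> regular (prod_fspace X Y) {z \<in> points (prod_fspace X Y). fst z \<in> V}"
    unfolding eq[OF V] by simp
qed auto

lemma fmorphism_snd: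
  assumes Y: "function_space Y"
  shows "fmorphism (prod_fspace X Y) Y snd"
proof (rule fmorphismI)
  interpret function_space Y by fact
  have eq: "{z \<in> points (prod_fspace X Y). snd z \<in> V} = points X \<times> V" if "openin (zariski Y) V" for V
    using openin_subset[OF that] by auto
  fix V assume V: "openin (zariski Y) V"
  have *: "openin (zariski (prod_fspace X Y)) (points X \<times> V) \<and>
      \<phi> \<circ> snd \<in> regular (prod_fspace X Y) (points X \<times> V)" if "\<phi> \<in> regular Y V" for \<phi>
    unfolding prod_fspace_def using that V openin_subset[OF V]
    by (intro conjI regular_generator[where c = "\<phi> \<circ> snd"]) auto
  show "openin (zariski (prod_fspace X Y)) {z \<in> points (prod_fspace X Y). snd z \<in> V}"
    unfolding eq[OF V] using *[OF reg_const[OF V]] by simp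
  fix \<phi> assume "\<phi> \<in> regular Y V"
  from *[OF this] show "\<phi> \<circ> snd \<in> regular (prod_fspace X Y) {z \<in> points (prod_fspace X Y). snd z \<in> V}"
    unfolding eq[OF V] by simp
qed auto

lemma fmorphism_pair:
  assumes Z: "function_space Z" and f: "fmorphism Z X f" and g: "fmorphism Z Y g"
  shows "fmorphism Z (prod_fspace X Y) (\<lambda>z. (f z, g z))"
  unfolding prod_fspace_def
proof (rule fmorphism_generatedI[OF Z])
  fix z assume "z \<in> points Z"
  then show "(f z, g z) \<in> points X \<times> points Y" using fmorphismD(2)[OF f] fmorphismD(2)[OF g] by auto
next
  fix V c assume "(V, c) \<in> {(U \<times> points Y, \<phi> \<circ> fst) |U \<phi>. openin (zariski X) U \<and> \<phi> \<in> regular X U} \<union>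
      {(points X \<times> V, \<psi> \<circ> snd) |V \<psi>. openin (zariski Y) V \<and> \<psi> \<in> regular Y V}"
  then consider U \<phi> where "V = U \<times> points Y" "c = \<phi> \<circ> fst" "openin (zariski X) U" "\<phi> \<in> regular X U"
    | U \<psi> where "V = points X \<times> U" "c = \<psi> \<circ> snd" "openin (zariski Y) U" "\<psi> \<in> regular Y U"
    by blast
  then show "openin (zariski Z) {z \<in> points Z. (f z, g z) \<in> V} \<and>
      c \<circ> (\<lambda>z. (f z, g z)) \<in> regular Z {z \<in> points Z. (f z, g z) \<in> V}"
  proof cases
    case (1 U \<phi>)
    have "{z \<in> points Z. (f z, g z) \<in> V} = {z \<in> points Z. f z \<in> U}"
      using fmorphismD(2)[OF g] 1 by auto
    then show ?thesis using fmorphismD(1,3)[OF f 1(3)] 1 by (auto simp: o_def)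
  next
    case (2 U \<phi>)
    have "{z \<in> points Z. (f z, g z) \<in> V} = {z \<in> points Z. g z \<in> U}"
      using fmorphismD(2)[OF f] 2 by auto
    then show ?thesis using fmorphismD(1,3)[OF g 2(3)] 2 by (auto simp: o_def)
  qed
qed

lemma fmorphism_component:
  assumes X: "function_space (X i)" and i: "i \<in> I"
  shows "fmorphism (product_fspace I X) (X i) (\<lambda>x. x i)"
proof (rule fmorphismI)
  interpret function_space "X i" by fact
  let ?P = "product_fspace I X"
  have eq: "{z \<in> points ?P. z i \<in> V} = {z \<in> \<Pi>\<^sub>E i\<in>I. points (X i). z i \<in> V}" for V by simp
  fix V assume V: "openin (zariski (X i)) V"
  have *: "openin (zariski ?P) {z \<in> points ?P. z i \<in> V} \<and>
      (\<lambda>z. \<phi> (z i)) \<in> regular ?P {z \<in> points ?P. z i \<in> V}" if "\<phi> \<in> regular (X i) V" for \<phi>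
    unfolding eq unfolding product_fspace_def using that V i
    by (intro conjI regular_generator[where c = "\<lambda>z. \<phi> (z i)"]) auto
  show "openin (zariski ?P) {z \<in> points ?P. z i \<in> V}"
    using *[OF reg_const[OF V]] by simp
  fix \<phi> assume "\<phi> \<in> regular (X i) V"
  from *[OF this] show "\<phi> \<circ> (\<lambda>z. z i) \<in> regular ?P {z \<in> points ?P. z i \<in> V}"
    by (simp add: o_def)
qed (use i in auto)

lemma fmorphism_into_product:
  assumes Z: "function_space Z" and h: "\<And>i. i \<in> I \<Longrightarrow> fmorphism Z (X i) (\<lambda>z. h z i)"
    and ext: "\<And>z. z \<in> points Z \<Longrightarrow> h z \<in> extensional I"
  shows "fmorphism Z (product_fspace I X) h"
  unfolding product_fspace_def
proof (rule fmorphism_generatedI[OF Z])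
  show into: "h z \<in> (\<Pi>\<^sub>E i\<in>I. points (X i))" if "z \<in> points Z" for z
    using fmorphismD(2)[OF h] ext that by (auto simp: PiE_iff)
  fix V c assume "(V, c) \<in> {({x \<in> \<Pi>\<^sub>E i\<in>I. points (X i). x i \<in> U}, \<lambda>x. \<phi> (x i)) |i U \<phi>.
        i \<in> I \<and> openin (zariski (X i)) U \<and> \<phi> \<in> regular (X i) U}"
  then obtain i U \<phi> where *: "V = {x \<in> \<Pi>\<^sub>E i\<in>I. points (X i). x i \<in> U}" "c = (\<lambda>x. \<phi> (x i))"
      "i \<in> I" "openin (zariski (X i)) U" "\<phi> \<in> regular (X i) U" by blast
  have "{z \<in> points Z. h z \<in> V} = {z \<in> points Z. h z i \<in> U}"
    using into * by auto
  then show "openin (zariski Z) {z \<in> points Z. h z \<in> V} \<and> c \<circ> h \<in> regular Z {z \<in> points Z. h z \<in> V}"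
    using fmorphismD(1,3)[OF h[OF *(3)] *(4)] * by (auto simp: o_def)
qed

subsection \<open>Subsets of affine space\<close>

lemma points_affine [simp]: "points (affine_fspace C S) = S"
  by (simp add: affine_fspace_def)

lemma function_space_affine: "function_space (affine_fspace C S)"
  unfolding affine_fspace_def by (rule function_space_generated)

lemma regular_coordinate: "c \<in> C \<Longrightarrow> c \<in> regular (affine_fspace C S) S"
  unfolding affine_fspace_def by (rule regular_generator) auto

lemma fmorphism_into_affine:
  assumes X: "function_space X" and into: "\<And>x. x \<in> points X \<Longrightarrow> h x \<in> S"
    and reg: "\<And>c. c \<in> C \<Longrightarrow> c \<circ> h \<in> regular X (points X)"
  shows "fmorphism X (affine_fspace C S) h"
  unfolding affine_fspace_def
proof (rule fmorphism_generatedI[OF X into])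
  fix V c assume Vc: "(V, c) \<in> (\<lambda>c. (S, c)) ` C"
  then have "{x \<in> points X. h x \<in> V} = points X" using into by auto
  then show "openin (zariski X) {x \<in> points X. h x \<in> V} \<and> c \<circ> h \<in> regular X {x \<in> points X. h x \<in> V}"
    using Vc reg by auto
qed

section \<open>Invertible matrices and their regular dependence on parameters\<close>

lemma GL_iff: "g \<in> carrier (GL n) \<longleftrightarrow> g \<in> carrier_mat n n \<and> det g \<noteq> 0"
proof
  assume "g \<in> carrier (GL n)"
  then have g: "g \<in> Units (ring_mat TYPE(complex) n ())" by (simp add: units_of_def)
  then have "g \<in> carrier_mat n n" by (simp add: Units_def ring_mat_def)
  then show "g \<in> carrier_mat n n \<and> det g \<noteq> 0" using unit_imp_det_non_zero[OF g] by simp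
next
  assume "g \<in> carrier_mat n n \<and> det g \<noteq> 0"
  then show "g \<in> carrier (GL n)"
    using det_non_zero_imp_unit[of g n] by (simp add: units_of_def)
qed

lemma GL_carrier: "g \<in> carrier (GL n) \<Longrightarrow> g \<in> carrier_mat n n"
  by (simp add: GL_iff)

lemma group_GL: "group (GL n)"
proof -
  interpret ring "ring_mat TYPE(complex) n ()" by (rule ring_mat)
  show ?thesis by (rule units_group)
qed

lemma mult_GL: "x \<otimes>\<^bsub>GL n\<^esub> y = x * y" and one_GL: "\<one>\<^bsub>GL n\<^esub> = 1\<^sub>m n"
  by (simp_all add: units_of_def ring_mat_def)

abbreviation minv :: "nat \<Rightarrow> complex mat \<Rightarrow> complex mat" where
  "minv n g \<equiv> inv\<^bsub>GL n\<^esub> g"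

lemma minv:
  assumes "g \<in> carrier (GL n)"
  shows "minv n g \<in> carrier (GL n)" "minv n g \<in> carrier_mat n n" "g * minv n g = 1\<^sub>m n" "minv n g * g = 1\<^sub>m n"
proof -
  interpret group "GL n" by (rule group_GL)
  show 1: "minv n g \<in> carrier (GL n)" using assms by simp
  then show "minv n g \<in> carrier_mat n n" by (rule GL_carrier)
  show "g * minv n g = 1\<^sub>m n" "minv n g * g = 1\<^sub>m n"
    using r_inv[OF assms] l_inv[OF assms] by (simp_all add: mult_GL one_GL)
qed

lemma GL_mult: "x \<in> carrier (GL n) \<Longrightarrow> y \<in> carrier (GL n) \<Longrightarrow> x * y \<in> carrier (GL n)"
  using group.is_monoid[OF group_GL, THEN monoid.m_closed] by (simp add: mult_GL)

lemma GL_one: "1\<^sub>m n \<in> carrier (GL n)"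
  by (simp add: GL_iff)

lemma GL_if_right_inverse:
  assumes "A \<in> carrier_mat n n" "B \<in> carrier_mat n n" "A * B = 1\<^sub>m n"
  shows "A \<in> carrier (GL n)" "minv n A = B"
proof -
  have "det A * det B = 1" using assms det_mult[of A n B] by simp
  then show A: "A \<in> carrier (GL n)" using assms by (auto simp: GL_iff)
  have "minv n A = minv n A * (A * B)" using assms minv[OF A] by simp
  also have "\<dots> = minv n A * A * B" by (rule assoc_mult_mat[symmetric]) (use assms minv[OF A] in auto)
  also have "\<dots> = B" using assms minv[OF A] by simp
  finally show "minv n A = B" .
qed

lemma minv_mult:
  assumes "x \<in> carrier (GL n)" "y \<in> carrier (GL n)"
  shows "minv n (x * y) = minv n y * minv n x"
  using group.inv_mult_group[OF group_GL assms] by (simp add: mult_GL)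

lemma minv_minv: "x \<in> carrier (GL n) \<Longrightarrow> minv n (minv n x) = x"
  by (rule group.inv_inv[OF group_GL])

lemma minv_adj:
  assumes g: "g \<in> carrier (GL n)"
  shows "minv n g = (1 / det g) \<cdot>\<^sub>m adj_mat g"
proof (rule GL_if_right_inverse(2))
  have c: "g \<in> carrier_mat n n" and d: "det g \<noteq> 0" using g by (auto simp: GL_iff)
  show "g \<in> carrier_mat n n" by fact
  show "(1 / det g) \<cdot>\<^sub>m adj_mat g \<in> carrier_mat n n" using adj_mat(1)[OF c] by simp
  show "g * ((1 / det g) \<cdot>\<^sub>m adj_mat g) = 1\<^sub>m n"
    using adj_mat(1,2)[OF c] c d by (simp add: mult_smult_distrib[of g n n _ n]) (rule eq_matI; simp)
qed

text \<open>Associativity with side conditions that the simplifier can discharge from the dimensions.\<close>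

lemma mat_assoc:
  "dim_col A = dim_row B \<Longrightarrow> dim_col B = dim_row C \<Longrightarrow> (A * B) * C = A * (B * (C :: 'a :: semiring_0 mat))"
  by (rule assoc_mult_mat[of A "dim_row A" "dim_row B" B "dim_row C" C "dim_col C"]) auto

definition mat_regular ::
    "'a fspace \<Rightarrow> 'a set \<Rightarrow> nat \<Rightarrow> nat \<Rightarrow> ('a \<Rightarrow> complex mat) \<Rightarrow> bool" where
  "mat_regular X U n m M \<longleftrightarrow> (\<forall>x\<in>U. M x \<in> carrier_mat n m) \<and>
     (\<forall>i<n. \<forall>j<m. (\<lambda>x. M x $$ (i, j)) \<in> regular X U)"

lemma mat_regularD:
  assumes "mat_regular X U n m M"
  shows "x \<in> U \<Longrightarrow> M x \<in> carrier_mat n m" "i < n \<Longrightarrow> j < m \<Longrightarrow> (\<lambda>x. M x $$ (i, j)) \<in> regular X U"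
  using assms by (auto simp: mat_regular_def)

lemma mat_regular_dims:
  assumes "mat_regular X U n m M" "x \<in> U"
  shows "dim_row (M x) = n" "dim_col (M x) = m"
  using mat_regularD(1)[OF assms] by auto

context function_space
begin

lemma reg_sum:
  assumes "openin (zariski X) U" "\<And>i. i \<in> I \<Longrightarrow> \<phi> i \<in> regular X U"
  shows "(\<lambda>x. \<Sum>i\<in>I. \<phi> i x) \<in> regular X U"
  using assms(2)
  by (induction I rule: infinite_finite_induct) (auto intro: reg_const reg_add assms(1))

lemma reg_prod:
  assumes "openin (zariski X) U" "\<And>i. i \<in> I \<Longrightarrow> \<phi> i \<in> regular X U"
  shows "(\<lambda>x. \<Prod>i\<in>I. \<phi> i x) \<in> regular X U"
  using assms(2)
  by (induction I rule: infinite_finite_induct) (auto intro: reg_const reg_mult assms(1))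

lemma mat_regular_mono:
  assumes "openin (zariski X) U" "openin (zariski X) V" "V \<subseteq> U" "mat_regular X U n m M"
  shows "mat_regular X V n m M"
  using assms reg_mono[OF assms(1-3)] by (auto simp: mat_regular_def)

lemma mat_regular_const:
  assumes "openin (zariski X) U" "A \<in> carrier_mat n m"
  shows "mat_regular X U n m (\<lambda>_. A)"
  using assms reg_const[OF assms(1)] by (auto simp: mat_regular_def)

lemma mat_regular_mult:
  assumes U: "openin (zariski X) U" and M: "mat_regular X U n m M" and N: "mat_regular X U m r N"
  shows "mat_regular X U n r (\<lambda>x. M x * N x)"
  unfolding mat_regular_def
proof (intro conjI ballI allI impI)
  fix i j assume ij: "i < n" "j < r"
  have "(\<lambda>x. \<Sum>k<m. M x $$ (i, k) * N x $$ (k, j)) \<in> regular X U"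
    using ij by (intro reg_sum[OF U] reg_mult[OF U] mat_regularD(2)[OF M] mat_regularD(2)[OF N]) auto
  then show "(\<lambda>x. (M x * N x) $$ (i, j)) \<in> regular X U"
  proof (rule reg_cong[OF U])
    fix x assume "x \<in> U"
    then have "M x \<in> carrier_mat n m" "N x \<in> carrier_mat m r"
      using mat_regularD(1)[OF M] mat_regularD(1)[OF N] by auto
    then show "(\<Sum>k<m. M x $$ (i, k) * N x $$ (k, j)) = (M x * N x) $$ (i, j)"
      using ij by (auto simp: scalar_prod_def atLeast0LessThan)
  qed
qed (use mat_regular_dims[OF M] mat_regular_dims[OF N] in auto)

lemma mat_regular_add:
  assumes U: "openin (zariski X) U" and M: "mat_regular X U n m M" and N: "mat_regular X U n m N"
  shows "mat_regular X U n m (\<lambda>x. M x + N x)"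
  unfolding mat_regular_def
proof (intro conjI ballI allI impI)
  fix i j assume ij: "i < n" "j < m"
  show "(\<lambda>x. (M x + N x) $$ (i, j)) \<in> regular X U"
    by (rule reg_cong[OF U reg_add[OF U mat_regularD(2)[OF M ij] mat_regularD(2)[OF N ij]]])
       (use ij mat_regular_dims[OF N] in auto)
qed (use mat_regular_dims[OF M] mat_regular_dims[OF N] in auto)

lemma mat_regular_minus:
  assumes U: "openin (zariski X) U" and M: "mat_regular X U n m M" and N: "mat_regular X U n m N"
  shows "mat_regular X U n m (\<lambda>x. M x - N x)"
  unfolding mat_regular_def
proof (intro conjI ballI allI impI)
  fix i j assume ij: "i < n" "j < m"
  have "(\<lambda>x. M x $$ (i, j) + (-1) * N x $$ (i, j)) \<in> regular X U"
    by (intro reg_add[OF U mat_regularD(2)[OF M ij] reg_mult[OF U reg_const[OF U] mat_regularD(2)[OF N ij]]])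
  then show "(\<lambda>x. (M x - N x) $$ (i, j)) \<in> regular X U"
    by (rule reg_cong[OF U]) (use ij mat_regular_dims[OF N] in auto)
qed (use mat_regular_dims[OF N] in auto)

lemma mat_regular_entries:
  assumes "\<And>i j. i < n \<Longrightarrow> j < m \<Longrightarrow> (\<lambda>x. \<phi> i j x) \<in> regular X U"
  shows "mat_regular X U n m (\<lambda>x. mat n m (\<lambda>(i, j). \<phi> i j x))"
  using assms by (auto simp: mat_regular_def)

lemma reg_det:
  assumes U: "openin (zariski X) U" and M: "mat_regular X U n n M"
  shows "(\<lambda>x. det (M x)) \<in> regular X U"
proof -
  have "(\<lambda>x. \<Sum>p\<in>{p. p permutes {0..<n}}. signof p * (\<Prod>i=0..<n. M x $$ (i, p i))) \<in> regular X U"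
    by (intro reg_sum[OF U] reg_mult[OF U] reg_const[OF U] reg_prod[OF U] mat_regularD(2)[OF M])
       (auto simp: permutes_in_image[where S = "{0..<n}", simplified] dest: permutes_in_image[of _ "{0..<n}"])
  then show ?thesis
    by (rule reg_cong[OF U]) (use mat_regularD(1)[OF M] in \<open>simp add: det_def'[of _ n]\<close>)
qed

text \<open>By Cramer's rule.\<close>
lemma mat_regular_minv:
  assumes U: "openin (zariski X) U" and M: "mat_regular X U n n M"
    and nz: "\<And>x. x \<in> U \<Longrightarrow> det (M x) \<noteq> 0"
  shows "mat_regular X U n n (\<lambda>x. minv n (M x))"
proof -
  have GL: "M x \<in> carrier (GL n)" if "x \<in> U" for x
    using mat_regularD(1)[OF M] nz that by (auto simp: GL_iff)
  show ?thesis
    unfolding mat_regular_def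
  proof (intro conjI ballI allI impI)
    fix i j assume ij: "i < n" "j < n"
    have "mat_regular X U (n-1) (n-1) (\<lambda>x. mat_delete (M x) j i)"
      unfolding mat_regular_def
    proof (intro conjI ballI allI impI)
      fix x assume "x \<in> U" then show "mat_delete (M x) j i \<in> carrier_mat (n-1) (n-1)"
        by (intro mat_delete_carrier mat_regularD(1)[OF M])
    next
      fix a b assume "a < n - 1" "b < n - 1"
      then show "(\<lambda>x. mat_delete (M x) j i $$ (a, b)) \<in> regular X U"
        by (intro reg_cong[OF U mat_regularD(2)[OF M, of "if a < j then a else Suc a"
              "if b < i then b else Suc b"]])
           (auto simp: mat_delete_def mat_regular_dims[OF M])
    qed
    then have "(\<lambda>x. cofactor (M x) j i) \<in> regular X U"
      unfolding cofactor_def by (intro reg_mult[OF U] reg_const[OF U] reg_det[OF U])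
    then have "(\<lambda>x. 1 / det (M x) * cofactor (M x) j i) \<in> regular X U"
      by (intro reg_mult[OF U] reg_inverse[OF U] reg_det[OF U M] nz)
    then show "(\<lambda>x. minv n (M x) $$ (i, j)) \<in> regular X U"
      by (rule reg_cong[OF U])
         (use GL ij in \<open>simp add: minv_adj, simp add: adj_mat_def mat_regular_dims[OF M]\<close>)
  qed (use minv(2) GL in auto)
qed

lemma open_det_nonzero:
  assumes "openin (zariski X) U" "mat_regular X U n n M"
  shows "openin (zariski X) {x \<in> U. det (M x) \<noteq> 0}"
  by (rule open_nonvanishing[OF assms(1) reg_det[OF assms]])

end

lemma mat_regular_pullback:
  assumes h: "fmorphism X Y h" and V: "openin (zariski Y) V" and M: "mat_regular Y V n m M"
  shows "mat_regular X {x \<in> points X. h x \<in> V} n m (\<lambda>x. M (h x))"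
  unfolding mat_regular_def
proof (intro conjI ballI allI impI)
  fix i j assume "i < n" "j < m"
  from fmorphismD(3)[OF h V mat_regularD(2)[OF M this]]
  show "(\<lambda>x. M (h x) $$ (i, j)) \<in> regular X {x \<in> points X. h x \<in> V}" by (simp add: o_def)
qed (use mat_regularD(1)[OF M] in auto)

section \<open>Coordinate projections, coordinate subspaces and minors\<close>

text \<open>\<open>tail_proj c d\<close> projects \<open>\<complex>\<^sup>d\<close> onto its last \<open>c\<close> coordinates; its kernel is the span of the first
  \<open>d - c\<close> unit vectors, which is the image of \<open>head_incl d (d - c)\<close>. A square matrix preserves the
  span of the first \<open>r\<close> unit vectors iff its lower left block vanishes; doing so for all \<open>r\<close> means being
  upper triangular.\<close>

definition tail_proj :: "nat \<Rightarrow> nat \<Rightarrow> complex mat" where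
  "tail_proj c d = mat c d (\<lambda>(i, j). if j = i + (d - c) then 1 else 0)"

definition head_incl :: "nat \<Rightarrow> nat \<Rightarrow> complex mat" where
  "head_incl d r = mat d r (\<lambda>(i, j). if i = j then 1 else 0)"

definition preserves_head :: "nat \<Rightarrow> complex mat \<Rightarrow> bool" where
  "preserves_head r h \<longleftrightarrow> (\<forall>i<dim_row h. \<forall>j<dim_col h. r \<le> i \<longrightarrow> j < r \<longrightarrow> h $$ (i, j) = 0)"

lemma tail_proj_carrier [simp]: "tail_proj c d \<in> carrier_mat c d" "dim_row (tail_proj c d) = c" "dim_col (tail_proj c d) = d"
  by (auto simp: tail_proj_def)

lemma head_incl_carrier [simp]: "head_incl d r \<in> carrier_mat d r" "dim_row (head_incl d r) = d" "dim_col (head_incl d r) = r"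
  by (auto simp: head_incl_def)

lemma delta_mult:
  "(if P then 1 else 0) * x = (if P then x else (0::complex))"
  "x * (if P then 1 else 0) = (if P then x else (0::complex))"
  by auto

lemma tail_proj_mult:
  assumes "c \<le> d" "M \<in> carrier_mat d m"
  shows "tail_proj c d * M = mat c m (\<lambda>(i, j). M $$ (i + (d - c), j))"
proof (rule eq_matI)
  fix i j assume ij: "i < dim_row (mat c m (\<lambda>(i, j). M $$ (i + (d - c), j)))"
    "j < dim_col (mat c m (\<lambda>(i, j). M $$ (i + (d - c), j)))"
  show "(tail_proj c d * M) $$ (i, j) = mat c m (\<lambda>(i, j). M $$ (i + (d - c), j)) $$ (i, j)"
    using assms ij
    by (auto simp: scalar_prod_def tail_proj_def atLeast0LessThan delta_mult)
qed (use assms in auto)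

lemma mult_tail_proj:
  assumes "c \<le> d" "M \<in> carrier_mat m c"
  shows "M * tail_proj c d = mat m d (\<lambda>(i, j). if j < d - c then 0 else M $$ (i, j - (d - c)))"
    (is "_ = ?R")
proof (rule eq_matI)
  fix i j assume ij: "i < dim_row ?R" "j < dim_col ?R"
  have "(M * tail_proj c d) $$ (i, j) = (\<Sum>k<c. (if j = k + (d - c) then M $$ (i, k) else 0))"
    using assms ij by (auto simp: scalar_prod_def tail_proj_def atLeast0LessThan intro!: sum.cong)
  also have "\<dots> = (\<Sum>k<c. (if k = j - (d - c) then (if j < d - c then 0 else M $$ (i, k)) else 0))"
    by (rule sum.cong) auto
  finally show "(M * tail_proj c d) $$ (i, j) = ?R $$ (i, j)"
    using assms ij by auto
qed (use assms in auto)

lemma mult_tail_proj_transpose: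
  assumes "c \<le> d" "M \<in> carrier_mat m d"
  shows "M * (tail_proj c d)\<^sup>T = mat m c (\<lambda>(i, j). M $$ (i, j + (d - c)))" (is "_ = ?R")
proof (rule eq_matI)
  fix i j assume ij: "i < dim_row ?R" "j < dim_col ?R"
  show "(M * (tail_proj c d)\<^sup>T) $$ (i, j) = ?R $$ (i, j)"
    using assms ij
    by (auto simp: scalar_prod_def tail_proj_def atLeast0LessThan delta_mult)
qed (use assms in auto)

lemma mult_head_incl:
  assumes "r \<le> d" "M \<in> carrier_mat m d"
  shows "M * head_incl d r = mat m r (\<lambda>(i, j). M $$ (i, j))" (is "_ = ?R")
proof (rule eq_matI)
  fix i j assume ij: "i < dim_row ?R" "j < dim_col ?R"
  show "(M * head_incl d r) $$ (i, j) = ?R $$ (i, j)"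
    using assms ij
    by (auto simp: scalar_prod_def head_incl_def atLeast0LessThan delta_mult)
qed (use assms in auto)

lemma head_incl_mult:
  assumes "r \<le> d" "M \<in> carrier_mat r m"
  shows "head_incl d r * M = mat d m (\<lambda>(i, j). if i < r then M $$ (i, j) else 0)" (is "_ = ?R")
proof (rule eq_matI)
  fix i j assume ij: "i < dim_row ?R" "j < dim_col ?R"
  show "(head_incl d r * M) $$ (i, j) = ?R $$ (i, j)"
    using assms ij
    by (auto simp: scalar_prod_def head_incl_def atLeast0LessThan delta_mult)
qed (use assms in auto)

lemma head_incl_transpose_mult:
  assumes "r \<le> d" "M \<in> carrier_mat d m"
  shows "(head_incl d r)\<^sup>T * M = mat r m (\<lambda>(i, j). M $$ (i, j))" (is "_ = ?R")
proof (rule eq_matI)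
  fix i j assume ij: "i < dim_row ?R" "j < dim_col ?R"
  show "((head_incl d r)\<^sup>T * M) $$ (i, j) = ?R $$ (i, j)"
    using assms ij
    by (auto simp: scalar_prod_def head_incl_def atLeast0LessThan delta_mult)
qed (use assms in auto)

lemma tail_proj_right_inverse: "c \<le> d \<Longrightarrow> tail_proj c d * (tail_proj c d)\<^sup>T = 1\<^sub>m c"
  by (subst mult_tail_proj_transpose[of c d _ c]) (auto simp: tail_proj_def intro!: eq_matI)

lemma tail_proj_comp: "\<lbrakk>c \<le> c'; c' \<le> d\<rbrakk> \<Longrightarrow> tail_proj c c' * tail_proj c' d = tail_proj c d"
  by (subst tail_proj_mult[of c c' _ d]) (auto simp: tail_proj_def)

lemma tail_proj_refl: "tail_proj d d = 1\<^sub>m d"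
  by (auto simp: tail_proj_def)

lemma head_incl_left_inverse: "r \<le> d \<Longrightarrow> (head_incl d r)\<^sup>T * head_incl d r = 1\<^sub>m r"
  by (subst head_incl_transpose_mult[of r d _ r]) (auto simp: head_incl_def)

lemma preserves_head_iff_tail:
  assumes "c \<le> d" "h \<in> carrier_mat d d"
  shows "preserves_head (d - c) h \<longleftrightarrow> tail_proj c d * h = (tail_proj c d * h * (tail_proj c d)\<^sup>T) * tail_proj c d"
proof -
  have 1: "tail_proj c d * h = mat c d (\<lambda>(i, j). h $$ (i + (d - c), j))"
    by (rule tail_proj_mult) (use assms in auto)
  have 2: "tail_proj c d * h * (tail_proj c d)\<^sup>T = mat c c (\<lambda>(i, j). h $$ (i + (d - c), j + (d - c)))"
    unfolding 1 by (subst mult_tail_proj_transpose[of c d _ c]) (use assms in auto)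
  have 3: "(tail_proj c d * h * (tail_proj c d)\<^sup>T) * tail_proj c d =
      mat c d (\<lambda>(i, j). if j < d - c then 0 else h $$ (i + (d - c), j))"
    unfolding 2 by (subst mult_tail_proj[of c d _ c]) (use assms in auto)
  show ?thesis
    unfolding 3 unfolding 1
  proof
    assume "preserves_head (d - c) h"
    then show "mat c d (\<lambda>(i, j). h $$ (i + (d - c), j)) =
        mat c d (\<lambda>(i, j). if j < d - c then 0 else h $$ (i + (d - c), j))"
      using assms by (intro eq_matI) (auto simp: preserves_head_def)
  next
    assume eq: "mat c d (\<lambda>(i, j). h $$ (i + (d - c), j)) =
        mat c d (\<lambda>(i, j). if j < d - c then 0 else h $$ (i + (d - c), j))"
    show "preserves_head (d - c) h"
      unfolding preserves_head_def
    proof (intro allI impI)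
      fix i j assume "i < dim_row h" "j < dim_col h" "d - c \<le> i" "j < d - c"
      then show "h $$ (i, j) = 0"
        using arg_cong[OF eq, of "\<lambda>M. M $$ (i - (d - c), j)"] assms by auto
    qed
  qed
qed

lemma preserves_headI_tail:
  assumes "c \<le> d" "h \<in> carrier_mat d d" "a \<in> carrier_mat c c" "tail_proj c d * h = a * tail_proj c d"
  shows "preserves_head (d - c) h"
proof -
  have "a = a * (tail_proj c d * (tail_proj c d)\<^sup>T)" using assms tail_proj_right_inverse by simp
  also have "\<dots> = tail_proj c d * h * (tail_proj c d)\<^sup>T" unfolding assms(4)
    using assms(3) by (simp add: mat_assoc)
  finally show ?thesis using assms preserves_head_iff_tail by simp
qed

lemma preserves_head_iff_head:
  assumes "r \<le> d" "h \<in> carrier_mat d d"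
  shows "preserves_head r h \<longleftrightarrow> h * head_incl d r = head_incl d r * ((head_incl d r)\<^sup>T * h * head_incl d r)"
proof -
  have 1: "h * head_incl d r = mat d r (\<lambda>(i, j). h $$ (i, j))"
    by (rule mult_head_incl) (use assms in auto)
  have 2: "(head_incl d r)\<^sup>T * h * head_incl d r = mat r r (\<lambda>(i, j). h $$ (i, j))"
    using assms by (simp add: mat_assoc 1) (subst head_incl_transpose_mult[of r d _ r]; auto)
  have 3: "head_incl d r * ((head_incl d r)\<^sup>T * h * head_incl d r) =
      mat d r (\<lambda>(i, j). if i < r then h $$ (i, j) else 0)"
    unfolding 2 by (subst head_incl_mult[of r d _ r]) (use assms in auto)
  show ?thesis
    unfolding 3 unfolding 1
  proof
    assume "preserves_head r h"
    then show "mat d r (\<lambda>(i, j). h $$ (i, j)) = mat d r (\<lambda>(i, j). if i < r then h $$ (i, j) else 0)"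
      using assms by (intro eq_matI) (auto simp: preserves_head_def)
  next
    assume eq: "mat d r (\<lambda>(i, j). h $$ (i, j)) = mat d r (\<lambda>(i, j). if i < r then h $$ (i, j) else 0)"
    show "preserves_head r h"
      unfolding preserves_head_def
    proof (intro allI impI)
      fix i j assume "i < dim_row h" "j < dim_col h" "r \<le> i" "j < r"
      then show "h $$ (i, j) = 0"
        using arg_cong[OF eq, of "\<lambda>M. M $$ (i, j)"] assms by auto
    qed
  qed
qed

text \<open>The diagonal block of an invertible matrix preserving a coordinate subspace is invertible, on the
  quotient as well as on the subspace.\<close>

lemma tail_block_GL:
  assumes c: "c \<le> d" and h: "h \<in> carrier (GL d)" and p: "preserves_head (d - c) h"
  defines "J \<equiv> tail_proj c d"
  shows "J * h * J\<^sup>T \<in> carrier (GL c)" "preserves_head (d - c) (minv d h)"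
proof -
  have hc: "h \<in> carrier_mat d d" and hi: "minv d h \<in> carrier_mat d d"
    using h minv by (auto simp: GL_iff)
  have Jc [simp]: "J \<in> carrier_mat c d" "dim_row J = c" "dim_col J = d" by (auto simp: J_def)
  have eq: "J * h = J * h * J\<^sup>T * J" using preserves_head_iff_tail[OF c hc] p by (simp add: J_def)
  have JJ: "J * J\<^sup>T = 1\<^sub>m c" using c by (simp add: J_def tail_proj_right_inverse)
  have a: "J * h * J\<^sup>T \<in> carrier_mat c c" using hc by auto
  have b: "J * minv d h * J\<^sup>T \<in> carrier_mat c c" using hi by auto
  have ahi: "J * h * J\<^sup>T * (J * minv d h) = J"
  proof -
    have "J * h * J\<^sup>T * (J * minv d h) = J * h * J\<^sup>T * J * minv d h" using hc hi by (simp add: mat_assoc)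
    also have "\<dots> = J * (h * minv d h)" unfolding eq[symmetric] using hc hi by (simp add: mat_assoc)
    finally show ?thesis using minv[OF h] by simp
  qed
  have "J * h * J\<^sup>T * (J * minv d h * J\<^sup>T) = (J * h * J\<^sup>T * (J * minv d h)) * J\<^sup>T"
    using hc hi by (simp add: mat_assoc)
  then have ab: "J * h * J\<^sup>T * (J * minv d h * J\<^sup>T) = 1\<^sub>m c" unfolding ahi JJ .
  show GL: "J * h * J\<^sup>T \<in> carrier (GL c)" by (rule GL_if_right_inverse(1)[OF a b ab])
  have "J * minv d h = minv c (J * h * J\<^sup>T) * (J * h * J\<^sup>T) * (J * minv d h)"
    using minv[OF GL] hi by (simp add: left_mult_one_mat[of _ c d])
  also have "\<dots> = minv c (J * h * J\<^sup>T) * (J * h * J\<^sup>T * (J * minv d h))"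
    using minv(2)[OF GL] hc hi by (simp add: mat_assoc)
  also have "\<dots> = minv c (J * h * J\<^sup>T) * J" unfolding ahi ..
  finally show "preserves_head (d - c) (minv d h)"
    using preserves_headI_tail[OF c hi minv(2)[OF GL]] by (simp add: J_def)
qed

lemma preserves_head_minv:
  assumes "r \<le> d" "h \<in> carrier (GL d)" "preserves_head r h"
  shows "preserves_head r (minv d h)"
  using tail_block_GL(2)[of "d - r" d h] assms by simp

lemma preserves_head_mult:
  assumes "r \<le> d" "g \<in> carrier_mat d d" "h \<in> carrier_mat d d" "preserves_head r g" "preserves_head r h"
  shows "preserves_head r (g * h)"
  unfolding preserves_head_def
proof (intro allI impI)
  fix i j assume ij: "i < dim_row (g * h)" "j < dim_col (g * h)" "r \<le> i" "j < r"
  have "g $$ (i, k) * h $$ (k, j) = 0" if "k < d" for k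
    using assms ij that by (cases "k < r") (auto simp: preserves_head_def)
  then show "(g * h) $$ (i, j) = 0"
    using ij assms by (auto simp: scalar_prod_def intro!: sum.neutral)
qed

lemma head_block_mult:
  assumes "r \<le> d" "g \<in> carrier_mat d d" "h \<in> carrier_mat d d" "preserves_head r h"
  shows "(head_incl d r)\<^sup>T * (g * h) * head_incl d r =
    ((head_incl d r)\<^sup>T * g * head_incl d r) * ((head_incl d r)\<^sup>T * h * head_incl d r)"
proof -
  have "(head_incl d r)\<^sup>T * (g * h) * head_incl d r = (head_incl d r)\<^sup>T * g * (h * head_incl d r)"
    using assms by (simp add: mat_assoc)
  also have "h * head_incl d r = head_incl d r * ((head_incl d r)\<^sup>T * h * head_incl d r)"
    using preserves_head_iff_head assms by blast
  finally show ?thesis using assms by (simp add: mat_assoc)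
qed

lemma head_block_entries:
  assumes "r \<le> d" "g \<in> carrier_mat d d"
  shows "(head_incl d r)\<^sup>T * g * head_incl d r = mat r r (\<lambda>(i, j). g $$ (i, j))"
  using assms by (simp add: mult_head_incl[of r d _ r] head_incl_transpose_mult[of r d _ d]) auto

lemma head_block_GL:
  assumes "r \<le> d" "h \<in> carrier (GL d)" "preserves_head r h"
  shows "(head_incl d r)\<^sup>T * h * head_incl d r \<in> carrier (GL r)"
proof -
  have c: "h \<in> carrier_mat d d" "minv d h \<in> carrier_mat d d" using assms minv by (auto simp: GL_iff)
  have "((head_incl d r)\<^sup>T * h * head_incl d r) * ((head_incl d r)\<^sup>T * minv d h * head_incl d r)
      = (head_incl d r)\<^sup>T * (h * minv d h) * head_incl d r"
    using head_block_mult[OF assms(1) c preserves_head_minv[OF assms]] by simp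
  also have "\<dots> = 1\<^sub>m r" using minv(3)[OF assms(2)] head_incl_left_inverse[OF assms(1)]
    by (simp add: right_mult_one_mat[of _ r d])
  finally have *: "((head_incl d r)\<^sup>T * h * head_incl d r) * ((head_incl d r)\<^sup>T * minv d h * head_incl d r) = 1\<^sub>m r" .
  show ?thesis by (rule GL_if_right_inverse(1)[OF _ _ *]; use c in auto)
qed

lemma is_subspace_iff:
  "is_subspace n W \<longleftrightarrow> W \<subseteq> carrier_vec n \<and> 0\<^sub>v n \<in> W \<and> (\<forall>v\<in>W. \<forall>w\<in>W. v + w \<in> W) \<and>
     (\<forall>c. \<forall>v\<in>W. c \<cdot>\<^sub>v v \<in> W)"
proof -
  interpret vec_space "TYPE(complex)" n .
  show ?thesis
    unfolding subspace_def submodule_def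
    using vectorspace_axioms module_axioms by (auto simp: module_vec_simps class_ring_simps)
qed

text \<open>Fill the matrix up with zero rows to a square matrix of determinant zero.\<close>
lemma kernel_vector_exists:
  fixes M :: "complex mat"
  assumes M: "M \<in> carrier_mat c d" and cd: "c < d"
  shows "\<exists>x\<in>carrier_vec d. x \<noteq> 0\<^sub>v d \<and> M *\<^sub>v x = 0\<^sub>v c"
proof -
  define P where "P = mat d d (\<lambda>(i, j). if i < c then M $$ (i, j) else 0)"
  have P: "P \<in> carrier_mat d d" by (simp add: P_def)
  have "P\<^sup>T *\<^sub>v unit_vec d (d - 1) = 0\<^sub>v d"
    using cd by (intro eq_vecI) (auto simp: P_def)
  moreover have "unit_vec d (d - 1) \<noteq> (0\<^sub>v d :: complex vec)" "unit_vec d (d - 1) \<in> carrier_vec d" using cd by auto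
  ultimately have "det (P\<^sup>T) = 0"
    using det_0_iff_vec_prod_zero[of "P\<^sup>T" d] P by (metis transpose_carrier_mat)
  then have "det P = 0" using det_transpose[OF P] by simp
  then obtain x where x: "x \<in> carrier_vec d" "x \<noteq> 0\<^sub>v d" "P *\<^sub>v x = 0\<^sub>v d"
    using det_0_iff_vec_prod_zero[OF P] by auto
  have "M *\<^sub>v x = 0\<^sub>v c"
  proof (rule eq_vecI)
    fix i assume "i < dim_vec (0\<^sub>v c)"
    then have i: "i < c" by simp
    have "row P i = row M i" using i cd M by (auto simp: P_def)
    then have "(M *\<^sub>v x) $ i = (P *\<^sub>v x) $ i" using i cd M P by simp
    then show "(M *\<^sub>v x) $ i = 0\<^sub>v c $ i" using x i cd by simp
  qed (use M in auto)
  with x show ?thesis by blast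
qed

text \<open>A matrix with a right inverse can be enlarged by one row: take the coordinate functional of a
  coordinate that does not vanish on some kernel vector, suitably scaled.\<close>

lemma right_invertible_add_row:
  fixes M :: "complex mat"
  assumes M: "M \<in> carrier_mat c d" and N: "N \<in> carrier_mat d c" and MN: "M * N = 1\<^sub>m c" and cd: "c < d"
  shows "\<exists>M' N'. M' \<in> carrier_mat (Suc c) d \<and> N' \<in> carrier_mat d (Suc c) \<and> M' * N' = 1\<^sub>m (Suc c) \<and>
    tail_proj c (Suc c) * M' = M"
proof -
  obtain x where x: "x \<in> carrier_vec d" "x \<noteq> 0\<^sub>v d" "M *\<^sub>v x = 0\<^sub>v c"
    using kernel_vector_exists[OF M cd] by blast
  then obtain i where i: "i < d" "x $ i \<noteq> 0" by (metis carrier_vecD eq_vecI index_zero_vec(1,2))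
  define M' where "M' = mat (Suc c) d (\<lambda>(a, b). if a = 0 then (if b = i then 1 / x $ i else 0) else M $$ (a - 1, b))"
  \<comment> \<open>The first column of the new right inverse is the kernel vector; multiples of it are subtracted from
    the old columns such that the new row annihilates them.\<close>
  define N' where "N' = mat d (Suc c) (\<lambda>(a, b). if b = 0 then x $ a
      else N $$ (a, b - 1) - x $ a * (N $$ (i, b - 1) / x $ i))"
  have Mx: "(\<Sum>k<d. M $$ (a, k) * x $ k) = 0" if "a < c" for a
    using arg_cong[OF x(3), of "\<lambda>v. v $ a"] that M x(1) by (simp add: scalar_prod_def atLeast0LessThan)
  have MNe: "(\<Sum>k<d. M $$ (a, k) * N $$ (k, b)) = (if a = b then 1 else 0)" if "a < c" "b < c" for a b
    using arg_cong[OF MN, of "\<lambda>A. A $$ (a, b)"] that M N by (simp add: scalar_prod_def atLeast0LessThan)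
  have "M' * N' = 1\<^sub>m (Suc c)"
  proof (rule eq_matI)
    fix a b assume "a < dim_row (1\<^sub>m (Suc c))" "b < dim_col (1\<^sub>m (Suc c))"
    then have ab: "a < Suc c" "b < Suc c" by auto
    have e: "(M' * N') $$ (a, b) = (\<Sum>k<d. M' $$ (a, k) * N' $$ (k, b))"
      using ab by (simp add: M'_def N'_def scalar_prod_def atLeast0LessThan)
    have d0: "(\<Sum>k<d. (if k = i then 1 / x $ i else 0) * f k) = f i / x $ i" for f :: "nat \<Rightarrow> complex"
    proof -
      have "(\<Sum>k<d. (if k = i then 1 / x $ i else 0) * f k) = (\<Sum>k<d. if k = i then f k / x $ i else 0)"
        by (rule sum.cong) auto
      then show ?thesis using i by simp
    qed
    consider "a = 0" "b = 0" | b' where "a = 0" "b = Suc b'" | a' where "a = Suc a'" "b = 0"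
      | a' b' where "a = Suc a'" "b = Suc b'" by (cases a; cases b) auto
    then show "(M' * N') $$ (a, b) = 1\<^sub>m (Suc c) $$ (a, b)"
    proof cases
      case 1
      have "(\<Sum>k<d. M' $$ (a, k) * N' $$ (k, b)) = (\<Sum>k<d. (if k = i then 1 / x $ i else 0) * x $ k)"
        using 1 by (intro sum.cong) (auto simp: M'_def N'_def)
      then show ?thesis unfolding e d0 using 1 i by simp
    next
      case 2
      have "(\<Sum>k<d. M' $$ (a, k) * N' $$ (k, b)) =
          (\<Sum>k<d. (if k = i then 1 / x $ i else 0) * (N $$ (k, b') - x $ k * (N $$ (i, b') / x $ i)))"
        using 2 ab by (intro sum.cong) (auto simp: M'_def N'_def)
      then show ?thesis unfolding e d0 using 2 ab i by simp
    next
      case 3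
      have "(\<Sum>k<d. M' $$ (a, k) * N' $$ (k, b)) = (\<Sum>k<d. M $$ (a', k) * x $ k)"
        using 3 ab by (intro sum.cong) (auto simp: M'_def N'_def)
      then show ?thesis unfolding e using 3 ab Mx by simp
    next
      case 4
      have "(\<Sum>k<d. M' $$ (a, k) * N' $$ (k, b)) =
          (\<Sum>k<d. M $$ (a', k) * N $$ (k, b') - M $$ (a', k) * x $ k * (N $$ (i, b') / x $ i))"
        using 4 ab by (intro sum.cong) (auto simp: M'_def N'_def algebra_simps)
      also have "\<dots> = (\<Sum>k<d. M $$ (a', k) * N $$ (k, b')) - (\<Sum>k<d. M $$ (a', k) * x $ k) * (N $$ (i, b') / x $ i)"
        by (simp only: sum_subtractf sum_distrib_right)
      finally show ?thesis unfolding e using 4 ab Mx MNe by simp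
    qed
  qed (auto simp: M'_def N'_def)
  moreover have "tail_proj c (Suc c) * M' = M"
    using M by (subst tail_proj_mult[of c "Suc c" _ d]) (auto simp: M'_def)
  ultimately show ?thesis
    by (intro exI[of _ M'] exI[of _ N']) (auto simp: M'_def N'_def)
qed

lemma right_invertible_complete:
  fixes M :: "complex mat"
  assumes "c \<le> d" "M \<in> carrier_mat c d" "N \<in> carrier_mat d c" "M * N = 1\<^sub>m c"
  shows "\<exists>G\<in>carrier (GL d). tail_proj c d * G = M"
  using assms
proof (induction "d - c" arbitrary: c M N)
  case 0
  then have "c = d" by simp
  then show ?case using 0 GL_if_right_inverse(1)[of M d N] by (auto simp: tail_proj_refl intro!: bexI[of _ M])
next
  case (Suc k)
  then have cd: "c < d" by simp
  obtain M' N' where *: "M' \<in> carrier_mat (Suc c) d" "N' \<in> carrier_mat d (Suc c)" "M' * N' = 1\<^sub>m (Suc c)"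
      "tail_proj c (Suc c) * M' = M"
    using right_invertible_add_row[OF Suc.prems(2-4) cd] by blast
  have "\<exists>G\<in>carrier (GL d). tail_proj (Suc c) d * G = M'"
    by (rule Suc.hyps(1)) (use Suc.hyps(2) cd * in auto)
  then obtain G where G: "G \<in> carrier (GL d)" "tail_proj (Suc c) d * G = M'" by blast
  have "tail_proj c d * G = tail_proj c (Suc c) * tail_proj (Suc c) d * G"
    using tail_proj_comp[of c "Suc c" d] cd by simp
  also have "\<dots> = tail_proj c (Suc c) * (tail_proj (Suc c) d * G)"
    using GL_carrier[OF G(1)] by (simp add: mat_assoc)
  also have "\<dots> = M" using G * by simp
  finally show ?case using G by blast
qed

text \<open>Let \<open>S\<close> be a set of vectors that is not contained in a hyperplane. Vectors of \<open>S\<close> can be chosen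
  as the last columns of a matrix one after the other such that all lower right minors are nonzero:
  by expansion along the new column, the next minor is a linear functional of the new vector, and this
  functional is nonzero since its value at a unit vector is the previous minor.\<close>

lemma lower_right_minors_nonzero:
  fixes S :: "complex vec set"
  assumes S: "S \<subseteq> carrier_vec d"
    and span: "\<And>y. y \<in> carrier_vec d \<Longrightarrow> (\<And>s. s \<in> S \<Longrightarrow> (\<Sum>i<d. s $ i * y $ i) = 0) \<Longrightarrow> y = 0\<^sub>v d"
    and r: "r \<le> d"
  shows "\<exists>w. (\<forall>j<r. w j \<in> S) \<and>
    (\<forall>r'\<le>r. det (mat r' r' (\<lambda>(i, j). w (r' - 1 - j) $ (i + (d - r')))) \<noteq> 0)"
  using r
proof (induction r)
  case 0
  then show ?case by simp
next
  case (Suc r)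
  then obtain w where w: "\<forall>j<r. w j \<in> S"
    "\<forall>r'\<le>r. det (mat r' r' (\<lambda>(i, j). w (r' - 1 - j) $ (i + (d - r')))) \<noteq> 0" by auto
  define A where "A x = mat (Suc r) (Suc r) (\<lambda>(i, j). (if j = 0 then x else w (r - j)) $ (i + (d - Suc r)))" for x
  have A: "A x \<in> carrier_mat (Suc r) (Suc r)" for x by (simp add: A_def)
  define \<kappa> where "\<kappa> i = cofactor (A (0\<^sub>v d)) i 0" for i
  have cof: "cofactor (A x) i 0 = \<kappa> i" if "i < Suc r" for x i
  proof -
    have "mat_delete (A x) i 0 = mat_delete (A (0\<^sub>v d)) i 0"
      by (rule eq_matI) (auto simp: mat_delete_def A_def)
    then show ?thesis by (simp add: \<kappa>_def cofactor_def)
  qed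
  have det: "det (A x) = (\<Sum>i<Suc r. x $ (i + (d - Suc r)) * \<kappa> i)" for x
    using laplace_expansion_column[OF A[of x], of 0] cof by (simp add: A_def)
  \<comment> \<open>The minor as a linear functional of the whole new column, of which it uses the last coordinates.\<close>
  define y where "y = vec d (\<lambda>a. if a < d - Suc r then 0 else \<kappa> (a - (d - Suc r)))"
  have det_y: "det (A x) = (\<Sum>a<d. x $ a * y $ a)" for x
  proof -
    have "(\<Sum>a<d. x $ a * y $ a) = (\<Sum>a\<in>{d - Suc r..<d}. x $ a * \<kappa> (a - (d - Suc r)))"
      using Suc.prems by (intro sum.mono_neutral_cong_right) (auto simp: y_def)
    also have "\<dots> = (\<Sum>i<Suc r. x $ (i + (d - Suc r)) * \<kappa> i)"
      using Suc.prems
      by (intro sum.reindex_bij_witness[of _ "\<lambda>i. i + (d - Suc r)" "\<lambda>a. a - (d - Suc r)"]) auto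
    finally show ?thesis using det by simp
  qed
  have "\<kappa> 0 = det (mat r r (\<lambda>(i, j). w (r - 1 - j) $ (i + (d - r))))"
  proof -
    have "mat_delete (A (0\<^sub>v d)) 0 0 = mat r r (\<lambda>(i, j). w (r - 1 - j) $ (i + (d - r)))"
      using Suc.prems by (intro eq_matI) (auto simp: mat_delete_def A_def)
    then show ?thesis by (simp add: \<kappa>_def cofactor_def)
  qed
  then have "y $ (d - Suc r) \<noteq> 0" using w(2) Suc.prems by (auto simp: y_def)
  then have "y \<noteq> 0\<^sub>v d" using Suc.prems by auto
  then obtain s where s: "s \<in> S" "(\<Sum>i<d. s $ i * y $ i) \<noteq> 0"
    using span[of y] by (auto simp: y_def)
  show ?case
  proof (intro exI[of _ "w(r := s)"] conjI allI impI)
    fix j assume "j < Suc r" then show "(w(r := s)) j \<in> S" using w s by auto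
  next
    fix r' assume r': "r' \<le> Suc r"
    show "det (mat r' r' (\<lambda>(i, j). (w(r := s)) (r' - 1 - j) $ (i + (d - r')))) \<noteq> 0"
    proof (cases "r' = Suc r")
      case True
      have "mat r' r' (\<lambda>(i, j). (w(r := s)) (r' - 1 - j) $ (i + (d - r'))) = A s"
        unfolding True A_def by (intro eq_matI) auto
      then show ?thesis using s det_y by simp
    next
      case False
      then have "mat r' r' (\<lambda>(i, j). (w(r := s)) (r' - 1 - j) $ (i + (d - r'))) =
          mat r' r' (\<lambda>(i, j). w (r' - 1 - j) $ (i + (d - r')))"
        using r' by (intro eq_matI) auto
      then show ?thesis using w(2) False r' by auto
    qed
  qed
qed

section \<open>Complete flags\<close>

lemma frame_flag_apply:
  "r \<le> n \<Longrightarrow> frame_flag n g r = (\<lambda>x. g *\<^sub>v x) ` {x \<in> carrier_vec n. \<forall>i\<in>{r..<n}. x $ i = 0}"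
  by (simp add: frame_flag_def)

lemma preserves_head_mult_vec:
  assumes "b \<in> carrier_mat n n" "preserves_head r b" "x \<in> carrier_vec n" "\<forall>i\<in>{r..<n}. x $ i = 0"
  shows "\<forall>i\<in>{r..<n}. (b *\<^sub>v x) $ i = 0"
proof
  fix i assume i: "i \<in> {r..<n}"
  have "b $$ (i, k) * x $ k = 0" if "k < n" for k
    using assms i that by (cases "k < r") (auto simp: preserves_head_def)
  then show "(b *\<^sub>v x) $ i = 0"
    using i assms by (auto simp: scalar_prod_def intro!: sum.neutral)
qed

lemma frame_flag_mult:
  assumes g: "g \<in> carrier_mat n n" and b: "b \<in> carrier (GL n)" and p: "\<And>r. r \<le> n \<Longrightarrow> preserves_head r b"
  shows "frame_flag n (g * b) = frame_flag n g"
proof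
  fix r
  have bc: "b \<in> carrier_mat n n" using b by (rule GL_carrier)
  show "frame_flag n (g * b) r = frame_flag n g r"
  proof (cases "r \<le> n")
    case True
    let ?X = "{x :: complex vec. x \<in> carrier_vec n \<and> (\<forall>i\<in>{r..<n}. x $ i = 0)}"
    have 1: "b *\<^sub>v x \<in> ?X" if "x \<in> ?X" for x
      using preserves_head_mult_vec[OF bc p[OF True]] that bc by auto
    have 2: "minv n b *\<^sub>v x \<in> ?X" if "x \<in> ?X" for x
      using preserves_head_mult_vec[OF minv(2)[OF b] preserves_head_minv[OF True b p[OF True]]] that
        minv(2)[OF b] by auto
    have 3: "g * b *\<^sub>v x = g *\<^sub>v (b *\<^sub>v x)" if "x \<in> ?X" for x
      using that g bc by auto
    have 4: "g *\<^sub>v x = g * b *\<^sub>v (minv n b *\<^sub>v x)" if "x \<in> ?X" for x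
    proof -
      have x: "x \<in> carrier_vec n" using that by simp
      have "b *\<^sub>v (minv n b *\<^sub>v x) = b * minv n b *\<^sub>v x"
        using bc minv(2)[OF b] x by simp
      then have "b *\<^sub>v (minv n b *\<^sub>v x) = x" using minv(3)[OF b] x by simp
      then show ?thesis using 3[OF 2[OF that]] by simp
    qed
    show ?thesis
      unfolding frame_flag_apply[OF True]
    proof (intro subset_antisym image_subsetI)
      fix x assume x: "x \<in> ?X"
      show "g * b *\<^sub>v x \<in> (\<lambda>x. g *\<^sub>v x) ` ?X" using 3[OF x] 1[OF x] by (rule image_eqI)
      show "g *\<^sub>v x \<in> (\<lambda>x. g * b *\<^sub>v x) ` ?X" using 4[OF x] 2[OF x] by (rule image_eqI)
    qed
  qed (simp add: frame_flag_def)
qed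

text \<open>The converse: frames of the same flag differ by an upper triangular matrix.\<close>
lemma frame_flag_eqD:
  assumes g: "g \<in> carrier (GL n)" and h: "h \<in> carrier (GL n)" and eq: "frame_flag n g = frame_flag n h" and r: "r \<le> n"
  shows "preserves_head r (minv n g * h)"
  unfolding preserves_head_def
proof (intro allI impI)
  have gc: "g \<in> carrier_mat n n" and hc: "h \<in> carrier_mat n n" using g h GL_carrier by auto
  note gi = minv[OF g]
  fix i j assume "i < dim_row (minv n g * h)" "j < dim_col (minv n g * h)" and ij: "r \<le> i" "j < r"
  then have i: "i < n" and j: "j < n" using gi hc by auto
  have "h *\<^sub>v unit_vec n j \<in> frame_flag n h r"
    using ij j r by (auto simp: frame_flag_apply)
  then obtain x where x: "x \<in> carrier_vec n" "\<forall>i\<in>{r..<n}. x $ i = 0" "h *\<^sub>v unit_vec n j = g *\<^sub>v x"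
    unfolding eq[symmetric] using r by (auto simp: frame_flag_apply)
  have "(minv n g * h) *\<^sub>v unit_vec n j = minv n g *\<^sub>v (h *\<^sub>v unit_vec n j)"
    using gi hc by (simp add: assoc_mult_mat_vec[of _ n n _ n])
  also have "\<dots> = minv n g * g *\<^sub>v x"
    unfolding x(3) using gi(2) gc x(1) by (intro assoc_mult_mat_vec[symmetric]) auto
  also have "\<dots> = x" using gi x(1) by simp
  finally have "(minv n g * h) *\<^sub>v unit_vec n j = x" .
  then have "((minv n g * h) *\<^sub>v unit_vec n j) $ i = 0" using x(2) i ij by simp
  then show "(minv n g * h) $$ (i, j) = 0"
    using i j gi hc by (simp add: mult_mat_vec_def)
qed

lemma frame_flag_complete:
  assumes g: "g \<in> carrier (GL n)"
  shows "frame_flag n g \<in> complete_flags n"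
proof -
  interpret vec_space "TYPE(complex)" n .
  have gc: "g \<in> carrier_mat n n" and dg: "det g \<noteq> 0" using g by (auto simp: GL_iff)
  have dist: "distinct (cols g)"
    unfolding distinct_conv_nth
    using det_identical_cols[OF gc] dg gc by (metis cols_length cols_nth carrier_matD(2))
  have li: "lin_indpt (set (cols g))"
    using idom_vec.lin_dep_cols_imp_det_0[OF gc] dg by blast
  have ff: "is_subspace n (frame_flag n g r) \<and>
      vectorspace.dim class_ring (module_vec TYPE(complex) n\<lparr>carrier := frame_flag n g r\<rparr>) = r" if r: "r \<le> n" for r
  proof -
    define xs where "xs = take r (cols g)"
    have len: "length xs = r" using r gc by (simp add: xs_def)
    have nth: "xs ! j = col g j" if "j < r" for j using that r gc by (simp add: xs_def)
    have sub: "set xs \<subseteq> set (cols g)" by (simp add: xs_def set_take_subset)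
    have xsc: "set xs \<subseteq> carrier_vec n" using sub cols_dim[of g] gc by auto
    have li': "lin_indpt (set xs)" by (rule subset_li_is_li[OF li sub])
    have card: "card (set xs) = r" using distinct_card[of xs] dist len by (simp add: xs_def)
    have lin: "lincomb_list c xs = g *\<^sub>v vec n (\<lambda>i. if i < r then c i else 0)" for c
    proof -
      have "lincomb_list c xs = mat_of_cols n xs *\<^sub>v vec (length xs) c"
        using xsc by (intro lincomb_list_as_mat_mult) auto
      also have "\<dots> = g *\<^sub>v vec n (\<lambda>i. if i < r then c i else 0)"
      proof (rule eq_vecI)
        fix a assume "a < dim_vec (g *\<^sub>v vec n (\<lambda>i. if i < r then c i else 0))"
        then have a: "a < n" using gc by simp
        have "(mat_of_cols n xs *\<^sub>v vec (length xs) c) $ a = (\<Sum>j<r. g $$ (a, j) * c j)"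
          using a len nth gc r by (auto simp: scalar_prod_def mat_of_cols_def atLeast0LessThan intro!: sum.cong)
        also have "\<dots> = (\<Sum>j<n. g $$ (a, j) * (if j < r then c j else 0))"
          using r by (intro sum.mono_neutral_cong_left) auto
        finally show "(mat_of_cols n xs *\<^sub>v vec (length xs) c) $ a = (g *\<^sub>v vec n (\<lambda>i. if i < r then c i else 0)) $ a"
          using a gc by (simp add: scalar_prod_def atLeast0LessThan)
      qed (use gc in auto)
      finally show ?thesis .
    qed
    have "span (set xs) = frame_flag n g r"
    proof -
      have "span (set xs) = {lincomb_list c xs |c. True}"
        unfolding span_list_as_span[OF xsc, symmetric] span_list_def by auto
      also have "\<dots> = frame_flag n g r"
        unfolding frame_flag_apply[OF r] lin
      proof safe
        fix c show "g *\<^sub>v vec n (\<lambda>i. if i < r then c i else 0) \<in> (\<lambda>x. g *\<^sub>v x) ` {x \<in> carrier_vec n. \<forall>i\<in>{r..<n}. x $ i = 0}"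
          by (intro imageI) auto
      next
        fix x :: "complex vec" assume x: "x \<in> carrier_vec n" "\<forall>i\<in>{r..<n}. x $ i = 0"
        then have "x = vec n (\<lambda>i. if i < r then x $ i else 0)" by (intro eq_vecI) auto
        then show "\<exists>c. g *\<^sub>v x = g *\<^sub>v vec n (\<lambda>i. if i < r then c i else 0) \<and> True" by metis
      qed
      finally show ?thesis .
    qed
    moreover have "vectorspace.dim class_ring (span_vs (set xs)) = card (set xs)"
      by (rule dim_span) (use xsc li' in \<open>auto simp: maximal_def\<close>)
    moreover have "is_subspace n (span (set xs))"
      using span_is_subspace[of "set xs"] xsc by simp
    ultimately show ?thesis using card by simp
  qed
  moreover have "frame_flag n g r \<subseteq> frame_flag n g (Suc r)" if "r < n" for r
    using that by (auto simp: frame_flag_apply)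
  moreover have "frame_flag n g \<in> extensional {..n}" by (auto simp: frame_flag_def)
  ultimately show ?thesis unfolding complete_flags_def by auto
qed

text \<open>A complete flag is strictly increasing, so one vector can be chosen in each step. The matrix of
  these vectors is invertible, and its flag is the given one, since the last nonzero coefficient of a
  linear combination determines the step of the flag in which it lies.\<close>

lemma complete_flag_frame:
  assumes W: "W \<in> complete_flags n"
  shows "\<exists>g\<in>carrier (GL n). frame_flag n g = W"
proof -
  have sub: "is_subspace n (W r)"
    and dim: "vectorspace.dim class_ring (module_vec TYPE(complex) n\<lparr>carrier := W r\<rparr>) = r" if "r \<le> n" for r
    using W that by (auto simp: complete_flags_def)
  have inc: "W r \<subseteq> W (Suc r)" if "r < n" for r using W that by (auto simp: complete_flags_def)
  have ext: "W \<in> extensional {..n}" using W by (auto simp: complete_flags_def)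
  have mono: "W r \<subseteq> W s" if "r \<le> s" "s \<le> n" for r s
    using that by (induction s rule: dec_induct) (use inc in \<open>auto simp: Suc_le_eq\<close>)
  have "\<exists>w. w \<in> W (Suc r) - W r" if r: "r < n" for r
  proof (rule ccontr)
    assume "\<not> ?thesis"
    then have "W (Suc r) = W r" using inc[OF r] by auto
    then show False using dim[of r] dim[of "Suc r"] r by simp
  qed
  then obtain w where w: "\<And>r. r < n \<Longrightarrow> w r \<in> W (Suc r) - W r" by metis
  have wc: "w r \<in> carrier_vec n" if "r < n" for r
    using w[OF that] sub[of "Suc r"] that by (auto simp: is_subspace_iff)
  define g where "g = mat n n (\<lambda>(i, j). w j $ i)"
  have gc: "g \<in> carrier_mat n n" by (simp add: g_def)
  have gx: "g *\<^sub>v x \<in> W r" if "r \<le> n" "x \<in> carrier_vec n" "\<forall>i\<in>{r..<n}. x $ i = 0" for r x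
    using that
  proof (induction r arbitrary: x)
    case 0
    then have "x = 0\<^sub>v n" by (intro eq_vecI) auto
    then have "g *\<^sub>v x = 0\<^sub>v n" using gc by (auto simp: mult_mat_vec_def scalar_prod_def intro!: eq_vecI)
    then show ?case using sub[of 0] by (simp add: is_subspace_iff)
  next
    case (Suc r)
    define x' where "x' = vec n (\<lambda>i. if i = r then 0 else x $ i)"
    have x': "x' \<in> carrier_vec n" "\<forall>i\<in>{r..<n}. x' $ i = 0"
      using Suc.prems by (auto simp: x'_def)
    have "g *\<^sub>v x = g *\<^sub>v x' + x $ r \<cdot>\<^sub>v w r"
    proof (rule eq_vecI)
      fix a assume "a < dim_vec (g *\<^sub>v x' + x $ r \<cdot>\<^sub>v w r)"
      then have a: "a < n" using wc[of r] Suc.prems by auto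
      have "(g *\<^sub>v x) $ a = (\<Sum>k<n. g $$ (a, k) * x $ k)"
        using a gc Suc.prems by (auto simp: scalar_prod_def atLeast0LessThan)
      also have "\<dots> = (\<Sum>k<n. g $$ (a, k) * x' $ k + (if k = r then x $ r * w r $ a else 0))"
        using a Suc.prems by (intro sum.cong) (auto simp: x'_def g_def)
      also have "\<dots> = (\<Sum>k<n. g $$ (a, k) * x' $ k) + x $ r * w r $ a"
        using Suc.prems by (simp add: sum.distrib)
      finally show "(g *\<^sub>v x) $ a = (g *\<^sub>v x' + x $ r \<cdot>\<^sub>v w r) $ a"
        using a gc x' wc[of r] Suc.prems by (simp add: scalar_prod_def atLeast0LessThan)
    qed (use gc wc[of r] Suc.prems in auto)
    moreover have "g *\<^sub>v x' \<in> W (Suc r)" using Suc.IH[OF _ x'] Suc.prems inc[of r] by auto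
    moreover have "x $ r \<cdot>\<^sub>v w r \<in> W (Suc r)"
      using w[of r] sub[of "Suc r"] Suc.prems by (auto simp: is_subspace_iff)
    ultimately show ?case using sub[of "Suc r"] Suc.prems by (auto simp: is_subspace_iff)
  qed
  have last: "x $ i = 0" if x: "x \<in> carrier_vec n" and r: "r \<le> n" and g: "g *\<^sub>v x \<in> W r" and i: "r \<le> i" "i < n" for x r i
  proof (rule ccontr)
    assume "x $ i \<noteq> 0"
    define m where "m = Max {j. j < n \<and> x $ j \<noteq> 0}"
    have "m \<in> {j. j < n \<and> x $ j \<noteq> 0}" unfolding m_def
      by (rule Max_in) (use i \<open>x $ i \<noteq> 0\<close> in auto)
    then have m: "m < n" "x $ m \<noteq> 0" by auto
    have ge: "j \<le> m" if "j < n" "x $ j \<noteq> 0" for j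
      unfolding m_def using that by (intro Max_ge) auto
    have "r \<le> m" using ge[OF i(2) \<open>x $ i \<noteq> 0\<close>] i by simp
    define x' where "x' = vec n (\<lambda>j. if j = m then 0 else - (x $ j / x $ m))"
    have x': "x' \<in> carrier_vec n" "\<forall>i\<in>{m..<n}. x' $ i = 0" using ge by (force simp: x'_def)+
    have "w m = (1 / x $ m) \<cdot>\<^sub>v (g *\<^sub>v x) + g *\<^sub>v x'"
    proof (rule eq_vecI)
      fix a assume "a < dim_vec ((1 / x $ m) \<cdot>\<^sub>v (g *\<^sub>v x) + g *\<^sub>v x')"
      then have a: "a < n" using gc by auto
      have "w m $ a = (\<Sum>k<n. if k = m then w m $ a else 0)" using m by simp
      also have "\<dots> = (\<Sum>k<n. 1 / x $ m * (g $$ (a, k) * x $ k) + g $$ (a, k) * x' $ k)"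
        using a m by (intro sum.cong) (auto simp: x'_def g_def)
      also have "\<dots> = 1 / x $ m * (\<Sum>k<n. g $$ (a, k) * x $ k) + (\<Sum>k<n. g $$ (a, k) * x' $ k)"
        by (simp only: sum.distrib sum_distrib_left)
      finally show "w m $ a = ((1 / x $ m) \<cdot>\<^sub>v (g *\<^sub>v x) + g *\<^sub>v x') $ a"
        using a gc x x' by (simp add: scalar_prod_def atLeast0LessThan)
    qed (use gc wc[OF m(1)] in auto)
    moreover have "g *\<^sub>v x \<in> W m" using g mono[OF \<open>r \<le> m\<close>] m by auto
    then have "(1 / x $ m) \<cdot>\<^sub>v (g *\<^sub>v x) + g *\<^sub>v x' \<in> W m"
      using gx[of m x'] x' m sub[of m] by (auto simp: is_subspace_iff)
    ultimately show False using w[OF m(1)] by simp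
  qed
  have "det g \<noteq> 0"
  proof
    assume "det g = 0"
    then obtain x where x: "x \<in> carrier_vec n" "x \<noteq> 0\<^sub>v n" "g *\<^sub>v x = 0\<^sub>v n"
      using det_0_iff_vec_prod_zero[OF gc] by auto
    have "g *\<^sub>v x \<in> W 0" using x sub[of 0] by (simp add: is_subspace_iff)
    then have "x = 0\<^sub>v n" using x(1) last[of x 0] by (intro eq_vecI) auto
    with x show False by simp
  qed
  then have g: "g \<in> carrier (GL n)" using gc by (simp add: GL_iff)
  have "frame_flag n g r = W r" for r
  proof (cases "r \<le> n")
    case True
    have "y \<in> frame_flag n g r" if y: "y \<in> W r" for y
    proof -
      have yc: "y \<in> carrier_vec n" using y sub[OF True] by (auto simp: is_subspace_iff)
      have gy: "g *\<^sub>v (minv n g *\<^sub>v y) = y"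
        using minv[OF g] gc yc by (simp flip: assoc_mult_mat_vec)
      have "\<forall>i\<in>{r..<n}. (minv n g *\<^sub>v y) $ i = 0"
        using last[of "minv n g *\<^sub>v y" r] True y gy minv(2)[OF g] yc by auto
      then show ?thesis
        unfolding frame_flag_apply[OF True] using minv(2)[OF g] yc gy
        by (intro image_eqI[of _ _ "minv n g *\<^sub>v y"]) auto
    qed
    then show ?thesis using gx[OF True] by (auto simp: frame_flag_apply[OF True])
  next
    case False
    then show ?thesis using ext by (auto simp: frame_flag_def extensional_def)
  qed
  then show ?thesis using g by blast
qed

abbreviation GL_space :: "nat \<Rightarrow> complex mat fspace" where
  "GL_space n \<equiv> affine_fspace {\<lambda>g. g $$ (a, b) |a b. a < n \<and> b < n} (carrier (GL n))"

lemma frame_flag_onto: "frame_flag n ` carrier (GL n) = complete_flags n"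
  using frame_flag_complete complete_flag_frame by blast

lemma fquotient_Fl: "fquotient (GL_space n) (Fl n) (frame_flag n)"
  unfolding Fl_def by (rule fquotient_quotient_fspace) (simp add: frame_flag_onto)

lemma points_Fl: "points (Fl n) = complete_flags n"
  using fquotientD(2)[OF fquotient_Fl] frame_flag_onto by simp

lemma function_space_Fl: "function_space (Fl n)"
  unfolding Fl_def by (intro function_space_quotient function_space_affine)

lemma mat_regular_GL_space: "mat_regular (GL_space n) (carrier (GL n)) n n (\<lambda>g. g)"
  unfolding mat_regular_def
proof (intro conjI ballI allI impI)
  fix i j assume "i < n" "j < n"
  then show "(\<lambda>g. g $$ (i, j)) \<in> regular (GL_space n) (carrier (GL n))"
    by (intro regular_coordinate) auto
qed (auto simp: GL_iff)

lemma fmorphism_into_GL_space: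
  assumes "function_space X" "mat_regular X (points X) n n M" "\<And>x. x \<in> points X \<Longrightarrow> det (M x) \<noteq> 0"
  shows "fmorphism X (GL_space n) M"
  by (rule fmorphism_into_affine[OF assms(1)])
     (use assms(3) mat_regularD[OF assms(2)] in \<open>auto simp: GL_iff o_def\<close>)

subsection \<open>Local sections of the map from frames to flags\<close>

text \<open>If all leading minors of \<open>A\<close> are nonzero, then \<open>unitri A\<close> is the invertible upper triangular
  matrix that makes \<open>A * unitri A\<close> lower unitriangular; its columns are obtained by inverting the
  leading blocks of \<open>A\<close>.\<close>

definition lead :: "nat \<Rightarrow> nat \<Rightarrow> complex mat \<Rightarrow> complex mat" where
  "lead n r A = (head_incl n r)\<^sup>T * A * head_incl n r"

definition unitri :: "nat \<Rightarrow> complex mat \<Rightarrow> complex mat" where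
  "unitri n A = mat n n (\<lambda>(i, r). if i \<le> r then minv (Suc r) (lead n (Suc r) A) $$ (i, r) else 0)"

lemma lead_carrier [simp]: "lead n r A \<in> carrier_mat r r"
  by (simp add: lead_def carrier_matI)

lemma lead_dims [simp]: "dim_row (lead n r A) = r" "dim_col (lead n r A) = r"
  by (simp_all add: lead_def)

lemma lead_index: "\<lbrakk>r \<le> n; A \<in> carrier_mat n n; i < r; j < r\<rbrakk> \<Longrightarrow> lead n r A $$ (i, j) = A $$ (i, j)"
  by (simp add: lead_def head_block_entries)

lemma unitri_carrier [simp]: "unitri n A \<in> carrier_mat n n"
  by (simp add: unitri_def)

lemma preserves_head_unitri: "preserves_head r (unitri n A)"
  by (auto simp: preserves_head_def unitri_def)

lemma mult_unitri_index:
  assumes A: "A \<in> carrier_mat n n" and nz: "det (lead n (Suc r) A) \<noteq> 0" and ir: "i \<le> r" "r < n"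
  shows "(A * unitri n A) $$ (i, r) = (if i = r then 1 else 0)"
proof -
  let ?L = "lead n (Suc r) A"
  have L: "?L \<in> carrier (GL (Suc r))" using nz by (simp add: GL_iff)
  note Li = minv[OF L]
  have "(A * unitri n A) $$ (i, r) = (\<Sum>k<n. A $$ (i, k) * unitri n A $$ (k, r))"
    using ir A by (simp add: scalar_prod_def atLeast0LessThan unitri_def)
  also have "\<dots> = (\<Sum>k<Suc r. ?L $$ (i, k) * minv (Suc r) ?L $$ (k, r))"
    using ir A by (intro sum.mono_neutral_cong_right) (auto simp: unitri_def lead_index)
  also have "\<dots> = (?L * minv (Suc r) ?L) $$ (i, r)"
    using ir Li(2) carrier_matD[OF lead_carrier[of n "Suc r" A]]
    by (auto simp: scalar_prod_def atLeast0LessThan)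
  finally show ?thesis using Li(3) ir by simp
qed

text \<open>The product with \<open>A\<close> is lower unitriangular, so it has determinant one.\<close>
lemma unitri_GL:
  assumes A: "A \<in> carrier_mat n n" and nz: "\<And>r. r \<le> n \<Longrightarrow> det (lead n r A) \<noteq> 0"
  shows "unitri n A \<in> carrier (GL n)"
proof -
  let ?P = "A * unitri n A"
  have P: "?P \<in> carrier_mat n n" using A by simp
  have "det ?P = prod_list (diag_mat ?P)"
    by (rule det_lower_triangular[OF _ P]) (use mult_unitri_index[OF A nz] in auto)
  also have "\<dots> = 1"
  proof -
    have "diag_mat ?P = map (\<lambda>i. 1) [0..<n]"
      using mult_unitri_index[OF A nz] carrier_matD[OF P] by (auto simp: diag_mat_def)
    then show ?thesis by (simp add: map_replicate_const)
  qed
  finally have "det A * det (unitri n A) = 1" using det_mult[OF A unitri_carrier] by simp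
  then show ?thesis by (auto simp: GL_iff)
qed

lemma lead_mult:
  assumes "r \<le> n" "A \<in> carrier_mat n n" "b \<in> carrier_mat n n" "preserves_head r b"
  shows "lead n r (A * b) = lead n r A * lead n r b"
  unfolding lead_def by (rule head_block_mult) (use assms in auto)

lemma lead_GL:
  assumes "r \<le> n" "b \<in> carrier (GL n)" "preserves_head r b"
  shows "lead n r b \<in> carrier (GL r)"
  unfolding lead_def by (rule head_block_GL) (use assms in auto)

text \<open>Leading blocks are multiplicative for upper triangular factors, so this follows from
  \<open>b (A b)\<inverse> = A\<inverse>\<close> for the leading blocks.\<close>
lemma unitri_mult:
  assumes A: "A \<in> carrier_mat n n" and nz: "\<And>r. r \<le> n \<Longrightarrow> det (lead n r A) \<noteq> 0"
    and b: "b \<in> carrier (GL n)" and p: "\<And>r. r \<le> n \<Longrightarrow> preserves_head r b"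
  shows "b * unitri n (A * b) = unitri n A"
proof (rule eq_matI)
  have bc: "b \<in> carrier_mat n n" using b by (rule GL_carrier)
  fix i r assume "i < dim_row (unitri n A)" "r < dim_col (unitri n A)"
  then have ir: "i < n" "r < n" by (auto simp: unitri_def)
  have e: "(b * unitri n (A * b)) $$ (i, r) = (\<Sum>k<n. b $$ (i, k) * unitri n (A * b) $$ (k, r))"
    using ir bc by (simp add: scalar_prod_def atLeast0LessThan unitri_def)
  show "(b * unitri n (A * b)) $$ (i, r) = unitri n A $$ (i, r)"
  proof (cases "i \<le> r")
    case False
    have "b $$ (i, k) * unitri n (A * b) $$ (k, r) = 0" if "k < n" for k
      using False that ir bc p[of "Suc r"]
      by (cases "k \<le> r") (auto simp: unitri_def preserves_head_def)
    then show ?thesis unfolding e using False ir by (auto simp: unitri_def intro!: sum.neutral)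
  next
    case True
    let ?L = "lead n (Suc r) A" and ?B = "lead n (Suc r) b"
    have L: "?L \<in> carrier (GL (Suc r))" using nz[of "Suc r"] ir by (simp add: GL_iff)
    have B: "?B \<in> carrier (GL (Suc r))" using ir p by (intro lead_GL b) auto
    have AB: "lead n (Suc r) (A * b) = ?L * ?B" using ir p A bc by (intro lead_mult) auto
    note Li = minv[OF L] and Bi = minv[OF B]
    have "(\<Sum>k<n. b $$ (i, k) * unitri n (A * b) $$ (k, r)) =
        (\<Sum>k<Suc r. ?B $$ (i, k) * (minv (Suc r) ?B * minv (Suc r) ?L) $$ (k, r))"
      using ir True bc
      by (intro sum.mono_neutral_cong_right) (auto simp: unitri_def lead_index AB minv_mult[OF L B])
    also have "\<dots> = (?B * (minv (Suc r) ?B * minv (Suc r) ?L)) $$ (i, r)"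
      using ir True Li(2) Bi(2) carrier_matD[OF lead_carrier[of n "Suc r" b]]
      by (subst index_mult_mat(1)) (auto simp: scalar_prod_def atLeast0LessThan intro!: sum.cong)
    also have "?B * (minv (Suc r) ?B * minv (Suc r) ?L) = ?B * minv (Suc r) ?B * minv (Suc r) ?L"
      by (rule assoc_mult_mat[symmetric, OF lead_carrier Bi(2) Li(2)])
    also have "\<dots> = minv (Suc r) ?L" using Bi Li by simp
    finally show ?thesis unfolding e using ir True by (simp add: unitri_def)
  qed
qed (use b GL_carrier in \<open>auto simp: unitri_def\<close>)

text \<open>Around the flag of \<open>g0\<close>, every flag has a unique frame \<open>g\<close> with \<open>g0\<inverse> g\<close> lower unitriangular
  (the big cell), and \<open>unitri\<close> shows that this frame is a regular function of the flag.\<close>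

lemma flag_local_section:
  assumes g0: "g0 \<in> carrier (GL n)"
  shows "\<exists>N \<sigma>. openin (zariski (Fl n)) N \<and> frame_flag n g0 \<in> N \<and> mat_regular (Fl n) N n n \<sigma> \<and>
    (\<forall>W\<in>N. \<sigma> W \<in> carrier (GL n) \<and> frame_flag n (\<sigma> W) = W)"
proof -
  interpret GL: function_space "GL_space n" by (rule function_space_affine)
  define A where "A g = minv n g0 * g" for g
  have Ac: "A g \<in> carrier_mat n n" if "g \<in> carrier (GL n)" for g
    using minv(2)[OF g0] GL_carrier[OF that] by (simp add: A_def)
  \<comment> \<open>The preimage of the big cell, saturated because an upper triangular factor multiplies the leading
    minors by nonzero numbers; \<open>\<tau>\<close> is the frame that is constant along the fibres.\<close>
  define G0 where "G0 = {g \<in> carrier (GL n). \<forall>r\<in>{..n}. det (lead n r (A g)) \<noteq> 0}"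
  define \<tau> where "\<tau> g = g * unitri n (A g)" for g
  have G0_GL: "g \<in> carrier (GL n)" and nz: "r \<le> n \<Longrightarrow> det (lead n r (A g)) \<noteq> 0" if "g \<in> G0" for g r
    using that by (auto simp: G0_def)
  have top: "openin (zariski (GL_space n)) (carrier (GL n))"
    using openin_topspace[of "zariski (GL_space n)"] by simp
  have regA: "mat_regular (GL_space n) (carrier (GL n)) n n A"
    unfolding A_def by (rule GL.mat_regular_mult[OF top GL.mat_regular_const[OF top minv(2)[OF g0]] mat_regular_GL_space])
  have regL: "mat_regular (GL_space n) (carrier (GL n)) r r (\<lambda>g. lead n r (A g))" for r
    unfolding lead_def
    by (intro GL.mat_regular_mult[where m = n] GL.mat_regular_const top regA) (auto simp: carrier_matI)
  have G0_open: "openin (zariski (GL_space n)) G0"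
  proof -
    have "G0 = (\<Inter>r\<in>{..n}. {g \<in> carrier (GL n). det (lead n r (A g)) \<noteq> 0})"
      by (auto simp: G0_def)
    also have "openin (zariski (GL_space n)) \<dots>"
      by (intro openin_INT2) (auto intro: GL.open_det_nonzero[OF top regL])
    finally show ?thesis .
  qed
  have inv: "g * b \<in> G0" "\<tau> (g * b) = \<tau> g"
    if g: "g \<in> G0" and b: "b \<in> carrier (GL n)" and p: "\<And>r. r \<le> n \<Longrightarrow> preserves_head r b" for g b
  proof -
    have gc: "g \<in> carrier_mat n n" and bc: "b \<in> carrier_mat n n" using G0_GL[OF g] b GL_carrier by auto
    have Agb: "A (g * b) = A g * b"
      unfolding A_def using gc bc minv(2)[OF g0] by (intro assoc_mult_mat[symmetric]) auto
    have "det (lead n r (A (g * b))) \<noteq> 0" if "r \<le> n" for r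
      unfolding Agb lead_mult[OF that Ac[OF G0_GL[OF g]] bc p[OF that]]
      using det_mult[OF lead_carrier[of n r] lead_carrier[of n r]] nz[OF g that] lead_GL[OF that b p[OF that]]
      by (simp add: GL_iff)
    then show "g * b \<in> G0" using GL_mult[OF G0_GL[OF g] b] by (simp add: G0_def)
    have "\<tau> (g * b) = g * (b * unitri n (A g * b))"
      unfolding \<tau>_def Agb by (rule assoc_mult_mat[OF gc bc unitri_carrier])
    also have "b * unitri n (A g * b) = unitri n (A g)"
      by (rule unitri_mult[OF Ac[OF G0_GL[OF g]] nz[OF g] b p])
    finally show "\<tau> (g * b) = \<tau> g" by (simp add: \<tau>_def)
  qed
  have fib: "h \<in> G0 \<and> \<tau> h = \<tau> g" if g: "g \<in> G0" and h: "h \<in> carrier (GL n)" and eq: "frame_flag n g = frame_flag n h" for g h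
  proof -
    let ?b = "minv n g * h"
    have "h = g * ?b"
      using minv[OF G0_GL[OF g]] GL_carrier[OF h] GL_carrier[OF G0_GL[OF g]]
      by (simp flip: assoc_mult_mat[of g n n "minv n g" n h n])
    moreover have "?b \<in> carrier (GL n)" by (intro GL_mult minv(1) G0_GL g h)
    moreover have "preserves_head r ?b" if "r \<le> n" for r by (rule frame_flag_eqD[OF G0_GL[OF g] h eq that])
    ultimately show ?thesis using inv[OF g, of ?b] by simp
  qed
  define N where "N = frame_flag n ` G0"
  define \<sigma> where "\<sigma> W = \<tau> (SOME g. g \<in> G0 \<and> frame_flag n g = W)" for W
  have \<sigma>: "\<sigma> (frame_flag n g) = \<tau> g" if "g \<in> G0" for g
  proof -
    have *: "(SOME g'. g' \<in> G0 \<and> frame_flag n g' = frame_flag n g) \<in> G0 \<and>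
        frame_flag n (SOME g'. g' \<in> G0 \<and> frame_flag n g' = frame_flag n g) = frame_flag n g"
      by (rule someI[of _ g]) (use that in simp)
    show ?thesis unfolding \<sigma>_def using fib[OF that, of "SOME g'. g' \<in> G0 \<and> frame_flag n g' = frame_flag n g"] * G0_GL
      by metis
  qed
  have pre: "{g \<in> points (GL_space n). frame_flag n g \<in> N} = G0"
  proof (intro subset_antisym subsetI)
    fix g assume "g \<in> {g \<in> points (GL_space n). frame_flag n g \<in> N}"
    then obtain g' where "g' \<in> G0" "g \<in> carrier (GL n)" "frame_flag n g' = frame_flag n g"
      by (auto simp: N_def)
    from fib[OF this] show "g \<in> G0" by blast
  qed (auto simp: N_def G0_def)
  have Nc: "N \<subseteq> points (Fl n)" unfolding N_def points_Fl using frame_flag_complete G0_GL by auto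
  have N: "openin (zariski (Fl n)) N"
    by (rule fquotientD(3)[OF fquotient_Fl Nc]) (simp only: pre G0_open)
  have \<tau>_GL: "\<tau> g \<in> carrier (GL n)" and \<tau>_flag: "frame_flag n (\<tau> g) = frame_flag n g" if "g \<in> G0" for g
  proof -
    have u: "unitri n (A g) \<in> carrier (GL n)" by (rule unitri_GL[OF Ac[OF G0_GL[OF that]] nz[OF that]])
    show "\<tau> g \<in> carrier (GL n)" unfolding \<tau>_def by (intro GL_mult G0_GL that u)
    show "frame_flag n (\<tau> g) = frame_flag n g" unfolding \<tau>_def
      by (intro frame_flag_mult u preserves_head_unitri GL_carrier G0_GL that)
  qed
  have reg\<tau>: "mat_regular (GL_space n) G0 n n \<tau>"
    unfolding \<tau>_def
  proof (intro GL.mat_regular_mult[OF G0_open, where m = n])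
    have sub: "G0 \<subseteq> carrier (GL n)" using G0_GL by auto
    show "mat_regular (GL_space n) G0 n n (\<lambda>g. g)"
      by (rule GL.mat_regular_mono[OF top G0_open sub mat_regular_GL_space])
    have "mat_regular (GL_space n) G0 (Suc r) (Suc r) (\<lambda>g. minv (Suc r) (lead n (Suc r) (A g)))" if "r < n" for r
      by (intro GL.mat_regular_minv[OF G0_open] GL.mat_regular_mono[OF top G0_open sub regL]) (use nz that in auto)
    then have regT: "(\<lambda>g. if i \<le> r then minv (Suc r) (lead n (Suc r) (A g)) $$ (i, r) else 0) \<in> regular (GL_space n) G0"
      if "r < n" for i r
      using that GL.reg_const[OF G0_open, of 0]
        mat_regularD(2)[of "GL_space n" G0 "Suc r" "Suc r" "\<lambda>g. minv (Suc r) (lead n (Suc r) (A g))" i r]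
      by (cases "i \<le> r") auto
    from regT show "mat_regular (GL_space n) G0 n n (\<lambda>g. unitri n (A g))"
      unfolding unitri_def by (intro GL.mat_regular_entries)
  qed
  have "mat_regular (Fl n) N n n \<sigma>"
    unfolding mat_regular_def
  proof (intro conjI ballI allI impI)
    fix W assume "W \<in> N" then show "\<sigma> W \<in> carrier_mat n n" using \<sigma> \<tau>_GL GL_carrier by (auto simp: N_def)
  next
    fix i j assume ij: "i < n" "j < n"
    show "(\<lambda>W. \<sigma> W $$ (i, j)) \<in> regular (Fl n) N"
    proof (rule fquotientD(4)[OF fquotient_Fl N])
      show "(\<lambda>W. \<sigma> W $$ (i, j)) \<circ> frame_flag n \<in> regular (GL_space n) {g \<in> points (GL_space n). frame_flag n g \<in> N}"
        unfolding pre by (rule GL.reg_cong[OF G0_open mat_regularD(2)[OF reg\<tau> ij]]) (simp add: \<sigma>)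
    qed
  qed
  moreover have "g0 \<in> G0"
  proof -
    have "A g0 = 1\<^sub>m n" using minv[OF g0] by (simp add: A_def)
    moreover have "lead n r (1\<^sub>m n) = 1\<^sub>m r" if "r \<le> n" for r
      using that lead_index[OF that] by (intro eq_matI) auto
    ultimately show ?thesis using g0 by (simp add: G0_def)
  qed
  ultimately show ?thesis
    using N \<sigma> \<tau>_GL \<tau>_flag by (intro exI[of _ N] exI[of _ \<sigma>]) (auto simp: N_def)
qed

section \<open>Morphisms of framed representations\<close>

definition right_invertible :: "nat \<Rightarrow> nat \<Rightarrow> complex mat \<Rightarrow> bool" where
  "right_invertible c d M \<longleftrightarrow> M \<in> carrier_mat c d \<and> (\<exists>N\<in>carrier_mat d c. M * N = 1\<^sub>m c)"

lemma right_invertible_carrier: "right_invertible c d M \<Longrightarrow> M \<in> carrier_mat c d"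
  by (simp add: right_invertible_def)

lemma right_invertible_cancel:
  assumes M: "right_invertible c d M" and A: "A \<in> carrier_mat n c" "B \<in> carrier_mat n c" and eq: "A * M = B * M"
  shows "A = B"
proof -
  obtain N where N: "N \<in> carrier_mat d c" "M * N = 1\<^sub>m c" and Mc: "M \<in> carrier_mat c d"
    using M by (auto simp: right_invertible_def)
  have "A * M * N = B * M * N" using eq by simp
  then show ?thesis using A N Mc by (simp add: mat_assoc carrier_matD[OF Mc] carrier_matD[OF N(1)])
qed

lemma right_invertible_GL: "g \<in> carrier (GL n) \<Longrightarrow> right_invertible n n g"
  unfolding right_invertible_def using minv GL_carrier by blast

lemma right_invertible_tail_proj: "c \<le> d \<Longrightarrow> right_invertible c d (tail_proj c d)"
  unfolding right_invertible_def using tail_proj_right_inverse by (intro conjI bexI) auto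

lemma right_invertible_mult:
  assumes "right_invertible a b M" "right_invertible b c N"
  shows "right_invertible a c (M * N)"
proof -
  obtain M' N' where *: "M' \<in> carrier_mat b a" "M * M' = 1\<^sub>m a" "N' \<in> carrier_mat c b" "N * N' = 1\<^sub>m b"
    "M \<in> carrier_mat a b" "N \<in> carrier_mat b c" using assms by (auto simp: right_invertible_def)
  have "M * N * (N' * M') = M * (N * N') * M'"
    using carrier_matD[OF *(1)] carrier_matD[OF *(3)] carrier_matD[OF *(5)] carrier_matD[OF *(6)]
    by (simp add: mat_assoc)
  also have "\<dots> = 1\<^sub>m a" using * by simp
  finally have "M * N * (N' * M') = 1\<^sub>m a" .
  moreover have "N' * M' \<in> carrier_mat c a" "M * N \<in> carrier_mat a c" using * by auto
  ultimately show ?thesis unfolding right_invertible_def by blast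
qed

definition rep_hom ::
    "('v, 'e) pre_digraph \<Rightarrow> ('v \<Rightarrow> complex mat) \<Rightarrow> ('v, 'e) framed_rep \<Rightarrow> ('v, 'e) framed_rep \<Rightarrow> bool" where
  "rep_hom Q \<pi> R R' \<longleftrightarrow>
     (\<forall>e\<in>arcs Q. \<pi> (head Q e) * Amap R e = Amap R' e * \<pi> (tail Q e) \<and>
                 \<pi> (tail Q e) * Bmap R e = Bmap R' e * \<pi> (head Q e)) \<and>
     (\<forall>v\<in>verts Q. \<pi> v * imap R v = imap R' v \<and> jmap R' v * \<pi> v = jmap R v)"

definition vanishes_on ::
    "('v, 'e) pre_digraph \<Rightarrow> ('v \<Rightarrow> nat) \<Rightarrow> ('v \<Rightarrow> nat) \<Rightarrow> ('v \<Rightarrow> complex vec set) \<Rightarrow> ('v, 'e) framed_rep \<Rightarrow> bool" where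
  "vanishes_on Q d f K R \<longleftrightarrow> (\<forall>v\<in>verts Q. \<forall>x\<in>K v.
        (\<forall>e\<in>arcs Q. tail Q e = v \<longrightarrow> Amap R e *\<^sub>v x = 0\<^sub>v (d (head Q e))) \<and>
        (\<forall>e\<in>arcs Q. head Q e = v \<longrightarrow> Bmap R e *\<^sub>v x = 0\<^sub>v (d (tail Q e))) \<and>
        jmap R v *\<^sub>v x = 0\<^sub>v (f v))"

lemma finsum_module_mat:
  assumes "finite F" "g \<in> F \<rightarrow> carrier_mat n m"
  shows "finsum (module_mat TYPE(complex) n m) g F = mat n m (\<lambda>(i, j). \<Sum>e\<in>F. g e $$ (i, j))"
proof -
  interpret abelian_group "module_mat TYPE(complex) n m" by (rule abelian_group_mat)
  show ?thesis
    using assms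
  proof (induction F)
    case empty
    then show ?case by (auto simp: finsum_empty module_mat_simps)
  next
    case (insert x F)
    have "finsum (module_mat TYPE(complex) n m) g (insert x F) = g x + finsum (module_mat TYPE(complex) n m) g F"
      using insert by (subst finsum_insert) (auto simp: module_mat_simps)
    also have "\<dots> = mat n m (\<lambda>(i, j). \<Sum>e\<in>insert x F. g e $$ (i, j))"
      using insert carrier_matD[OF funcset_mem[OF insert.prems, of x]] by (intro eq_matI) auto
    finally show ?case .
  qed
qed

lemma finsum_module_mat_carrier:
  assumes "finite F" "g \<in> F \<rightarrow> carrier_mat n m"
  shows "finsum (module_mat TYPE(complex) n m) g F \<in> carrier_mat n m"
  by (subst finsum_module_mat[OF assms]) auto

lemma mult_finsum_module_mat:
  assumes F: "finite F" and g: "g \<in> F \<rightarrow> carrier_mat n m" and M: "M \<in> carrier_mat k n"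
  shows "M * finsum (module_mat TYPE(complex) n m) g F = finsum (module_mat TYPE(complex) k m) (\<lambda>e. M * g e) F"
proof -
  have Mg: "(\<lambda>e. M * g e) \<in> F \<rightarrow> carrier_mat k m" using mult_carrier_mat[OF M] g by auto
  show ?thesis
  proof (rule eq_matI)
  fix i j assume "i < dim_row (finsum (module_mat TYPE(complex) k m) (\<lambda>e. M * g e) F)"
    "j < dim_col (finsum (module_mat TYPE(complex) k m) (\<lambda>e. M * g e) F)"
  then have ij: "i < k" "j < m" using finsum_module_mat_carrier[of F "\<lambda>e. M * g e" k m, OF F Mg] by auto
  have "(M * finsum (module_mat TYPE(complex) n m) g F) $$ (i, j) =
      (\<Sum>a<n. M $$ (i, a) * (\<Sum>e\<in>F. g e $$ (a, j)))"
    unfolding finsum_module_mat[of F g n m, OF F g] using ij M by (simp add: scalar_prod_def atLeast0LessThan)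
  also have "\<dots> = (\<Sum>e\<in>F. \<Sum>a<n. M $$ (i, a) * g e $$ (a, j))"
    by (simp add: sum_distrib_left) (rule sum.swap)
  also have "\<dots> = (\<Sum>e\<in>F. (M * g e) $$ (i, j))"
    using ij M carrier_matD[OF funcset_mem[OF g]] by (intro sum.cong) (auto simp: scalar_prod_def atLeast0LessThan)
  finally show "(M * finsum (module_mat TYPE(complex) n m) g F) $$ (i, j) =
      finsum (module_mat TYPE(complex) k m) (\<lambda>e. M * g e) F $$ (i, j)"
    unfolding finsum_module_mat[of F "\<lambda>e. M * g e" k m, OF F Mg] using ij by simp
qed (use finsum_module_mat_carrier[OF F g] finsum_module_mat_carrier[OF F Mg] M in auto)
qed

lemma finsum_module_mat_mult:
  assumes F: "finite F" and g: "g \<in> F \<rightarrow> carrier_mat n m" and M: "M \<in> carrier_mat m k"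
  shows "finsum (module_mat TYPE(complex) n m) g F * M = finsum (module_mat TYPE(complex) n k) (\<lambda>e. g e * M) F"
proof -
  have Mg: "(\<lambda>e. g e * M) \<in> F \<rightarrow> carrier_mat n k" using mult_carrier_mat[OF _ M] g by auto
  show ?thesis
  proof (rule eq_matI)
  fix i j assume "i < dim_row (finsum (module_mat TYPE(complex) n k) (\<lambda>e. g e * M) F)"
    "j < dim_col (finsum (module_mat TYPE(complex) n k) (\<lambda>e. g e * M) F)"
  then have ij: "i < n" "j < k" using finsum_module_mat_carrier[of F "\<lambda>e. g e * M" n k, OF F Mg] by auto
  have "(finsum (module_mat TYPE(complex) n m) g F * M) $$ (i, j) =
      (\<Sum>a<m. (\<Sum>e\<in>F. g e $$ (i, a)) * M $$ (a, j))"
    unfolding finsum_module_mat[of F g n m, OF F g] using ij M by (simp add: scalar_prod_def atLeast0LessThan)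
  also have "\<dots> = (\<Sum>e\<in>F. \<Sum>a<m. g e $$ (i, a) * M $$ (a, j))"
    by (simp add: sum_distrib_right) (rule sum.swap)
  also have "\<dots> = (\<Sum>e\<in>F. (g e * M) $$ (i, j))"
    using ij M carrier_matD[OF funcset_mem[OF g]] by (intro sum.cong) (auto simp: scalar_prod_def atLeast0LessThan)
  finally show "(finsum (module_mat TYPE(complex) n m) g F * M) $$ (i, j) =
      finsum (module_mat TYPE(complex) n k) (\<lambda>e. g e * M) F $$ (i, j)"
    unfolding finsum_module_mat[of F "\<lambda>e. g e * M" n k, OF F Mg] using ij by simp
qed (use finsum_module_mat_carrier[OF F g] finsum_module_mat_carrier[OF F Mg] M in auto)
qed

locale framed_quiver = fin_digraph Q for Q :: "('v, 'e) pre_digraph" +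
  fixes f :: "'v \<Rightarrow> nat"
begin

lemma framed_repsD:
  assumes "R \<in> framed_reps Q d f"
  shows "e \<in> arcs Q \<Longrightarrow> Amap R e \<in> carrier_mat (d (head Q e)) (d (tail Q e))"
    "e \<in> arcs Q \<Longrightarrow> Bmap R e \<in> carrier_mat (d (tail Q e)) (d (head Q e))"
    "v \<in> verts Q \<Longrightarrow> imap R v \<in> carrier_mat (d v) (f v)"
    "v \<in> verts Q \<Longrightarrow> jmap R v \<in> carrier_mat (f v) (d v)"
  using assms by (auto simp: framed_reps_def PiE_iff)

lemma framed_reps_eqI:
  assumes R: "R \<in> framed_reps Q d f" and R': "R' \<in> framed_reps Q d' f"
    and "\<And>e. e \<in> arcs Q \<Longrightarrow> Amap R e = Amap R' e" "\<And>e. e \<in> arcs Q \<Longrightarrow> Bmap R e = Bmap R' e"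
    "\<And>v. v \<in> verts Q \<Longrightarrow> imap R v = imap R' v" "\<And>v. v \<in> verts Q \<Longrightarrow> jmap R v = jmap R' v"
  shows "R = R'"
proof -
  have "Amap R = Amap R'"
    by (rule extensionalityI[of _ "arcs Q"]) (use assms in \<open>auto simp: framed_reps_def PiE_iff\<close>)
  moreover have "Bmap R = Bmap R'"
    by (rule extensionalityI[of _ "arcs Q"]) (use assms in \<open>auto simp: framed_reps_def PiE_iff\<close>)
  moreover have "imap R = imap R'"
    by (rule extensionalityI[of _ "verts Q"]) (use assms in \<open>auto simp: framed_reps_def PiE_iff\<close>)
  moreover have "jmap R = jmap R'"
    by (rule extensionalityI[of _ "verts Q"]) (use assms in \<open>auto simp: framed_reps_def PiE_iff\<close>)
  ultimately show ?thesis by (cases R; cases R') simp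
qed

lemma rep_homD:
  assumes "rep_hom Q \<pi> R R'"
  shows "e \<in> arcs Q \<Longrightarrow> \<pi> (head Q e) * Amap R e = Amap R' e * \<pi> (tail Q e)"
    "e \<in> arcs Q \<Longrightarrow> \<pi> (tail Q e) * Bmap R e = Bmap R' e * \<pi> (head Q e)"
    "v \<in> verts Q \<Longrightarrow> \<pi> v * imap R v = imap R' v"
    "v \<in> verts Q \<Longrightarrow> jmap R' v * \<pi> v = jmap R v"
  using assms by (auto simp: rep_hom_def)

lemma rep_hom_cong:
  assumes "\<And>v. v \<in> verts Q \<Longrightarrow> \<pi> v = \<pi>' v"
  shows "rep_hom Q \<pi> R R' \<longleftrightarrow> rep_hom Q \<pi>' R R'"
  unfolding rep_hom_def using assms head_in_verts tail_in_verts by auto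

lemma rep_hom_comp:
  assumes R: "R \<in> framed_reps Q d f" and R': "R' \<in> framed_reps Q d' f" and R'': "R'' \<in> framed_reps Q d'' f"
    and \<pi>: "\<And>v. v \<in> verts Q \<Longrightarrow> \<pi> v \<in> carrier_mat (d' v) (d v)"
    and \<sigma>: "\<And>v. v \<in> verts Q \<Longrightarrow> \<sigma> v \<in> carrier_mat (d'' v) (d' v)"
    and h: "rep_hom Q \<pi> R R'" and k: "rep_hom Q \<sigma> R' R''"
  shows "rep_hom Q (\<lambda>v. \<sigma> v * \<pi> v) R R''"
  unfolding rep_hom_def
proof (intro conjI ballI)
  note D = framed_repsD[OF R] framed_repsD[OF R'] framed_repsD[OF R'']
  fix e assume e: "e \<in> arcs Q"
  then have v: "head Q e \<in> verts Q" "tail Q e \<in> verts Q" by auto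
  note c = \<pi>[OF v(1), THEN carrier_matD(1)] \<pi>[OF v(1), THEN carrier_matD(2)]
    \<pi>[OF v(2), THEN carrier_matD(1)] \<pi>[OF v(2), THEN carrier_matD(2)]
    \<sigma>[OF v(1), THEN carrier_matD(1)] \<sigma>[OF v(1), THEN carrier_matD(2)]
    \<sigma>[OF v(2), THEN carrier_matD(1)] \<sigma>[OF v(2), THEN carrier_matD(2)]
    D(1,2,5,6,9,10)[OF e, THEN carrier_matD(1)] D(1,2,5,6,9,10)[OF e, THEN carrier_matD(2)]
  have "\<sigma> (head Q e) * \<pi> (head Q e) * Amap R e = \<sigma> (head Q e) * (Amap R' e * \<pi> (tail Q e))"
    using rep_homD(1)[OF h e] c by (simp add: mat_assoc)
  also have "\<dots> = \<sigma> (head Q e) * Amap R' e * \<pi> (tail Q e)" using c by (simp add: mat_assoc)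
  also have "\<dots> = Amap R'' e * (\<sigma> (tail Q e) * \<pi> (tail Q e))"
    unfolding rep_homD(1)[OF k e] using c by (simp add: mat_assoc)
  finally show "\<sigma> (head Q e) * \<pi> (head Q e) * Amap R e = Amap R'' e * (\<sigma> (tail Q e) * \<pi> (tail Q e))" .
  have "\<sigma> (tail Q e) * \<pi> (tail Q e) * Bmap R e = \<sigma> (tail Q e) * (Bmap R' e * \<pi> (head Q e))"
    using rep_homD(2)[OF h e] c by (simp add: mat_assoc)
  also have "\<dots> = \<sigma> (tail Q e) * Bmap R' e * \<pi> (head Q e)" using c by (simp add: mat_assoc)
  also have "\<dots> = Bmap R'' e * (\<sigma> (head Q e) * \<pi> (head Q e))"
    unfolding rep_homD(2)[OF k e] using c by (simp add: mat_assoc)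
  finally show "\<sigma> (tail Q e) * \<pi> (tail Q e) * Bmap R e = Bmap R'' e * (\<sigma> (head Q e) * \<pi> (head Q e))" .
next
  note D = framed_repsD[OF R] framed_repsD[OF R'] framed_repsD[OF R'']
  fix v assume v: "v \<in> verts Q"
  note c = \<pi>[OF v, THEN carrier_matD(1)] \<pi>[OF v, THEN carrier_matD(2)]
    \<sigma>[OF v, THEN carrier_matD(1)] \<sigma>[OF v, THEN carrier_matD(2)]
    D(3,4,7,8,11,12)[OF v, THEN carrier_matD(1)] D(3,4,7,8,11,12)[OF v, THEN carrier_matD(2)]
  show "\<sigma> v * \<pi> v * imap R v = imap R'' v"
    using rep_homD(3)[OF h v] rep_homD(3)[OF k v] c by (simp add: mat_assoc)
  show "jmap R'' v * (\<sigma> v * \<pi> v) = jmap R v"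
    using rep_homD(4)[OF h v] rep_homD(4)[OF k v] c by (simp flip: mat_assoc)
qed

text \<open>The equations for \<open>\<sigma>\<close> hold after composition with the surjective maps \<open>\<pi>\<close>.\<close>
lemma rep_hom_cancel:
  assumes R: "R \<in> framed_reps Q d f" and R': "R' \<in> framed_reps Q d' f" and R'': "R'' \<in> framed_reps Q d'' f"
    and \<pi>: "\<And>v. v \<in> verts Q \<Longrightarrow> right_invertible (d' v) (d v) (\<pi> v)"
    and \<sigma>: "\<And>v. v \<in> verts Q \<Longrightarrow> \<sigma> v \<in> carrier_mat (d'' v) (d' v)"
    and h: "rep_hom Q \<pi> R R'" and k: "rep_hom Q (\<lambda>v. \<sigma> v * \<pi> v) R R''"
  shows "rep_hom Q \<sigma> R' R''"
  unfolding rep_hom_def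
proof (intro conjI ballI)
  note D = framed_repsD[OF R] framed_repsD[OF R'] framed_repsD[OF R'']
  fix e assume e: "e \<in> arcs Q"
  then have v: "head Q e \<in> verts Q" "tail Q e \<in> verts Q" by auto
  note p = \<pi>[THEN right_invertible_carrier]
  note c = p[OF v(1), THEN carrier_matD(1)] p[OF v(1), THEN carrier_matD(2)]
    p[OF v(2), THEN carrier_matD(1)] p[OF v(2), THEN carrier_matD(2)]
    \<sigma>[OF v(1), THEN carrier_matD(1)] \<sigma>[OF v(1), THEN carrier_matD(2)]
    \<sigma>[OF v(2), THEN carrier_matD(1)] \<sigma>[OF v(2), THEN carrier_matD(2)]
    D(1,2,5,6,9,10)[OF e, THEN carrier_matD(1)] D(1,2,5,6,9,10)[OF e, THEN carrier_matD(2)]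
  have "\<sigma> (head Q e) * Amap R' e * \<pi> (tail Q e) = \<sigma> (head Q e) * (\<pi> (head Q e) * Amap R e)"
    unfolding rep_homD(1)[OF h e] using c by (simp add: mat_assoc)
  also have "\<dots> = Amap R'' e * \<sigma> (tail Q e) * \<pi> (tail Q e)"
    using rep_homD(1)[OF k e] c by (simp add: mat_assoc)
  finally show "\<sigma> (head Q e) * Amap R' e = Amap R'' e * \<sigma> (tail Q e)"
    by (rule right_invertible_cancel[OF \<pi>[OF v(2)], rotated 2])
       (use D(5,9)[OF e] \<sigma>[OF v(1)] \<sigma>[OF v(2)] in auto)
  have "\<sigma> (tail Q e) * Bmap R' e * \<pi> (head Q e) = \<sigma> (tail Q e) * (\<pi> (tail Q e) * Bmap R e)"
    unfolding rep_homD(2)[OF h e] using c by (simp add: mat_assoc)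
  also have "\<dots> = Bmap R'' e * \<sigma> (head Q e) * \<pi> (head Q e)"
    using rep_homD(2)[OF k e] c by (simp add: mat_assoc)
  finally show "\<sigma> (tail Q e) * Bmap R' e = Bmap R'' e * \<sigma> (head Q e)"
    by (rule right_invertible_cancel[OF \<pi>[OF v(1)], rotated 2])
       (use D(6,10)[OF e] \<sigma>[OF v(1)] \<sigma>[OF v(2)] in auto)
next
  note D = framed_repsD[OF R] framed_repsD[OF R'] framed_repsD[OF R'']
  fix v assume v: "v \<in> verts Q"
  note p = \<pi>[THEN right_invertible_carrier]
  note c = p[OF v, THEN carrier_matD(1)] p[OF v, THEN carrier_matD(2)]
    \<sigma>[OF v, THEN carrier_matD(1)] \<sigma>[OF v, THEN carrier_matD(2)]
    D(3,4,7,8,11,12)[OF v, THEN carrier_matD(1)] D(3,4,7,8,11,12)[OF v, THEN carrier_matD(2)]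
  show "\<sigma> v * imap R' v = imap R'' v"
    using rep_homD(3)[OF h v] rep_homD(3)[OF k v] c by (simp flip: rep_homD(3)[OF h v] add: mat_assoc)
  have "jmap R'' v * \<sigma> v * \<pi> v = jmap R' v * \<pi> v"
    using rep_homD(4)[OF h v] rep_homD(4)[OF k v] c by (simp add: mat_assoc)
  then show "jmap R'' v * \<sigma> v = jmap R' v"
    by (rule right_invertible_cancel[OF \<pi>[OF v], rotated 2])
       (use D(8,12)[OF v] \<sigma>[OF v] in auto)
qed

lemma rep_hom_one: "R \<in> framed_reps Q d f \<Longrightarrow> rep_hom Q (\<lambda>v. 1\<^sub>m (d v)) R R"
  unfolding rep_hom_def
  using left_mult_one_mat[OF framed_repsD(1)] left_mult_one_mat[OF framed_repsD(2)] left_mult_one_mat[OF framed_repsD(3)]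
    right_mult_one_mat[OF framed_repsD(1)] right_mult_one_mat[OF framed_repsD(2)] right_mult_one_mat[OF framed_repsD(4)]
  by metis

lemma rep_hom_one_eq:
  assumes "R \<in> framed_reps Q d f" "R' \<in> framed_reps Q d f" "rep_hom Q (\<lambda>v. 1\<^sub>m (d v)) R R'"
  shows "R = R'"
  by (rule framed_reps_eqI[OF assms(1,2)])
     (use rep_homD[OF assms(3)] framed_repsD[OF assms(1)] framed_repsD[OF assms(2)] in
       \<open>metis left_mult_one_mat right_mult_one_mat\<close>)+

text \<open>The target of a surjective morphism is determined by the source.\<close>

lemma rep_hom_unique:
  assumes R: "R \<in> framed_reps Q d f" and R1: "R1 \<in> framed_reps Q d' f" and R2: "R2 \<in> framed_reps Q d' f"
    and \<pi>: "\<And>v. v \<in> verts Q \<Longrightarrow> right_invertible (d' v) (d v) (\<pi> v)"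
    and h: "rep_hom Q \<pi> R R1" "rep_hom Q \<pi> R R2"
  shows "R1 = R2"
proof (rule rep_hom_one_eq[OF R1 R2])
  have "rep_hom Q (\<lambda>v. 1\<^sub>m (d' v) * \<pi> v) R R2"
    using h(2) by (rule rep_hom_cong[THEN iffD1, rotated]) (use left_mult_one_mat[OF right_invertible_carrier[OF \<pi>]] in auto)
  from rep_hom_cancel[OF R R1 R2 \<pi> _ h(1) this] show "rep_hom Q (\<lambda>v. 1\<^sub>m (d' v)) R1 R2" by simp
qed

subsection \<open>Stability and the moment map\<close>

text \<open>The image of a morphism to a stable representation is a subrepresentation containing the image of
  the framing.\<close>

lemma stable_hom_surj:
  assumes R: "R \<in> framed_reps Q d f" and R': "R' \<in> framed_reps Q d' f"
    and \<pi>: "\<And>v. v \<in> verts Q \<Longrightarrow> \<pi> v \<in> carrier_mat (d' v) (d v)"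
    and h: "rep_hom Q \<pi> R R'" and st: "stable Q d' f R'" and v: "v \<in> verts Q"
  shows "right_invertible (d' v) (d v) (\<pi> v)"
proof -
  define W where "W v = (\<lambda>x. \<pi> v *\<^sub>v x) ` carrier_vec (d v)" for v
  note D = framed_repsD[OF R] framed_repsD[OF R']
  have "\<forall>v\<in>verts Q. W v = carrier_vec (d' v)"
  proof (rule st[unfolded stable_def, THEN spec, THEN mp])
    show "(\<forall>v\<in>verts Q. is_subspace (d' v) (W v) \<and> (\<forall>x\<in>carrier_vec (f v). imap R' v *\<^sub>v x \<in> W v)) \<and>
      (\<forall>e\<in>arcs Q. (\<forall>x\<in>W (tail Q e). Amap R' e *\<^sub>v x \<in> W (head Q e)) \<and>
                 (\<forall>x\<in>W (head Q e). Bmap R' e *\<^sub>v x \<in> W (tail Q e)))"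
    proof (intro conjI ballI)
      fix v assume v: "v \<in> verts Q"
      note p = \<pi>[OF v]
      show "is_subspace (d' v) (W v)"
        unfolding is_subspace_iff W_def
      proof (intro conjI ballI allI)
        show "0\<^sub>v (d' v) \<in> (\<lambda>x. \<pi> v *\<^sub>v x) ` carrier_vec (d v)"
          by (rule image_eqI[of _ _ "0\<^sub>v (d v)"]) (use p in auto)
        fix y assume "y \<in> (\<lambda>x. \<pi> v *\<^sub>v x) ` carrier_vec (d v)"
        then obtain x where x: "x \<in> carrier_vec (d v)" "y = \<pi> v *\<^sub>v x" by blast
        show "c \<cdot>\<^sub>v y \<in> (\<lambda>x. \<pi> v *\<^sub>v x) ` carrier_vec (d v)" for c
          by (rule image_eqI[of _ _ "c \<cdot>\<^sub>v x"]) (use p x in \<open>auto simp: mult_mat_vec\<close>)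
        fix y' assume "y' \<in> (\<lambda>x. \<pi> v *\<^sub>v x) ` carrier_vec (d v)"
        then obtain x' where x': "x' \<in> carrier_vec (d v)" "y' = \<pi> v *\<^sub>v x'" by blast
        show "y + y' \<in> (\<lambda>x. \<pi> v *\<^sub>v x) ` carrier_vec (d v)"
          by (rule image_eqI[of _ _ "x + x'"]) (use p x x' in \<open>auto simp: mult_add_distrib_mat_vec\<close>)
      qed (use p in auto)
      fix x :: "complex vec" assume x: "x \<in> carrier_vec (f v)"
      show "imap R' v *\<^sub>v x \<in> W v"
        unfolding W_def rep_homD(3)[OF h v, symmetric]
        by (rule image_eqI[of _ _ "imap R v *\<^sub>v x"]) (use p x D(3)[OF v] in auto)
    next
      fix e assume e: "e \<in> arcs Q"
      then have v: "head Q e \<in> verts Q" "tail Q e \<in> verts Q" by auto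
      fix y assume "y \<in> W (tail Q e)"
      then obtain x where x: "x \<in> carrier_vec (d (tail Q e))" "y = \<pi> (tail Q e) *\<^sub>v x" by (auto simp: W_def)
      have "Amap R' e *\<^sub>v y = Amap R' e * \<pi> (tail Q e) *\<^sub>v x"
        using x \<pi>[OF v(2)] D(5)[OF e] by simp
      also have "\<dots> = \<pi> (head Q e) *\<^sub>v (Amap R e *\<^sub>v x)"
        unfolding rep_homD(1)[OF h e, symmetric] using x \<pi>[OF v(1)] D(1)[OF e] by simp
      finally show "Amap R' e *\<^sub>v y \<in> W (head Q e)" unfolding W_def using D(1)[OF e] x by auto
    next
      fix e assume e: "e \<in> arcs Q"
      then have v: "head Q e \<in> verts Q" "tail Q e \<in> verts Q" by auto
      fix y assume "y \<in> W (head Q e)"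
      then obtain x where x: "x \<in> carrier_vec (d (head Q e))" "y = \<pi> (head Q e) *\<^sub>v x" by (auto simp: W_def)
      have "Bmap R' e *\<^sub>v y = Bmap R' e * \<pi> (head Q e) *\<^sub>v x"
        using x \<pi>[OF v(1)] D(6)[OF e] by simp
      also have "\<dots> = \<pi> (tail Q e) *\<^sub>v (Bmap R e *\<^sub>v x)"
        unfolding rep_homD(2)[OF h e, symmetric] using x \<pi>[OF v(2)] D(2)[OF e] by simp
      finally show "Bmap R' e *\<^sub>v y \<in> W (tail Q e)" unfolding W_def using D(2)[OF e] x by auto
    qed
  qed
  then have W: "W v = carrier_vec (d' v)" using v by blast
  have "\<exists>x\<in>carrier_vec (d v). \<pi> v *\<^sub>v x = unit_vec (d' v) j" for j
    using W unit_vec_carrier[of "d' v" j] unfolding W_def by (metis (no_types, lifting) imageE)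
  then obtain x where x: "\<And>j. x j \<in> carrier_vec (d v)" "\<And>j. \<pi> v *\<^sub>v x j = unit_vec (d' v) j" by metis
  define N where "N = mat (d v) (d' v) (\<lambda>(i, j). x j $ i)"
  have "\<pi> v * N = 1\<^sub>m (d' v)"
  proof (rule eq_matI)
    fix i j assume "i < dim_row (1\<^sub>m (d' v))" "j < dim_col (1\<^sub>m (d' v))"
    then have ij: "i < d' v" "j < d' v" by auto
    have "col N j = x j" using ij x(1)[of j] by (auto simp: N_def)
    then have "(\<pi> v * N) $$ (i, j) = (\<pi> v *\<^sub>v x j) $ i"
      using ij \<pi>[OF v] by (simp add: N_def)
    then show "(\<pi> v * N) $$ (i, j) = 1\<^sub>m (d' v) $$ (i, j)" using ij x(2) by simp
  qed (use \<pi>[OF v] in \<open>auto simp: N_def\<close>)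
  then show ?thesis using \<pi>[OF v] by (auto simp: right_invertible_def N_def intro!: bexI[of _ N])
qed

text \<open>The preimage of a subrepresentation under a morphism is a subrepresentation, so stability passes to
  quotients.\<close>

lemma stable_quotient:
  assumes R: "R \<in> framed_reps Q d f" and R': "R' \<in> framed_reps Q d' f"
    and \<pi>: "\<And>v. v \<in> verts Q \<Longrightarrow> right_invertible (d' v) (d v) (\<pi> v)"
    and h: "rep_hom Q \<pi> R R'" and st: "stable Q d f R"
  shows "stable Q d' f R'"
  unfolding stable_def
proof (intro allI impI ballI)
  fix D' v assume D': "(\<forall>v\<in>verts Q. is_subspace (d' v) (D' v) \<and> (\<forall>x\<in>carrier_vec (f v). imap R' v *\<^sub>v x \<in> D' v)) \<and>
      (\<forall>e\<in>arcs Q. (\<forall>x\<in>D' (tail Q e). Amap R' e *\<^sub>v x \<in> D' (head Q e)) \<and>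
                 (\<forall>x\<in>D' (head Q e). Bmap R' e *\<^sub>v x \<in> D' (tail Q e)))" and v: "v \<in> verts Q"
  define W where "W v = {x \<in> carrier_vec (d v). \<pi> v *\<^sub>v x \<in> D' v}" for v
  note D = framed_repsD[OF R] framed_repsD[OF R']
  note p = \<pi>[THEN right_invertible_carrier]
  have "\<forall>v\<in>verts Q. W v = carrier_vec (d v)"
  proof (rule st[unfolded stable_def, THEN spec, THEN mp])
    show "(\<forall>v\<in>verts Q. is_subspace (d v) (W v) \<and> (\<forall>x\<in>carrier_vec (f v). imap R v *\<^sub>v x \<in> W v)) \<and>
      (\<forall>e\<in>arcs Q. (\<forall>x\<in>W (tail Q e). Amap R e *\<^sub>v x \<in> W (head Q e)) \<and>
                 (\<forall>x\<in>W (head Q e). Bmap R e *\<^sub>v x \<in> W (tail Q e)))"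
    proof (intro conjI ballI)
      fix v assume v: "v \<in> verts Q"
      have sub: "is_subspace (d' v) (D' v)" using D' v by blast
      have "\<pi> v *\<^sub>v 0\<^sub>v (d v) = 0\<^sub>v (d' v)" using p[OF v] by auto
      then show "is_subspace (d v) (W v)"
        using p[OF v] sub unfolding is_subspace_iff W_def
        by (auto simp: mult_add_distrib_mat_vec mult_mat_vec)
      fix x :: "complex vec" assume x: "x \<in> carrier_vec (f v)"
      have "\<pi> v *\<^sub>v (imap R v *\<^sub>v x) = imap R' v *\<^sub>v x"
        unfolding rep_homD(3)[OF h v, symmetric] using p[OF v] D(3)[OF v] x by simp
      then show "imap R v *\<^sub>v x \<in> W v" unfolding W_def using D' v D(3)[OF v] x by auto
    next
      fix e assume e: "e \<in> arcs Q"
      then have v: "head Q e \<in> verts Q" "tail Q e \<in> verts Q" by auto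
      fix x assume "x \<in> W (tail Q e)"
      then have x: "x \<in> carrier_vec (d (tail Q e))" "\<pi> (tail Q e) *\<^sub>v x \<in> D' (tail Q e)" by (auto simp: W_def)
      have "\<pi> (head Q e) *\<^sub>v (Amap R e *\<^sub>v x) = \<pi> (head Q e) * Amap R e *\<^sub>v x"
        using p[OF v(1)] D(1)[OF e] x by simp
      also have "\<dots> = Amap R' e *\<^sub>v (\<pi> (tail Q e) *\<^sub>v x)"
        unfolding rep_homD(1)[OF h e] using p[OF v(2)] D(5)[OF e] x by simp
      finally show "Amap R e *\<^sub>v x \<in> W (head Q e)" unfolding W_def using D' e D(1)[OF e] x by auto
    next
      fix e assume e: "e \<in> arcs Q"
      then have v: "head Q e \<in> verts Q" "tail Q e \<in> verts Q" by auto
      fix x assume "x \<in> W (head Q e)"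
      then have x: "x \<in> carrier_vec (d (head Q e))" "\<pi> (head Q e) *\<^sub>v x \<in> D' (head Q e)" by (auto simp: W_def)
      have "\<pi> (tail Q e) *\<^sub>v (Bmap R e *\<^sub>v x) = \<pi> (tail Q e) * Bmap R e *\<^sub>v x"
        using p[OF v(2)] D(2)[OF e] x by simp
      also have "\<dots> = Bmap R' e *\<^sub>v (\<pi> (head Q e) *\<^sub>v x)"
        unfolding rep_homD(2)[OF h e] using p[OF v(1)] D(6)[OF e] x by simp
      finally show "Bmap R e *\<^sub>v x \<in> W (tail Q e)" unfolding W_def using D' e D(2)[OF e] x by auto
    qed
  qed
  then have W: "W v = carrier_vec (d v)" using v by blast
  obtain N where N: "N \<in> carrier_mat (d v) (d' v)" "\<pi> v * N = 1\<^sub>m (d' v)"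
    using \<pi>[OF v] by (auto simp: right_invertible_def)
  have "y \<in> D' v" if y: "y \<in> carrier_vec (d' v)" for y
  proof -
    have "N *\<^sub>v y \<in> W v" unfolding W using N y by auto
    then have "\<pi> v *\<^sub>v (N *\<^sub>v y) \<in> D' v" by (simp add: W_def)
    moreover have "\<pi> v *\<^sub>v (N *\<^sub>v y) = \<pi> v * N *\<^sub>v y"
      using N y p[OF v] by (intro assoc_mult_mat_vec[symmetric]) auto
    ultimately show ?thesis using N y by simp
  qed
  moreover have "D' v \<subseteq> carrier_vec (d' v)" using D' v by (auto simp: is_subspace_iff)
  ultimately show "D' v = carrier_vec (d' v)" by auto
qed

text \<open>The maps \<open>\<pi>\<close> intertwine the left hand sides of the two moment map equations and can be cancelled.\<close>
lemma moment_map_quotient: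
  assumes R: "R \<in> framed_reps Q d f" and R': "R' \<in> framed_reps Q d' f"
    and \<pi>: "\<And>v. v \<in> verts Q \<Longrightarrow> right_invertible (d' v) (d v) (\<pi> v)"
    and h: "rep_hom Q \<pi> R R'" and mm: "moment_map_eq Q d R"
  shows "moment_map_eq Q d' R'"
  unfolding moment_map_eq_def
proof
  fix v assume v: "v \<in> verts Q"
  note D = framed_repsD[OF R] framed_repsD[OF R']
  note p = \<pi>[THEN right_invertible_carrier]
  let ?H = "{e \<in> arcs Q. head Q e = v}" and ?T = "{e \<in> arcs Q. tail Q e = v}"
  define S1 where "S1 = finsum (module_mat TYPE(complex) (d v) (d v)) (\<lambda>e. Amap R e * Bmap R e) ?H"
  define S2 where "S2 = finsum (module_mat TYPE(complex) (d v) (d v)) (\<lambda>e. Bmap R e * Amap R e) ?T"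
  define S1' where "S1' = finsum (module_mat TYPE(complex) (d' v) (d' v)) (\<lambda>e. Amap R' e * Bmap R' e) ?H"
  define S2' where "S2' = finsum (module_mat TYPE(complex) (d' v) (d' v)) (\<lambda>e. Bmap R' e * Amap R' e) ?T"
  have fin: "finite ?H" "finite ?T" by auto
  have c1: "(\<lambda>e. Amap R e * Bmap R e) \<in> ?H \<rightarrow> carrier_mat (d v) (d v)" "(\<lambda>e. Amap R' e * Bmap R' e) \<in> ?H \<rightarrow> carrier_mat (d' v) (d' v)"
    using D(1,2,5,6) by (auto intro!: mult_carrier_mat)
  have c2: "(\<lambda>e. Bmap R e * Amap R e) \<in> ?T \<rightarrow> carrier_mat (d v) (d v)" "(\<lambda>e. Bmap R' e * Amap R' e) \<in> ?T \<rightarrow> carrier_mat (d' v) (d' v)"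
    using D(1,2,5,6) by (auto intro!: mult_carrier_mat)
  have Sc: "S1 \<in> carrier_mat (d v) (d v)" "S2 \<in> carrier_mat (d v) (d v)" "S1' \<in> carrier_mat (d' v) (d' v)" "S2' \<in> carrier_mat (d' v) (d' v)"
    unfolding S1_def S2_def S1'_def S2'_def by (intro finsum_module_mat_carrier fin c1 c2; simp)+
  have move: "\<pi> x * (M * N) = M' * N' * \<pi> x"
    if "\<pi> x * M = M' * \<pi> y" "\<pi> y * N = N' * \<pi> x" "M \<in> carrier_mat (d x) (d y)" "N \<in> carrier_mat (d y) (d x)"
      "M' \<in> carrier_mat (d' x) (d' y)" "N' \<in> carrier_mat (d' y) (d' x)" "x \<in> verts Q" "y \<in> verts Q" for x y M N M' N'
  proof -
    note c = that(3-6)[THEN carrier_matD(1)] that(3-6)[THEN carrier_matD(2)]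
      p[OF that(7), THEN carrier_matD(1)] p[OF that(7), THEN carrier_matD(2)]
      p[OF that(8), THEN carrier_matD(1)] p[OF that(8), THEN carrier_matD(2)]
    have "\<pi> x * (M * N) = (\<pi> x * M) * N" using c by (simp add: mat_assoc)
    also have "\<dots> = M' * (\<pi> y * N)" unfolding that(1) using c by (simp add: mat_assoc)
    also have "\<dots> = M' * N' * \<pi> x" unfolding that(2) using c by (simp add: mat_assoc)
    finally show ?thesis .
  qed
  have E1: "\<pi> v * S1 = S1' * \<pi> v"
  proof -
    have "finsum (module_mat TYPE(complex) (d' v) (d v)) (\<lambda>e. \<pi> v * (Amap R e * Bmap R e)) ?H =
        finsum (module_mat TYPE(complex) (d' v) (d v)) (\<lambda>e. Amap R' e * Bmap R' e * \<pi> v) ?H"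
    proof -
      have eq: "\<pi> v * (Amap R e * Bmap R e) = Amap R' e * Bmap R' e * \<pi> v" if "e \<in> ?H" for e
        using that move[OF rep_homD(1)[OF h] rep_homD(2)[OF h] D(1) D(2) D(5) D(6), of e] by auto
      have c: "(\<lambda>e. \<pi> v * (Amap R e * Bmap R e)) \<in> ?H \<rightarrow> carrier_mat (d' v) (d v)"
        using c1(1) mult_carrier_mat[OF p[OF v]] by auto
      have c': "(\<lambda>e. Amap R' e * Bmap R' e * \<pi> v) \<in> ?H \<rightarrow> carrier_mat (d' v) (d v)"
        using c1(2) mult_carrier_mat[OF _ p[OF v]] by auto
      show ?thesis
        unfolding finsum_module_mat[of ?H "\<lambda>e. \<pi> v * (Amap R e * Bmap R e)" "d' v" "d v", OF fin(1) c]
          finsum_module_mat[of ?H "\<lambda>e. Amap R' e * Bmap R' e * \<pi> v" "d' v" "d v", OF fin(1) c']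
        using eq by (auto intro!: eq_matI sum.cong)
    qed
    then show ?thesis
      unfolding S1_def S1'_def mult_finsum_module_mat[of ?H "\<lambda>e. Amap R e * Bmap R e" "d v" "d v", OF fin(1) c1(1) p[OF v]]
        finsum_module_mat_mult[of ?H "\<lambda>e. Amap R' e * Bmap R' e" "d' v" "d' v", OF fin(1) c1(2) p[OF v]] .
  qed
  have E2: "\<pi> v * S2 = S2' * \<pi> v"
  proof -
    have "finsum (module_mat TYPE(complex) (d' v) (d v)) (\<lambda>e. \<pi> v * (Bmap R e * Amap R e)) ?T =
        finsum (module_mat TYPE(complex) (d' v) (d v)) (\<lambda>e. Bmap R' e * Amap R' e * \<pi> v) ?T"
    proof -
      have eq: "\<pi> v * (Bmap R e * Amap R e) = Bmap R' e * Amap R' e * \<pi> v" if "e \<in> ?T" for e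
        using that move[OF rep_homD(2)[OF h] rep_homD(1)[OF h] D(2) D(1) D(6) D(5), of e] by auto
      have c: "(\<lambda>e. \<pi> v * (Bmap R e * Amap R e)) \<in> ?T \<rightarrow> carrier_mat (d' v) (d v)"
        using c2(1) mult_carrier_mat[OF p[OF v]] by auto
      have c': "(\<lambda>e. Bmap R' e * Amap R' e * \<pi> v) \<in> ?T \<rightarrow> carrier_mat (d' v) (d v)"
        using c2(2) mult_carrier_mat[OF _ p[OF v]] by auto
      show ?thesis
        unfolding finsum_module_mat[of ?T "\<lambda>e. \<pi> v * (Bmap R e * Amap R e)" "d' v" "d v", OF fin(2) c]
          finsum_module_mat[of ?T "\<lambda>e. Bmap R' e * Amap R' e * \<pi> v" "d' v" "d v", OF fin(2) c']
        using eq by (auto intro!: eq_matI sum.cong)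
    qed
    then show ?thesis
      unfolding S2_def S2'_def mult_finsum_module_mat[of ?T "\<lambda>e. Bmap R e * Amap R e" "d v" "d v", OF fin(2) c2(1) p[OF v]]
        finsum_module_mat_mult[of ?T "\<lambda>e. Bmap R' e * Amap R' e" "d' v" "d' v", OF fin(2) c2(2) p[OF v]] .
  qed
  have E3: "\<pi> v * (imap R v * jmap R v) = imap R' v * jmap R' v * \<pi> v"
  proof -
    have "\<pi> v * (imap R v * jmap R v) = (\<pi> v * imap R v) * jmap R v"
      using p[OF v] D(3,4)[OF v] by (intro assoc_mult_mat[symmetric]) auto
    also have "\<dots> = imap R' v * (jmap R' v * \<pi> v)" by (simp add: rep_homD(3,4)[OF h v])
    also have "\<dots> = imap R' v * jmap R' v * \<pi> v"
      using p[OF v] D(7,8)[OF v] by (intro assoc_mult_mat[symmetric]) auto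
    finally show ?thesis .
  qed
  have ij: "imap R v * jmap R v \<in> carrier_mat (d v) (d v)" "imap R' v * jmap R' v \<in> carrier_mat (d' v) (d' v)"
    using D(3,4,7,8)[OF v] by auto
  have "(S1' - S2' + imap R' v * jmap R' v) * \<pi> v = (S1' - S2') * \<pi> v + imap R' v * jmap R' v * \<pi> v"
    by (rule add_mult_distrib_mat[OF minus_carrier_mat[OF Sc(4)] ij(2) p[OF v]])
  also have "(S1' - S2') * \<pi> v = \<pi> v * S1 - \<pi> v * S2"
    unfolding E1 E2 by (rule minus_mult_distrib_mat[OF Sc(3,4) p[OF v]])
  also have "\<dots> = \<pi> v * (S1 - S2)"
    by (rule mult_minus_distrib_mat[OF p[OF v] Sc(1,2), symmetric])
  also have "\<pi> v * (S1 - S2) + imap R' v * jmap R' v * \<pi> v = \<pi> v * (S1 - S2 + imap R v * jmap R v)"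
    unfolding E3[symmetric] by (rule mult_add_distrib_mat[OF p[OF v] minus_carrier_mat[OF Sc(2)] ij(1), symmetric])
  also have "S1 - S2 + imap R v * jmap R v = 0\<^sub>m (d v) (d v)"
    using mm v by (simp add: moment_map_eq_def S1_def S2_def)
  also have "\<pi> v * 0\<^sub>m (d v) (d v) = 0\<^sub>m (d' v) (d' v) * \<pi> v" using p[OF v] by simp
  finally show "S1' - S2' + imap R' v * jmap R' v = 0\<^sub>m (d' v) (d' v)"
    by (rule right_invertible_cancel[OF \<pi>[OF v], rotated 2]) (use Sc ij in auto)
qed

subsection \<open>The action of the group\<close>

lemma rep_act_framed:
  assumes R: "R \<in> framed_reps Q d f" and g: "\<And>v. v \<in> verts Q \<Longrightarrow> g v \<in> carrier (GL (d v))"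
  shows "rep_act Q d g R \<in> framed_reps Q d f" "rep_hom Q g R (rep_act Q d g R)"
proof -
  note D = framed_repsD[OF R]
  have gc: "g v \<in> carrier_mat (d v) (d v)" "minv (d v) (g v) \<in> carrier_mat (d v) (d v)" if "v \<in> verts Q" for v
    using g[OF that] GL_carrier minv by auto
  have hv: "head Q e \<in> verts Q" "tail Q e \<in> verts Q" if "e \<in> arcs Q" for e using that by auto
  show "rep_act Q d g R \<in> framed_reps Q d f"
    unfolding framed_reps_def rep_act_def mem_Collect_eq framed_rep.simps
    by (intro conjI PiE_I; simp?; intro mult_carrier_mat[OF mult_carrier_mat[OF gc(1) D(1)] gc(2)]
        mult_carrier_mat[OF mult_carrier_mat[OF gc(1) D(2)] gc(2)] mult_carrier_mat[OF gc(1) D(3)]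
        mult_carrier_mat[OF D(4) gc(2)] hv)
  have can: "M * minv (d v) (g v) * g v = M" if "M \<in> carrier_mat n (d v)" "v \<in> verts Q" for M n v
  proof -
    have "M * minv (d v) (g v) * g v = M * (minv (d v) (g v) * g v)"
      using that gc by (intro assoc_mult_mat) auto
    then show ?thesis using minv(4)[OF g[OF that(2)]] that by simp
  qed
  show "rep_hom Q g R (rep_act Q d g R)"
    unfolding rep_hom_def rep_act_def framed_rep.simps
  proof (intro conjI ballI)
    fix e assume e: "e \<in> arcs Q"
    show "g (head Q e) * Amap R e = (\<lambda>e\<in>arcs Q. g (head Q e) * Amap R e * minv (d (tail Q e)) (g (tail Q e))) e * g (tail Q e)"
      using e can[OF mult_carrier_mat[OF gc(1)[OF hv(1)[OF e]] D(1)[OF e]] hv(2)[OF e]] by simp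
    show "g (tail Q e) * Bmap R e = (\<lambda>e\<in>arcs Q. g (tail Q e) * Bmap R e * minv (d (head Q e)) (g (head Q e))) e * g (head Q e)"
      using e can[OF mult_carrier_mat[OF gc(1)[OF hv(2)[OF e]] D(2)[OF e]] hv(1)[OF e]] by simp
  next
    fix v assume v: "v \<in> verts Q"
    show "(\<lambda>v\<in>verts Q. jmap R v * minv (d v) (g v)) v * g v = jmap R v"
      using v can[OF D(4)[OF v] v] by simp
  qed simp
qed

lemma rep_act_eqI:
  assumes "R \<in> framed_reps Q d f" "\<And>v. v \<in> verts Q \<Longrightarrow> g v \<in> carrier (GL (d v))"
    "R' \<in> framed_reps Q d f" "rep_hom Q g R R'"
  shows "R' = rep_act Q d g R"
  by (rule rep_hom_unique[OF assms(1,3) rep_act_framed(1)[OF assms(1,2)] right_invertible_GL[OF assms(2)]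
        assms(4) rep_act_framed(2)[OF assms(1,2)]])

lemma rep_act_mult:
  assumes R: "R \<in> framed_reps Q d f" and g: "\<And>v. v \<in> verts Q \<Longrightarrow> g v \<in> carrier (GL (d v))"
    and h: "\<And>v. v \<in> verts Q \<Longrightarrow> h v \<in> carrier (GL (d v))"
  shows "rep_act Q d g (rep_act Q d h R) = rep_act Q d (\<lambda>v. g v * h v) R"
proof (rule rep_act_eqI[OF R])
  show "g v * h v \<in> carrier (GL (d v))" if "v \<in> verts Q" for v using GL_mult g h that by blast
  note hR = rep_act_framed[OF R h]
  note ghR = rep_act_framed[OF hR(1) g]
  show "rep_act Q d g (rep_act Q d h R) \<in> framed_reps Q d f" by (rule ghR)
  show "rep_hom Q (\<lambda>v. g v * h v) R (rep_act Q d g (rep_act Q d h R))"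
    by (rule rep_hom_comp[OF R hR(1) ghR(1) _ _ hR(2) ghR(2)]) (use g h GL_carrier in auto)
qed

lemma rep_act_cong:
  assumes "\<And>v. v \<in> verts Q \<Longrightarrow> g v = h v"
  shows "rep_act Q d g R = rep_act Q d h R"
  unfolding rep_act_def using assms head_in_verts tail_in_verts by (auto intro!: restrict_ext)

lemma rep_act_stable_moment:
  assumes "R \<in> framed_reps Q d f" "\<And>v. v \<in> verts Q \<Longrightarrow> g v \<in> carrier (GL (d v))"
  shows "stable Q d f R \<Longrightarrow> stable Q d f (rep_act Q d g R)"
    "moment_map_eq Q d R \<Longrightarrow> moment_map_eq Q d (rep_act Q d g R)"
  using stable_quotient[OF assms(1) rep_act_framed(1)[OF assms] right_invertible_GL[OF assms(2)] rep_act_framed(2)[OF assms]]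
    moment_map_quotient[OF assms(1) rep_act_framed(1)[OF assms] right_invertible_GL[OF assms(2)] rep_act_framed(2)[OF assms]]
  by auto

end

section \<open>Normal forms of points\<close>

lemma mat_eq_if_mult_vec_eq:
  assumes A: "A \<in> carrier_mat n m" "B \<in> carrier_mat n m" and eq: "\<And>x. x \<in> carrier_vec m \<Longrightarrow> A *\<^sub>v x = B *\<^sub>v x"
  shows "A = (B :: complex mat)"
proof (rule eq_matI)
  fix i j assume "i < dim_row B" "j < dim_col B"
  then have ij: "i < n" "j < m" using A by auto
  have "(A *\<^sub>v unit_vec m j) $ i = (B *\<^sub>v unit_vec m j) $ i" using eq[of "unit_vec m j"] by simp
  then show "A $$ (i, j) = B $$ (i, j)" using ij A by simp
qed (use A in auto)

text \<open>The image of \<open>1 - N M\<close> is in the kernel of \<open>M\<close>.\<close>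
lemma mult_proj_if_vanishes_on_kernel:
  assumes M: "M \<in> carrier_mat c d" "N \<in> carrier_mat d c" "M * N = 1\<^sub>m c" and X: "X \<in> carrier_mat n d"
    and van: "\<And>x. x \<in> mat_kernel M \<Longrightarrow> X *\<^sub>v x = 0\<^sub>v n"
  shows "X * (N * M) = (X :: complex mat)"
proof (rule mat_eq_if_mult_vec_eq[OF _ X])
  show "X * (N * M) \<in> carrier_mat n d" using M X by auto
  fix x :: "complex vec" assume x: "x \<in> carrier_vec d"
  have Mx: "M *\<^sub>v x \<in> carrier_vec c" "N *\<^sub>v (M *\<^sub>v x) \<in> carrier_vec d" using M x by auto
  have "M *\<^sub>v (N *\<^sub>v (M *\<^sub>v x)) = M * N *\<^sub>v (M *\<^sub>v x)"
    by (rule assoc_mult_mat_vec[OF M(1,2) Mx(1), symmetric])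
  then have "M *\<^sub>v (x - N *\<^sub>v (M *\<^sub>v x)) = 0\<^sub>v c"
    using M x Mx by (simp add: mult_minus_distrib_mat_vec[of M c d])
  then have "x - N *\<^sub>v (M *\<^sub>v x) \<in> mat_kernel M"
    using M x Mx by (simp add: mat_kernel_def)
  from van[OF this] have "X *\<^sub>v x - X *\<^sub>v (N *\<^sub>v (M *\<^sub>v x)) = 0\<^sub>v n"
    using X x Mx by (simp add: mult_minus_distrib_mat_vec[of X n d])
  then have "(X *\<^sub>v x) $ i = (X *\<^sub>v (N *\<^sub>v (M *\<^sub>v x))) $ i" if "i < n" for i
    using X that by (metis carrier_matD(1) dim_mult_mat_vec index_minus_vec(1) index_zero_vec(1) right_minus_eq)
  then have "X *\<^sub>v x = X *\<^sub>v (N *\<^sub>v (M *\<^sub>v x))" using X by (intro eq_vecI) auto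
  then show "X * (N * M) *\<^sub>v x = X *\<^sub>v x"
    using M X x Mx by (simp add: assoc_mult_mat_vec[of X n d "N * M" d] assoc_mult_mat_vec[of N d c M d])
qed

context framed_quiver
begin

text \<open>The first representations of points in normal form, where the composition of all \<open>\<pi>\<close> is the
  projection onto the last \<open>c v\<close> coordinates.\<close>
definition core_reps :: "('v \<Rightarrow> nat) \<Rightarrow> ('v \<Rightarrow> nat) \<Rightarrow> ('v, 'e) framed_rep set" where
  "core_reps d c = {R \<in> framed_reps Q d f. stable Q d f R \<and> moment_map_eq Q d R \<and>
     vanishes_on Q d f (\<lambda>v. mat_kernel (tail_proj (c v) (d v))) R}"

text \<open>The quotient of a representation by the span of the first \<open>d v - c v\<close> unit vectors. On that subspace
  all outgoing maps are required to vanish, so it does not matter that \<open>tail_proj\<^sup>T\<close> is only one of many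
  sections of the projection.\<close>
definition trunc :: "('v \<Rightarrow> nat) \<Rightarrow> ('v \<Rightarrow> nat) \<Rightarrow> ('v, 'e) framed_rep \<Rightarrow> ('v, 'e) framed_rep" where
  "trunc d c R =
     \<lparr>Amap = (\<lambda>e\<in>arcs Q. tail_proj (c (head Q e)) (d (head Q e)) * Amap R e * (tail_proj (c (tail Q e)) (d (tail Q e)))\<^sup>T),
      Bmap = (\<lambda>e\<in>arcs Q. tail_proj (c (tail Q e)) (d (tail Q e)) * Bmap R e * (tail_proj (c (head Q e)) (d (head Q e)))\<^sup>T),
      imap = (\<lambda>v\<in>verts Q. tail_proj (c v) (d v) * imap R v),
      jmap = (\<lambda>v\<in>verts Q. jmap R v * (tail_proj (c v) (d v))\<^sup>T)\<rparr>"

lemma core_framed: "R \<in> core_reps d c \<Longrightarrow> R \<in> framed_reps Q d f"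
  by (simp add: core_reps_def)

lemma vanishes_onD:
  assumes "vanishes_on Q d f K R"
  shows "e \<in> arcs Q \<Longrightarrow> x \<in> K (tail Q e) \<Longrightarrow> Amap R e *\<^sub>v x = 0\<^sub>v (d (head Q e))"
    "e \<in> arcs Q \<Longrightarrow> x \<in> K (head Q e) \<Longrightarrow> Bmap R e *\<^sub>v x = 0\<^sub>v (d (tail Q e))"
    "v \<in> verts Q \<Longrightarrow> x \<in> K v \<Longrightarrow> jmap R v *\<^sub>v x = 0\<^sub>v (f v)"
  using assms head_in_verts tail_in_verts unfolding vanishes_on_def by blast+

text \<open>An isomorphism of representations transports subspaces on which the maps vanish.\<close>

lemma vanishes_on_transport:
  assumes R: "R \<in> framed_reps Q d f" and R': "R' \<in> framed_reps Q d f"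
    and g: "\<And>v. v \<in> verts Q \<Longrightarrow> g v \<in> carrier_mat (d v) (d v)" and h: "rep_hom Q g R R'"
    and van: "vanishes_on Q d f K R"
    and K: "\<And>v x. v \<in> verts Q \<Longrightarrow> x \<in> K' v \<Longrightarrow> \<exists>y\<in>K v. y \<in> carrier_vec (d v) \<and> x = g v *\<^sub>v y"
  shows "vanishes_on Q d f K' R'"
proof -
  note D = framed_repsD[OF R] framed_repsD[OF R']
  have hv: "head Q e \<in> verts Q" "tail Q e \<in> verts Q" if "e \<in> arcs Q" for e using that by auto
  have A: "Amap R' e *\<^sub>v x = 0\<^sub>v (d (head Q e))" if e: "e \<in> arcs Q" and x: "x \<in> K' (tail Q e)" for e x
  proof -
    obtain y where y: "y \<in> K (tail Q e)" "y \<in> carrier_vec (d (tail Q e))" "x = g (tail Q e) *\<^sub>v y"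
      using K[OF hv(2)[OF e] x] by blast
    have "Amap R' e *\<^sub>v x = Amap R' e * g (tail Q e) *\<^sub>v y"
      unfolding y(3) by (rule assoc_mult_mat_vec[OF D(5)[OF e] g[OF hv(2)[OF e]] y(2), symmetric])
    also have "\<dots> = g (head Q e) *\<^sub>v (Amap R e *\<^sub>v y)"
      unfolding rep_homD(1)[OF h e, symmetric] by (rule assoc_mult_mat_vec[OF g[OF hv(1)[OF e]] D(1)[OF e] y(2)])
    also have "\<dots> = 0\<^sub>v (d (head Q e))"
      unfolding vanishes_onD(1)[OF van e y(1)] using g[OF hv(1)[OF e]] by auto
    finally show ?thesis .
  qed
  have B: "Bmap R' e *\<^sub>v x = 0\<^sub>v (d (tail Q e))" if e: "e \<in> arcs Q" and x: "x \<in> K' (head Q e)" for e x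
  proof -
    obtain y where y: "y \<in> K (head Q e)" "y \<in> carrier_vec (d (head Q e))" "x = g (head Q e) *\<^sub>v y"
      using K[OF hv(1)[OF e] x] by blast
    have "Bmap R' e *\<^sub>v x = Bmap R' e * g (head Q e) *\<^sub>v y"
      unfolding y(3) by (rule assoc_mult_mat_vec[OF D(6)[OF e] g[OF hv(1)[OF e]] y(2), symmetric])
    also have "\<dots> = g (tail Q e) *\<^sub>v (Bmap R e *\<^sub>v y)"
      unfolding rep_homD(2)[OF h e, symmetric] by (rule assoc_mult_mat_vec[OF g[OF hv(2)[OF e]] D(2)[OF e] y(2)])
    also have "\<dots> = 0\<^sub>v (d (tail Q e))"
      unfolding vanishes_onD(2)[OF van e y(1)] using g[OF hv(2)[OF e]] by auto
    finally show ?thesis .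
  qed
  have J: "jmap R' v *\<^sub>v x = 0\<^sub>v (f v)" if v: "v \<in> verts Q" and x: "x \<in> K' v" for v x
  proof -
    obtain y where y: "y \<in> K v" "y \<in> carrier_vec (d v)" "x = g v *\<^sub>v y"
      using K[OF v x] by blast
    have "jmap R' v *\<^sub>v x = jmap R' v * g v *\<^sub>v y"
      unfolding y(3) by (rule assoc_mult_mat_vec[OF D(8)[OF v] g[OF v] y(2), symmetric])
    then show ?thesis unfolding rep_homD(4)[OF h v] vanishes_onD(3)[OF van v y(1)] .
  qed
  show ?thesis unfolding vanishes_on_def using A B J by auto
qed

lemma kernel_tail_proj_mono:
  assumes "c0 \<le> c" "c \<le> d"
  shows "mat_kernel (tail_proj c d) \<subseteq> mat_kernel (tail_proj c0 d)"
proof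
  fix x assume "x \<in> mat_kernel (tail_proj c d)"
  then have x: "x \<in> carrier_vec d" "tail_proj c d *\<^sub>v x = 0\<^sub>v c" by (auto simp: mat_kernel_def)
  have "tail_proj c0 d *\<^sub>v x = tail_proj c0 c * tail_proj c d *\<^sub>v x"
    using tail_proj_comp[OF assms] by simp
  also have "\<dots> = tail_proj c0 c *\<^sub>v (tail_proj c d *\<^sub>v x)" using x(1) by (intro assoc_mult_mat_vec) auto
  also have "\<dots> = 0\<^sub>v c0" unfolding x(2) by auto
  finally show "x \<in> mat_kernel (tail_proj c0 d)" using x(1) by (auto simp: mat_kernel_def)
qed

lemma trunc_hom:
  assumes R: "R \<in> core_reps d c0" and c: "\<And>v. v \<in> verts Q \<Longrightarrow> c0 v \<le> c v \<and> c v \<le> d v"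
  shows "trunc d c R \<in> framed_reps Q c f" "rep_hom Q (\<lambda>v. tail_proj (c v) (d v)) R (trunc d c R)"
proof -
  note D = framed_repsD[OF core_framed[OF R]]
  have hv: "head Q e \<in> verts Q" "tail Q e \<in> verts Q" if "e \<in> arcs Q" for e using that by auto
  have Jt: "(tail_proj (c v) (d v))\<^sup>T \<in> carrier_mat (d v) (c v)" for v by simp
  show "trunc d c R \<in> framed_reps Q c f"
    unfolding framed_reps_def trunc_def mem_Collect_eq framed_rep.simps
    by (intro conjI PiE_I; simp?; intro mult_carrier_mat[OF mult_carrier_mat[OF tail_proj_carrier(1) D(1)] Jt]
        mult_carrier_mat[OF mult_carrier_mat[OF tail_proj_carrier(1) D(2)] Jt] mult_carrier_mat[OF tail_proj_carrier(1) D(3)]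
        mult_carrier_mat[OF D(4) Jt])
  have van: "vanishes_on Q d f (\<lambda>v. mat_kernel (tail_proj (c0 v) (d v))) R" using R by (simp add: core_reps_def)
  have ker: "x \<in> mat_kernel (tail_proj (c0 v) (d v))" if "v \<in> verts Q" "x \<in> mat_kernel (tail_proj (c v) (d v))" for v x
    using kernel_tail_proj_mono c that by blast
  have id: "X * (tail_proj (c v) (d v))\<^sup>T * tail_proj (c v) (d v) = X"
    if "v \<in> verts Q" "X \<in> carrier_mat n (d v)" "\<And>x. x \<in> mat_kernel (tail_proj (c v) (d v)) \<Longrightarrow> X *\<^sub>v x = 0\<^sub>v n" for X n v
  proof -
    have "X * ((tail_proj (c v) (d v))\<^sup>T * tail_proj (c v) (d v)) = X"
      by (rule mult_proj_if_vanishes_on_kernel[OF tail_proj_carrier(1) Jt tail_proj_right_inverse that(2,3)])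
         (use c that in auto)
    then show ?thesis using that(2) by (simp add: mat_assoc)
  qed
  have A: "Amap R e * (tail_proj (c (tail Q e)) (d (tail Q e)))\<^sup>T * tail_proj (c (tail Q e)) (d (tail Q e)) = Amap R e" if "e \<in> arcs Q" for e
    by (rule id[OF hv(2) D(1)]) (use that vanishes_onD(1)[OF van] ker hv in auto)
  have B: "Bmap R e * (tail_proj (c (head Q e)) (d (head Q e)))\<^sup>T * tail_proj (c (head Q e)) (d (head Q e)) = Bmap R e" if "e \<in> arcs Q" for e
    by (rule id[OF hv(1) D(2)]) (use that vanishes_onD(2)[OF van] ker hv in auto)
  have J: "jmap R v * (tail_proj (c v) (d v))\<^sup>T * tail_proj (c v) (d v) = jmap R v" if "v \<in> verts Q" for v
    by (rule id[OF that D(4)]) (use that vanishes_onD(3)[OF van] ker in auto)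
  show "rep_hom Q (\<lambda>v. tail_proj (c v) (d v)) R (trunc d c R)"
    unfolding rep_hom_def trunc_def framed_rep.simps
  proof (intro conjI ballI)
    fix e assume e: "e \<in> arcs Q"
    show "tail_proj (c (head Q e)) (d (head Q e)) * Amap R e =
      (\<lambda>e\<in>arcs Q. tail_proj (c (head Q e)) (d (head Q e)) * Amap R e * (tail_proj (c (tail Q e)) (d (tail Q e)))\<^sup>T) e
        * tail_proj (c (tail Q e)) (d (tail Q e))"
      using e D(1)[OF e] A[OF e] by (simp add: mat_assoc)
    show "tail_proj (c (tail Q e)) (d (tail Q e)) * Bmap R e =
      (\<lambda>e\<in>arcs Q. tail_proj (c (tail Q e)) (d (tail Q e)) * Bmap R e * (tail_proj (c (head Q e)) (d (head Q e)))\<^sup>T) e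
        * tail_proj (c (head Q e)) (d (head Q e))"
      using e D(2)[OF e] B[OF e] by (simp add: mat_assoc)
  qed (use J in auto)
qed

text \<open>Stability and the moment map equation are invariant under any change of basis, the vanishing
  condition under those that preserve the kernel.\<close>
lemma core_act:
  assumes R: "R \<in> core_reps d c" and cd: "\<And>v. v \<in> verts Q \<Longrightarrow> c v \<le> d v"
    and h: "\<And>v. v \<in> verts Q \<Longrightarrow> h v \<in> carrier (GL (d v)) \<and> preserves_head (d v - c v) (h v)"
  shows "rep_act Q d h R \<in> core_reps d c"
proof -
  have hG: "h v \<in> carrier (GL (d v))" if "v \<in> verts Q" for v using h that by blast
  note a = rep_act_framed[OF core_framed[OF R] hG] rep_act_stable_moment[OF core_framed[OF R] hG]
  have "vanishes_on Q d f (\<lambda>v. mat_kernel (tail_proj (c v) (d v))) (rep_act Q d h R)"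
  proof (rule vanishes_on_transport[OF core_framed[OF R] a(1) _ a(2)])
    show "h v \<in> carrier_mat (d v) (d v)" if "v \<in> verts Q" for v using hG[OF that] by (rule GL_carrier)
    show "vanishes_on Q d f (\<lambda>v. mat_kernel (tail_proj (c v) (d v))) R" using R by (simp add: core_reps_def)
    fix v x assume v: "v \<in> verts Q" and "x \<in> mat_kernel (tail_proj (c v) (d v))"
    then have x: "x \<in> carrier_vec (d v)" "tail_proj (c v) (d v) *\<^sub>v x = 0\<^sub>v (c v)" by (auto simp: mat_kernel_def)
    let ?J = "tail_proj (c v) (d v)" and ?k = "minv (d v) (h v)"
    note k = minv[OF hG[OF v]]
    have "preserves_head (d v - c v) ?k" using tail_block_GL(2)[OF cd[OF v] hG[OF v]] h v by blast
    then have eq: "?J * ?k = ?J * ?k * ?J\<^sup>T * ?J" using preserves_head_iff_tail[OF cd[OF v] k(2)] by simp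
    have "?J *\<^sub>v (?k *\<^sub>v x) = ?J * ?k *\<^sub>v x" using k x by (intro assoc_mult_mat_vec[symmetric]) auto
    also have "\<dots> = ?J * ?k * ?J\<^sup>T * ?J *\<^sub>v x" using eq by simp
    also have "\<dots> = ?J * ?k * ?J\<^sup>T *\<^sub>v (?J *\<^sub>v x)" using k x by (intro assoc_mult_mat_vec) auto
    also have "\<dots> = 0\<^sub>v (c v)"
    proof -
      have "?J * ?k * ?J\<^sup>T \<in> carrier_mat (c v) (c v)" using k by auto
      then show ?thesis unfolding x(2) by auto
    qed
    finally have "?k *\<^sub>v x \<in> mat_kernel ?J" using k x by (auto simp: mat_kernel_def)
    moreover have "h v *\<^sub>v (?k *\<^sub>v x) = h v * ?k *\<^sub>v x"
      using k x GL_carrier[OF hG[OF v]] by (intro assoc_mult_mat_vec[symmetric]) auto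
    then have "x = h v *\<^sub>v (?k *\<^sub>v x)" using k x by simp
    moreover have "?k *\<^sub>v x \<in> carrier_vec (d v)" using k x by auto
    ultimately show "\<exists>y\<in>mat_kernel ?J. y \<in> carrier_vec (d v) \<and> x = h v *\<^sub>v y" by blast
  qed
  then show ?thesis using R a by (simp add: core_reps_def)
qed

lemma trunc_refl:
  assumes "R \<in> core_reps d c" "\<And>v. v \<in> verts Q \<Longrightarrow> c v \<le> d v"
  shows "trunc d d R = R"
proof -
  have t: "trunc d d R \<in> framed_reps Q d f" "rep_hom Q (\<lambda>v. tail_proj (d v) (d v)) R (trunc d d R)"
    using trunc_hom[OF assms(1), of d] assms(2) by auto
  have "rep_hom Q (\<lambda>v. 1\<^sub>m (d v)) R (trunc d d R)" using t(2) by (simp add: tail_proj_refl)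
  from rep_hom_one_eq[OF core_framed[OF assms(1)] t(1) this] show ?thesis by simp
qed

lemma parabolic_data_iff:
  "x \<in> parabolic_data Q l d f \<longleftrightarrow>
     fst x \<in> extensional {..l} \<and> snd x \<in> extensional {..<l} \<and> (\<forall>m<l. snd x m \<in> extensional (verts Q)) \<and>
     (\<forall>m\<le>l. fst x m \<in> framed_reps Q (d m) f \<and> stable Q (d m) f (fst x m) \<and> moment_map_eq Q (d m) (fst x m)) \<and>
     (\<forall>m<l. \<forall>v\<in>verts Q. snd x m v \<in> carrier_mat (d (Suc m) v) (d m v)) \<and>
     (\<forall>m<l. rep_hom Q (snd x m) (fst x m) (fst x (Suc m))) \<and>
     vanishes_on Q (d 0) f (\<lambda>v. mat_kernel (comp_pi (d 0 v) (snd x) v l)) (fst x 0)"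
  unfolding parabolic_data_def rep_hom_def vanishes_on_def
  by (cases x) (simp add: PiE_iff Ball_def, blast)

end

locale decreasing_path = framed_quiver Q f for Q :: "('v, 'e) pre_digraph" and f +
  fixes l :: nat and ds :: "nat \<Rightarrow> 'v \<Rightarrow> nat"
  assumes step_le: "m < l \<Longrightarrow> v \<in> verts Q \<Longrightarrow> ds (Suc m) v \<le> ds m v"
begin

abbreviation "data \<equiv> parabolic_data Q l ds f"
abbreviation "core \<equiv> core_reps (ds 0) (ds l)"

definition norm_pt :: "('v, 'e) framed_rep \<Rightarrow> ('v, 'e) parabolic" where
  "norm_pt R = (\<lambda>m\<in>{..l}. trunc (ds 0) (ds m) R, \<lambda>m\<in>{..<l}. \<lambda>v\<in>verts Q. tail_proj (ds (Suc m) v) (ds m v))"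

lemma dims_antimono: "\<lbrakk>m \<le> m'; m' \<le> l; v \<in> verts Q\<rbrakk> \<Longrightarrow> ds m' v \<le> ds m v"
  by (induction m' rule: dec_induct) (use step_le in \<open>auto simp: Suc_le_eq intro: order_trans\<close>)

lemma dims_between: "\<lbrakk>m \<le> l; v \<in> verts Q\<rbrakk> \<Longrightarrow> ds l v \<le> ds m v \<and> ds m v \<le> ds 0 v"
  using dims_antimono[of m l v] dims_antimono[of 0 m v] by auto

lemma dataD:
  assumes "x \<in> data"
  shows "fst x \<in> extensional {..l}" "snd x \<in> extensional {..<l}" "m < l \<Longrightarrow> snd x m \<in> extensional (verts Q)"
    "m \<le> l \<Longrightarrow> fst x m \<in> framed_reps Q (ds m) f" "m \<le> l \<Longrightarrow> stable Q (ds m) f (fst x m)"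
    "m \<le> l \<Longrightarrow> moment_map_eq Q (ds m) (fst x m)"
    "m < l \<Longrightarrow> v \<in> verts Q \<Longrightarrow> snd x m v \<in> carrier_mat (ds (Suc m) v) (ds m v)"
    "m < l \<Longrightarrow> rep_hom Q (snd x m) (fst x m) (fst x (Suc m))"
    "vanishes_on Q (ds 0) f (\<lambda>v. mat_kernel (comp_pi (ds 0 v) (snd x) v l)) (fst x 0)"
  using assms unfolding parabolic_data_iff by blast+

lemma data_surj:
  assumes x: "x \<in> data" and m: "m < l" and v: "v \<in> verts Q"
  shows "right_invertible (ds (Suc m) v) (ds m v) (snd x m v)"
  by (rule stable_hom_surj[OF dataD(4)[OF x] dataD(4)[OF x] dataD(7)[OF x m] dataD(8)[OF x m] dataD(5)[OF x] v])
     (use m in auto)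

lemma comp_pi_carrier:
  assumes x: "x \<in> data" and m: "m \<le> l" and v: "v \<in> verts Q"
  shows "comp_pi (ds 0 v) (snd x) v m \<in> carrier_mat (ds m v) (ds 0 v)"
  using m by (induction m) (use dataD(7)[OF x _ v] in \<open>auto simp: Suc_le_eq intro!: mult_carrier_mat\<close>)

lemma comp_pi_hom:
  assumes x: "x \<in> data" and m: "m \<le> l"
  shows "rep_hom Q (\<lambda>v. comp_pi (ds 0 v) (snd x) v m) (fst x 0) (fst x m)"
  using m
proof (induction m)
  case 0
  then show ?case using rep_hom_one[OF dataD(4)[OF x, of 0]] by simp
next
  case (Suc m)
  have "rep_hom Q (\<lambda>v. snd x m v * comp_pi (ds 0 v) (snd x) v m) (fst x 0) (fst x (Suc m))"
    by (rule rep_hom_comp[OF dataD(4)[OF x] dataD(4)[OF x, of m] dataD(4)[OF x]])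
       (use Suc dataD(7,8)[OF x] comp_pi_carrier[OF x] in auto)
  then show ?case by simp
qed

lemma comp_pi_tail_proj:
  assumes "\<And>m. m < l \<Longrightarrow> \<pi> m v = tail_proj (ds (Suc m) v) (ds m v)" "v \<in> verts Q" "m \<le> l"
  shows "comp_pi (ds 0 v) \<pi> v m = tail_proj (ds m v) (ds 0 v)"
  using assms(3)
proof (induction m)
  case 0
  then show ?case by (simp add: tail_proj_refl)
next
  case (Suc m)
  then show ?case using assms(1)[of m] tail_proj_comp step_le[of m v] dims_between[of m v] assms(2) by simp
qed

text \<open>If all maps \<open>\<pi>\<close> are the standard projections, the whole point can be recovered from its first
  representation.\<close>

lemma normal_form:
  assumes y: "y \<in> data" and pi: "\<And>m v. m < l \<Longrightarrow> v \<in> verts Q \<Longrightarrow> snd y m v = tail_proj (ds (Suc m) v) (ds m v)"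
  shows "fst y 0 \<in> core" "norm_pt (fst y 0) = y"
proof -
  have cp: "comp_pi (ds 0 v) (snd y) v m = tail_proj (ds m v) (ds 0 v)" if "v \<in> verts Q" "m \<le> l" for v m
    by (rule comp_pi_tail_proj) (use pi that in auto)
  show core: "fst y 0 \<in> core"
    unfolding core_reps_def using dataD(4-6)[OF y, of 0] dataD(9)[OF y] cp by (auto simp: vanishes_on_def)
  have t: "trunc (ds 0) (ds m) (fst y 0) = fst y m" if m: "m \<le> l" for m
  proof (rule rep_hom_unique[OF core_framed[OF core] trunc_hom(1)[OF core] dataD(4)[OF y m] _ trunc_hom(2)[OF core]])
    show "ds l v \<le> ds m v \<and> ds m v \<le> ds 0 v" if "v \<in> verts Q" for v using dims_between m that by blast
    then show "right_invertible (ds m v) (ds 0 v) (tail_proj (ds m v) (ds 0 v))" if "v \<in> verts Q" for v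
      using that right_invertible_tail_proj by blast
    show "rep_hom Q (\<lambda>v. tail_proj (ds m v) (ds 0 v)) (fst y 0) (fst y m)"
      using comp_pi_hom[OF y m] by (rule rep_hom_cong[THEN iffD1, rotated]) (use cp m in auto)
    show "ds l v \<le> ds m v \<and> ds m v \<le> ds 0 v" if "v \<in> verts Q" for v using dims_between m that by blast
  qed
  have "(\<lambda>m\<in>{..l}. trunc (ds 0) (ds m) (fst y 0)) = fst y"
    by (rule extensionalityI[of _ "{..l}"]) (use dataD(1)[OF y] t in auto)
  moreover have "(\<lambda>m\<in>{..<l}. \<lambda>v\<in>verts Q. tail_proj (ds (Suc m) v) (ds m v)) = snd y"
  proof (rule extensionalityI[of _ "{..<l}"])
    fix m assume m: "m \<in> {..<l}"
    have "(\<lambda>v\<in>verts Q. tail_proj (ds (Suc m) v) (ds m v)) = snd y m"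
      by (rule extensionalityI[of _ "verts Q"]) (use dataD(3)[OF y] pi m in auto)
    then show "(\<lambda>m\<in>{..<l}. \<lambda>v\<in>verts Q. tail_proj (ds (Suc m) v) (ds m v)) m = snd y m" using m by simp
  qed (use dataD(2)[OF y] in auto)
  ultimately show "norm_pt (fst y 0) = y" unfolding norm_pt_def by (cases y) simp
qed

lemma core_trunc:
  assumes R: "R \<in> core" and m: "m \<le> l"
  shows "trunc (ds 0) (ds m) R \<in> framed_reps Q (ds m) f"
    "rep_hom Q (\<lambda>v. tail_proj (ds m v) (ds 0 v)) R (trunc (ds 0) (ds m) R)"
  by (rule trunc_hom[OF R]; use dims_between m in blast)+

text \<open>All representations are quotients of the first one and inherit its properties; the maps between them
  are morphisms since they are so after composition with the projection from the first one.\<close>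
lemma norm_pt_data:
  assumes R: "R \<in> core"
  shows "norm_pt R \<in> data"
  unfolding parabolic_data_iff
proof (intro conjI allI impI ballI)
  have rinv: "right_invertible (ds m v) (ds 0 v) (tail_proj (ds m v) (ds 0 v))" if "m \<le> l" "v \<in> verts Q" for m v
    using right_invertible_tail_proj dims_between that by blast
  fix m assume m: "m \<le> l"
  show "fst (norm_pt R) m \<in> framed_reps Q (ds m) f" using core_trunc[OF R m] m by (simp add: norm_pt_def)
  show "stable Q (ds m) f (fst (norm_pt R) m)"
    using stable_quotient[OF core_framed[OF R] core_trunc(1)[OF R m] rinv[OF m] core_trunc(2)[OF R m]] R m
    by (simp add: norm_pt_def core_reps_def)
  show "moment_map_eq Q (ds m) (fst (norm_pt R) m)"
    using moment_map_quotient[OF core_framed[OF R] core_trunc(1)[OF R m] rinv[OF m] core_trunc(2)[OF R m]] R m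
    by (simp add: norm_pt_def core_reps_def)
next
  fix m assume m: "m < l"
  then have m': "m \<le> l" "Suc m \<le> l" by auto
  have "rep_hom Q (\<lambda>v. tail_proj (ds (Suc m) v) (ds m v)) (trunc (ds 0) (ds m) R) (trunc (ds 0) (ds (Suc m)) R)"
  proof (rule rep_hom_cancel[OF core_framed[OF R] core_trunc(1)[OF R m'(1)] core_trunc(1)[OF R m'(2)] _ _ core_trunc(2)[OF R m'(1)]])
    show "right_invertible (ds m v) (ds 0 v) (tail_proj (ds m v) (ds 0 v))" if "v \<in> verts Q" for v
      using right_invertible_tail_proj dims_between that m' by blast
    show "rep_hom Q (\<lambda>v. tail_proj (ds (Suc m) v) (ds m v) * tail_proj (ds m v) (ds 0 v)) R (trunc (ds 0) (ds (Suc m)) R)"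
      using core_trunc(2)[OF R m'(2)]
      by (rule rep_hom_cong[THEN iffD1, rotated]) (use tail_proj_comp step_le[OF m] dims_between[OF m'(1)] in auto)
  qed auto
  then show "rep_hom Q (snd (norm_pt R) m) (fst (norm_pt R) m) (fst (norm_pt R) (Suc m))"
    using m m' rep_hom_cong[of "snd (norm_pt R) m" "\<lambda>v. tail_proj (ds (Suc m) v) (ds m v)"]
    by (simp add: norm_pt_def)
next
  have "comp_pi (ds 0 v) (snd (norm_pt R)) v l = tail_proj (ds l v) (ds 0 v)" if "v \<in> verts Q" for v
    by (rule comp_pi_tail_proj) (use that in \<open>auto simp: norm_pt_def\<close>)
  moreover have "fst (norm_pt R) 0 = R"
    using trunc_refl[OF R] dims_between[of l] by (simp add: norm_pt_def)
  ultimately show "vanishes_on Q (ds 0) f (\<lambda>v. mat_kernel (comp_pi (ds 0 v) (snd (norm_pt R)) v l)) (fst (norm_pt R) 0)"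
    using R by (auto simp: core_reps_def vanishes_on_def)
qed (auto simp: norm_pt_def)

lemma norm_pt_simps:
  assumes "R \<in> core"
  shows "fst (norm_pt R) 0 = R" "m \<le> l \<Longrightarrow> fst (norm_pt R) m = trunc (ds 0) (ds m) R"
    "m < l \<Longrightarrow> v \<in> verts Q \<Longrightarrow> snd (norm_pt R) m v = tail_proj (ds (Suc m) v) (ds m v)"
  using trunc_refl[OF assms] dims_between[of l] by (auto simp: norm_pt_def)

subsection \<open>Orbits\<close>

abbreviation "pgroup \<equiv> parabolic_group Q l ds"
abbreviation "pact \<equiv> parabolic_act Q l ds"
abbreviation "porbit \<equiv> parabolic_orbit Q l ds"

lemma pgroup_carrier:
  "g \<in> carrier pgroup \<longleftrightarrow> g \<in> extensional {..l} \<and> (\<forall>m\<le>l. g m \<in> extensional (verts Q) \<and> (\<forall>v\<in>verts Q. g m v \<in> carrier (GL (ds m v))))"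
  by (simp only: parabolic_group_def carrier_product_group PiE_iff) blast

text \<open>Points are in the same orbit iff there is an isomorphism between them. Working with its intertwining
  equations avoids the inverse matrices in the definition of the action.\<close>
definition phom :: "(nat \<Rightarrow> 'v \<Rightarrow> complex mat) \<Rightarrow> ('v, 'e) parabolic \<Rightarrow> ('v, 'e) parabolic \<Rightarrow> bool" where
  "phom g x y \<longleftrightarrow> (\<forall>m\<le>l. rep_hom Q (g m) (fst x m) (fst y m)) \<and>
     (\<forall>m<l. \<forall>v\<in>verts Q. g (Suc m) v * snd x m v = snd y m v * g m v)"

lemma comp_pi_intertwine:
  assumes \<pi>: "\<And>m. m < l \<Longrightarrow> \<pi> m v \<in> carrier_mat (ds (Suc m) v) (ds m v)"
    and \<sigma>: "\<And>m. m < l \<Longrightarrow> \<sigma> m v \<in> carrier_mat (ds (Suc m) v) (ds m v)"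
    and g: "\<And>m. m \<le> l \<Longrightarrow> g m v \<in> carrier_mat (ds m v) (ds m v)"
    and eq: "\<And>m. m < l \<Longrightarrow> g (Suc m) v * \<pi> m v = \<sigma> m v * g m v" and m: "m \<le> l"
  shows "comp_pi (ds 0 v) \<sigma> v m * g 0 v = g m v * comp_pi (ds 0 v) \<pi> v m \<and>
      comp_pi (ds 0 v) \<sigma> v m \<in> carrier_mat (ds m v) (ds 0 v)"
proof -
  have "comp_pi (ds 0 v) \<sigma> v m * g 0 v = g m v * comp_pi (ds 0 v) \<pi> v m \<and>
      comp_pi (ds 0 v) \<sigma> v m \<in> carrier_mat (ds m v) (ds 0 v) \<and> comp_pi (ds 0 v) \<pi> v m \<in> carrier_mat (ds m v) (ds 0 v)"
    using m
  proof (induction m)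
    case 0
    then show ?case using g[of 0] by simp
  next
    case (Suc m)
    let ?c = "comp_pi (ds 0 v) \<sigma> v m" and ?c' = "comp_pi (ds 0 v) \<pi> v m"
    have m: "m < l" "m \<le> l" using Suc by auto
    have IH: "?c * g 0 v = g m v * ?c'" "?c \<in> carrier_mat (ds m v) (ds 0 v)" "?c' \<in> carrier_mat (ds m v) (ds 0 v)"
      using Suc m by auto
    note dims = carrier_matD[OF \<pi>[OF m(1)]] carrier_matD[OF \<sigma>[OF m(1)]] carrier_matD[OF IH(2)] carrier_matD[OF IH(3)]
      carrier_matD[OF g[OF m(2)]] carrier_matD[OF g[OF Suc.prems]] carrier_matD[OF g[OF le0]]
    have "\<sigma> m v * ?c * g 0 v = \<sigma> m v * (g m v * ?c')"
      using dims IH(1) by (simp add: mat_assoc)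
    also have "\<dots> = g (Suc m) v * \<pi> m v * ?c'"
      unfolding eq[OF m(1)] using dims by (simp add: mat_assoc)
    also have "\<dots> = g (Suc m) v * (\<pi> m v * ?c')" using dims by (simp add: mat_assoc)
    finally show ?case using mult_carrier_mat[OF \<sigma>[OF m(1)] IH(2)] mult_carrier_mat[OF \<pi>[OF m(1)] IH(3)] by simp
  qed
  then show ?thesis by blast
qed

lemma pact_data:
  assumes x: "x \<in> data" and g: "g \<in> carrier pgroup"
  shows "pact g x \<in> data" "phom g x (pact g x)"
proof -
  have G: "g m v \<in> carrier (GL (ds m v))" if "m \<le> l" "v \<in> verts Q" for m v using g that by (simp add: pgroup_carrier)
  have Gc: "g m v \<in> carrier_mat (ds m v) (ds m v)" "minv (ds m v) (g m v) \<in> carrier_mat (ds m v) (ds m v)"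
    if "m \<le> l" "v \<in> verts Q" for m v using G[OF that] GL_carrier minv by auto
  have f: "fst (pact g x) m = rep_act Q (ds m) (g m) (fst x m)" if "m \<le> l" for m
    using that by (simp add: parabolic_act_def)
  have s: "snd (pact g x) m v = g (Suc m) v * snd x m v * minv (ds m v) (g m v)" if "m < l" "v \<in> verts Q" for m v
    using that by (simp add: parabolic_act_def)
  have F: "fst (pact g x) m \<in> framed_reps Q (ds m) f" "rep_hom Q (g m) (fst x m) (fst (pact g x) m)" if "m \<le> l" for m
    unfolding f[OF that] by (rule rep_act_framed[OF dataD(4)[OF x that] G[OF that]]; assumption)+
  have sc: "snd (pact g x) m v \<in> carrier_mat (ds (Suc m) v) (ds m v)" if "m < l" "v \<in> verts Q" for m v
    unfolding s[OF that] using that Gc[of m v] Gc[of "Suc m" v] dataD(7)[OF x that] by auto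
  have S: "g (Suc m) v * snd x m v = snd (pact g x) m v * g m v" if "m < l" "v \<in> verts Q" for m v
    unfolding s[OF that] using that Gc[of m v] Gc[of "Suc m" v] dataD(7)[OF x that] minv(4)[OF G[of m v]]
    by (simp add: mat_assoc)
  show ph: "phom g x (pact g x)" unfolding phom_def using F S by blast
  have comp: "comp_pi (ds 0 v) (snd (pact g x)) v m * g 0 v = g m v * comp_pi (ds 0 v) (snd x) v m \<and>
      comp_pi (ds 0 v) (snd (pact g x)) v m \<in> carrier_mat (ds m v) (ds 0 v)"
    if "m \<le> l" "v \<in> verts Q" for m v
    by (rule comp_pi_intertwine) (use that dataD(7)[OF x] sc Gc S in auto)
  show "pact g x \<in> data"
    unfolding parabolic_data_iff
  proof (intro conjI allI impI ballI)
    fix m assume m: "m \<le> l"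
    show "fst (pact g x) m \<in> framed_reps Q (ds m) f" by (rule F[OF m])
    show "stable Q (ds m) f (fst (pact g x) m)" "moment_map_eq Q (ds m) (fst (pact g x) m)"
      unfolding f[OF m] using rep_act_stable_moment[OF dataD(4)[OF x m] G[OF m]] dataD(5,6)[OF x m] by auto
  next
    fix m assume m: "m < l"
    show "snd (pact g x) m v \<in> carrier_mat (ds (Suc m) v) (ds m v)" if "v \<in> verts Q" for v by (rule sc[OF m that])
    have m': "m \<le> l" "Suc m \<le> l" using m by auto
    show "rep_hom Q (snd (pact g x) m) (fst (pact g x) m) (fst (pact g x) (Suc m))"
    proof (rule rep_hom_cancel[OF dataD(4)[OF x m'(1)] F(1)[OF m'(1)] F(1)[OF m'(2)] _ _ F(2)[OF m'(1)]])
      show "right_invertible (ds m v) (ds m v) (g m v)" if "v \<in> verts Q" for v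
        by (rule right_invertible_GL[OF G[OF m'(1) that]])
      have "rep_hom Q (\<lambda>v. g (Suc m) v * snd x m v) (fst x m) (fst (pact g x) (Suc m))"
        by (rule rep_hom_comp[OF dataD(4)[OF x m'(1)] dataD(4)[OF x m'(2)] F(1)[OF m'(2)] dataD(7)[OF x m] Gc(1)[OF m'(2)] dataD(8)[OF x m] F(2)[OF m'(2)]])
      then show "rep_hom Q (\<lambda>v. snd (pact g x) m v * g m v) (fst x m) (fst (pact g x) (Suc m))"
        by (rule rep_hom_cong[THEN iffD1, rotated]) (use S[OF m] in auto)
    qed (rule sc[OF m])
  next
    show "vanishes_on Q (ds 0) f (\<lambda>v. mat_kernel (comp_pi (ds 0 v) (snd (pact g x)) v l)) (fst (pact g x) 0)"
    proof (rule vanishes_on_transport[OF dataD(4)[OF x le0] F(1)[OF le0] Gc(1)[OF le0] F(2)[OF le0] dataD(9)[OF x]])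
      fix v y assume v: "v \<in> verts Q" and "y \<in> mat_kernel (comp_pi (ds 0 v) (snd (pact g x)) v l)"
      then have y: "y \<in> carrier_vec (ds 0 v)" "comp_pi (ds 0 v) (snd (pact g x)) v l *\<^sub>v y = 0\<^sub>v (ds l v)"
        using comp[OF order_refl v] by (auto simp: mat_kernel_def)
      let ?c = "comp_pi (ds 0 v) (snd (pact g x)) v l" and ?c' = "comp_pi (ds 0 v) (snd x) v l" and ?k = "minv (ds 0 v) (g 0 v)"
      note k = minv[OF G[OF le0 v]] and kl = minv[OF G[OF order_refl v]]
      have c': "?c' \<in> carrier_mat (ds l v) (ds 0 v)" by (rule comp_pi_carrier[OF x order_refl v])
      have z: "?k *\<^sub>v y \<in> carrier_vec (ds 0 v)" using k y by auto
      have yk: "g 0 v *\<^sub>v (?k *\<^sub>v y) = y"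
        using assoc_mult_mat_vec[OF Gc(1)[OF le0 v] k(2) y(1)] k(3) y by simp
      have "g l v *\<^sub>v (?c' *\<^sub>v (?k *\<^sub>v y)) = g l v * ?c' *\<^sub>v (?k *\<^sub>v y)"
        by (rule assoc_mult_mat_vec[OF Gc(1)[OF order_refl v] c' z, symmetric])
      also have "\<dots> = ?c * g 0 v *\<^sub>v (?k *\<^sub>v y)" using comp[OF order_refl v] by simp
      also have "\<dots> = ?c *\<^sub>v (g 0 v *\<^sub>v (?k *\<^sub>v y))"
        by (rule assoc_mult_mat_vec[OF _ Gc(1)[OF le0 v] z]) (use comp[OF order_refl v] in blast)
      finally have "g l v *\<^sub>v (?c' *\<^sub>v (?k *\<^sub>v y)) = 0\<^sub>v (ds l v)" unfolding yk y(2) .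
      then have "minv (ds l v) (g l v) *\<^sub>v (g l v *\<^sub>v (?c' *\<^sub>v (?k *\<^sub>v y))) = 0\<^sub>v (ds l v)"
        using kl(2) by auto
      moreover have "minv (ds l v) (g l v) *\<^sub>v (g l v *\<^sub>v (?c' *\<^sub>v (?k *\<^sub>v y))) = minv (ds l v) (g l v) * g l v *\<^sub>v (?c' *\<^sub>v (?k *\<^sub>v y))"
        by (rule assoc_mult_mat_vec[OF kl(2) Gc(1)[OF order_refl v], symmetric]) (use c' z in auto)
      ultimately have "?c' *\<^sub>v (?k *\<^sub>v y) = 0\<^sub>v (ds l v)" using kl(4) c' z by simp
      then have "?k *\<^sub>v y \<in> mat_kernel ?c'" using z c' by (auto simp: mat_kernel_def)
      then show "\<exists>z\<in>mat_kernel ?c'. z \<in> carrier_vec (ds 0 v) \<and> y = g 0 v *\<^sub>v z"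
        using z yk by metis
    qed
  qed (auto simp: parabolic_act_def)
qed

lemma pact_eqI:
  assumes x: "x \<in> data" and g: "g \<in> carrier pgroup" and y: "y \<in> data" and h: "phom g x y"
  shows "y = pact g x"
proof -
  have G: "g m v \<in> carrier (GL (ds m v))" if "m \<le> l" "v \<in> verts Q" for m v using g that by (simp add: pgroup_carrier)
  note a = pact_data[OF x g]
  have f: "fst y m = fst (pact g x) m" if "m \<le> l" for m
    by (rule rep_hom_unique[OF dataD(4)[OF x that] dataD(4)[OF y that] dataD(4)[OF a(1) that] right_invertible_GL[OF G[OF that]]])
       (use h a(2) that in \<open>auto simp: phom_def\<close>)
  have s: "snd y m v = snd (pact g x) m v" if "m < l" "v \<in> verts Q" for m v
    by (rule right_invertible_cancel[OF right_invertible_GL[OF G[of m v]] dataD(7)[OF y that] dataD(7)[OF a(1) that]])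
       (use h a(2) that in \<open>auto simp: phom_def\<close>)
  have "fst y = fst (pact g x)"
    by (rule extensionalityI[OF dataD(1)[OF y] dataD(1)[OF a(1)]]) (use f in auto)
  moreover have "snd y = snd (pact g x)"
  proof (rule extensionalityI[OF dataD(2)[OF y] dataD(2)[OF a(1)]])
    fix m assume "m \<in> {..<l}"
    then show "snd y m = snd (pact g x) m"
      by (intro extensionalityI[OF dataD(3)[OF y] dataD(3)[OF a(1)]]) (use s in auto)
  qed
  ultimately show ?thesis by (simp add: prod_eq_iff)
qed

lemma group_pgroup: "group pgroup"
  unfolding parabolic_group_def by (intro product_group group_GL)

lemma phom_comp:
  assumes x: "x \<in> data" and y: "y \<in> data" and z: "z \<in> data" and g: "g \<in> carrier pgroup" and h: "h \<in> carrier pgroup"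
    and xy: "phom h x y" and yz: "phom g y z"
  shows "phom (\<lambda>m v. g m v * h m v) x z"
proof -
  have G: "g m v \<in> carrier_mat (ds m v) (ds m v)" "h m v \<in> carrier_mat (ds m v) (ds m v)" if "m \<le> l" "v \<in> verts Q" for m v
    using g h that GL_carrier by (auto simp: pgroup_carrier)
  show ?thesis
    unfolding phom_def
  proof (intro conjI allI impI ballI)
    fix m assume m: "m \<le> l"
    show "rep_hom Q (\<lambda>v. g m v * h m v) (fst x m) (fst z m)"
      by (rule rep_hom_comp[OF dataD(4)[OF x m] dataD(4)[OF y m] dataD(4)[OF z m] G(2)[OF m] G(1)[OF m]])
         (use xy yz m in \<open>auto simp: phom_def\<close>)
  next
    fix m v assume m: "m < l" and v: "v \<in> verts Q"
    then have m': "m \<le> l" "Suc m \<le> l" by auto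
    note dims = G[OF m'(1) v, THEN carrier_matD(1)] G[OF m'(1) v, THEN carrier_matD(2)]
      G[OF m'(2) v, THEN carrier_matD(1)] G[OF m'(2) v, THEN carrier_matD(2)]
      carrier_matD[OF dataD(7)[OF x m v]] carrier_matD[OF dataD(7)[OF y m v]] carrier_matD[OF dataD(7)[OF z m v]]
    have 1: "h (Suc m) v * snd x m v = snd y m v * h m v" and 2: "g (Suc m) v * snd y m v = snd z m v * g m v"
      using xy yz m v by (auto simp: phom_def)
    have "g (Suc m) v * h (Suc m) v * snd x m v = g (Suc m) v * (snd y m v * h m v)"
      unfolding 1[symmetric] using dims by (simp add: mat_assoc)
    also have "\<dots> = g (Suc m) v * snd y m v * h m v" using dims by (simp add: mat_assoc)
    also have "\<dots> = snd z m v * (g m v * h m v)" unfolding 2 using dims by (simp add: mat_assoc)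
    finally show "g (Suc m) v * h (Suc m) v * snd x m v = snd z m v * (g m v * h m v)" .
  qed
qed

lemma phom_cong:
  assumes "\<And>m v. m \<le> l \<Longrightarrow> v \<in> verts Q \<Longrightarrow> g m v = h m v" "phom g x y"
  shows "phom h x y"
  using assms unfolding phom_def
  by (auto simp: Suc_le_eq cong: rep_hom_cong)

lemma pact_mult:
  assumes x: "x \<in> data" and g: "g \<in> carrier pgroup" and h: "h \<in> carrier pgroup"
  shows "pact g (pact h x) = pact (g \<otimes>\<^bsub>pgroup\<^esub> h) x"
proof -
  interpret group pgroup by (rule group_pgroup)
  note hx = pact_data[OF x h]
  note ghx = pact_data[OF hx(1) g]
  have "phom (g \<otimes>\<^bsub>pgroup\<^esub> h) x (pact g (pact h x))"
    by (rule phom_cong[OF _ phom_comp[OF x hx(1) ghx(1) g h hx(2) ghx(2)]])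
       (simp add: parabolic_group_def mult_GL)
  then show ?thesis using pact_eqI[OF x m_closed[OF g h] ghx(1)] by simp
qed

lemma porbit_iff: "y \<in> porbit x \<longleftrightarrow> (\<exists>g\<in>carrier pgroup. y = pact g x)"
  by (auto simp: orbit_def)

lemma porbit_self:
  assumes x: "x \<in> data"
  shows "x \<in> porbit x"
proof -
  interpret group pgroup by (rule group_pgroup)
  have "phom (\<lambda>m v. 1\<^sub>m (ds m v)) x x"
    unfolding phom_def using rep_hom_one[OF dataD(4)[OF x]] dataD(7)[OF x] left_mult_one_mat right_mult_one_mat
    by (metis order_refl)
  then have "phom \<one>\<^bsub>pgroup\<^esub> x x"
    by (rule phom_cong[rotated]) (simp add: parabolic_group_def one_GL)
  then have "x = pact \<one>\<^bsub>pgroup\<^esub> x" by (rule pact_eqI[OF x one_closed x])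
  then show ?thesis unfolding porbit_iff using one_closed by blast
qed

lemma porbit_pact:
  assumes x: "x \<in> data" and g: "g \<in> carrier pgroup"
  shows "porbit (pact g x) = porbit x"
proof -
  interpret group pgroup by (rule group_pgroup)
  show ?thesis
  proof (intro subset_antisym subsetI)
    fix y assume "y \<in> porbit (pact g x)"
    then obtain h where "h \<in> carrier pgroup" "y = pact h (pact g x)" by (auto simp: porbit_iff)
    then show "y \<in> porbit x" using pact_mult[OF x _ g] g porbit_iff by (metis m_closed)
  next
    fix y assume "y \<in> porbit x"
    then obtain h where h: "h \<in> carrier pgroup" "y = pact h x" by (auto simp: porbit_iff)
    have "pact (h \<otimes>\<^bsub>pgroup\<^esub> inv\<^bsub>pgroup\<^esub> g) (pact g x) = pact (h \<otimes>\<^bsub>pgroup\<^esub> inv\<^bsub>pgroup\<^esub> g \<otimes>\<^bsub>pgroup\<^esub> g) x"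
      using h g by (intro pact_mult[OF x]) auto
    also have "\<dots> = y" using h g by (simp add: m_assoc)
    finally show "y \<in> porbit (pact g x)" using h g porbit_iff by (metis inv_closed m_closed)
  qed
qed

text \<open>Two normal forms are in the same orbit iff their representations differ by a change of basis that
  preserves the kernels of all projections.\<close>

lemma porbit_norm_pt_eq_iff:
  assumes R: "R \<in> core" and R': "R' \<in> core"
  shows "porbit (norm_pt R) = porbit (norm_pt R') \<longleftrightarrow>
    (\<exists>h. (\<forall>v\<in>verts Q. h v \<in> carrier (GL (ds 0 v)) \<and> (\<forall>m\<le>l. preserves_head (ds 0 v - ds m v) (h v))) \<and>
       R' = rep_act Q (ds 0) h R)"
proof
  assume "porbit (norm_pt R) = porbit (norm_pt R')"
  then have "norm_pt R' \<in> porbit (norm_pt R)" using porbit_self[OF norm_pt_data[OF R']] by simp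
  then obtain g where g: "g \<in> carrier pgroup" "norm_pt R' = pact g (norm_pt R)" by (auto simp: porbit_iff)
  then have h: "phom g (norm_pt R) (norm_pt R')" using pact_data(2)[OF norm_pt_data[OF R]] by simp
  have G: "g m v \<in> carrier (GL (ds m v))" if "m \<le> l" "v \<in> verts Q" for m v using g that by (simp add: pgroup_carrier)
  have J: "tail_proj (ds m v) (ds 0 v) * g 0 v = g m v * tail_proj (ds m v) (ds 0 v)" if "m \<le> l" "v \<in> verts Q" for m v
    using that(1)
  proof (induction m)
    case 0
    then show ?case using GL_carrier[OF G[OF le0 that(2)]] by (simp add: tail_proj_refl)
  next
    case (Suc m)
    then have m: "m < l" "m \<le> l" by auto
    have t: "tail_proj (ds (Suc m) v) (ds m v) * tail_proj (ds m v) (ds 0 v) = tail_proj (ds (Suc m) v) (ds 0 v)"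
      using tail_proj_comp step_le[OF m(1) that(2)] dims_between[OF m(2) that(2)] by blast
    note dims = carrier_matD[OF GL_carrier[OF G[OF m(2) that(2)]]] carrier_matD[OF GL_carrier[OF G[OF Suc.prems that(2)]]]
      carrier_matD[OF GL_carrier[OF G[OF le0 that(2)]]]
    have eq: "g (Suc m) v * tail_proj (ds (Suc m) v) (ds m v) = tail_proj (ds (Suc m) v) (ds m v) * g m v"
      using h m that by (auto simp: phom_def norm_pt_simps(3)[OF R] norm_pt_simps(3)[OF R'])
    have "tail_proj (ds (Suc m) v) (ds 0 v) * g 0 v =
        tail_proj (ds (Suc m) v) (ds m v) * (g m v * tail_proj (ds m v) (ds 0 v))"
      unfolding t[symmetric] using Suc dims by (simp add: mat_assoc)
    also have "\<dots> = g (Suc m) v * (tail_proj (ds (Suc m) v) (ds m v) * tail_proj (ds m v) (ds 0 v))"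
      using dims eq by (simp flip: mat_assoc)
    finally show ?case unfolding t .
  qed
  have "rep_hom Q (g 0) R R'"
    using h norm_pt_simps(1)[OF R] norm_pt_simps(1)[OF R'] unfolding phom_def by (metis le0)
  then have "R' = rep_act Q (ds 0) (g 0) R"
    using rep_act_eqI[OF core_framed[OF R] _ core_framed[OF R']] G[OF le0] by blast
  moreover have "preserves_head (ds 0 v - ds m v) (g 0 v)" if "m \<le> l" "v \<in> verts Q" for m v
    by (rule preserves_headI_tail[OF _ GL_carrier[OF G[OF le0 that(2)]] GL_carrier[OF G[OF that]] J[OF that]])
       (use dims_between[OF that] in simp)
  ultimately show "\<exists>h. (\<forall>v\<in>verts Q. h v \<in> carrier (GL (ds 0 v)) \<and> (\<forall>m\<le>l. preserves_head (ds 0 v - ds m v) (h v))) \<and>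
       R' = rep_act Q (ds 0) h R"
    using G[OF le0] by blast
next
  assume "\<exists>h. (\<forall>v\<in>verts Q. h v \<in> carrier (GL (ds 0 v)) \<and> (\<forall>m\<le>l. preserves_head (ds 0 v - ds m v) (h v))) \<and>
       R' = rep_act Q (ds 0) h R"
  then obtain h where h: "\<And>v. v \<in> verts Q \<Longrightarrow> h v \<in> carrier (GL (ds 0 v))"
    "\<And>v m. v \<in> verts Q \<Longrightarrow> m \<le> l \<Longrightarrow> preserves_head (ds 0 v - ds m v) (h v)" and R'_eq: "R' = rep_act Q (ds 0) h R" by blast
  define g where "g = (\<lambda>m\<in>{..l}. \<lambda>v\<in>verts Q. tail_proj (ds m v) (ds 0 v) * h v * (tail_proj (ds m v) (ds 0 v))\<^sup>T)"
  have g_eq: "g m v = tail_proj (ds m v) (ds 0 v) * h v * (tail_proj (ds m v) (ds 0 v))\<^sup>T" if "m \<le> l" "v \<in> verts Q" for m v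
    using that by (simp add: g_def)
  have G: "g m v \<in> carrier (GL (ds m v))" if "m \<le> l" "v \<in> verts Q" for m v
    unfolding g_eq[OF that] by (rule tail_block_GL(1)) (use that h dims_between in auto)
  have g: "g \<in> carrier pgroup" unfolding pgroup_carrier using G by (auto simp: g_def)
  have J: "tail_proj (ds m v) (ds 0 v) * h v = g m v * tail_proj (ds m v) (ds 0 v)" if "m \<le> l" "v \<in> verts Q" for m v
    unfolding g_eq[OF that]
    using preserves_head_iff_tail[of "ds m v" "ds 0 v" "h v"] h[OF that(2)] that dims_between[OF that] GL_carrier by blast
  have hc: "h v \<in> carrier_mat (ds 0 v) (ds 0 v)" if "v \<in> verts Q" for v using h(1)[OF that] by (rule GL_carrier)
  have hR: "rep_hom Q h R R'" unfolding R'_eq by (rule rep_act_framed(2)[OF core_framed[OF R] h(1)])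
  have rinv: "right_invertible (ds m v) (ds 0 v) (tail_proj (ds m v) (ds 0 v))" if "m \<le> l" "v \<in> verts Q" for m v
    using right_invertible_tail_proj dims_between that by blast
  have "phom g (norm_pt R) (norm_pt R')"
    unfolding phom_def
  proof (intro conjI allI impI ballI)
    fix m assume m: "m \<le> l"
    have "rep_hom Q (g m) (trunc (ds 0) (ds m) R) (trunc (ds 0) (ds m) R')"
    proof (rule rep_hom_cancel[OF core_framed[OF R] core_trunc(1)[OF R m] core_trunc(1)[OF R' m] rinv[OF m] _ core_trunc(2)[OF R m]])
      have "rep_hom Q (\<lambda>v. tail_proj (ds m v) (ds 0 v) * h v) R (trunc (ds 0) (ds m) R')"
        by (rule rep_hom_comp[OF core_framed[OF R] core_framed[OF R'] core_trunc(1)[OF R' m] hc _ hR core_trunc(2)[OF R' m]]) auto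
      then show "rep_hom Q (\<lambda>v. g m v * tail_proj (ds m v) (ds 0 v)) R (trunc (ds 0) (ds m) R')"
        by (rule rep_hom_cong[THEN iffD1, rotated]) (use J[OF m] in auto)
    qed (use GL_carrier[OF G[OF m]] in auto)
    then show "rep_hom Q (g m) (fst (norm_pt R) m) (fst (norm_pt R') m)"
      using norm_pt_simps(2)[OF R m] norm_pt_simps(2)[OF R' m] by simp
  next
    fix m v assume m: "m < l" and v: "v \<in> verts Q"
    then have m': "m \<le> l" "Suc m \<le> l" by auto
    let ?J' = "tail_proj (ds (Suc m) v) (ds m v)" and ?J = "tail_proj (ds m v) (ds 0 v)"
    have t: "?J' * ?J = tail_proj (ds (Suc m) v) (ds 0 v)"
      using tail_proj_comp step_le[OF m v] dims_between[OF m'(1) v] by blast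
    note dims = carrier_matD[OF GL_carrier[OF G[OF m'(1) v]]] carrier_matD[OF GL_carrier[OF G[OF m'(2) v]]]
      carrier_matD[OF hc[OF v]]
    have "g (Suc m) v * ?J' * ?J = g (Suc m) v * tail_proj (ds (Suc m) v) (ds 0 v)"
      unfolding t[symmetric] using dims by (simp add: mat_assoc)
    also have "\<dots> = ?J' * ?J * h v" unfolding t using J[OF m'(2) v] by simp
    also have "\<dots> = ?J' * (?J * h v)" using dims by (simp add: mat_assoc)
    also have "\<dots> = ?J' * g m v * ?J" unfolding J[OF m'(1) v] using dims by (simp add: mat_assoc)
    finally have "g (Suc m) v * ?J' = ?J' * g m v"
      by (rule right_invertible_cancel[OF rinv[OF m'(1) v], rotated 2])
         (use GL_carrier[OF G[OF m'(1) v]] GL_carrier[OF G[OF m'(2) v]] in auto)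
    then show "g (Suc m) v * snd (norm_pt R) m v = snd (norm_pt R') m v * g m v"
      using norm_pt_simps(3)[OF R m v] norm_pt_simps(3)[OF R' m v] by simp
  qed
  then have "norm_pt R' = pact g (norm_pt R)" by (rule pact_eqI[OF norm_pt_data[OF R] g norm_pt_data[OF R']])
  then show "porbit (norm_pt R) = porbit (norm_pt R')" using porbit_pact[OF norm_pt_data[OF R] g] by simp
qed

end

section \<open>The moduli space as a quotient of the space of normal forms\<close>

lemma index_shift:
  "\<lbrakk>i < a; a \<le> b\<rbrakk> \<Longrightarrow> i + (b - a) < (b :: nat)"
  "\<lbrakk>\<not> i < b - a; i < b; a \<le> b\<rbrakk> \<Longrightarrow> i - (b - a) < (a :: nat)"
  by auto

context framed_quiver
begin

definition rep_regular ::
    "'a fspace \<Rightarrow> 'a set \<Rightarrow> ('v \<Rightarrow> nat) \<Rightarrow> ('a \<Rightarrow> ('v, 'e) framed_rep) \<Rightarrow> bool" where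
  "rep_regular X U d \<rho> \<longleftrightarrow>
     (\<forall>e\<in>arcs Q. mat_regular X U (d (head Q e)) (d (tail Q e)) (\<lambda>x. Amap (\<rho> x) e) \<and>
                 mat_regular X U (d (tail Q e)) (d (head Q e)) (\<lambda>x. Bmap (\<rho> x) e)) \<and>
     (\<forall>v\<in>verts Q. mat_regular X U (d v) (f v) (\<lambda>x. imap (\<rho> x) v) \<and>
                  mat_regular X U (f v) (d v) (\<lambda>x. jmap (\<rho> x) v))"

lemma rep_regularD:
  assumes "rep_regular X U d \<rho>"
  shows "e \<in> arcs Q \<Longrightarrow> mat_regular X U (d (head Q e)) (d (tail Q e)) (\<lambda>x. Amap (\<rho> x) e)"
    "e \<in> arcs Q \<Longrightarrow> mat_regular X U (d (tail Q e)) (d (head Q e)) (\<lambda>x. Bmap (\<rho> x) e)"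
    "v \<in> verts Q \<Longrightarrow> mat_regular X U (d v) (f v) (\<lambda>x. imap (\<rho> x) v)"
    "v \<in> verts Q \<Longrightarrow> mat_regular X U (f v) (d v) (\<lambda>x. jmap (\<rho> x) v)"
  using assms by (auto simp: rep_regular_def)

text \<open>The coordinate functions of the affine space of representations.\<close>
definition rep_coords :: "('v \<Rightarrow> nat) \<Rightarrow> (('v, 'e) framed_rep \<Rightarrow> complex) set" where
  "rep_coords d =
     {\<lambda>R. Amap R e $$ (a, b) |e a b. e \<in> arcs Q \<and> a < d (head Q e) \<and> b < d (tail Q e)} \<union>
     {\<lambda>R. Bmap R e $$ (a, b) |e a b. e \<in> arcs Q \<and> a < d (tail Q e) \<and> b < d (head Q e)} \<union>
     {\<lambda>R. imap R v $$ (a, b) |v a b. v \<in> verts Q \<and> a < d v \<and> b < f v} \<union>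
     {\<lambda>R. jmap R v $$ (a, b) |v a b. v \<in> verts Q \<and> a < f v \<and> b < d v}"

abbreviation core_space :: "('v \<Rightarrow> nat) \<Rightarrow> ('v \<Rightarrow> nat) \<Rightarrow> ('v, 'e) framed_rep fspace" where
  "core_space d c \<equiv> affine_fspace (rep_coords d) (core_reps d c)"

lemma rep_regular_core: "rep_regular (core_space d c) (core_reps d c) d (\<lambda>R. R)"
  unfolding rep_regular_def mat_regular_def
proof (intro conjI ballI allI impI)
  fix e a b assume "e \<in> arcs Q" "a < d (head Q e)" "b < d (tail Q e)"
  then show "(\<lambda>R. Amap R e $$ (a, b)) \<in> regular (core_space d c) (core_reps d c)"
    by (intro regular_coordinate) (unfold rep_coords_def, blast)
next
  fix e a b assume "e \<in> arcs Q" "a < d (tail Q e)" "b < d (head Q e)"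
  then show "(\<lambda>R. Bmap R e $$ (a, b)) \<in> regular (core_space d c) (core_reps d c)"
    by (intro regular_coordinate) (unfold rep_coords_def, blast)
next
  fix v a b assume "v \<in> verts Q" "a < d v" "b < f v"
  then show "(\<lambda>R. imap R v $$ (a, b)) \<in> regular (core_space d c) (core_reps d c)"
    by (intro regular_coordinate) (unfold rep_coords_def, blast)
next
  fix v a b assume "v \<in> verts Q" "a < f v" "b < d v"
  then show "(\<lambda>R. jmap R v $$ (a, b)) \<in> regular (core_space d c) (core_reps d c)"
    by (intro regular_coordinate) (unfold rep_coords_def, blast)
qed (use framed_repsD[OF core_framed] in blast)+

lemma fmorphism_into_core:
  assumes X: "function_space X" and into: "\<And>x. x \<in> points X \<Longrightarrow> \<rho> x \<in> core_reps d c"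
    and reg: "rep_regular X (points X) d \<rho>"
  shows "fmorphism X (core_space d c) \<rho>"
proof (rule fmorphism_into_affine[OF X into])
  note D = rep_regularD[OF reg, THEN mat_regularD(2)]
  fix c assume "c \<in> rep_coords d"
  then show "c \<circ> \<rho> \<in> regular X (points X)"
    unfolding rep_coords_def using D by (auto simp: o_def)
qed

lemma rep_regular_pullback:
  assumes h: "fmorphism X Y h" and V: "openin (zariski Y) V" and \<rho>: "rep_regular Y V d \<rho>"
  shows "rep_regular X {x \<in> points X. h x \<in> V} d (\<lambda>x. \<rho> (h x))"
  unfolding rep_regular_def
  by (intro conjI ballI mat_regular_pullback[OF h V rep_regularD(1)[OF \<rho>]] mat_regular_pullback[OF h V rep_regularD(2)[OF \<rho>]]
      mat_regular_pullback[OF h V rep_regularD(3)[OF \<rho>]] mat_regular_pullback[OF h V rep_regularD(4)[OF \<rho>]])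

lemma rep_regular_mono:
  assumes "function_space X" "openin (zariski X) U" "openin (zariski X) V" "V \<subseteq> U" "rep_regular X U d \<rho>"
  shows "rep_regular X V d \<rho>"
  using function_space.mat_regular_mono[OF assms(1-4)] assms(5) unfolding rep_regular_def by auto

lemma rep_regular_act:
  assumes X: "function_space X" and U: "openin (zariski X) U" and \<rho>: "rep_regular X U d \<rho>"
    and g: "\<And>v. v \<in> verts Q \<Longrightarrow> mat_regular X U (d v) (d v) (\<lambda>x. g x v)"
    and nz: "\<And>v x. v \<in> verts Q \<Longrightarrow> x \<in> U \<Longrightarrow> det (g x v) \<noteq> 0"
  shows "rep_regular X U d (\<lambda>x. rep_act Q d (g x) (\<rho> x))"
proof -
  interpret function_space X by fact
  note D = rep_regularD[OF \<rho>]
  have gi: "mat_regular X U (d v) (d v) (\<lambda>x. minv (d v) (g x v))" if "v \<in> verts Q" for v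
    by (rule mat_regular_minv[OF U g[OF that] nz[OF that]])
  have hv: "head Q e \<in> verts Q" "tail Q e \<in> verts Q" if "e \<in> arcs Q" for e using that by auto
  show ?thesis
    unfolding rep_regular_def rep_act_def framed_rep.simps
    by (intro conjI ballI; simp; intro mat_regular_mult[OF U mat_regular_mult[OF U g D(1)] gi]
        mat_regular_mult[OF U mat_regular_mult[OF U g D(2)] gi] mat_regular_mult[OF U g D(3)]
        mat_regular_mult[OF U D(4) gi] hv)
qed

lemma rep_regular_trunc:
  assumes X: "function_space X" and U: "openin (zariski X) U" and \<rho>: "rep_regular X U d \<rho>"
  shows "rep_regular X U c (\<lambda>x. trunc d c (\<rho> x))"
proof -
  interpret function_space X by fact
  note D = rep_regularD[OF \<rho>]
  have J: "mat_regular X U (c v) (d v) (\<lambda>x. tail_proj (c v) (d v))"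
    "mat_regular X U (d v) (c v) (\<lambda>x. (tail_proj (c v) (d v))\<^sup>T)" for v
    by (intro mat_regular_const[OF U]; simp)+
  show ?thesis
    unfolding rep_regular_def trunc_def framed_rep.simps
    by (intro conjI ballI; simp; intro mat_regular_mult[OF U mat_regular_mult[OF U J(1) D(1)] J(2)]
        mat_regular_mult[OF U mat_regular_mult[OF U J(1) D(2)] J(2)] mat_regular_mult[OF U J(1) D(3)]
        mat_regular_mult[OF U D(4) J(2)])
qed

end

context decreasing_path
begin

abbreviation pspace :: "('v, 'e) parabolic fspace" where
  "pspace \<equiv> affine_fspace (parabolic_coords Q l ds f) data"

abbreviation variety :: "('v, 'e) parabolic set fspace" where
  "variety \<equiv> parabolic_quiver_variety Q l ds f"

lemma data_regular:
  shows "m \<le> l \<Longrightarrow> rep_regular pspace data (ds m) (\<lambda>x. fst x m)"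
    and "m < l \<Longrightarrow> v \<in> verts Q \<Longrightarrow> mat_regular pspace data (ds (Suc m) v) (ds m v) (\<lambda>x. snd x m v)"
proof -
  assume m: "m \<le> l"
  note D = framed_repsD[OF dataD(4)[OF _ m]]
  show "rep_regular pspace data (ds m) (\<lambda>x. fst x m)"
    unfolding rep_regular_def mat_regular_def
  proof (intro conjI ballI allI impI)
    fix e a b assume "e \<in> arcs Q" "a < ds m (head Q e)" "b < ds m (tail Q e)"
    then show "(\<lambda>x. Amap (fst x m) e $$ (a, b)) \<in> regular pspace data"
      using m by (intro regular_coordinate) (unfold parabolic_coords_def, blast)
  next
    fix e a b assume "e \<in> arcs Q" "a < ds m (tail Q e)" "b < ds m (head Q e)"
    then show "(\<lambda>x. Bmap (fst x m) e $$ (a, b)) \<in> regular pspace data"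
      using m by (intro regular_coordinate) (unfold parabolic_coords_def, blast)
  next
    fix v a b assume "v \<in> verts Q" "a < ds m v" "b < f v"
    then show "(\<lambda>x. imap (fst x m) v $$ (a, b)) \<in> regular pspace data"
      using m by (intro regular_coordinate) (unfold parabolic_coords_def, blast)
  next
    fix v a b assume "v \<in> verts Q" "a < f v" "b < ds m v"
    then show "(\<lambda>x. jmap (fst x m) v $$ (a, b)) \<in> regular pspace data"
      using m by (intro regular_coordinate) (unfold parabolic_coords_def, blast)
  qed (use D in blast)+
next
  assume m: "m < l" and v: "v \<in> verts Q"
  show "mat_regular pspace data (ds (Suc m) v) (ds m v) (\<lambda>x. snd x m v)"
    unfolding mat_regular_def
  proof (intro conjI ballI allI impI)
    fix a b assume "a < ds (Suc m) v" "b < ds m v"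
    then show "(\<lambda>x. snd x m v $$ (a, b)) \<in> regular pspace data"
      using m v by (intro regular_coordinate) (unfold parabolic_coords_def, blast)
  qed (use dataD(7)[OF _ m v] in blast)
qed

lemma fmorphism_into_pspace:
  assumes X: "function_space X" and into: "\<And>x. x \<in> points X \<Longrightarrow> h x \<in> data"
    and rep: "\<And>m. m \<le> l \<Longrightarrow> rep_regular X (points X) (ds m) (\<lambda>x. fst (h x) m)"
    and pi: "\<And>m v. m < l \<Longrightarrow> v \<in> verts Q \<Longrightarrow> mat_regular X (points X) (ds (Suc m) v) (ds m v) (\<lambda>x. snd (h x) m v)"
  shows "fmorphism X pspace h"
proof (rule fmorphism_into_affine[OF X into])
  note D = rep_regularD[OF rep, THEN mat_regularD(2)] mat_regularD(2)[OF pi]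
  fix c assume "c \<in> parabolic_coords Q l ds f"
  then show "c \<circ> h \<in> regular X (points X)"
    unfolding parabolic_coords_def using D by (auto simp: o_def)
qed

lemma fmorphism_norm_pt: "fmorphism (core_space (ds 0) (ds l)) pspace norm_pt"
proof (rule fmorphism_into_pspace[OF function_space_affine])
  let ?X = "core_space (ds 0) (ds l)"
  interpret function_space ?X by (rule function_space_affine)
  have top: "openin (zariski ?X) core" using openin_topspace[of "zariski ?X"] by simp
  show "norm_pt R \<in> data" if "R \<in> points ?X" for R using norm_pt_data that by simp
  fix m
  show "rep_regular ?X (points ?X) (ds m) (\<lambda>R. fst (norm_pt R) m)" if m: "m \<le> l"
    using rep_regular_trunc[OF function_space_axioms top rep_regular_core, of "ds m"] m
    by (simp add: norm_pt_def)
  show "mat_regular ?X (points ?X) (ds (Suc m) v) (ds m v) (\<lambda>R. snd (norm_pt R) m v)" if "m < l" "v \<in> verts Q" for v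
    using mat_regular_const[OF top tail_proj_carrier(1)] that by (simp add: norm_pt_def)
qed

subsection \<open>Local adapted frames\<close>

text \<open>\<open>adapted C x n v\<close> is the candidate for a frame of the representation number \<open>l - n\<close> at \<open>v\<close>: its
  last rows are the pullback of the previous one along \<open>\<pi>\<close>, the other rows are the constant rows of
  \<open>C\<close>. It depends polynomially on \<open>x\<close>, and where it is invertible it makes all \<open>\<pi>\<close> equal to the
  standard projections.\<close>

primrec adapted ::
    "(nat \<Rightarrow> 'v \<Rightarrow> complex mat) \<Rightarrow> ('v, 'e) parabolic \<Rightarrow> nat \<Rightarrow> 'v \<Rightarrow> complex mat" where
  "adapted C x 0 v = 1\<^sub>m (ds l v)"
| "adapted C x (Suc n) v = mat (ds (l - Suc n) v) (ds (l - Suc n) v) (\<lambda>(i, j).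
     if i < ds (l - Suc n) v - ds (l - n) v then C (l - Suc n) v $$ (i, j)
     else (adapted C x n v * snd x (l - Suc n) v) $$ (i - (ds (l - Suc n) v - ds (l - n) v), j))"

lemma adapted_carrier: "adapted C x n v \<in> carrier_mat (ds (l - n) v) (ds (l - n) v)"
  by (cases n) auto

lemma adapted_tail:
  assumes x: "x \<in> data" and n: "n < l" and v: "v \<in> verts Q"
  shows "tail_proj (ds (l - n) v) (ds (l - Suc n) v) * adapted C x (Suc n) v = adapted C x n v * snd x (l - Suc n) v"
proof -
  let ?a = "ds (l - n) v" and ?b = "ds (l - Suc n) v"
  have S: "Suc (l - Suc n) = l - n" using n by simp
  have le: "?a \<le> ?b" using step_le[of "l - Suc n" v] n v S by simp
  have pi: "snd x (l - Suc n) v \<in> carrier_mat ?a ?b" using dataD(7)[OF x, of "l - Suc n" v] n v S by simp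
  have M: "adapted C x n v * snd x (l - Suc n) v \<in> carrier_mat ?a ?b" using adapted_carrier pi by (rule mult_carrier_mat)
  show ?thesis
    unfolding tail_proj_mult[OF le adapted_carrier]
  proof (rule eq_matI)
    fix i j assume "i < dim_row (adapted C x n v * snd x (l - Suc n) v)" "j < dim_col (adapted C x n v * snd x (l - Suc n) v)"
    then have ij: "i < ?a" "j < ?b" "i + (?b - ?a) < ?b" using carrier_matD[OF M] index_shift(1)[OF _ le] by auto
    show "mat ?a ?b (\<lambda>(i, j). adapted C x (Suc n) v $$ (i + (?b - ?a), j)) $$ (i, j) = (adapted C x n v * snd x (l - Suc n) v) $$ (i, j)"
      unfolding adapted.simps index_mat(1)[OF ij(1,2)] prod.case index_mat(1)[OF ij(3,2)] by simp
  qed (use carrier_matD[OF M] in auto)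
qed

lemma adapted_regular:
  assumes n: "n \<le> l" and v: "v \<in> verts Q"
  shows "mat_regular pspace data (ds (l - n) v) (ds (l - n) v) (\<lambda>x. adapted C x n v)"
  using n
proof (induction n)
  interpret function_space pspace by (rule function_space_affine)
  have top: "openin (zariski pspace) data" using openin_topspace[of "zariski pspace"] by simp
  {
    case 0
    show ?case using mat_regular_const[OF top, of "1\<^sub>m (ds l v)" "ds l v" "ds l v"] by simp
  next
    case (Suc n)
    let ?a = "ds (l - n) v" and ?b = "ds (l - Suc n) v"
    have S: "Suc (l - Suc n) = l - n" using Suc by simp
    have le: "?a \<le> ?b" using step_le[of "l - Suc n" v] Suc.prems v S by simp
    have pi: "mat_regular pspace data ?a ?b (\<lambda>x. snd x (l - Suc n) v)"
      using data_regular(2)[of "l - Suc n" v] Suc.prems v S by simp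
    have M: "mat_regular pspace data ?a ?b (\<lambda>x. adapted C x n v * snd x (l - Suc n) v)"
      by (rule mat_regular_mult[OF top _ pi]) (use Suc in auto)
    show ?case
      unfolding adapted.simps
    proof (rule mat_regular_entries)
      fix i j assume ij: "i < ?b" "j < ?b"
      show "(\<lambda>x. if i < ?b - ?a then C (l - Suc n) v $$ (i, j)
          else (adapted C x n v * snd x (l - Suc n) v) $$ (i - (?b - ?a), j)) \<in> regular pspace data"
      proof (cases "i < ?b - ?a")
        case True
        then show ?thesis using reg_const[OF top] by simp
      next
        case False
        then show ?thesis using mat_regularD(2)[OF M index_shift(2)[OF False ij(1) le] ij(2)] by (simp only: if_False)
      qed
    qed
  }
qed

text \<open>At a given point, the constants can be chosen such that all candidates are frames, since the
  pullback of a frame along the surjective \<open>\<pi>\<close> has linearly independent rows.\<close>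

lemma adapted_exists:
  assumes x: "x \<in> data"
  shows "\<exists>C. \<forall>n\<le>l. \<forall>v\<in>verts Q. det (adapted C x n v) \<noteq> 0"
proof -
  \<comment> \<open>Complete the rows of the pullback of each frame to the next frame. The constants are then the
    rows that were added.\<close>
  define F where "F n v = rec_nat (1\<^sub>m (ds l v)) (\<lambda>n G. SOME G'. G' \<in> carrier (GL (ds (l - Suc n) v)) \<and>
      tail_proj (ds (l - n) v) (ds (l - Suc n) v) * G' = G * snd x (l - Suc n) v) n" for n v
  have F0: "F 0 v = 1\<^sub>m (ds l v)" for v by (simp add: F_def)
  have FS: "F (Suc n) v = (SOME G'. G' \<in> carrier (GL (ds (l - Suc n) v)) \<and>
      tail_proj (ds (l - n) v) (ds (l - Suc n) v) * G' = F n v * snd x (l - Suc n) v)" for n v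
    by (simp add: F_def)
  have step: "F (Suc n) v \<in> carrier (GL (ds (l - Suc n) v)) \<and>
      tail_proj (ds (l - n) v) (ds (l - Suc n) v) * F (Suc n) v = F n v * snd x (l - Suc n) v"
    if n: "n < l" and v: "v \<in> verts Q" and IH: "F n v \<in> carrier (GL (ds (l - n) v))" for n v
  proof -
    have S: "Suc (l - Suc n) = l - n" using n by simp
    have le: "ds (l - n) v \<le> ds (l - Suc n) v" using step_le[of "l - Suc n" v] n v S by simp
    have "right_invertible (ds (l - n) v) (ds (l - Suc n) v) (F n v * snd x (l - Suc n) v)"
      by (rule right_invertible_mult[OF right_invertible_GL[OF IH]])
         (use data_surj[OF x, of "l - Suc n" v] n v S in simp)
    then have "\<exists>G. G \<in> carrier (GL (ds (l - Suc n) v)) \<and>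
        tail_proj (ds (l - n) v) (ds (l - Suc n) v) * G = F n v * snd x (l - Suc n) v"
      using right_invertible_complete[OF le] unfolding right_invertible_def by blast
    then show ?thesis unfolding FS by (rule someI_ex)
  qed
  have FGL: "F n v \<in> carrier (GL (ds (l - n) v))" if "n \<le> l" "v \<in> verts Q" for n v
    using that(1)
  proof (induction n)
    case 0
    then show ?case by (simp add: F0 GL_one)
  next
    case (Suc n)
    then show ?case using step[of n v] that(2) by (simp add: Suc_le_eq)
  qed
  define C where "C m v = F (l - m) v" for m v
  have eq: "adapted C x n v = F n v" if "n \<le> l" "v \<in> verts Q" for n v
    using that(1)
  proof (induction n)
    case 0
    then show ?case by (simp add: F0)
  next
    case (Suc n)
    then have n: "n < l" by simp
    have S: "Suc (l - Suc n) = l - n" using n by simp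
    have le: "ds (l - n) v \<le> ds (l - Suc n) v" using step_le[of "l - Suc n" v] n that(2) S by simp
    note FS = FGL[OF Suc.prems that(2), THEN GL_carrier]
    have t: "mat (ds (l - n) v) (ds (l - Suc n) v) (\<lambda>(i, j). F (Suc n) v $$ (i + (ds (l - Suc n) v - ds (l - n) v), j)) =
        F n v * snd x (l - Suc n) v"
      using step[OF n that(2) FGL[of n v]] n that(2) tail_proj_mult[OF le FS] by simp
    show ?case
    proof (rule eq_matI)
      fix i j assume "i < dim_row (F (Suc n) v)" "j < dim_col (F (Suc n) v)"
      then have ij: "i < ds (l - Suc n) v" "j < ds (l - Suc n) v" using FS by auto
      show "adapted C x (Suc n) v $$ (i, j) = F (Suc n) v $$ (i, j)"
      proof (cases "i < ds (l - Suc n) v - ds (l - n) v")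
        case True
        moreover have "l - (l - Suc n) = Suc n" using n by simp
        ultimately show ?thesis using ij by (simp add: C_def)
      next
        case False
        have "(F n v * snd x (l - Suc n) v) $$ (i - (ds (l - Suc n) v - ds (l - n) v), j) = F (Suc n) v $$ (i, j)"
          unfolding t[symmetric] index_mat(1)[OF index_shift(2)[OF False ij(1) le] ij(2)] using False by simp
        then show ?thesis using False ij Suc by simp
      qed
    qed (use FS in auto)
  qed
  show ?thesis using eq FGL by (intro exI[of _ C]) (auto simp: GL_iff)
qed

lemma fquotient_pspace: "fquotient pspace variety porbit"
  unfolding parabolic_quiver_variety_def by (rule fquotient_quotient_fspace) (auto simp: orbits_def)

text \<open>Near a point \<open>y\<close>, changing the bases to the adapted frames with the constants belonging to \<open>y\<close> is a
  regular map to normal forms that stays in the orbit. Every orbit meets the space of normal forms, and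
  the structure of the quotient can be computed there.\<close>
lemma fquotient_core: "fquotient (core_space (ds 0) (ds l)) variety (porbit \<circ> norm_pt)"
proof (rule fquotient_via[OF function_space_affine fquotient_pspace fmorphism_norm_pt])
  interpret P: function_space pspace by (rule function_space_affine)
  have top: "openin (zariski pspace) data" using openin_topspace[of "zariski pspace"] by simp
  fix y assume "y \<in> points pspace"
  then have y: "y \<in> data" by simp
  obtain C where C: "\<forall>n\<le>l. \<forall>v\<in>verts Q. det (adapted C y n v) \<noteq> 0" using adapted_exists[OF y] by blast
  define N where "N = {x \<in> data. \<forall>n\<le>l. \<forall>v\<in>verts Q. det (adapted C x n v) \<noteq> 0}"
  have "N = data \<inter> (\<Inter>(n, v)\<in>{..l} \<times> verts Q. {x \<in> data. det (adapted C x n v) \<noteq> 0})"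
    by (auto simp: N_def)
  also have "openin (zariski pspace) \<dots>"
    using finite_verts by (intro openin_Int_Inter top) (auto intro!: P.open_det_nonzero[OF top adapted_regular])
  finally have N: "openin (zariski pspace) N" .
  define r where "r x = rep_act Q (ds 0) (adapted C x l) (fst x 0)" for x
  have NS: "N \<subseteq> data" by (auto simp: N_def)
  have key: "r x \<in> core \<and> porbit (norm_pt (r x)) = porbit x" if xN: "x \<in> N" for x
  proof -
    have x: "x \<in> data" using NS xN by auto
    define g where "g = (\<lambda>m\<in>{..l}. \<lambda>v\<in>verts Q. adapted C x (l - m) v)"
    have g_eq: "g m v = adapted C x (l - m) v" if "m \<le> l" "v \<in> verts Q" for m v using that by (simp add: g_def)
    have G: "g m v \<in> carrier (GL (ds m v))" if "m \<le> l" "v \<in> verts Q" for m v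
      using adapted_carrier[of C x "l - m" v] xN that by (auto simp: g_eq GL_iff N_def)
    have g: "g \<in> carrier pgroup" unfolding pgroup_carrier using G by (auto simp: g_def)
    note gx = pact_data[OF x g]
    have pi: "snd (pact g x) m v = tail_proj (ds (Suc m) v) (ds m v)" if m: "m < l" and v: "v \<in> verts Q" for m v
    proof -
      have m': "m \<le> l" "Suc m \<le> l" using m by auto
      have e: "l - m = Suc (l - Suc m)" "l - (l - Suc m) = Suc m" "l - Suc (l - Suc m) = m" using m by auto
      have "tail_proj (ds (Suc m) v) (ds m v) * g m v = g (Suc m) v * snd x m v"
        using adapted_tail[OF x, of "l - Suc m" v C] m v e g_eq[OF m'(1) v] g_eq[OF m'(2) v] by simp
      also have "\<dots> = snd (pact g x) m v * g m v" using gx(2) m v by (simp add: phom_def)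
      finally show ?thesis
        by (intro right_invertible_cancel[OF right_invertible_GL[OF G[OF m'(1) v]] dataD(7)[OF gx(1) m v]]) auto
    qed
    have f0: "fst (pact g x) 0 = r x"
      unfolding r_def parabolic_act_def using g_eq[of 0] by (simp, intro rep_act_cong) simp
    note nf = normal_form[OF gx(1) pi]
    show ?thesis using nf porbit_pact[OF x g] unfolding f0 by simp
  qed
  have "fmorphism (open_fsubspace pspace N) (core_space (ds 0) (ds l)) r"
  proof (rule fmorphism_into_core[OF function_space_open[OF function_space_affine N]])
    show "r x \<in> core" if "x \<in> points (open_fsubspace pspace N)" for x using key that by simp
    have "rep_regular pspace N (ds 0) r"
      unfolding r_def
    proof (rule rep_regular_act[OF function_space_affine N])
      show "rep_regular pspace N (ds 0) (\<lambda>x. fst x 0)"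
        by (rule rep_regular_mono[OF function_space_affine top N NS data_regular(1)]) simp
      show "mat_regular pspace N (ds 0 v) (ds 0 v) (\<lambda>x. adapted C x l v)" if "v \<in> verts Q" for v
        using P.mat_regular_mono[OF top N NS adapted_regular[OF order_refl that]] by simp
    qed (auto simp: N_def)
    moreover have "points (open_fsubspace pspace N) = N" using NS by auto
    ultimately show "rep_regular (open_fsubspace pspace N) (points (open_fsubspace pspace N)) (ds 0) r"
      by (simp add: rep_regular_def mat_regular_def)
  qed
  moreover have "y \<in> N" using y C by (simp add: N_def)
  ultimately show "\<exists>N r. openin (zariski pspace) N \<and> y \<in> N \<and>
      fmorphism (open_fsubspace pspace N) (core_space (ds 0) (ds l)) r \<and> (\<forall>z\<in>N. porbit (norm_pt (r z)) = porbit z)"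
    using N key by blast
qed

end

section \<open>Block triangular normalization\<close>

text \<open>Write \<open>b\<close> in blocks according to \<open>d = (d - c) + c\<close> and let \<open>P\<close> be its lower right block. If \<open>P\<close> is
  invertible, subtracting multiples of the last \<open>c\<close> columns from the first ones makes the lower left
  block vanish; \<open>block_normal c d b\<close> is the result. It commutes with left multiplication by matrices
  that preserve the span of the first \<open>d - c\<close> unit vectors.\<close>

definition corner :: "nat \<Rightarrow> nat \<Rightarrow> complex mat \<Rightarrow> complex mat" where
  "corner c d b = tail_proj c d * b * (tail_proj c d)\<^sup>T"

definition block_elim :: "nat \<Rightarrow> nat \<Rightarrow> complex mat \<Rightarrow> complex mat" where
  "block_elim c d b = 1\<^sub>m d + ((tail_proj c d)\<^sup>T * tail_proj c d - (tail_proj c d)\<^sup>T * minv c (corner c d b) * (tail_proj c d * b))"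

definition block_normal :: "nat \<Rightarrow> nat \<Rightarrow> complex mat \<Rightarrow> complex mat" where
  "block_normal c d b = b * block_elim c d b"

lemma corner_carrier [simp]: "corner c d b \<in> carrier_mat c c" "dim_row (corner c d b) = c" "dim_col (corner c d b) = c"
  by (simp_all add: corner_def carrier_matI)

lemma block_elim_carrier:
  assumes b: "b \<in> carrier_mat d d" and P: "det (corner c d b) \<noteq> 0"
  shows "block_elim c d b \<in> carrier_mat d d"
proof -
  have "corner c d b \<in> carrier (GL c)" using P by (simp add: GL_iff)
  note Pi = carrier_matD[OF minv(2)[OF this]]
  show ?thesis unfolding block_elim_def using b Pi by (intro carrier_matI) simp_all
qed

text \<open>The matrix has the form \<open>1 + (E - F)\<close> with \<open>E E = E = F E\<close> and \<open>F F = F = E F\<close>, so \<open>E - F\<close> squares to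
  zero and the inverse is \<open>1 - (E - F)\<close>.\<close>
lemma block_elim_GL:
  assumes c: "c \<le> d" and b: "b \<in> carrier_mat d d" and P: "det (corner c d b) \<noteq> 0"
  shows "block_elim c d b \<in> carrier (GL d)"
proof -
  define J where "J = tail_proj c d"
  define P where "P = corner c d b"
  have GP: "P \<in> carrier (GL c)" using assms by (simp add: GL_iff P_def)
  note Pi = minv[OF GP]
  define E where "E = J\<^sup>T * J"
  define F where "F = J\<^sup>T * minv c P * (J * b)"
  have dJ: "dim_row J = c" "dim_col J = d" by (simp_all add: J_def)
  have dims: "dim_row b = d" "dim_col b = d" "dim_row (minv c P) = c" "dim_col (minv c P) = c"
    using b Pi(2) by auto
  have cE: "E \<in> carrier_mat d d" and cF: "F \<in> carrier_mat d d"
    unfolding E_def F_def using dJ dims by (auto intro!: carrier_matI)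
  have JJ: "J * J\<^sup>T = 1\<^sub>m c" unfolding J_def using tail_proj_right_inverse[OF c] .
  have JbJ: "J * (b * J\<^sup>T) = P" unfolding P_def corner_def J_def using b by (simp add: mat_assoc)
  have assoc1: "J * (J\<^sup>T * X) = X" if "dim_row X = c" for X :: "complex mat"
  proof -
    have "J * (J\<^sup>T * X) = J * J\<^sup>T * X" using dJ that by (simp add: mat_assoc)
    then show ?thesis using JJ that left_mult_one_mat[of X c "dim_col X"] by auto
  qed
  have assoc2: "J * (b * (J\<^sup>T * X)) = P * X" if "dim_row X = c" for X
    unfolding JbJ[symmetric] using dJ dims that by (simp add: mat_assoc)
  have assoc3: "minv c P * (P * X) = X" if "dim_row X = c" for X
  proof -
    have "minv c P * (P * X) = minv c P * P * X" using dims that by (simp add: mat_assoc P_def)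
    then show ?thesis using Pi(4) that left_mult_one_mat[of X c "dim_col X"] by auto
  qed
  have EE: "E * E = E" and EF: "E * F = F" and FE: "F * E = E" and FF: "F * F = F"
    unfolding E_def F_def using dJ dims by (simp_all add: mat_assoc assoc1 assoc2 assoc3 P_def[symmetric])
  have sq: "(E - F) * (E - F) = 0\<^sub>m d d"
  proof -
    have "(E - F) * (E - F) = (E - F) * E - (E - F) * F"
      by (rule mult_minus_distrib_mat[OF minus_carrier_mat[OF cF] cE cF])
    also have "(E - F) * E = E * E - F * E" by (rule minus_mult_distrib_mat[OF cE cF cE])
    also have "(E - F) * F = E * F - F * F" by (rule minus_mult_distrib_mat[OF cE cF cF])
    finally show ?thesis unfolding EE EF FE FF using cE cF by (intro eq_matI) auto
  qed
  have cD: "E - F \<in> carrier_mat d d" using cF by (rule minus_carrier_mat)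
  have "(1\<^sub>m d + (E - F)) * (1\<^sub>m d - (E - F)) = (1\<^sub>m d + (E - F)) * 1\<^sub>m d - (1\<^sub>m d + (E - F)) * (E - F)"
    by (rule mult_minus_distrib_mat[OF add_carrier_mat[OF cD] one_carrier_mat cD])
  also have "(1\<^sub>m d + (E - F)) * (E - F) = 1\<^sub>m d * (E - F) + (E - F) * (E - F)"
    by (rule add_mult_distrib_mat[OF one_carrier_mat cD cD])
  also have "(1\<^sub>m d + (E - F)) * 1\<^sub>m d - (1\<^sub>m d * (E - F) + (E - F) * (E - F)) = 1\<^sub>m d"
    unfolding sq using cD cE cF by (intro eq_matI) auto
  finally have "(1\<^sub>m d + (E - F)) * (1\<^sub>m d - (E - F)) = 1\<^sub>m d" .
  from GL_if_right_inverse(1)[OF add_carrier_mat[OF cD] minus_carrier_mat[OF cD] this]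
  show ?thesis by (simp add: block_elim_def E_def F_def J_def P_def)
qed

lemma block_normal:
  assumes c: "c \<le> d" and b: "b \<in> carrier (GL d)" and P: "det (corner c d b) \<noteq> 0"
  shows "block_normal c d b \<in> carrier (GL d)" "preserves_head (d - c) (block_normal c d b)"
proof -
  have bc: "b \<in> carrier_mat d d" using b by (rule GL_carrier)
  show L: "block_normal c d b \<in> carrier (GL d)"
    unfolding block_normal_def by (intro GL_mult b block_elim_GL c bc P)
  define J where "J = tail_proj c d"
  define P where "P = corner c d b"
  have GP: "P \<in> carrier (GL c)" using assms by (simp add: GL_iff P_def)
  note Pi = minv[OF GP]
  have dJ: "dim_row J = c" "dim_col J = d" by (simp_all add: J_def)
  have dims: "dim_row b = d" "dim_col b = d" "dim_row (minv c P) = c" "dim_col (minv c P) = c" "dim_row P = c" "dim_col P = c"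
    using bc Pi(2) by (auto simp: P_def)
  have Jb: "J * b \<in> carrier_mat c d" using dJ dims by (intro carrier_matI) auto
  have cE: "J\<^sup>T * J \<in> carrier_mat d d" and cF: "J\<^sup>T * minv c P * (J * b) \<in> carrier_mat d d"
    using dJ dims by (auto intro!: carrier_matI)
  have JbJ: "J * b * J\<^sup>T = P" unfolding P_def corner_def J_def ..
  have "J * block_normal c d b = J * b * (1\<^sub>m d + (J\<^sup>T * J - J\<^sup>T * minv c P * (J * b)))"
    unfolding block_normal_def block_elim_def J_def[symmetric] P_def[symmetric] using dJ dims by (simp add: mat_assoc)
  also have "\<dots> = J * b * 1\<^sub>m d + J * b * (J\<^sup>T * J - J\<^sup>T * minv c P * (J * b))"
    by (rule mult_add_distrib_mat[OF Jb one_carrier_mat minus_carrier_mat[OF cF]])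
  also have "J * b * (J\<^sup>T * J - J\<^sup>T * minv c P * (J * b)) = J * b * (J\<^sup>T * J) - J * b * (J\<^sup>T * minv c P * (J * b))"
    by (rule mult_minus_distrib_mat[OF Jb cE cF])
  also have "J * b * (J\<^sup>T * J) = (J * b * J\<^sup>T) * J" using dJ dims by (simp add: mat_assoc)
  also have "J * b * (J\<^sup>T * minv c P * (J * b)) = (J * b * J\<^sup>T) * minv c P * (J * b)" using dJ dims by (simp add: mat_assoc)
  also have "(J * b * J\<^sup>T) * minv c P * (J * b) = J * b" unfolding JbJ Pi(3) by (rule left_mult_one_mat[OF Jb])
  also have "J * b * 1\<^sub>m d + (J * b * J\<^sup>T * J - J * b) = P * J"
    unfolding JbJ using Jb dJ dims by (intro eq_matI) auto
  finally have "tail_proj c d * block_normal c d b = P * tail_proj c d" by (simp add: J_def)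
  then show "preserves_head (d - c) (block_normal c d b)"
    by (rule preserves_headI_tail[OF c GL_carrier[OF L] GL_carrier[OF GP]])
qed

lemma corner_mult:
  assumes c: "c \<le> d" and b: "b \<in> carrier_mat d d" and h: "h \<in> carrier_mat d d" and p: "preserves_head (d - c) h"
  shows "corner c d (h * b) = corner c d h * corner c d b" "tail_proj c d * (h * b) = corner c d h * (tail_proj c d * b)"
proof -
  have eq: "tail_proj c d * h = corner c d h * tail_proj c d"
    using preserves_head_iff_tail[OF c h] p by (simp add: corner_def)
  have "tail_proj c d * (h * b) = tail_proj c d * h * b" using b h by (simp add: mat_assoc)
  then show 1: "tail_proj c d * (h * b) = corner c d h * (tail_proj c d * b)"
    unfolding eq using b by (simp add: mat_assoc)
  have "corner c d (h * b) = corner c d h * (tail_proj c d * b) * (tail_proj c d)\<^sup>T"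
    unfolding corner_def[of c d "h * b"] 1 ..
  then show "corner c d (h * b) = corner c d h * corner c d b"
    unfolding corner_def[of c d b] using b by (simp add: mat_assoc)
qed

lemma corner_GL:
  assumes "c \<le> d" "h \<in> carrier (GL d)" "preserves_head (d - c) h"
  shows "corner c d h \<in> carrier (GL c)"
  unfolding corner_def by (rule tail_block_GL(1)[OF assms])

lemma det_corner_mult:
  assumes c: "c \<le> d" and b: "b \<in> carrier_mat d d" and h: "h \<in> carrier (GL d)" and p: "preserves_head (d - c) h"
  shows "det (corner c d (h * b)) \<noteq> 0 \<longleftrightarrow> det (corner c d b) \<noteq> 0"
  unfolding corner_mult(1)[OF c b GL_carrier[OF h] p] det_mult[OF corner_carrier(1) corner_carrier(1)]
  using corner_GL[OF c h p] by (simp add: GL_iff)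

text \<open>Multiplication by \<open>h\<close> multiplies the lower blocks of \<open>b\<close> by the lower right block of \<open>h\<close>, which cancels
  in \<open>block_elim\<close>.\<close>
lemma block_normal_mult:
  assumes c: "c \<le> d" and b: "b \<in> carrier_mat d d" and P: "det (corner c d b) \<noteq> 0"
    and h: "h \<in> carrier (GL d)" and p: "preserves_head (d - c) h"
  shows "block_normal c d (h * b) = h * block_normal c d b"
proof -
  have hc: "h \<in> carrier_mat d d" using h by (rule GL_carrier)
  have G: "corner c d b \<in> carrier (GL c)" using P by (simp add: GL_iff)
  note H = corner_GL[OF c h p]
  note Pi = minv[OF G] and Hi = minv[OF H]
  let ?J = "tail_proj c d"
  have "minv c (corner c d (h * b)) * (?J * (h * b)) = minv c (corner c d b) * minv c (corner c d h) * (corner c d h * (?J * b))"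
    unfolding corner_mult[OF c b hc p] minv_mult[OF H G] ..
  also have "\<dots> = minv c (corner c d b) * (minv c (corner c d h) * corner c d h) * (?J * b)"
    using carrier_matD[OF Pi(2)] carrier_matD[OF Hi(2)] b by (simp add: mat_assoc)
  also have "\<dots> = minv c (corner c d b) * (?J * b)" unfolding Hi(4) using Pi(2) by simp
  finally have eq: "minv c (corner c d (h * b)) * (?J * (h * b)) = minv c (corner c d b) * (?J * b)" .
  have "minv c (corner c d (h * b)) \<in> carrier_mat c c"
    unfolding corner_mult(1)[OF c b hc p] by (intro minv(2) GL_mult H G)
  then have "block_elim c d (h * b) = block_elim c d b"
    unfolding block_elim_def using eq carrier_matD[OF Pi(2)] b hc by (simp add: mat_assoc)
  then show ?thesis
    unfolding block_normal_def using block_elim_carrier[OF b P] b hc by (simp add: mat_assoc)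
qed

lemma (in function_space) mat_regular_block_normal:
  assumes U: "openin (zariski X) U" and b: "mat_regular X U d d b"
    and P: "\<And>x. x \<in> U \<Longrightarrow> det (corner c d (b x)) \<noteq> 0"
  shows "mat_regular X U d d (\<lambda>x. block_normal c d (b x))"
proof -
  have J: "mat_regular X U c d (\<lambda>x. tail_proj c d)" "mat_regular X U d c (\<lambda>x. (tail_proj c d)\<^sup>T)"
    by (intro mat_regular_const[OF U]; simp)+
  have Jb: "mat_regular X U c d (\<lambda>x. tail_proj c d * b x)" by (rule mat_regular_mult[OF U J(1) b])
  have Pr: "mat_regular X U c c (\<lambda>x. corner c d (b x))"
    unfolding corner_def by (rule mat_regular_mult[OF U Jb J(2)])
  show ?thesis
    unfolding block_normal_def block_elim_def
    by (intro mat_regular_mult[OF U b] mat_regular_add[OF U] mat_regular_minus[OF U] mat_regular_const[OF U one_carrier_mat]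
        mat_regular_mult[OF U J(2) J(1)] mat_regular_mult[OF U mat_regular_mult[OF U J(2) mat_regular_minv[OF U Pr P]] Jb])
qed

section \<open>Extending a frame of the kernel\<close>

definition extend_frame :: "nat \<Rightarrow> nat \<Rightarrow> complex mat \<Rightarrow> complex mat" where
  "extend_frame k d G = four_block_mat G (0\<^sub>m k (d - k)) (0\<^sub>m (d - k) k) (1\<^sub>m (d - k))"

lemma extend_frame_carrier: "\<lbrakk>k \<le> d; G \<in> carrier_mat k k\<rbrakk> \<Longrightarrow> extend_frame k d G \<in> carrier_mat d d"
  unfolding extend_frame_def using four_block_carrier_mat[of G k k "1\<^sub>m (d - k)" "d - k" "d - k"] by simp

lemma extend_frame_index:
  assumes "k \<le> d" "G \<in> carrier_mat k k" "i < d" "j < d"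
  shows "extend_frame k d G $$ (i, j) = (if i < k \<and> j < k then G $$ (i, j) else if i = j then 1 else 0)"
  using assms unfolding extend_frame_def by (subst index_mat_four_block(1)) auto

lemma extend_frame_mult:
  assumes "k \<le> d" "G \<in> carrier_mat k k" "G' \<in> carrier_mat k k"
  shows "extend_frame k d (G * G') = extend_frame k d G * extend_frame k d G'"
  unfolding extend_frame_def
  unfolding mult_four_block_mat[OF assms(2) zero_carrier_mat zero_carrier_mat one_carrier_mat
      assms(3) zero_carrier_mat zero_carrier_mat one_carrier_mat]
  using assms by simp

lemma extend_frame_one: "k \<le> d \<Longrightarrow> extend_frame k d (1\<^sub>m k) = 1\<^sub>m d"
  by (rule eq_matI) (auto simp: extend_frame_index carrier_matD[OF extend_frame_carrier[OF _ one_carrier_mat]])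

lemma extend_frame_GL:
  assumes k: "k \<le> d" and G: "G \<in> carrier (GL k)"
  shows "extend_frame k d G \<in> carrier (GL d)" "minv d (extend_frame k d G) = extend_frame k d (minv k G)"
proof -
  note Gi = minv[OF G]
  have "extend_frame k d G * extend_frame k d (minv k G) = 1\<^sub>m d"
    using extend_frame_mult[OF k GL_carrier[OF G] Gi(2)] extend_frame_one[OF k] Gi(3) by simp
  from GL_if_right_inverse[OF extend_frame_carrier[OF k GL_carrier[OF G]] extend_frame_carrier[OF k Gi(2)] this]
  show "extend_frame k d G \<in> carrier (GL d)" "minv d (extend_frame k d G) = extend_frame k d (minv k G)" by auto
qed

lemma extend_frame_preserves:
  assumes "r \<le> k" "k \<le> d" "G \<in> carrier_mat k k" "preserves_head r G"
  shows "preserves_head r (extend_frame k d G)"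
  using assms carrier_matD[OF extend_frame_carrier[OF assms(2,3)]]
  by (auto simp: preserves_head_def extend_frame_index)

lemma preserves_head_full: "G \<in> carrier_mat k k \<Longrightarrow> preserves_head k G"
  by (auto simp: preserves_head_def)

lemma lead_extend_frame: "\<lbrakk>k \<le> d; G \<in> carrier_mat k k\<rbrakk> \<Longrightarrow> lead d k (extend_frame k d G) = G"
  by (rule eq_matI) (auto simp: lead_index extend_frame_carrier extend_frame_index)

lemma preserves_head_from_lead:
  assumes "r \<le> k" "k \<le> d" "h \<in> carrier_mat d d" "preserves_head k h" "preserves_head r (lead d k h)"
  shows "preserves_head r h"
  unfolding preserves_head_def
proof (intro allI impI)
  fix i j assume ij: "i < dim_row h" "j < dim_col h" "r \<le> i" "j < r"
  show "h $$ (i, j) = 0"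
  proof (cases "i < k")
    case True
    then have "lead d k h $$ (i, j) = 0" using assms(1,5) ij by (auto simp: preserves_head_def)
    then show ?thesis using lead_index[OF assms(2,3) True, of j] assms(1) ij by simp
  next
    case False
    then show ?thesis using assms ij by (auto simp: preserves_head_def)
  qed
qed

lemma preserves_head_lead:
  assumes "r \<le> k" "k \<le> d" "h \<in> carrier_mat d d" "preserves_head r h"
  shows "preserves_head r (lead d k h)"
  using assms by (auto simp: preserves_head_def lead_index)

lemma (in function_space) mat_regular_extend_frame:
  assumes U: "openin (zariski X) U" and G: "mat_regular X U k k G" and k: "k \<le> d"
  shows "mat_regular X U d d (\<lambda>x. extend_frame k d (G x))"
  unfolding mat_regular_def
proof (intro conjI ballI allI impI)
  fix i j assume ij: "i < d" "j < d"
  have "(\<lambda>x. if i < k \<and> j < k then G x $$ (i, j) else if i = j then 1 else 0) \<in> regular X U"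
    using mat_regularD(2)[OF G] reg_const[OF U] by (cases "i < k \<and> j < k"; cases "i = j") auto
  then show "(\<lambda>x. extend_frame k d (G x) $$ (i, j)) \<in> regular X U"
    by (rule reg_cong[OF U]) (use extend_frame_index[OF k mat_regularD(1)[OF G] ij] in simp)
qed (use extend_frame_carrier[OF k mat_regularD(1)[OF G]] in auto)

section \<open>Frames given by paths\<close>

context framed_quiver
begin

text \<open>The vectors obtained from the framing by following paths of the doubled quiver. They are functions of
  the representation, so that one choice of paths gives vectors in all representations.\<close>

inductive_set words :: "('v \<times> (('v, 'e) framed_rep \<Rightarrow> complex vec)) set" where
  start: "\<lbrakk>v \<in> verts Q; x \<in> carrier_vec (f v)\<rbrakk> \<Longrightarrow> (v, \<lambda>R. imap R v *\<^sub>v x) \<in> words"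
| forward: "\<lbrakk>e \<in> arcs Q; (tail Q e, w) \<in> words\<rbrakk> \<Longrightarrow> (head Q e, \<lambda>R. Amap R e *\<^sub>v w R) \<in> words"
| backward: "\<lbrakk>e \<in> arcs Q; (head Q e, w) \<in> words\<rbrakk> \<Longrightarrow> (tail Q e, \<lambda>R. Bmap R e *\<^sub>v w R) \<in> words"

lemma words_carrier:
  assumes "(v, w) \<in> words" "R \<in> framed_reps Q d f"
  shows "v \<in> verts Q \<and> w R \<in> carrier_vec (d v)"
  using assms(1)
  by (induction rule: words.induct) (use framed_repsD[OF assms(2)] in \<open>auto intro!: mult_mat_vec_carrier\<close>)

lemma words_hom:
  assumes "(v, w) \<in> words" and R: "R \<in> framed_reps Q d f" and R': "R' \<in> framed_reps Q d' f"
    and \<pi>: "\<And>v. v \<in> verts Q \<Longrightarrow> \<pi> v \<in> carrier_mat (d' v) (d v)" and h: "rep_hom Q \<pi> R R'"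
  shows "w R' = \<pi> v *\<^sub>v w R"
  using assms(1)
proof (induction rule: words.induct)
  note D = framed_repsD[OF R] and D' = framed_repsD[OF R']
  {
    case (start v x)
    show ?case unfolding rep_homD(3)[OF h start(1), symmetric]
      by (rule assoc_mult_mat_vec[OF \<pi>[OF start(1)] D(3)[OF start(1)] start(2)])
  next
    case (forward e w)
    have v: "head Q e \<in> verts Q" "tail Q e \<in> verts Q" using forward by auto
    have w: "w R \<in> carrier_vec (d (tail Q e))" using words_carrier[OF forward(2) R] by simp
    have "Amap R' e *\<^sub>v w R' = Amap R' e * \<pi> (tail Q e) *\<^sub>v w R"
      unfolding forward.IH by (rule assoc_mult_mat_vec[OF D'(1)[OF forward(1)] \<pi>[OF v(2)] w, symmetric])
    also have "\<dots> = \<pi> (head Q e) *\<^sub>v (Amap R e *\<^sub>v w R)"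
      unfolding rep_homD(1)[OF h forward(1), symmetric] by (rule assoc_mult_mat_vec[OF \<pi>[OF v(1)] D(1)[OF forward(1)] w])
    finally show ?case .
  next
    case (backward e w)
    have v: "head Q e \<in> verts Q" "tail Q e \<in> verts Q" using backward by auto
    have w: "w R \<in> carrier_vec (d (head Q e))" using words_carrier[OF backward(2) R] by simp
    have "Bmap R' e *\<^sub>v w R' = Bmap R' e * \<pi> (head Q e) *\<^sub>v w R"
      unfolding backward.IH by (rule assoc_mult_mat_vec[OF D'(2)[OF backward(1)] \<pi>[OF v(1)] w, symmetric])
    also have "\<dots> = \<pi> (tail Q e) *\<^sub>v (Bmap R e *\<^sub>v w R)"
      unfolding rep_homD(2)[OF h backward(1), symmetric] by (rule assoc_mult_mat_vec[OF \<pi>[OF v(2)] D(2)[OF backward(1)] w])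
    finally show ?case .
  }
qed

lemma words_regular:
  assumes "(v, w) \<in> words" and X: "function_space X" and U: "openin (zariski X) U"
    and \<rho>: "rep_regular X U d \<rho>" and fr: "\<And>x. x \<in> U \<Longrightarrow> \<rho> x \<in> framed_reps Q d f"
  shows "i < d v \<Longrightarrow> (\<lambda>x. w (\<rho> x) $ i) \<in> regular X U"
  using assms(1)
proof (induction arbitrary: i rule: words.induct)
  interpret function_space X by fact
  note D = rep_regularD[OF \<rho>]
  have step: "(\<lambda>x. (M x *\<^sub>v y x) $ i) \<in> regular X U"
    if M: "mat_regular X U n m M" and i: "i < n" and y: "\<And>j. j < m \<Longrightarrow> (\<lambda>x. y x $ j) \<in> regular X U"
      and yc: "\<And>x. x \<in> U \<Longrightarrow> y x \<in> carrier_vec m" for M n m y i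
  proof -
    have "(\<lambda>x. \<Sum>j<m. M x $$ (i, j) * y x $ j) \<in> regular X U"
      by (intro reg_sum[OF U] reg_mult[OF U] mat_regularD(2)[OF M i] y) auto
    then show ?thesis
    proof (rule reg_cong[OF U])
      fix x assume x: "x \<in> U"
      show "(\<Sum>j<m. M x $$ (i, j) * y x $ j) = (M x *\<^sub>v y x) $ i"
        using mat_regular_dims[OF M x] i yc[OF x] by (simp add: scalar_prod_def atLeast0LessThan)
    qed
  qed
  {
    case (start v x)
    then show ?case using reg_const[OF U] by (intro step[OF D(3)]) auto
  next
    case (forward e w)
    then show ?case using words_carrier[OF forward(2) fr] by (intro step[OF D(1)]) auto
  next
    case (backward e w)
    then show ?case using words_carrier[OF backward(2) fr] by (intro step[OF D(2)]) auto
  }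
qed

lemma is_subspace_preimage:
  assumes U: "is_subspace n U" and M: "M \<in> carrier_mat n m"
  shows "is_subspace m {x \<in> carrier_vec m. M *\<^sub>v x \<in> U}"
proof -
  have "M *\<^sub>v 0\<^sub>v m = 0\<^sub>v n" using M by auto
  then show ?thesis
    using U M unfolding is_subspace_iff by (auto simp: mult_add_distrib_mat_vec mult_mat_vec)
qed

text \<open>The spans of these vectors form a subrepresentation, so for a stable representation they are
  everything and no nonzero functional vanishes on all of them.\<close>

lemma words_span:
  assumes R: "R \<in> framed_reps Q d f" and st: "stable Q d f R" and v: "v \<in> verts Q" and y: "y \<in> carrier_vec (d v)"
    and van: "\<And>w. (v, w) \<in> words \<Longrightarrow> (\<Sum>i<d v. w R $ i * y $ i) = 0"
  shows "y = 0\<^sub>v (d v)"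
proof -
  define S where "S v = {w R |w. (v, w) \<in> words}" for v
  define W where "W v = {x \<in> carrier_vec (d v). \<forall>U. is_subspace (d v) U \<longrightarrow> S v \<subseteq> U \<longrightarrow> x \<in> U}" for v
  note D = framed_repsD[OF R]
  have SW: "S v \<subseteq> W v" if "v \<in> verts Q" for v using words_carrier[OF _ R] by (auto simp: S_def W_def)
  have "\<forall>v\<in>verts Q. W v = carrier_vec (d v)"
  proof (rule st[unfolded stable_def, THEN spec, THEN mp], intro conjI ballI)
    fix v assume v: "v \<in> verts Q"
    show "is_subspace (d v) (W v)"
      unfolding is_subspace_iff[where n = "d v" and W = "W v"] unfolding W_def is_subspace_iff by auto
    fix x :: "complex vec" assume "x \<in> carrier_vec (f v)"
    then have "imap R v *\<^sub>v x \<in> S v"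
      unfolding S_def by (auto intro!: exI[of _ "\<lambda>R. imap R v *\<^sub>v x"] words.start[OF v])
    then show "imap R v *\<^sub>v x \<in> W v" using SW[OF v] by blast
  next
    fix e x assume e: "e \<in> arcs Q" and x: "x \<in> W (tail Q e)"
    have "Amap R e *\<^sub>v x \<in> U" if U: "is_subspace (d (head Q e)) U" "S (head Q e) \<subseteq> U" for U
    proof -
      have "S (tail Q e) \<subseteq> {x \<in> carrier_vec (d (tail Q e)). Amap R e *\<^sub>v x \<in> U}"
        using U(2) words.forward[OF e] words_carrier[OF _ R] unfolding S_def by blast
      then show ?thesis using x is_subspace_preimage[OF U(1) D(1)[OF e]] unfolding W_def by blast
    qed
    then show "Amap R e *\<^sub>v x \<in> W (head Q e)" using D(1)[OF e] x unfolding W_def by auto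
  next
    fix e x assume e: "e \<in> arcs Q" and x: "x \<in> W (head Q e)"
    have "Bmap R e *\<^sub>v x \<in> U" if U: "is_subspace (d (tail Q e)) U" "S (tail Q e) \<subseteq> U" for U
    proof -
      have "S (head Q e) \<subseteq> {x \<in> carrier_vec (d (head Q e)). Bmap R e *\<^sub>v x \<in> U}"
        using U(2) words.backward[OF e] words_carrier[OF _ R] unfolding S_def by blast
      then show ?thesis using x is_subspace_preimage[OF U(1) D(2)[OF e]] unfolding W_def by blast
    qed
    then show "Bmap R e *\<^sub>v x \<in> W (tail Q e)" using D(2)[OF e] x unfolding W_def by auto
  qed
  then have W: "W v = carrier_vec (d v)" using v by blast
  let ?H = "{x \<in> carrier_vec (d v). (\<Sum>i<d v. x $ i * y $ i) = 0}"
  have "is_subspace (d v) ?H"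
    unfolding is_subspace_iff
    by (auto simp: distrib_right sum.distrib mult.assoc simp flip: sum_distrib_left)
  moreover have "S v \<subseteq> ?H" using van words_carrier[OF _ R] unfolding S_def by auto
  ultimately have H: "x \<in> ?H" if "x \<in> carrier_vec (d v)" for x using that W unfolding W_def by blast
  show ?thesis
  proof (rule eq_vecI)
    fix i assume "i < dim_vec (0\<^sub>v (d v))"
    then have i: "i < d v" by simp
    have "(\<Sum>a<d v. unit_vec (d v) i $ a * y $ a) = (\<Sum>a<d v. if a = i then y $ a else 0)"
      using i by (intro sum.cong) auto
    then show "y $ i = 0\<^sub>v (d v) $ i" using H[of "unit_vec (d v) i"] i by simp
  qed (use y in simp)
qed

text \<open>The words appear as columns from the last to the first, since they are chosen such that the lower
  right blocks are invertible.\<close>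
definition word_frame ::
    "('v \<Rightarrow> nat) \<Rightarrow> ('v \<Rightarrow> nat \<Rightarrow> ('v, 'e) framed_rep \<Rightarrow> complex vec) \<Rightarrow> 'v \<Rightarrow> ('v, 'e) framed_rep \<Rightarrow> complex mat" where
  "word_frame d \<beta> v R = mat (d v) (d v) (\<lambda>(i, j). \<beta> v (d v - 1 - j) R $ i)"

lemma word_frame_carrier [simp]: "word_frame d \<beta> v R \<in> carrier_mat (d v) (d v)"
  by (simp add: word_frame_def)

lemma word_frame_hom:
  assumes \<beta>: "\<And>j. j < d v \<Longrightarrow> (v, \<beta> v j) \<in> words" and R: "R \<in> framed_reps Q d f" and R': "R' \<in> framed_reps Q d f"
    and g: "\<And>v. v \<in> verts Q \<Longrightarrow> g v \<in> carrier_mat (d v) (d v)" and h: "rep_hom Q g R R'" and v: "v \<in> verts Q"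
  shows "word_frame d \<beta> v R' = g v * word_frame d \<beta> v R"
proof (rule eq_matI)
  fix i j assume "i < dim_row (g v * word_frame d \<beta> v R)" "j < dim_col (g v * word_frame d \<beta> v R)"
  then have ij: "i < d v" "j < d v" using g[OF v] by (auto simp: word_frame_def)
  then have \<beta>': "(v, \<beta> v (d v - 1 - j)) \<in> words" by (intro \<beta>) auto
  have "col (word_frame d \<beta> v R) j = \<beta> v (d v - 1 - j) R"
    using ij words_carrier[OF \<beta>' R] by (intro eq_vecI) (auto simp: word_frame_def)
  then show "word_frame d \<beta> v R' $$ (i, j) = (g v * word_frame d \<beta> v R) $$ (i, j)"
    using ij g[OF v] words_hom[OF \<beta>' R R' g h] by (simp add: word_frame_def)
qed (use g[OF v] in \<open>auto simp: word_frame_def\<close>)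

text \<open>The words span, so \<open>lower_right_minors_nonzero\<close> chooses among them.\<close>
lemma word_frame_exists:
  assumes R: "R \<in> framed_reps Q d f" and st: "stable Q d f R" and c: "\<And>v. v \<in> verts Q \<Longrightarrow> c v \<le> d v"
  shows "\<exists>\<beta>. (\<forall>v\<in>verts Q. \<forall>j<d v. (v, \<beta> v j) \<in> words) \<and>
    (\<forall>v\<in>verts Q. det (word_frame d \<beta> v R) \<noteq> 0 \<and> det (corner (c v) (d v) (word_frame d \<beta> v R)) \<noteq> 0)"
proof -
  have "\<exists>\<gamma>. (\<forall>j<d v. (v, \<gamma> j) \<in> words) \<and> det (word_frame d (\<lambda>_. \<gamma>) v R) \<noteq> 0 \<and>
      det (corner (c v) (d v) (word_frame d (\<lambda>_. \<gamma>) v R)) \<noteq> 0" if v: "v \<in> verts Q" for v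
  proof -
    define S where "S = {w R |w. (v, w) \<in> words}"
    have "\<exists>w. (\<forall>j<d v. w j \<in> S) \<and>
        (\<forall>r'\<le>d v. det (mat r' r' (\<lambda>(i, j). w (r' - 1 - j) $ (i + (d v - r')))) \<noteq> 0)"
    proof (rule lower_right_minors_nonzero[OF _ _ order_refl])
      show "S \<subseteq> carrier_vec (d v)" using words_carrier[OF _ R] by (auto simp: S_def)
      show "y = 0\<^sub>v (d v)" if "y \<in> carrier_vec (d v)" "\<And>s. s \<in> S \<Longrightarrow> (\<Sum>i<d v. s $ i * y $ i) = 0" for y
        by (rule words_span[OF R st v that(1)]) (use that(2) in \<open>auto simp: S_def\<close>)
    qed
    then obtain w where w: "\<And>j. j < d v \<Longrightarrow> w j \<in> S"
      and minors: "\<And>r'. r' \<le> d v \<Longrightarrow> det (mat r' r' (\<lambda>(i, j). w (r' - 1 - j) $ (i + (d v - r')))) \<noteq> 0" by blast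
    have "\<forall>j. \<exists>\<gamma>. j < d v \<longrightarrow> (v, \<gamma>) \<in> words \<and> w j = \<gamma> R" using w by (auto simp: S_def)
    then obtain \<gamma> where \<gamma>: "\<And>j. j < d v \<Longrightarrow> (v, \<gamma> j) \<in> words \<and> w j = \<gamma> j R" by metis
    have b: "word_frame d (\<lambda>_. \<gamma>) v R = mat (d v) (d v) (\<lambda>(i, j). w (d v - 1 - j) $ (i + (d v - d v)))"
      using \<gamma> by (intro eq_matI) (auto simp: word_frame_def)
    have "corner (c v) (d v) (word_frame d (\<lambda>_. \<gamma>) v R) = mat (c v) (c v) (\<lambda>(i, j). w (c v - 1 - j) $ (i + (d v - c v)))"
    proof (rule eq_matI)
      fix i j assume "i < dim_row (mat (c v) (c v) (\<lambda>(i, j). w (c v - 1 - j) $ (i + (d v - c v))))"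
        "j < dim_col (mat (c v) (c v) (\<lambda>(i, j). w (c v - 1 - j) $ (i + (d v - c v))))"
      then have ij: "i < c v" "j < c v" by auto
      have cd: "c v \<le> d v" by (rule c[OF v])
      have e: "corner (c v) (d v) (word_frame d (\<lambda>_. \<gamma>) v R) = mat (c v) (c v) (\<lambda>(i, j).
          mat (c v) (d v) (\<lambda>(i, j). word_frame d (\<lambda>_. \<gamma>) v R $$ (i + (d v - c v), j)) $$ (i, j + (d v - c v)))"
        unfolding corner_def tail_proj_mult[OF cd word_frame_carrier[of d "\<lambda>_. \<gamma>" v R]]
        by (rule mult_tail_proj_transpose[OF cd]) simp
      have s: "i + (d v - c v) < d v" "j + (d v - c v) < d v" "d v - 1 - (j + (d v - c v)) = c v - 1 - j" "c v - 1 - j < d v"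
        using ij cd by auto
      show "corner (c v) (d v) (word_frame d (\<lambda>_. \<gamma>) v R) $$ (i, j) =
          mat (c v) (c v) (\<lambda>(i, j). w (c v - 1 - j) $ (i + (d v - c v))) $$ (i, j)"
        unfolding e unfolding word_frame_def index_mat(1)[OF ij] prod.case index_mat(1)[OF ij(1) s(2)] index_mat(1)[OF s(1,2)] s(3)
        using \<gamma>[OF s(4)] by simp
    qed simp_all
    then show ?thesis using \<gamma> b minors[OF order_refl] minors[OF c[OF v]] by (intro exI[of _ \<gamma>]) auto
  qed
  then obtain \<beta> where "\<And>v. v \<in> verts Q \<Longrightarrow> (\<forall>j<d v. (v, \<beta> v j) \<in> words) \<and> det (word_frame d (\<lambda>_. \<beta> v) v R) \<noteq> 0 \<and>
      det (corner (c v) (d v) (word_frame d (\<lambda>_. \<beta> v) v R)) \<noteq> 0"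
    by metis
  then show ?thesis by (intro exI[of _ \<beta>]) (simp add: word_frame_def)
qed

end

section \<open>The fibration\<close>

lemma two_step_simps [simp]: "two_step d d' 0 = d" "two_step d d' 1 = d'" "two_step d d' (Suc n) = d'"
  by (simp_all add: two_step_def)

text \<open>The assumption says that the kernels of the compositions of the \<open>\<pi>\<close> have all possible dimensions,
  that is, that they form a complete flag of the largest kernel.\<close>
locale unit_path = decreasing_path Q f l ds for Q :: "('v, 'e) pre_digraph" and f l ds +
  assumes all_dims: "\<lbrakk>v \<in> verts Q; r \<le> ds 0 v - ds l v\<rbrakk> \<Longrightarrow> \<exists>m\<le>l. ds 0 v - ds m v = r"
begin

sublocale two: decreasing_path Q f 1 "two_step (ds 0) (ds l)"
  by unfold_locales (use dims_between[of l] in simp)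

abbreviation "ker_dim v \<equiv> ds 0 v - ds l v"

definition \<nu> :: "('v, 'e) framed_rep \<Rightarrow> ('v, 'e) parabolic set" where
  "\<nu> R = porbit (norm_pt R)"

definition \<nu>2 :: "('v, 'e) framed_rep \<Rightarrow> ('v, 'e) parabolic set" where
  "\<nu>2 R = two.porbit (two.norm_pt R)"

abbreviation "core_sp \<equiv> core_space (ds 0) (ds l)"

lemma fquotient_\<nu>: "fquotient core_sp variety \<nu>"
  using fquotient_core by (simp add: \<nu>_def[abs_def] o_def)

lemma fquotient_\<nu>2: "fquotient core_sp two.variety \<nu>2"
  using two.fquotient_core by (simp add: \<nu>2_def[abs_def] o_def)

lemma last_dim_le: "v \<in> verts Q \<Longrightarrow> ds l v \<le> ds 0 v"
  using dims_between[of l v] by simp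

lemma \<nu>_eq_iff:
  assumes "R \<in> core" "R' \<in> core"
  shows "\<nu> R = \<nu> R' \<longleftrightarrow> (\<exists>h. (\<forall>v\<in>verts Q. h v \<in> carrier (GL (ds 0 v)) \<and> (\<forall>r\<le>ker_dim v. preserves_head r (h v))) \<and>
    R' = rep_act Q (ds 0) h R)"
proof -
  have "(\<forall>m\<le>l. preserves_head (ds 0 v - ds m v) h) \<longleftrightarrow> (\<forall>r\<le>ker_dim v. preserves_head r h)" if "v \<in> verts Q" for v h
    using all_dims[OF that] dims_between[OF _ that] by (metis diff_le_mono2)
  then show ?thesis unfolding \<nu>_def porbit_norm_pt_eq_iff[OF assms] by (simp cong: conj_cong)
qed

text \<open>The group of changes of basis for the path that consists of the two end points.\<close>
definition fixes_kernel :: "('v \<Rightarrow> complex mat) \<Rightarrow> bool" where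
  "fixes_kernel h \<longleftrightarrow> (\<forall>v\<in>verts Q. h v \<in> carrier (GL (ds 0 v)) \<and> preserves_head (ker_dim v) (h v))"

lemma fixes_kernelD:
  assumes "fixes_kernel h" "v \<in> verts Q"
  shows "h v \<in> carrier (GL (ds 0 v))" "preserves_head (ker_dim v) (h v)"
  using assms by (auto simp: fixes_kernel_def)

lemma \<nu>2_eq_iff:
  assumes "R \<in> core" "R' \<in> core"
  shows "\<nu>2 R = \<nu>2 R' \<longleftrightarrow> (\<exists>h. fixes_kernel h \<and> R' = rep_act Q (ds 0) h R)"
proof -
  have "(\<forall>m\<le>1. preserves_head (ds 0 v - two_step (ds 0) (ds l) m v) h) \<longleftrightarrow> preserves_head (ker_dim v) h" for v h
    by (auto simp: le_Suc_eq preserves_head_def)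
  moreover have "R \<in> two.core" "R' \<in> two.core" using assms by auto
  ultimately show ?thesis unfolding \<nu>2_def fixes_kernel_def using two.porbit_norm_pt_eq_iff[of R R'] by simp
qed

lemma forget_data:
  assumes x: "x \<in> data"
  shows "forget_middle Q l ds x \<in> two.data"
  unfolding parabolic_data_iff
proof (intro conjI allI impI ballI)
  fix m :: nat assume m: "m \<le> 1"
  then show "fst (forget_middle Q l ds x) m \<in> framed_reps Q (two_step (ds 0) (ds l) m) f"
    "stable Q (two_step (ds 0) (ds l) m) f (fst (forget_middle Q l ds x) m)"
    "moment_map_eq Q (two_step (ds 0) (ds l) m) (fst (forget_middle Q l ds x) m)"
    using dataD(4-6)[OF x] by (auto simp: forget_middle_def le_Suc_eq)
next
  fix m :: nat assume m: "m < 1"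
  show "rep_hom Q (snd (forget_middle Q l ds x) m) (fst (forget_middle Q l ds x) m) (fst (forget_middle Q l ds x) (Suc m))"
    using m comp_pi_hom[OF x order_refl]
      rep_hom_cong[of "snd (forget_middle Q l ds x) m" "\<lambda>v. comp_pi (ds 0 v) (snd x) v l"]
    by (simp add: forget_middle_def)
next
  show "vanishes_on Q (two_step (ds 0) (ds l) 0) f
     (\<lambda>v. mat_kernel (comp_pi (two_step (ds 0) (ds l) 0 v) (snd (forget_middle Q l ds x)) v 1)) (fst (forget_middle Q l ds x) 0)"
    using dataD(9)[OF x] right_mult_one_mat[OF comp_pi_carrier[OF x order_refl]]
    by (simp add: vanishes_on_def forget_middle_def)
qed (use comp_pi_carrier[OF x order_refl] in \<open>auto simp: forget_middle_def\<close>)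

lemma forget_norm_pt:
  assumes R: "R \<in> core"
  shows "forget_middle Q l ds (norm_pt R) = two.norm_pt R"
proof -
  have "comp_pi (ds 0 v) (snd (norm_pt R)) v l = tail_proj (ds l v) (ds 0 v)" if "v \<in> verts Q" for v
    by (rule comp_pi_tail_proj) (use norm_pt_simps(3)[OF R] that in auto)
  then have "two.norm_pt (fst (forget_middle Q l ds (norm_pt R)) 0) = forget_middle Q l ds (norm_pt R)"
    by (intro two.normal_form(2)[OF forget_data[OF norm_pt_data[OF R]]]) (auto simp: forget_middle_def)
  then show ?thesis using norm_pt_simps(1)[OF R] by (simp add: forget_middle_def)
qed

lemma forget_orbit:
  assumes x: "x \<in> data" and g: "g \<in> carrier pgroup"
  shows "two.porbit (forget_middle Q l ds (pact g x)) = two.porbit (forget_middle Q l ds x)"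
proof -
  define g2 where "g2 = (\<lambda>m\<in>{..1::nat}. if m = 0 then g 0 else g l)"
  have G: "g m v \<in> carrier (GL (ds m v))" if "m \<le> l" "v \<in> verts Q" for m v using g that by (simp add: pgroup_carrier)
  have g2: "g2 \<in> carrier two.pgroup"
    using g unfolding pgroup_carrier two.pgroup_carrier by (auto simp: g2_def le_Suc_eq)
  note gx = pact_data[OF x g]
  have comp: "comp_pi (ds 0 v) (snd (pact g x)) v l * g 0 v = g l v * comp_pi (ds 0 v) (snd x) v l" if "v \<in> verts Q" for v
    using comp_pi_intertwine[of "snd x" v "snd (pact g x)" g l] dataD(7)[OF x _ that] dataD(7)[OF gx(1) _ that]
      G[OF _ that] GL_carrier gx(2) that by (auto simp: phom_def)
  have "two.phom g2 (forget_middle Q l ds x) (forget_middle Q l ds (pact g x))"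
    unfolding two.phom_def
  proof (intro conjI allI impI ballI)
    fix m :: nat assume "m \<le> 1"
    then show "rep_hom Q (g2 m) (fst (forget_middle Q l ds x) m) (fst (forget_middle Q l ds (pact g x)) m)"
      using gx(2) by (auto simp: phom_def forget_middle_def g2_def)
  qed (use comp in \<open>simp add: forget_middle_def g2_def\<close>)
  then have "forget_middle Q l ds (pact g x) = two.pact g2 (forget_middle Q l ds x)"
    by (rule two.pact_eqI[OF forget_data[OF x] g2 forget_data[OF gx(1)]])
  then show ?thesis using two.porbit_pact[OF forget_data[OF x] g2] by simp
qed

lemma natural_projection_\<nu>:
  assumes R: "R \<in> core"
  shows "natural_projection Q l ds (\<nu> R) = \<nu>2 R"
proof -
  have "two.porbit (forget_middle Q l ds x) = \<nu>2 R" if "x \<in> \<nu> R" for x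
  proof -
    obtain g where "g \<in> carrier pgroup" "x = pact g (norm_pt R)" using \<open>x \<in> \<nu> R\<close> by (auto simp: \<nu>_def porbit_iff)
    then show ?thesis using forget_orbit[OF norm_pt_data[OF R]] forget_norm_pt[OF R] by (simp add: \<nu>2_def)
  qed
  moreover have "norm_pt R \<in> \<nu> R" unfolding \<nu>_def by (rule porbit_self[OF norm_pt_data[OF R]])
  ultimately show ?thesis unfolding natural_projection_def by blast
qed

lemma fmorphism_natural_projection: "fmorphism variety two.variety (natural_projection Q l ds)"
  by (rule fquotient_lift[OF fquotient_\<nu>], rule function_space.fmorphism_cong[OF function_space_affine fquotientD(1)[OF fquotient_\<nu>2]])
     (simp add: natural_projection_\<nu>)

abbreviation flags :: "('v \<Rightarrow> nat \<Rightarrow> complex vec set) fspace" where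
  "flags \<equiv> product_fspace (verts Q) (\<lambda>v. Fl (ker_dim v))"

end

subsection \<open>Normal forms along the fibres\<close>

text \<open>A choice of paths gives an equivariant normal form on the open set where the chosen vectors are
  frames that can be made block triangular.\<close>

locale frame_choice = unit_path Q f l ds for Q :: "('v, 'e) pre_digraph" and f l ds +
  fixes \<beta> :: "'v \<Rightarrow> nat \<Rightarrow> ('v, 'e) framed_rep \<Rightarrow> complex vec"
  assumes \<beta>_words: "\<lbrakk>v \<in> verts Q; j < ds 0 v\<rbrakk> \<Longrightarrow> (v, \<beta> v j) \<in> words"
begin

definition "frame_dom = {R \<in> core. \<forall>v\<in>verts Q. det (word_frame (ds 0) \<beta> v R) \<noteq> 0 \<and>
    det (corner (ds l v) (ds 0 v) (word_frame (ds 0) \<beta> v R)) \<noteq> 0}"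

text \<open>A frame adapted to the kernel that is equivariant under changes of basis preserving the kernel.\<close>
definition "L v R = block_normal (ds l v) (ds 0 v) (word_frame (ds 0) \<beta> v R)"

text \<open>The representative of the orbit, under changes of basis preserving the kernel, whose frame is
  standard.\<close>
definition "sec R = rep_act Q (ds 0) (\<lambda>v. minv (ds 0 v) (L v R)) R"

text \<open>The coordinate vectors of the kernel in terms of the equivariant frame. A change of basis \<open>h\<close>
  multiplies this matrix from the right by the inverse of a block of \<open>h\<close>, so the flag of its columns is
  invariant if \<open>h\<close> preserves all the coordinate subspaces of the kernel.\<close>
definition "kernel_frame v R = lead (ds 0 v) (ker_dim v) (minv (ds 0 v) (L v R))"

definition "flag_map R = (\<lambda>v\<in>verts Q. frame_flag (ker_dim v) (kernel_frame v R))"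

lemma frame_dom_core: "R \<in> frame_dom \<Longrightarrow> R \<in> core"
  by (simp add: frame_dom_def)

lemma L_GL:
  assumes "R \<in> frame_dom" "v \<in> verts Q"
  shows "L v R \<in> carrier (GL (ds 0 v))" "preserves_head (ker_dim v) (L v R)"
proof -
  have "word_frame (ds 0) \<beta> v R \<in> carrier (GL (ds 0 v))" using assms by (simp add: frame_dom_def GL_iff)
  then show "L v R \<in> carrier (GL (ds 0 v))" "preserves_head (ker_dim v) (L v R)"
    unfolding L_def using assms by (intro block_normal last_dim_le; simp add: frame_dom_def)+
qed

lemma frame_dom_act:
  assumes R: "R \<in> frame_dom" and h: "fixes_kernel h"
  shows "rep_act Q (ds 0) h R \<in> frame_dom" "v \<in> verts Q \<Longrightarrow> L v (rep_act Q (ds 0) h R) = h v * L v R"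
proof -
  note hG = fixes_kernelD(1)[OF h] and hp = fixes_kernelD(2)[OF h]
  have a: "rep_act Q (ds 0) h R \<in> framed_reps Q (ds 0) f" "rep_hom Q h R (rep_act Q (ds 0) h R)"
    by (rule rep_act_framed[OF core_framed[OF frame_dom_core[OF R]] hG]; assumption)+
  have b: "word_frame (ds 0) \<beta> v (rep_act Q (ds 0) h R) = h v * word_frame (ds 0) \<beta> v R" if v: "v \<in> verts Q" for v
    by (rule word_frame_hom[of "ds 0" v \<beta> R "rep_act Q (ds 0) h R" h])
       (use \<beta>_words[OF v] core_framed[OF frame_dom_core[OF R]] a GL_carrier[OF hG] v in auto)
  have "det (h v * word_frame (ds 0) \<beta> v R) \<noteq> 0 \<and> det (corner (ds l v) (ds 0 v) (h v * word_frame (ds 0) \<beta> v R)) \<noteq> 0"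
    if v: "v \<in> verts Q" for v
    using R v hG[OF v] hp[OF v] det_mult[OF GL_carrier[OF hG[OF v]] word_frame_carrier[of "ds 0" \<beta> v R]]
      det_corner_mult[OF last_dim_le[OF v] word_frame_carrier[of "ds 0" \<beta> v R] hG[OF v]]
    by (auto simp: frame_dom_def GL_iff)
  then show "rep_act Q (ds 0) h R \<in> frame_dom"
    using core_act[OF frame_dom_core[OF R] last_dim_le] h b by (simp add: frame_dom_def fixes_kernel_def)
  show "L v (rep_act Q (ds 0) h R) = h v * L v R" if v: "v \<in> verts Q"
    unfolding L_def b[OF v]
    by (rule block_normal_mult[OF last_dim_le[OF v] word_frame_carrier[of "ds 0" \<beta> v R] _ hG[OF v]]) (use R hp[OF v] v in \<open>auto simp: frame_dom_def\<close>)
qed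

lemma minv_L: "R \<in> frame_dom \<Longrightarrow> fixes_kernel (\<lambda>v. minv (ds 0 v) (L v R))"
  unfolding fixes_kernel_def using minv(1)[OF L_GL(1)] preserves_head_minv[OF diff_le_self L_GL] by blast

lemma sec_frame_dom:
  assumes R: "R \<in> frame_dom"
  shows "sec R \<in> frame_dom" "v \<in> verts Q \<Longrightarrow> L v (sec R) = 1\<^sub>m (ds 0 v)" "\<nu>2 (sec R) = \<nu>2 R"
proof -
  show "sec R \<in> frame_dom" unfolding sec_def by (rule frame_dom_act(1)[OF R minv_L[OF R]])
  then show "\<nu>2 (sec R) = \<nu>2 R"
    using \<nu>2_eq_iff[OF frame_dom_core[OF R] frame_dom_core[OF \<open>sec R \<in> frame_dom\<close>]] minv_L[OF R] sec_def by blast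
  show "L v (sec R) = 1\<^sub>m (ds 0 v)" if "v \<in> verts Q"
    unfolding sec_def frame_dom_act(2)[OF R minv_L[OF R] that] by (rule minv(4)[OF L_GL(1)[OF R that]])
qed

lemma frame_dom_\<nu>2:
  assumes R: "R \<in> frame_dom" and R': "R' \<in> core" and eq: "\<nu>2 R = \<nu>2 R'"
  shows "R' \<in> frame_dom" "sec R' = sec R"
proof -
  obtain h where h: "fixes_kernel h" and R'_eq: "R' = rep_act Q (ds 0) h R"
    using \<nu>2_eq_iff[OF frame_dom_core[OF R] R'] eq by blast
  show R'_dom: "R' \<in> frame_dom" unfolding R'_eq by (rule frame_dom_act(1)[OF R h])
  have LR: "minv (ds 0 v) (L v R') * h v = minv (ds 0 v) (L v R)" if v: "v \<in> verts Q" for v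
  proof -
    note hG = fixes_kernelD(1)[OF h v] and LG = L_GL(1)[OF R v]
    note hi = minv[OF hG] and Li = minv[OF LG]
    have "minv (ds 0 v) (L v R') * h v = minv (ds 0 v) (L v R) * minv (ds 0 v) (h v) * h v"
      unfolding R'_eq frame_dom_act(2)[OF R h v] minv_mult[OF hG LG] ..
    also have "\<dots> = minv (ds 0 v) (L v R) * (minv (ds 0 v) (h v) * h v)"
      by (rule assoc_mult_mat[OF Li(2) hi(2) GL_carrier[OF hG]])
    finally show ?thesis unfolding hi(4) using Li(2) by simp
  qed
  have "sec R' = rep_act Q (ds 0) (\<lambda>v. minv (ds 0 v) (L v R')) (rep_act Q (ds 0) h R)"
    unfolding sec_def R'_eq ..
  also have "\<dots> = rep_act Q (ds 0) (\<lambda>v. minv (ds 0 v) (L v R') * h v) R"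
    by (rule rep_act_mult[OF core_framed[OF frame_dom_core[OF R]] fixes_kernelD(1)[OF minv_L[OF R'_dom]] fixes_kernelD(1)[OF h]])
  also have "\<dots> = sec R" unfolding sec_def by (rule rep_act_cong) (rule LR)
  finally show "sec R' = sec R" .
qed

lemma kernel_frame_GL: "\<lbrakk>R \<in> frame_dom; v \<in> verts Q\<rbrakk> \<Longrightarrow> kernel_frame v R \<in> carrier (GL (ker_dim v))"
  unfolding kernel_frame_def by (rule lead_GL) (use fixes_kernelD[OF minv_L] in auto)

lemma flag_map_\<nu>:
  assumes R: "R \<in> frame_dom" and R': "R' \<in> core" and eq: "\<nu> R = \<nu> R'"
  shows "flag_map R' = flag_map R"
proof -
  obtain h where h: "\<And>v. v \<in> verts Q \<Longrightarrow> h v \<in> carrier (GL (ds 0 v)) \<and> (\<forall>r\<le>ker_dim v. preserves_head r (h v))"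
    and R'_eq: "R' = rep_act Q (ds 0) h R"
    using \<nu>_eq_iff[OF frame_dom_core[OF R] R'] eq by blast
  have h2: "fixes_kernel h" using h by (auto simp: fixes_kernel_def)
  have "frame_flag (ker_dim v) (kernel_frame v R') = frame_flag (ker_dim v) (kernel_frame v R)" if v: "v \<in> verts Q" for v
  proof -
    have hG: "h v \<in> carrier (GL (ds 0 v))" using h[OF v] by blast
    note hi = minv[OF hG]
    have p: "preserves_head r (minv (ds 0 v) (h v))" if "r \<le> ker_dim v" for r
      using preserves_head_minv[of r "ds 0 v" "h v"] h[OF v] that by simp
    have "kernel_frame v R' = kernel_frame v R * lead (ds 0 v) (ker_dim v) (minv (ds 0 v) (h v))"
      unfolding kernel_frame_def R'_eq frame_dom_act(2)[OF R h2 v] minv_mult[OF hG L_GL(1)[OF R v]]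
      by (rule lead_mult[OF diff_le_self _ hi(2) p]) (use fixes_kernelD(1)[OF minv_L[OF R] v] GL_carrier in auto)
    moreover have "frame_flag (ker_dim v) (kernel_frame v R * lead (ds 0 v) (ker_dim v) (minv (ds 0 v) (h v))) =
        frame_flag (ker_dim v) (kernel_frame v R)"
      by (intro frame_flag_mult GL_carrier[OF kernel_frame_GL[OF R v]] lead_GL hi(1) p preserves_head_lead[OF _ _ hi(2)]) auto
    ultimately show ?thesis by simp
  qed
  then show ?thesis unfolding flag_map_def by (intro restrict_ext)
qed

text \<open>For \<open>R\<close> with the standard frame, this is the point of the same fibre whose flags are given by \<open>G\<close>.\<close>
definition "twist G R = rep_act Q (ds 0) (\<lambda>v. minv (ds 0 v) (extend_frame (ker_dim v) (ds 0 v) (G v))) R"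

abbreviation "kernel_frames G \<equiv> \<forall>v\<in>verts Q. G v \<in> carrier (GL (ker_dim v))"

lemma extend_minv:
  assumes "kernel_frames G"
  shows "fixes_kernel (\<lambda>v. minv (ds 0 v) (extend_frame (ker_dim v) (ds 0 v) (G v)))"
  unfolding fixes_kernel_def
proof
  fix v assume v: "v \<in> verts Q"
  then have G: "G v \<in> carrier (GL (ker_dim v))" using assms by blast
  have k: "ker_dim v \<le> ds 0 v" by simp
  have "preserves_head (ker_dim v) (extend_frame (ker_dim v) (ds 0 v) (minv (ker_dim v) (G v)))"
    by (intro extend_frame_preserves[OF order_refl k] preserves_head_full minv(2)[OF G])
  then show "minv (ds 0 v) (extend_frame (ker_dim v) (ds 0 v) (G v)) \<in> carrier (GL (ds 0 v)) \<and>
      preserves_head (ker_dim v) (minv (ds 0 v) (extend_frame (ker_dim v) (ds 0 v) (G v)))"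
    using extend_frame_GL[OF k G] minv(1)[OF extend_frame_GL(1)[OF k G]] by simp
qed

lemma twist_sec:
  assumes R: "R \<in> frame_dom" and G: "kernel_frames G"
  shows "twist G (sec R) \<in> frame_dom" "\<nu>2 (twist G (sec R)) = \<nu>2 R"
    "flag_map (twist G (sec R)) = (\<lambda>v\<in>verts Q. frame_flag (ker_dim v) (G v))"
proof -
  note S = sec_frame_dom[OF R]
  show T: "twist G (sec R) \<in> frame_dom" unfolding twist_def by (rule frame_dom_act(1)[OF S(1) extend_minv[OF G]])
  have "\<nu>2 (sec R) = \<nu>2 (twist G (sec R))"
    unfolding \<nu>2_eq_iff[OF frame_dom_core[OF S(1)] frame_dom_core[OF T]] using extend_minv[OF G] twist_def by blast
  then show "\<nu>2 (twist G (sec R)) = \<nu>2 R" using S(3) by simp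
  have "kernel_frame v (twist G (sec R)) = G v" if v: "v \<in> verts Q" for v
  proof -
    have k: "ker_dim v \<le> ds 0 v" by simp
    have Gv: "G v \<in> carrier (GL (ker_dim v))" using G v by blast
    note e = extend_frame_GL[OF k Gv]
    have "L v (twist G (sec R)) = minv (ds 0 v) (extend_frame (ker_dim v) (ds 0 v) (G v))"
      unfolding twist_def frame_dom_act(2)[OF S(1) extend_minv[OF G] v] S(2)[OF v] by (rule right_mult_one_mat[OF minv(2)[OF e(1)]])
    then show ?thesis
      unfolding kernel_frame_def using minv_minv[OF e(1)] lead_extend_frame[OF k GL_carrier[OF Gv]] by simp
  qed
  then show "flag_map (twist G (sec R)) = (\<lambda>v\<in>verts Q. frame_flag (ker_dim v) (G v))"
    unfolding flag_map_def by (intro restrict_ext) simp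
qed

text \<open>The point of the fibre is recovered from its normal form and its flag, up to a change of basis
  that preserves all the coordinate subspaces.\<close>

lemma \<nu>_twist_sec:
  assumes R: "R \<in> frame_dom" and G: "kernel_frames G"
    and fl: "flag_map R = (\<lambda>v\<in>verts Q. frame_flag (ker_dim v) (G v))"
  shows "\<nu> (twist G (sec R)) = \<nu> R"
proof -
  let ?h = "\<lambda>v. minv (ds 0 v) (extend_frame (ker_dim v) (ds 0 v) (G v)) * minv (ds 0 v) (L v R)"
  have "twist G (sec R) = rep_act Q (ds 0) ?h R"
    unfolding twist_def sec_def
    by (rule rep_act_mult[OF core_framed[OF frame_dom_core[OF R]] fixes_kernelD(1)[OF extend_minv[OF G]] fixes_kernelD(1)[OF minv_L[OF R]]])
  moreover have "?h v \<in> carrier (GL (ds 0 v)) \<and> (\<forall>r\<le>ker_dim v. preserves_head r (?h v))" if v: "v \<in> verts Q" for v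
  proof (intro conjI allI impI)
    note E = fixes_kernelD[OF extend_minv[OF G] v] and M = fixes_kernelD[OF minv_L[OF R] v]
    have Gv: "G v \<in> carrier (GL (ker_dim v))" using G v by blast
    have Ec: "minv (ds 0 v) (extend_frame (ker_dim v) (ds 0 v) (G v)) \<in> carrier_mat (ds 0 v) (ds 0 v)"
      and Mc: "minv (ds 0 v) (L v R) \<in> carrier_mat (ds 0 v) (ds 0 v)" using E M GL_carrier by auto
    have k: "ker_dim v \<le> ds 0 v" by simp
    show "?h v \<in> carrier (GL (ds 0 v))" using E M GL_mult by blast
    fix r assume r: "r \<le> ker_dim v"
    have "lead (ds 0 v) (ker_dim v) (?h v) = minv (ker_dim v) (G v) * kernel_frame v R"
      unfolding kernel_frame_def lead_mult[OF k Ec Mc M(2)]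
      using extend_frame_GL(2)[OF k Gv] lead_extend_frame[OF k minv(2)[OF Gv]] by simp
    moreover have "preserves_head r (minv (ker_dim v) (G v) * kernel_frame v R)"
      by (rule frame_flag_eqD[OF Gv kernel_frame_GL[OF R v] _ r])
         (use fun_cong[OF fl, of v] v in \<open>simp add: flag_map_def\<close>)
    ultimately show "preserves_head r (?h v)"
      using preserves_head_from_lead[OF r k mult_carrier_mat[OF Ec Mc]] preserves_head_mult[OF k Ec Mc] E M by simp
  qed
  ultimately have "\<nu> R = \<nu> (twist G (sec R))"
    unfolding \<nu>_eq_iff[OF frame_dom_core[OF R] frame_dom_core[OF twist_sec(1)[OF R G]]] by (intro exI[of _ ?h]) simp
  then show ?thesis ..
qed

subsection \<open>Regularity\<close>

lemma core_open: "openin (zariski core_sp) core"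
  using openin_topspace[of "zariski core_sp"] by simp

lemma word_frame_regular: "v \<in> verts Q \<Longrightarrow> mat_regular core_sp core (ds 0 v) (ds 0 v) (word_frame (ds 0) \<beta> v)"
proof -
  assume v: "v \<in> verts Q"
  interpret function_space core_sp by (rule function_space_affine)
  have "(\<lambda>R. \<beta> v (ds 0 v - 1 - j) R $ i) \<in> regular core_sp core" if "i < ds 0 v" "j < ds 0 v" for i j
    by (rule words_regular[OF \<beta>_words[OF v] function_space_axioms core_open rep_regular_core core_framed])
       (use that in auto)
  then show ?thesis unfolding word_frame_def by (intro mat_regular_entries)
qed

lemma frame_dom_open: "openin (zariski core_sp) frame_dom"
proof -
  interpret function_space core_sp by (rule function_space_affine)
  have c: "mat_regular core_sp core (ds l v) (ds l v) (\<lambda>R. corner (ds l v) (ds 0 v) (word_frame (ds 0) \<beta> v R))" if "v \<in> verts Q" for v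
    unfolding corner_def
    by (intro mat_regular_mult[where m = "ds 0 v"] mat_regular_const core_open word_frame_regular that) auto
  have "frame_dom = core \<inter> (\<Inter>v\<in>verts Q. {R \<in> core. det (word_frame (ds 0) \<beta> v R) \<noteq> 0} \<inter>
      {R \<in> core. det (corner (ds l v) (ds 0 v) (word_frame (ds 0) \<beta> v R)) \<noteq> 0})"
    by (auto simp: frame_dom_def)
  also have "openin (zariski core_sp) \<dots>"
    by (intro openin_Int_Inter core_open)
       (use finite_verts open_det_nonzero[OF core_open word_frame_regular] open_det_nonzero[OF core_open c] in auto)
  finally show ?thesis .
qed

lemma frame_dom_subset: "frame_dom \<subseteq> core"
  by (auto simp: frame_dom_def)

lemma L_regular: "v \<in> verts Q \<Longrightarrow> mat_regular core_sp frame_dom (ds 0 v) (ds 0 v) (L v)"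
proof -
  assume v: "v \<in> verts Q"
  interpret function_space core_sp by (rule function_space_affine)
  show ?thesis
    unfolding L_def
    by (rule mat_regular_block_normal[OF frame_dom_open mat_regular_mono[OF core_open frame_dom_open frame_dom_subset word_frame_regular[OF v]]])
       (use v in \<open>auto simp: frame_dom_def\<close>)
qed

lemma minv_L_regular: "v \<in> verts Q \<Longrightarrow> mat_regular core_sp frame_dom (ds 0 v) (ds 0 v) (\<lambda>R. minv (ds 0 v) (L v R))"
  by (rule function_space.mat_regular_minv[OF function_space_affine frame_dom_open L_regular])
     (use L_GL(1) in \<open>auto simp: GL_iff\<close>)

abbreviation "frame_sp \<equiv> open_fsubspace core_sp frame_dom"

lemma points_frame_sp: "points frame_sp = frame_dom"
  using frame_dom_subset by auto

lemma function_space_frame_sp: "function_space frame_sp"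
  by (rule function_space_open[OF function_space_affine frame_dom_open])

lemma fmorphism_sec: "fmorphism frame_sp core_sp sec"
proof (rule fmorphism_into_core[OF function_space_frame_sp])
  show "sec R \<in> core" if "R \<in> points frame_sp" for R using sec_frame_dom(1) frame_dom_core that unfolding points_frame_sp by blast
  have "rep_regular core_sp frame_dom (ds 0) sec"
    unfolding sec_def[abs_def]
    by (intro rep_regular_act[OF function_space_affine frame_dom_open] minv_L_regular
        rep_regular_mono[OF function_space_affine core_open frame_dom_open frame_dom_subset rep_regular_core])
       (use fixes_kernelD(1)[OF minv_L] in \<open>auto simp: GL_iff\<close>)
  then show "rep_regular frame_sp (points frame_sp) (ds 0) sec"
    unfolding points_frame_sp by (simp add: rep_regular_def mat_regular_def)
qed

lemma fmorphism_flag_map: "fmorphism frame_sp flags flag_map"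
proof (rule fmorphism_into_product[OF function_space_frame_sp])
  interpret function_space core_sp by (rule function_space_affine)
  show "flag_map z \<in> extensional (verts Q)" for z by (simp add: flag_map_def)
  fix v assume v: "v \<in> verts Q"
  have "mat_regular core_sp frame_dom (ker_dim v) (ker_dim v) (kernel_frame v)"
    unfolding kernel_frame_def[abs_def] lead_def
    by (intro mat_regular_mult[where m = "ds 0 v"] mat_regular_const frame_dom_open minv_L_regular v) (auto simp: carrier_matI)
  then have "mat_regular frame_sp (points frame_sp) (ker_dim v) (ker_dim v) (kernel_frame v)"
    unfolding points_frame_sp by (simp add: mat_regular_def)
  then have "fmorphism frame_sp (GL_space (ker_dim v)) (kernel_frame v)"
    by (rule fmorphism_into_GL_space[OF function_space_frame_sp])
       (use kernel_frame_GL v points_frame_sp in \<open>auto simp: GL_iff\<close>)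
  from fmorphism_compose[OF this fquotientD(1)[OF fquotient_Fl]]
  show "fmorphism frame_sp (Fl (ker_dim v)) (\<lambda>R. flag_map R v)"
    using v by (simp add: flag_map_def o_def)
qed

definition "chart = \<nu>2 ` frame_dom"

lemma preimage_chart: "{R \<in> points core_sp. \<nu>2 R \<in> chart} = frame_dom"
  unfolding chart_def using frame_dom_\<nu>2(1) frame_dom_core by auto

lemma chart_open: "openin (zariski two.variety) chart"
proof (rule fquotientD(3)[OF fquotient_\<nu>2])
  show "chart \<subseteq> points two.variety" unfolding chart_def using fquotientD(2)[OF fquotient_\<nu>2] frame_dom_core by auto
qed (simp only: preimage_chart frame_dom_open)

lemma fquotient_chart: "fquotient frame_sp (open_fsubspace two.variety chart) \<nu>2"
  using fquotient_restrict[OF function_space_affine fquotient_\<nu>2 chart_open] unfolding preimage_chart .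

abbreviation "over_chart \<equiv> {x \<in> points variety. natural_projection Q l ds x \<in> chart}"

lemma over_chart_open: "openin (zariski variety) over_chart"
  by (rule fmorphismD(1)[OF fmorphism_natural_projection chart_open])

lemma preimage_over_chart: "{R \<in> points core_sp. \<nu> R \<in> over_chart} = frame_dom"
proof -
  have "\<nu> R \<in> over_chart \<longleftrightarrow> \<nu>2 R \<in> chart" if "R \<in> points core_sp" for R
    using that natural_projection_\<nu>[of R] fmorphismD(2)[OF fquotientD(1)[OF fquotient_\<nu>] that] by simp
  then show ?thesis using preimage_chart by blast
qed

lemma fquotient_over_chart: "fquotient frame_sp (open_fsubspace variety over_chart) \<nu>"
  using fquotient_restrict[OF function_space_affine fquotient_\<nu> over_chart_open] unfolding preimage_over_chart .

lemma points_chart: "points (open_fsubspace two.variety chart) = \<nu>2 ` frame_dom"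
  using fquotientD(2)[OF fquotient_chart] unfolding points_frame_sp by simp

lemma points_over_chart: "points (open_fsubspace variety over_chart) = \<nu> ` frame_dom"
  using fquotientD(2)[OF fquotient_over_chart] unfolding points_frame_sp by simp

lemma flag_frames:
  assumes "W \<in> points flags"
  shows "\<exists>G. (\<forall>v\<in>verts Q. G v \<in> carrier (GL (ker_dim v))) \<and> W = (\<lambda>v\<in>verts Q. frame_flag (ker_dim v) (G v))"
proof -
  have W: "W \<in> extensional (verts Q)" "\<And>v. v \<in> verts Q \<Longrightarrow> W v \<in> complete_flags (ker_dim v)"
    using assms by (auto simp: PiE_iff points_Fl)
  have "\<forall>v\<in>verts Q. \<exists>g. g \<in> carrier (GL (ker_dim v)) \<and> frame_flag (ker_dim v) g = W v"
    using complete_flag_frame W(2) by blast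
  then obtain G where G: "\<forall>v\<in>verts Q. G v \<in> carrier (GL (ker_dim v)) \<and> frame_flag (ker_dim v) (G v) = W v"
    by (rule bchoice[THEN exE]) blast
  then have "W = (\<lambda>v\<in>verts Q. frame_flag (ker_dim v) (G v))"
    by (intro extensionalityI[OF W(1)]) auto
  with G show ?thesis by blast
qed

text \<open>The trivialization maps the orbit of \<open>R\<close> to its image and its flags. Its inverse twists the
  representative of the image by frames of the flags, and does not depend on the choice of these
  frames.\<close>
lemma local_trivialization:
  "\<exists>\<Phi>. fisomorphism (open_fsubspace variety over_chart) (prod_fspace (open_fsubspace two.variety chart) flags) \<Phi> \<and>
    (\<forall>x\<in>points variety. natural_projection Q l ds x \<in> chart \<longrightarrow> fst (\<Phi> x) = natural_projection Q l ds x)"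
proof -
  let ?E = "open_fsubspace variety over_chart" and ?B = "open_fsubspace two.variety chart"
  let ?P = "prod_fspace ?B flags"
  interpret P: function_space ?P by (rule function_space_prod)
  have fsE: "function_space variety" "function_space two.variety"
    unfolding parabolic_quiver_variety_def by (intro function_space_quotient function_space_affine)+
  have fsB: "function_space ?B" by (rule function_space_open[OF fsE(2) chart_open])
  have mor: "fmorphism frame_sp ?P (\<lambda>R. (\<nu>2 R, flag_map R))"
    by (rule fmorphism_pair[OF function_space_frame_sp fquotientD(1)[OF fquotient_chart] fmorphism_flag_map])
  have inv: "(\<nu>2 R, flag_map R) = (\<nu>2 R', flag_map R')"
    if "R \<in> points frame_sp" "R' \<in> points frame_sp" "\<nu> R = \<nu> R'" for R R'
  proof -
    have R: "R \<in> frame_dom" "R' \<in> core" "R \<in> core" using that frame_dom_core unfolding points_frame_sp by auto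
    show ?thesis
      using flag_map_\<nu>[OF R(1,2) that(3)] natural_projection_\<nu>[OF R(2)] natural_projection_\<nu>[OF R(3)] that(3) by simp
  qed
  have "\<exists>\<Phi>. fmorphism ?E ?P \<Phi> \<and> (\<forall>R\<in>points frame_sp. \<Phi> (\<nu> R) = (\<nu>2 R, flag_map R))"
    by (rule fquotient_induced[OF function_space_frame_sp fquotient_over_chart mor inv])
  then obtain \<Phi> where \<Phi>: "fmorphism ?E ?P \<Phi>" "\<And>R. R \<in> frame_dom \<Longrightarrow> \<Phi> (\<nu> R) = (\<nu>2 R, flag_map R)"
    unfolding points_frame_sp by blast
  have inv2: "sec R = sec R'" if "R \<in> points frame_sp" "R' \<in> points frame_sp" "\<nu>2 R = \<nu>2 R'" for R R'
    using that frame_dom_core frame_dom_\<nu>2(2)[of R' R] unfolding points_frame_sp by auto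
  have "\<exists>\<sigma>. fmorphism ?B core_sp \<sigma> \<and> (\<forall>R\<in>points frame_sp. \<sigma> (\<nu>2 R) = sec R)"
    by (rule fquotient_induced[OF function_space_frame_sp fquotient_chart fmorphism_sec inv2])
  then obtain \<sigma> where \<sigma>: "fmorphism ?B core_sp \<sigma>" "\<And>R. R \<in> frame_dom \<Longrightarrow> \<sigma> (\<nu>2 R) = sec R"
    unfolding points_frame_sp by blast
  \<comment> \<open>The frames are arbitrary here; near each point they can be replaced by regularly varying frames,
    which shows that \<open>\<Psi>\<close> is a morphism.\<close>
  define \<Psi> where "\<Psi> z = \<nu> (twist (\<lambda>v. SOME g. g \<in> carrier (GL (ker_dim v)) \<and> frame_flag (ker_dim v) g = snd z v) (\<sigma> (fst z)))"
    for z :: "('v, 'e) parabolic set \<times> ('v \<Rightarrow> nat \<Rightarrow> complex vec set)"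
  have \<Psi>: "\<Psi> (\<nu>2 R, \<lambda>v\<in>verts Q. frame_flag (ker_dim v) (G v)) = \<nu> (twist G (sec R))"
    if R: "R \<in> frame_dom" and G: "kernel_frames G" for R G
  proof -
    define G' where "G' v = (SOME g. g \<in> carrier (GL (ker_dim v)) \<and>
        frame_flag (ker_dim v) g = (\<lambda>v\<in>verts Q. frame_flag (ker_dim v) (G v)) v)" for v
    have G': "G' v \<in> carrier (GL (ker_dim v)) \<and> frame_flag (ker_dim v) (G' v) = frame_flag (ker_dim v) (G v)"
      if "v \<in> verts Q" for v
      unfolding G'_def using that by simp (rule someI[of _ "G v"], use G that in simp)
    have G'G: "kernel_frames G'" using G' by blast
    note T = twist_sec[OF R G] and T' = twist_sec[OF R G'G]
    have "\<nu> (twist G' (sec (twist G (sec R)))) = \<nu> (twist G (sec R))"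
      by (rule \<nu>_twist_sec[OF T(1) G'G]) (simp_all add: T(3) G' cong: restrict_cong)
    moreover have "sec (twist G (sec R)) = sec R"
      by (rule frame_dom_\<nu>2(2)[OF R frame_dom_core[OF T(1)] T(2)[symmetric]])
    ultimately show ?thesis unfolding \<Psi>_def fst_conv snd_conv G'_def[symmetric] \<sigma>(2)[OF R] by simp
  qed
  have \<Psi>E: "fmorphism ?P variety \<Psi>"
  proof (rule P.fmorphism_local)
    fix z0 assume "z0 \<in> points ?P"
    then have z0: "fst z0 \<in> points ?B" "snd z0 \<in> points flags" by auto
    obtain G0 where G0: "\<forall>v\<in>verts Q. G0 v \<in> carrier (GL (ker_dim v))" "snd z0 = (\<lambda>v\<in>verts Q. frame_flag (ker_dim v) (G0 v))"
      using flag_frames[OF z0(2)] by blast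
    have "\<forall>v\<in>verts Q. \<exists>NT. openin (zariski (Fl (ker_dim v))) (fst NT) \<and> frame_flag (ker_dim v) (G0 v) \<in> fst NT \<and>
        mat_regular (Fl (ker_dim v)) (fst NT) (ker_dim v) (ker_dim v) (snd NT) \<and>
        (\<forall>W\<in>fst NT. snd NT W \<in> carrier (GL (ker_dim v)) \<and> frame_flag (ker_dim v) (snd NT W) = W)"
      using flag_local_section G0(1) by (metis fst_conv snd_conv)
    then obtain NT where NT: "\<forall>v\<in>verts Q. openin (zariski (Fl (ker_dim v))) (fst (NT v)) \<and> frame_flag (ker_dim v) (G0 v) \<in> fst (NT v) \<and>
        mat_regular (Fl (ker_dim v)) (fst (NT v)) (ker_dim v) (ker_dim v) (snd (NT v)) \<and>
        (\<forall>W\<in>fst (NT v). snd (NT v) W \<in> carrier (GL (ker_dim v)) \<and> frame_flag (ker_dim v) (snd (NT v) W) = W)"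
      by (rule bchoice[THEN exE]) blast
    define N where "N v = fst (NT v)" for v
    define \<tau> where "\<tau> v = snd (NT v)" for v
    have N: "openin (zariski (Fl (ker_dim v))) (N v)" "frame_flag (ker_dim v) (G0 v) \<in> N v"
      "mat_regular (Fl (ker_dim v)) (N v) (ker_dim v) (ker_dim v) (\<tau> v)"
      "W \<in> N v \<Longrightarrow> \<tau> v W \<in> carrier (GL (ker_dim v))" "W \<in> N v \<Longrightarrow> frame_flag (ker_dim v) (\<tau> v W) = W"
      if "v \<in> verts Q" for v W using NT that unfolding N_def \<tau>_def by blast+
    have ev: "fmorphism ?P (Fl (ker_dim v)) (\<lambda>z. snd z v)" if "v \<in> verts Q" for v
      using fmorphism_compose[OF fmorphism_snd[OF function_space_product, of ?B "verts Q" "\<lambda>v. Fl (ker_dim v)"]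
          fmorphism_component[where X = "\<lambda>v. Fl (ker_dim v)", OF function_space_Fl that]]
      by (simp add: o_def)
    define M where "M = {z \<in> points ?P. \<forall>v\<in>verts Q. snd z v \<in> N v}"
    have M_sub: "M \<subseteq> points ?P" by (auto simp: M_def)
    have "M = points ?P \<inter> (\<Inter>v\<in>verts Q. {z \<in> points ?P. snd z v \<in> N v})" by (auto simp: M_def)
    also have "openin (zariski ?P) \<dots>"
      by (intro openin_Int_Inter openin_topspace) (use finite_verts fmorphismD(1)[OF ev N(1)] in auto)
    finally have M: "openin (zariski ?P) M" .
    have pM: "points (open_fsubspace ?P M) = M" using M_sub by auto
    let ?\<rho> = "\<lambda>z. twist (\<lambda>v. \<tau> v (snd z v)) (\<sigma> (fst z))"
    have zM: "\<exists>R\<in>frame_dom. fst z = \<nu>2 R \<and> ?\<rho> z = twist (\<lambda>v. \<tau> v (snd z v)) (sec R) \<and> (\<forall>v\<in>verts Q. \<tau> v (snd z v) \<in> carrier (GL (ker_dim v))) \<and>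
        snd z = (\<lambda>v\<in>verts Q. frame_flag (ker_dim v) (\<tau> v (snd z v)))" if z: "z \<in> M" for z
    proof -
      have zP: "z \<in> points ?P" using z M_sub by blast
      obtain R where R: "R \<in> frame_dom" "fst z = \<nu>2 R" using zP points_chart by auto
      have "snd z \<in> extensional (verts Q)" using zP by (auto simp: PiE_iff)
      then have "snd z = (\<lambda>v\<in>verts Q. frame_flag (ker_dim v) (\<tau> v (snd z v)))"
        by (intro extensionalityI[of _ "verts Q"]) (use z N(5) in \<open>auto simp: M_def\<close>)
      then show ?thesis using R \<sigma>(2)[OF R(1)] N(4) z by (intro bexI[of _ R]) (auto simp: M_def)
    qed
    have "fmorphism (open_fsubspace ?P M) core_sp ?\<rho>"
    proof (rule fmorphism_into_core[OF function_space_open[OF function_space_prod M]])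
      show "?\<rho> z \<in> core" if z: "z \<in> points (open_fsubspace ?P M)" for z
      proof -
        obtain R where "R \<in> frame_dom" "?\<rho> z = twist (\<lambda>v. \<tau> v (snd z v)) (sec R)" "\<forall>v\<in>verts Q. \<tau> v (snd z v) \<in> carrier (GL (ker_dim v))"
          using zM[OF z[unfolded pM]] by (elim bexE conjE)
        then show ?thesis using twist_sec(1)[of R "\<lambda>v. \<tau> v (snd z v)"] frame_dom_core by simp
      qed
      have topP: "openin (zariski ?P) (points ?P)" by (rule openin_topspace)
      have all: "{z \<in> points ?P. \<sigma> (fst z) \<in> core} = points ?P"
        using fmorphismD(2)[OF \<sigma>(1)] by auto
      have "rep_regular ?P {z \<in> points ?P. \<sigma> (fst z) \<in> core} (ds 0) (\<lambda>z. \<sigma> (fst z))"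
        by (rule rep_regular_pullback[OF fmorphism_compose[OF fmorphism_fst[OF fsB] \<sigma>(1)] core_open rep_regular_core, unfolded comp_def])
      then have "rep_regular ?P (points ?P) (ds 0) (\<lambda>z. \<sigma> (fst z))" unfolding all .
      then have r1: "rep_regular ?P M (ds 0) (\<lambda>z. \<sigma> (fst z))"
        by (rule rep_regular_mono[OF function_space_prod topP M M_sub])
      have r2: "mat_regular ?P M (ker_dim v) (ker_dim v) (\<lambda>z. \<tau> v (snd z v))" if v: "v \<in> verts Q" for v
        by (rule P.mat_regular_mono[OF fmorphismD(1)[OF ev[OF v] N(1)[OF v]] M _ mat_regular_pullback[OF ev[OF v] N(1)[OF v] N(3)[OF v]]])
           (use v in \<open>auto simp: M_def\<close>)
      have GLM: "extend_frame (ker_dim v) (ds 0 v) (\<tau> v (snd z v)) \<in> carrier (GL (ds 0 v))" if "v \<in> verts Q" "z \<in> M" for v z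
        using extend_frame_GL(1)[OF diff_le_self N(4)[OF that(1)]] that by (auto simp: M_def)
      have "rep_regular ?P M (ds 0) ?\<rho>"
        unfolding twist_def
      proof (rule rep_regular_act[OF function_space_prod M r1])
        show "mat_regular ?P M (ds 0 v) (ds 0 v) (\<lambda>z. minv (ds 0 v) (extend_frame (ker_dim v) (ds 0 v) (\<tau> v (snd z v))))" if "v \<in> verts Q" for v
          by (intro P.mat_regular_minv[OF M] P.mat_regular_extend_frame[OF M r2[OF that]] diff_le_self)
             (use GLM that in \<open>auto simp: GL_iff\<close>)
        show "det (minv (ds 0 v) (extend_frame (ker_dim v) (ds 0 v) (\<tau> v (snd z v)))) \<noteq> 0" if "v \<in> verts Q" "z \<in> M" for v z
          using minv(1)[OF GLM[OF that]] by (simp add: GL_iff)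
      qed
      then show "rep_regular (open_fsubspace ?P M) (points (open_fsubspace ?P M)) (ds 0) ?\<rho>"
        unfolding pM by (simp add: rep_regular_def mat_regular_def)
    qed
    then have "fmorphism (open_fsubspace ?P M) variety (\<nu> \<circ> ?\<rho>)"
      by (rule fmorphism_compose[OF _ fquotientD(1)[OF fquotient_\<nu>]])
    then have "fmorphism (open_fsubspace ?P M) variety \<Psi>"
    proof (rule function_space.fmorphism_cong[OF function_space_open[OF function_space_prod M]])
      fix z assume "z \<in> points (open_fsubspace ?P M)"
      then have "z \<in> M" unfolding pM .
      from zM[OF this] obtain R where R: "R \<in> frame_dom" "fst z = \<nu>2 R" "?\<rho> z = twist (\<lambda>v. \<tau> v (snd z v)) (sec R)" "\<forall>v\<in>verts Q. \<tau> v (snd z v) \<in> carrier (GL (ker_dim v))"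
          "snd z = (\<lambda>v\<in>verts Q. frame_flag (ker_dim v) (\<tau> v (snd z v)))"
        by (elim bexE conjE)
      have "\<Psi> z = \<Psi> (\<nu>2 R, \<lambda>v\<in>verts Q. frame_flag (ker_dim v) (\<tau> v (snd z v)))"
        using R(2,5) by (metis prod.collapse)
      also have "\<dots> = \<nu> (?\<rho> z)" unfolding R(3) by (rule \<Psi>[OF R(1)]) (use R(4) in blast)
      finally show "(\<nu> \<circ> ?\<rho>) z = \<Psi> z" by simp
    qed
    moreover have "z0 \<in> M" using \<open>z0 \<in> points ?P\<close> G0(2) N(2) by (auto simp: M_def)
    ultimately show "\<exists>N. openin (zariski ?P) N \<and> z0 \<in> N \<and> fmorphism (open_fsubspace ?P N) variety \<Psi>"
      using M by blast
  qed
  have repr: "\<exists>R G. R \<in> frame_dom \<and> (\<forall>v\<in>verts Q. G v \<in> carrier (GL (ker_dim v))) \<and> z = (\<nu>2 R, \<lambda>v\<in>verts Q. frame_flag (ker_dim v) (G v))"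
    if z: "z \<in> points ?P" for z
  proof -
    obtain R where R: "R \<in> frame_dom" "fst z = \<nu>2 R" using z points_chart by auto
    have "snd z \<in> points flags" using z unfolding points_prod by (rule mem_Times_iff[THEN iffD1, THEN conjunct2])
    then obtain G where G: "\<forall>v\<in>verts Q. G v \<in> carrier (GL (ker_dim v))" "snd z = (\<lambda>v\<in>verts Q. frame_flag (ker_dim v) (G v))"
      using flag_frames by blast
    show ?thesis
      by (intro exI[of _ R] exI[of _ G] conjI R(1) G(1)) (simp only: prod_eq_iff R(2)[symmetric] G(2)[symmetric] fst_conv snd_conv simp_thms)
  qed
  have "\<Psi> z \<in> over_chart" if z: "z \<in> points ?P" for z
  proof -
    obtain R G where R: "R \<in> frame_dom" "\<forall>v\<in>verts Q. G v \<in> carrier (GL (ker_dim v))" "z = (\<nu>2 R, \<lambda>v\<in>verts Q. frame_flag (ker_dim v) (G v))"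
      using repr[OF z] by (elim exE conjE)
    have "twist G (sec R) \<in> frame_dom" using twist_sec(1)[OF R(1)] R(2) by blast
    then show ?thesis using \<Psi>[OF R(1), of G] R(2,3) preimage_over_chart by auto
  qed
  then have "fmorphism ?P ?E \<Psi>" by (rule fmorphism_into_open[OF over_chart_open \<Psi>E])
  moreover have "\<Psi> (\<Phi> x) = x" if x: "x \<in> points ?E" for x
  proof -
    obtain R where R: "R \<in> frame_dom" "x = \<nu> R" using x points_over_chart by auto
    have fl: "flag_map R = (\<lambda>v\<in>verts Q. frame_flag (ker_dim v) (kernel_frame v R))" by (simp add: flag_map_def)
    have G: "kernel_frames (\<lambda>v. kernel_frame v R)" using kernel_frame_GL[OF R(1)] by blast
    show ?thesis
      using \<Phi>(2)[OF R(1)] \<Psi>[OF R(1) G] \<nu>_twist_sec[OF R(1) G fl] R(2) fl by simp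
  qed
  moreover have "\<Phi> (\<Psi> z) = z" if z: "z \<in> points ?P" for z
  proof -
    obtain R G where R: "R \<in> frame_dom" "kernel_frames G" "z = (\<nu>2 R, \<lambda>v\<in>verts Q. frame_flag (ker_dim v) (G v))"
      using repr[OF z] by (elim exE conjE)
    show ?thesis using twist_sec[OF R(1,2)] \<Psi>[OF R(1,2)] \<Phi>(2) R(3) by simp
  qed
  moreover have "fst (\<Phi> x) = natural_projection Q l ds x" if "x \<in> points variety" "natural_projection Q l ds x \<in> chart" for x
  proof -
    have "x \<in> points ?E" using that by simp
    then obtain R where "R \<in> frame_dom" "x = \<nu> R" using points_over_chart by auto
    then show ?thesis using \<Phi>(2) natural_projection_\<nu> frame_dom_core by simp
  qed
  ultimately show ?thesis using \<Phi>(1) unfolding fisomorphism_def by blast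
qed

end

text \<open>Each point of the base lies in the chart of some choice of paths.\<close>
lemma (in unit_path) locally_trivial_natural_projection:
  "locally_trivial_fibration variety two.variety (natural_projection Q l ds) flags"
  unfolding locally_trivial_fibration_def
proof (intro conjI ballI fmorphism_natural_projection)
  fix b assume "b \<in> points two.variety"
  then obtain R where R: "R \<in> core" "b = \<nu>2 R" using fquotientD(2)[OF fquotient_\<nu>2] by auto
  obtain \<beta> where \<beta>: "\<forall>v\<in>verts Q. \<forall>j<ds 0 v. (v, \<beta> v j) \<in> words"
    "\<forall>v\<in>verts Q. det (word_frame (ds 0) \<beta> v R) \<noteq> 0 \<and> det (corner (ds l v) (ds 0 v) (word_frame (ds 0) \<beta> v R)) \<noteq> 0"
    using word_frame_exists[OF core_framed[OF R(1)], of "ds l"] R(1) last_dim_le by (auto simp: core_reps_def)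
  interpret frame_choice Q f l ds \<beta> by unfold_locales (use \<beta>(1) in blast)
  have "b \<in> chart" using R \<beta>(2) by (auto simp: chart_def frame_dom_def)
  then show "\<exists>U. openin (zariski two.variety) U \<and> b \<in> U \<and>
      (\<exists>\<Phi>. fisomorphism (open_fsubspace variety {x \<in> points variety. natural_projection Q l ds x \<in> U})
              (prod_fspace (open_fsubspace two.variety U) flags) \<Phi> \<and>
           (\<forall>x\<in>points variety. natural_projection Q l ds x \<in> U \<longrightarrow> fst (\<Phi> x) = natural_projection Q l ds x))"
    using chart_open local_trivialization by blast
qed

text \<open>Both spaces are quotients of the same space of normal forms by the same group.\<close>
lemma paths_isomorphic:
  assumes "unit_path Q l ds" "unit_path Q l' ds'" "ds 0 = ds' 0" "ds l = ds' l'"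
  shows "fisomorphic (parabolic_quiver_variety Q l ds f) (parabolic_quiver_variety Q l' ds' f)"
proof -
  interpret A: unit_path Q f l ds by fact
  interpret B: unit_path Q f l' ds' by fact
  show ?thesis
  proof (rule fquotients_isomorphic[OF function_space_affine A.fquotient_\<nu>])
    show "fquotient A.core_sp B.variety B.\<nu>" using B.fquotient_\<nu> assms(3,4) by simp
    fix x y assume "x \<in> points A.core_sp" "y \<in> points A.core_sp"
    then show "A.\<nu> x = A.\<nu> y \<longleftrightarrow> B.\<nu> x = B.\<nu> y"
      using A.\<nu>_eq_iff[of x y] B.\<nu>_eq_iff[of x y] assms(3,4) by simp
  qed
qed

section \<open>Dependence on the dimension vectors\<close>

text \<open>All constructions use the dimension vectors only at the vertices.\<close>

context framed_quiver
begin

lemma framed_reps_verts_cong: "(\<And>v. v \<in> verts Q \<Longrightarrow> d v = d' v) \<Longrightarrow> framed_reps Q d f = framed_reps Q d' f"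
  unfolding framed_reps_def by (simp cong: PiE_cong)

lemma stable_verts_cong: "(\<And>v. v \<in> verts Q \<Longrightarrow> d v = d' v) \<Longrightarrow> stable Q d f R = stable Q d' f R"
  unfolding stable_def by (simp cong: ball_cong)

lemma moment_verts_cong: "(\<And>v. v \<in> verts Q \<Longrightarrow> d v = d' v) \<Longrightarrow> moment_map_eq Q d R = moment_map_eq Q d' R"
  unfolding moment_map_eq_def by (simp cong: ball_cong)

lemma vanishes_verts_cong:
  "(\<And>v. v \<in> verts Q \<Longrightarrow> d v = d' v \<and> K v = K' v) \<Longrightarrow> vanishes_on Q d f K R = vanishes_on Q d' f K' R"
  unfolding vanishes_on_def by (simp cong: ball_cong)

lemma parabolic_data_verts_cong:
  fixes ds ds' :: "nat \<Rightarrow> 'v \<Rightarrow> nat"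
  assumes "\<And>m v. m \<le> l \<Longrightarrow> v \<in> verts Q \<Longrightarrow> ds m v = ds' m v"
  shows "parabolic_data Q l ds f = parabolic_data Q l ds' f"
proof (rule Set.set_eqI)
  fix x :: "('v, 'e) parabolic"
  have "framed_reps Q (ds m) f = framed_reps Q (ds' m) f" "stable Q (ds m) f R = stable Q (ds' m) f R"
    "moment_map_eq Q (ds m) R = moment_map_eq Q (ds' m) R" if "m \<le> l" for m R
    using assms[OF that] framed_reps_verts_cong stable_verts_cong moment_verts_cong by blast+
  moreover have "vanishes_on Q (ds 0) f (\<lambda>v. mat_kernel (comp_pi (ds 0 v) (snd x) v l)) (fst x 0) =
      vanishes_on Q (ds' 0) f (\<lambda>v. mat_kernel (comp_pi (ds' 0 v) (snd x) v l)) (fst x 0)"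
    by (rule vanishes_verts_cong) (use assms[OF le0] in simp)
  moreover have "ds m v = ds' m v" "ds (Suc m) v = ds' (Suc m) v" if "m < l" "v \<in> verts Q" for m v
    using assms that by auto
  ultimately show "x \<in> parabolic_data Q l ds f \<longleftrightarrow> x \<in> parabolic_data Q l ds' f"
    unfolding parabolic_data_iff by (simp cong: conj_cong)
qed

lemma parabolic_coords_verts_cong:
  fixes ds ds' :: "nat \<Rightarrow> 'v \<Rightarrow> nat"
  assumes "\<And>m v. m \<le> l \<Longrightarrow> v \<in> verts Q \<Longrightarrow> ds m v = ds' m v"
  shows "parabolic_coords Q l ds f = parabolic_coords Q l ds' f"
proof -
  have "parabolic_coords Q l ds f \<subseteq> parabolic_coords Q l ds' f"
    if "\<And>m v. m \<le> l \<Longrightarrow> v \<in> verts Q \<Longrightarrow> ds m v = ds' m v" for ds ds' :: "nat \<Rightarrow> 'v \<Rightarrow> nat"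
  proof -
    have e: "ds m (head Q e) = ds' m (head Q e)" "ds m (tail Q e) = ds' m (tail Q e)" if "m \<le> l" "e \<in> arcs Q" for m e
      using \<open>\<And>m v. m \<le> l \<Longrightarrow> v \<in> verts Q \<Longrightarrow> ds m v = ds' m v\<close> that by auto
    have p: "ds (Suc m) v = ds' (Suc m) v" "ds m v = ds' m v" if "m < l" "v \<in> verts Q" for m v
      using \<open>\<And>m v. m \<le> l \<Longrightarrow> v \<in> verts Q \<Longrightarrow> ds m v = ds' m v\<close> that by auto
    show ?thesis
      unfolding parabolic_coords_def
      apply (intro Un_mono)
      subgoal using e by auto metis
      subgoal using e by auto metis
      subgoal using that by auto metis
      subgoal using that by auto metis
      subgoal using p by auto metis
      done
  qed
  then show ?thesis using assms by (intro subset_antisym) (blast, metis)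
qed

lemma parabolic_orbit_verts_cong:
  fixes ds ds' :: "nat \<Rightarrow> 'v \<Rightarrow> nat"
  assumes "\<And>m v. m \<le> l \<Longrightarrow> v \<in> verts Q \<Longrightarrow> ds m v = ds' m v"
  shows "parabolic_orbit Q l ds x = parabolic_orbit Q l ds' x"
proof -
  have "carrier (parabolic_group Q l ds) = carrier (parabolic_group Q l ds')"
    unfolding parabolic_group_def carrier_product_group by (intro PiE_cong) (use assms in simp)
  moreover have "parabolic_act Q l ds g x = parabolic_act Q l ds' g x" for g
    using assms by (simp add: parabolic_act_def rep_act_def cong: restrict_cong)
  ultimately show ?thesis by (simp add: orbit_def)
qed

lemma parabolic_quiver_variety_verts_cong:
  fixes ds ds' :: "nat \<Rightarrow> 'v \<Rightarrow> nat"
  assumes "\<And>m v. m \<le> l \<Longrightarrow> v \<in> verts Q \<Longrightarrow> ds m v = ds' m v"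
  shows "parabolic_quiver_variety Q l ds f = parabolic_quiver_variety Q l ds' f"
proof -
  have "parabolic_orbit Q l ds = parabolic_orbit Q l ds'"
    using parabolic_orbit_verts_cong[of l ds ds', OF assms] by blast
  moreover from this have "orbits (parabolic_group Q l ds) E (parabolic_act Q l ds) =
      orbits (parabolic_group Q l ds') E (parabolic_act Q l ds')" for E :: "('v, 'e) parabolic set"
    unfolding orbits_def by (simp add: fun_eq_iff)
  ultimately show ?thesis
    unfolding parabolic_quiver_variety_def
    using parabolic_data_verts_cong[of l ds ds', OF assms] parabolic_coords_verts_cong[of l ds ds', OF assms] by simp
qed

lemma natural_projection_verts_cong:
  fixes ds ds' :: "nat \<Rightarrow> 'v \<Rightarrow> nat"
  assumes "\<And>m v. m \<le> l \<Longrightarrow> v \<in> verts Q \<Longrightarrow> ds m v = ds' m v"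
  shows "natural_projection Q l ds = natural_projection Q l ds'"
proof -
  have "parabolic_orbit Q 1 (two_step (ds 0) (ds l)) x = parabolic_orbit Q 1 (two_step (ds' 0) (ds' l)) x" for x
    by (rule parabolic_orbit_verts_cong) (use assms[OF le0] assms[OF order_refl] in \<open>auto simp: two_step_def\<close>)
  moreover have "forget_middle Q l ds x = forget_middle Q l ds' x" for x
    using assms[OF le0] by (simp add: forget_middle_def cong: restrict_cong)
  ultimately show ?thesis unfolding natural_projection_def by simp
qed

text \<open>At each vertex, the dimension drops by at most one in each step, so it takes all intermediate
  values.\<close>

lemma unit_path_of_unit_step_path:
  fixes ds :: "nat \<Rightarrow> 'v \<Rightarrow> nat"
  assumes p: "unit_step_path Q d k l ds"
  shows "unit_path Q l (\<lambda>m v. if v \<in> verts Q then ds m v else 0)"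
proof
  have step: "ds (Suc m) v \<le> ds m v \<and> ds m v \<le> Suc (ds (Suc m) v)" if "m < l" "v \<in> verts Q" for m v
  proof -
    have "\<forall>i<l. \<exists>w\<in>verts Q. \<forall>v\<in>verts Q. int (ds i v) - int (ds (Suc i) v) = (if v = w then 1 else 0)"
      using p unfolding unit_step_path_def by (elim conjE)
    from this[rule_format, OF that(1)] obtain w where
        "\<forall>v\<in>verts Q. int (ds m v) - int (ds (Suc m) v) = (if v = w then 1 else 0)"
      by (elim bexE) (rule that)
    then have "int (ds m v) - int (ds (Suc m) v) = (if v = w then 1 else 0)" using \<open>v \<in> verts Q\<close> by (rule bspec)
    then show ?thesis by (simp split: if_splits)
  qed
  show "(if v \<in> verts Q then ds (Suc m) v else 0) \<le> (if v \<in> verts Q then ds m v else 0)" if "m < l" "v \<in> verts Q" for m v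
    using step that by simp
  fix v r assume v: "v \<in> verts Q"
  have "\<forall>r\<le>ds 0 v - ds n v. \<exists>m\<le>n. ds 0 v - ds m v = r" if "n \<le> l" for n
    using that
  proof (induction n)
    case 0
    then show ?case by auto
  next
    case (Suc n)
    then have IH: "\<forall>r\<le>ds 0 v - ds n v. \<exists>m\<le>n. ds 0 v - ds m v = r" and s: "ds n v \<le> Suc (ds (Suc n) v)"
      using step[of n v] v by auto
    show ?case
    proof (intro allI impI)
      fix r assume "r \<le> ds 0 v - ds (Suc n) v"
      then consider "r \<le> ds 0 v - ds n v" | "r = ds 0 v - ds (Suc n) v" using s by linarith
      then show "\<exists>m\<le>Suc n. ds 0 v - ds m v = r" using IH by cases (meson le_SucI, blast)
    qed
  qed
  moreover assume "r \<le> (if v \<in> verts Q then ds 0 v else 0) - (if v \<in> verts Q then ds l v else 0)"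
  ultimately show "\<exists>m\<le>l. (if v \<in> verts Q then ds 0 v else 0) - (if v \<in> verts Q then ds m v else 0) = r"
    using v by simp
qed

end

theorem corollary1p10:
  fixes Q :: "('v, 'e) pre_digraph"
    and d k f :: "'v \<Rightarrow> nat"
    and ds :: "nat \<Rightarrow> 'v \<Rightarrow> nat"
    and l :: nat
  assumes "fin_digraph Q"
    and "unit_step_path Q d k l ds"
  shows "(\<forall>l' ds'. unit_step_path Q d k l' ds' \<longrightarrow>
            fisomorphic (parabolic_quiver_variety Q l ds f)
                        (parabolic_quiver_variety Q l' ds' f)) \<and>
         locally_trivial_fibration
           (parabolic_quiver_variety Q l ds f)
           (parabolic_quiver_variety Q 1 (two_step d (\<lambda>v. d v - k v)) f)
           (natural_projection Q l ds)
           (product_fspace (verts Q) (\<lambda>v. Fl (k v)))"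
proof -
  interpret fin_digraph Q by fact
  interpret framed_quiver Q f by unfold_locales
  \<comment> \<open>The hypotheses constrain the dimension vectors at the vertices only, so they are made equal elsewhere.\<close>
  define cut where "cut (ds' :: nat \<Rightarrow> 'v \<Rightarrow> nat) m v = (if v \<in> verts Q then ds' m v else 0)" for ds' m v
  have path: "unit_path Q l' (cut ds')" if "unit_step_path Q d k l' ds'" for l' ds'
    using unit_path_of_unit_step_path[OF that] by (simp add: cut_def[abs_def])
  have ends: "ds' 0 v = d v" "ds' l' v = d v - k v" "k v = d v - ds' l' v"
    if "unit_step_path Q d k l' ds'" "v \<in> verts Q" for l' ds' v
  proof -
    have "int (k v) = int (ds' 0 v) - int (ds' l' v)" and 1: "ds' 0 v = d v"
      using that unfolding unit_step_path_def by blast+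
    then show "ds' 0 v = d v" "ds' l' v = d v - k v" "k v = d v - ds' l' v" by linarith+
  qed
  have variety_cut: "parabolic_quiver_variety Q l' ds' f = parabolic_quiver_variety Q l' (cut ds') f" for l' ds'
    by (rule parabolic_quiver_variety_verts_cong) (simp add: cut_def)
  interpret unit_path Q f l "cut ds" by (rule path[OF assms(2)])
  have "fisomorphic (parabolic_quiver_variety Q l ds f) (parabolic_quiver_variety Q l' ds' f)"
    if p: "unit_step_path Q d k l' ds'" for l' ds'
    unfolding variety_cut[of l ds] variety_cut[of l' ds']
    by (rule paths_isomorphic[OF path[OF assms(2)] path[OF p]])
       (simp_all add: cut_def fun_eq_iff ends(1,2)[OF assms(2)] ends(1,2)[OF p])
  moreover have "parabolic_quiver_variety Q 1 (two_step d (\<lambda>v. d v - k v)) f =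
      parabolic_quiver_variety Q 1 (two_step (cut ds 0) (cut ds l)) f"
    by (rule parabolic_quiver_variety_verts_cong) (simp add: two_step_def cut_def ends(1,2)[OF assms(2)])
  moreover have "natural_projection Q l ds = natural_projection Q l (cut ds)"
    by (rule natural_projection_verts_cong) (simp add: cut_def)
  moreover have "product_fspace (verts Q) (\<lambda>v. Fl (k v)) = flags"
  proof -
    have eq: "k v = ker_dim v" if "v \<in> verts Q" for v
      using ends(1,3)[OF assms(2) that] that by (simp add: cut_def)
    have "(\<Pi>\<^sub>E v\<in>verts Q. points (Fl (k v))) = (\<Pi>\<^sub>E v\<in>verts Q. points (Fl (ker_dim v)))"
      using eq by (intro PiE_cong) simp
    moreover have "{({x \<in> P. x v \<in> U}, \<lambda>x. \<phi> (x v)) |v U \<phi>. v \<in> verts Q \<and> openin (zariski (Fl (k v))) U \<and> \<phi> \<in> regular (Fl (k v)) U} =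
        {({x \<in> P. x v \<in> U}, \<lambda>x. \<phi> (x v)) |v U \<phi>. v \<in> verts Q \<and> openin (zariski (Fl (ker_dim v))) U \<and> \<phi> \<in> regular (Fl (ker_dim v)) U}" for P
      using eq by (metis (no_types, lifting))
    ultimately show ?thesis unfolding product_fspace_def by simp
  qed
  ultimately show ?thesis
    using locally_trivial_natural_projection variety_cut[of l ds] by simp
qed

end
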